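(* Let $N\ge2$ be an integer. Suppose that $G\in C^1(\mathbb{R})$ and that $g:=G'$ satisfies $g(t)\le c\,e^{\alpha|t|^{N/(N-1)}}$ for all $t\in\mathbb{R}$ with some constants $\alpha,c>0$. (1) If $G$ satisfies $(G_0)$ and $u$ is a maximizer of $\Phi$ on $\mathcal{B}_1$, then there exists $\theta\in\mathbb{R}$ such that $$\int_{B_1}|\nabla u|^{N-2}\nabla u\cdot\nabla\varphi\,dx=\theta\int_{B_1}\Bigl(\ln\frac1{|\cdot|}*\bigl(1_{B_1}G(u)\bigr)\Bigr)g(u)\varphi\,dx\qquad\text{for all }\varphi\in W^{1,N}_0(B_1).$$ (2) If $G$ satisfies $(G_1)$ and $u$ is a maximizer of $\Psi$ on $\mathcal{B}_\infty$, then there exists $\theta\in\mathbb{R}$ such that $$\int_{\mathbb{R}^N}\bigl(|\nabla u|^{N-2}\nabla u\cdot\nabla\varphi+|u|^{N-2}u\varphi\bigr)\,dx=\theta\int_{\mathbb{R}^N}\Bigl(\ln\frac1{|\cdot|}*G(u)\Bigr)g(u)\varphi\,dx$$ for all $\varphi\in W^{1,N}_0(\mathbb{R}^N)$ with bounded support.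
   Context: $B_1\subset\mathbb{R}^N$ is the unit ball centered at $0$; $|\cdot|_N$ is the $L^N$-norm; $\mathcal{B}_1:=\{u\in W^{1,N}_0(B_1):|\nabla u|_N\le1\}$; $\mathcal{B}_\infty:=\{u\in W^{1,N}(\mathbb{R}^N):\|u\|_N\le1\}$ with $\|u\|_N^N:=|\nabla u|_N^N+|u|_N^N$. Assumption $(G_0)$: $G:\mathbb{R}\to[0,\infty)$ is even, continuous, and strictly increasing on $[0,\infty)$, and there exist constants $\alpha,c>0$ with $G(t)\le c\,e^{\alpha|t|^{N/(N-1)}}$ for all $t\in\mathbb{R}$. Assumption $(G_1)$: $G$ satisfies $(G_0)$ and $G(t)=O(|t|)$ as $t\to0$. With $\ln^+=\max\{\ln,0\}$: $\Phi(u)=\int_{B_1}\int_{B_1}\ln\frac1{|x-y|}G(u(x))G(u(y))\,dx\,dy$, understood as the difference of the (finite) integrals with kernels $\ln^+\frac1{|x-y|}$ and $\ln^+|x-y|$. Similarly $\Psi(u)=\int_{\mathbb{R}^N}\int_{\mathbb{R}^N}\ln\frac1{|x-y|}G(u(x))G(u(y))\,dx\,dy:=\Psi_+(u)-\Psi_-(u)\in[-\infty,\infty)$, where $\Psi_+$ and $\Psi_-$ are the integrals with kernels $\ln^+\frac1{|x-y|}$ and $\ln^+|x-y|$ respectively; in the paper's setting $\Psi_+(u)<\infty$ for every $u\in W^{1,N}(\mathbb{R}^N)$ as a consequence of $(G_1)$. $1_{B_1}G(u)$ is extended by zero outside $B_1$ and $*$ is convolution on $\mathbb{R}^N$. *)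

theory Defs
  imports "HOL-Analysis.Analysis" "HOL-Library.Landau_Symbols"
begin

text \<open>
  Functions on an open set \<open>\<Omega>\<close> are represented by total functions on \<open>real ^ 'n\<close>; the spaces, norms
  and functionals below depend only on their values on \<open>\<Omega>\<close>, and only up to null sets.
  Throughout, the dimension is \<open>CARD('n)\<close>.
\<close>

definition partial_deriv :: "'n \<Rightarrow> (real ^ 'n \<Rightarrow> real) \<Rightarrow> real ^ 'n \<Rightarrow> real" where
  "partial_deriv i f x = frechet_derivative f (at x) (axis i 1)"

primrec C_times :: "nat \<Rightarrow> (real ^ 'n \<Rightarrow> real) \<Rightarrow> bool" where
  "C_times 0 f = continuous_on UNIV f"
| "C_times (Suc k) f = ((\<forall>x. f differentiable (at x)) \<and> (\<forall>i. C_times k (partial_deriv i f)))"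

definition test_functions :: "(real ^ 'n) set \<Rightarrow> (real ^ 'n \<Rightarrow> real) set" where
  "test_functions \<Omega> =
     {\<phi>. (\<forall>k. C_times k \<phi>) \<and> compact (closure {x. \<phi> x \<noteq> 0}) \<and> closure {x. \<phi> x \<noteq> 0} \<subseteq> \<Omega>}"

definition locally_integrable_on ::
    "(real ^ 'n) set \<Rightarrow> (real ^ 'n \<Rightarrow> 'b::euclidean_space) \<Rightarrow> bool" where
  "locally_integrable_on \<Omega> f \<longleftrightarrow> (\<forall>K. compact K \<and> K \<subseteq> \<Omega> \<longrightarrow> set_integrable lebesgue K f)"

definition has_weak_gradient ::
    "(real ^ 'n) set \<Rightarrow> (real ^ 'n \<Rightarrow> real) \<Rightarrow> (real ^ 'n \<Rightarrow> real ^ 'n) \<Rightarrow> bool" where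
  "has_weak_gradient \<Omega> u v \<longleftrightarrow>
     locally_integrable_on \<Omega> u \<and> locally_integrable_on \<Omega> v \<and>
     (\<forall>\<phi>\<in>test_functions \<Omega>. \<forall>i.
        (LINT x:\<Omega>|lebesgue. u x * partial_deriv i \<phi> x) = - (LINT x:\<Omega>|lebesgue. v x $ i * \<phi> x))"

text \<open>A weak gradient is unique up to null sets; \<open>weak_grad\<close> picks a representative.\<close>

definition weak_grad ::
    "(real ^ 'n) set \<Rightarrow> (real ^ 'n \<Rightarrow> real) \<Rightarrow> real ^ 'n \<Rightarrow> real ^ 'n" where
  "weak_grad \<Omega> u = (SOME v. has_weak_gradient \<Omega> u v)"

definition Lp_space :: "(real ^ 'n) set \<Rightarrow> nat \<Rightarrow> (real ^ 'n \<Rightarrow> 'b::euclidean_space) set" where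
  "Lp_space \<Omega> p =
     {f. set_borel_measurable lebesgue \<Omega> f \<and> set_integrable lebesgue \<Omega> (\<lambda>x. norm (f x) ^ p)}"

definition Lp_norm :: "(real ^ 'n) set \<Rightarrow> nat \<Rightarrow> (real ^ 'n \<Rightarrow> 'b::euclidean_space) \<Rightarrow> real" where
  "Lp_norm \<Omega> p f = root p (LINT x:\<Omega>|lebesgue. norm (f x) ^ p)"

definition sobolev :: "(real ^ 'n) set \<Rightarrow> nat \<Rightarrow> (real ^ 'n \<Rightarrow> real) set" where
  "sobolev \<Omega> p = {u \<in> Lp_space \<Omega> p. \<exists>v\<in>Lp_space \<Omega> p. has_weak_gradient \<Omega> u v}"

definition sobolev_norm :: "(real ^ 'n) set \<Rightarrow> nat \<Rightarrow> (real ^ 'n \<Rightarrow> real) \<Rightarrow> real" where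
  "sobolev_norm \<Omega> p u = root p (Lp_norm \<Omega> p (weak_grad \<Omega> u) ^ p + Lp_norm \<Omega> p u ^ p)"

definition sobolev0 :: "(real ^ 'n) set \<Rightarrow> nat \<Rightarrow> (real ^ 'n \<Rightarrow> real) set" where
  "sobolev0 \<Omega> p =
     {u \<in> sobolev \<Omega> p. \<forall>\<epsilon>>0. \<exists>\<xi>\<in>test_functions \<Omega>. sobolev_norm \<Omega> p (\<lambda>x. u x - \<xi> x) < \<epsilon>}"

definition bounded_support :: "(real ^ 'n \<Rightarrow> real) \<Rightarrow> bool" where
  "bounded_support \<phi> \<longleftrightarrow> (\<exists>R. AE x in lebesgue. norm x > R \<longrightarrow> \<phi> x = 0)"

definition ball_B1 :: "(real ^ 'n \<Rightarrow> real) set" where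
  "ball_B1 = {u \<in> sobolev0 (ball 0 1) CARD('n).
     Lp_norm (ball 0 1) CARD('n) (weak_grad (ball 0 1) u) \<le> 1}"

definition ball_Binf :: "(real ^ 'n \<Rightarrow> real) set" where
  "ball_Binf = {u \<in> sobolev UNIV CARD('n). sobolev_norm UNIV CARD('n) u \<le> 1}"

definition exp_growth :: "nat \<Rightarrow> (real \<Rightarrow> real) \<Rightarrow> bool" where
  "exp_growth N f \<longleftrightarrow>
     (\<exists>\<alpha>>0. \<exists>c>0. \<forall>t. f t \<le> c * exp (\<alpha> * \<bar>t\<bar> powr (real N / (real N - 1))))"

definition cond_G0 :: "nat \<Rightarrow> (real \<Rightarrow> real) \<Rightarrow> bool" where
  "cond_G0 N G \<longleftrightarrow> (\<forall>t. 0 \<le> G t) \<and> (\<forall>t. G (- t) = G t) \<and> continuous_on UNIV G \<and>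
     strict_mono_on {0..} G \<and> exp_growth N G"

definition cond_G1 :: "nat \<Rightarrow> (real \<Rightarrow> real) \<Rightarrow> bool" where
  "cond_G1 N G \<longleftrightarrow> cond_G0 N G \<and> G \<in> O[at 0](\<lambda>t. \<bar>t\<bar>)"

definition ln_plus :: "real \<Rightarrow> real" where
  "ln_plus t = max (ln t) 0"

text \<open>
  On the null set \<open>x = y\<close> the kernels take the value 0, since \<open>1 / 0 = 0\<close> and \<open>ln 0 = 0\<close>.
\<close>

definition energy_pos ::
    "(real ^ 'n) set \<Rightarrow> (real \<Rightarrow> real) \<Rightarrow> (real ^ 'n \<Rightarrow> real) \<Rightarrow> ennreal" where
  "energy_pos \<Omega> G u = (\<integral>\<^sup>+x\<in>\<Omega>. (\<integral>\<^sup>+y\<in>\<Omega>.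
     ennreal (ln_plus (1 / norm (x - y)) * G (u x) * G (u y)) \<partial>lebesgue) \<partial>lebesgue)"

definition energy_neg ::
    "(real ^ 'n) set \<Rightarrow> (real \<Rightarrow> real) \<Rightarrow> (real ^ 'n \<Rightarrow> real) \<Rightarrow> ennreal" where
  "energy_neg \<Omega> G u = (\<integral>\<^sup>+x\<in>\<Omega>. (\<integral>\<^sup>+y\<in>\<Omega>.
     ennreal (ln_plus (norm (x - y)) * G (u x) * G (u y)) \<partial>lebesgue) \<partial>lebesgue)"

text \<open>
  The logarithmic energy takes values in \<open>[-\<infinity>, \<infinity>)\<close>. The case distinction assigns \<open>-\<infinity>\<close> also when
  both parts are infinite; plain subtraction on \<open>ereal\<close> would give \<open>\<infinity>\<close> there.
\<close>

definition log_energy ::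
    "(real ^ 'n) set \<Rightarrow> (real \<Rightarrow> real) \<Rightarrow> (real ^ 'n \<Rightarrow> real) \<Rightarrow> ereal" where
  "log_energy \<Omega> G u =
     (if energy_neg \<Omega> G u = \<infinity> then - \<infinity>
      else enn2ereal (energy_pos \<Omega> G u) - enn2ereal (energy_neg \<Omega> G u))"

definition Phi :: "(real \<Rightarrow> real) \<Rightarrow> (real ^ 'n \<Rightarrow> real) \<Rightarrow> ereal" where
  "Phi G u = log_energy (ball 0 1) G u"

definition Psi :: "(real \<Rightarrow> real) \<Rightarrow> (real ^ 'n \<Rightarrow> real) \<Rightarrow> ereal" where
  "Psi G u = log_energy UNIV G u"

definition convolution_exists ::
    "(real ^ 'n \<Rightarrow> real) \<Rightarrow> (real ^ 'n \<Rightarrow> real) \<Rightarrow> real ^ 'n \<Rightarrow> bool" where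
  "convolution_exists k f x \<longleftrightarrow> integrable lebesgue (\<lambda>y. k (x - y) * f y)"

definition convolution ::
    "(real ^ 'n \<Rightarrow> real) \<Rightarrow> (real ^ 'n \<Rightarrow> real) \<Rightarrow> real ^ 'n \<Rightarrow> real" where
  "convolution k f x = (LINT y|lebesgue. k (x - y) * f y)"

definition log_kernel :: "real ^ 'n \<Rightarrow> real" where
  "log_kernel z = ln (1 / norm z)"

end

theory Submission
  imports Defs
begin

text \<open>
 Let \<open>F = G(u)\<close> on the domain \<open>\<Omega>\<close> and \<open>W = ln (1 / |.|) * F\<close>. In a direction \<open>\<phi>\<close> the energy has derivative
 \<open>2 A(\<phi>)\<close> with \<open>A(\<phi>) = \<integral> W g(u) \<phi>\<close>, and the \<open>N\<close>-th power of the constraint norm has derivative \<open>N B(\<phi>)\<close>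
 with \<open>B\<close> the left-hand side of the asserted equation. At a maximizer no admissible \<open>\<phi>\<close> has \<open>A(\<phi>) > 0\<close>
 and \<open>B(\<phi>) < 0\<close>, since moving along such a \<open>\<phi>\<close> would raise the energy inside the constraint set. For two
 linear forms this means \<open>B = \<theta> A\<close>, unless \<open>A\<close> vanishes identically (\<open>lagrange_multiplier\<close>).

 The degenerate case needs an argument, because \<open>G\<close> is strictly increasing but \<open>g\<close> may vanish on large
 sets. If \<open>A = 0\<close> then \<open>W g(u) = 0\<close> almost everywhere, and \<open>potential_nondegenerate\<close> shows \<open>u = 0\<close>, whence
 \<open>B = 0\<close> as well. Where \<open>g(u) \<noteq> 0\<close> the potential vanishes, and so does its gradient. But \<open>-\<Delta>W\<close>
 is nonnegative for every \<open>N \<ge> 2\<close>, and its integral against a nonnegative truncation \<open>\<psi>\<close> of \<open>u\<close> is positive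
 if \<open>F > 0\<close> where \<open>\<psi> > 0\<close> and \<open>\<psi>\<close> is not null; so \<open>u\<close> cannot take values in an interval on which \<open>g\<close> has no
 zero. Hence \<open>g(u) = 0\<close> almost everywhere, \<open>G(u)\<close> has zero gradient, and a Sobolev inequality shows that \<open>u\<close>
 vanishes: \<open>|u|\<close> exceeds no positive level.

 Differentiating the energy requires \<open>exp (a |u| powr (N / (N - 1)))\<close> to be locally integrable for
 every \<open>a > 0\<close>. This is \<open>trudinger\<close>: by a weak isoperimetric inequality a superlevel set of \<open>u\<close> at least
 halves over a step of height \<open>h\<close> that carries gradient energy at most a fixed multiple of \<open>h ^ N\<close>; dividing
 a height \<open>s\<close> into about \<open>\<Lambda> s powr (N / (N - 1))\<close> equal steps, at least half of them are of this kind above a level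
 beyond which little gradient energy remains, for an arbitrary \<open>\<Lambda>\<close>.

 The analysis uses Borel functions on the whole space and Lebesgue-Borel measure. Elements of
 \<open>W\<^sub>0\<close> on the ball enter through their extension by zero. On the whole space, comparison with the zero
 function shows that the maximizer has finite energy, which provides the decay of \<open>F\<close> at infinity.
\<close>

type_synonym 'n sfun = "real ^ 'n => real"

abbreviation Borel :: "('a::topological_space \<Rightarrow> 'b::topological_space) set" where
 "Borel \<equiv> borel_measurable borel"

abbreviation nn_lborel :: "('a::euclidean_space \<Rightarrow> ennreal) \<Rightarrow> ennreal" (binder "NNINT " 10) where
 "nn_lborel f \<equiv> integral\<^sup>N lborel f"

text \<open>The kernels \<open>z / |z| ^ (2 s)\<close> are regularised by replacing \<open>|z|\<^sup>2\<close> with \<open>|z|\<^sup>2 + e\<^sup>2\<close>.\<close>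

abbreviation rsq :: "real \<Rightarrow> real ^ 'n::finite \<Rightarrow> real" where
 "rsq e z \<equiv> (norm z)\<^sup>2 + e\<^sup>2"

lemmas integrable_dominated = Bochner_Integration.integrable_bound
lemmas integrable_plus = Bochner_Integration.integrable_add
lemmas integral_eqI = Bochner_Integration.integral_cong

section \<open>Smooth bump functions\<close>

text \<open>The factor \<open>1 / t ^ m\<close> makes the family closed under differentiation up to linear combinations.\<close>

definition flat_exp :: "nat => real => real" where
 "flat_exp m t = (if t > 0 then exp (- 1 / t) / t ^ m else 0)"

lemma flat_exp_nonneg: "0 \<le> flat_exp m t"
 by (simp add: flat_exp_def)

lemma flat_exp_tendsto_0: "(flat_exp m \<longlongrightarrow> 0) (at 0)"
proof -
 have R: "(flat_exp m \<longlongrightarrow> 0) (at_right 0)"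
 proof -
  have "((\<lambda>t. inverse t ^ m / exp (inverse t)) \<longlongrightarrow> (0::real)) (at_right 0)"
   by (rule filterlim_compose[OF tendsto_power_div_exp_0 filterlim_inverse_at_top_right])
  moreover have "eventually (\<lambda>t. inverse t ^ m / exp (inverse t) = flat_exp m t) (at_right 0)"
   unfolding eventually_at_right_field
   by (rule exI[of _ 1]) (auto simp: flat_exp_def exp_minus field_simps)
  ultimately show ?thesis by (rule Lim_transform_eventually)
 qed
 have L: "(flat_exp m \<longlongrightarrow> 0) (at_left 0)"
 proof -
  have "eventually (\<lambda>t. 0 = flat_exp m t) (at_left 0)"
   unfolding eventually_at_left_field
   by (rule exI[of _ "-1"]) (auto simp: flat_exp_def)
  thus ?thesis by (rule Lim_transform_eventually[OF tendsto_const])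
 qed
 show ?thesis using L R by (simp add: filterlim_split_at)
qed

lemma flat_exp_deriv:
 "(flat_exp m has_real_derivative (flat_exp (m + 2) t - real m * flat_exp (m + 1) t)) (at t)"
proof -
 consider "t > 0" | "t < 0" | "t = 0" by linarith
 thus ?thesis
 proof cases
  case 1
  have "((\<lambda>t. exp (- 1 / t) / t ^ m) has_real_derivative
      (flat_exp (m + 2) t - real m * flat_exp (m + 1) t)) (at t)"
  proof -
   have "((\<lambda>t. exp (- 1 / t) / t ^ m) has_real_derivative
      (exp (-1 / t) * (1 / t\<^sup>2) * t ^ m - exp (-1/t) * (real m * t ^ (m - 1))) / (t ^ m * t ^ m)) (at t)"
    using 1 by (auto intro!: derivative_eq_intros simp: power2_eq_square)
   also have "(exp (-1 / t) * (1 / t\<^sup>2) * t ^ m - exp (-1/t) * (real m * t ^ (m - 1))) / (t ^ m * t ^ m)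
     = flat_exp (m + 2) t - real m * flat_exp (m + 1) t"
    using 1 by (cases m) (simp_all add: flat_exp_def field_simps power2_eq_square)
   finally show ?thesis .
  qed
  moreover have "eventually (\<lambda>s. s \<in> {0<..}) (nhds t)"
   using 1 by (intro eventually_nhds_in_open) auto
  hence "eventually (\<lambda>s. flat_exp m s = exp (- 1 / s) / s ^ m) (nhds t)"
   by eventually_elim (auto simp: flat_exp_def)
  ultimately show ?thesis by (subst DERIV_cong_ev[OF refl _ refl]) auto
 next
  case 2
  have "eventually (\<lambda>s. s \<in> {..<0}) (nhds t)"
   using 2 by (intro eventually_nhds_in_open) auto
  hence "eventually (\<lambda>s. flat_exp m s = 0) (nhds t)"
   by eventually_elim (auto simp: flat_exp_def)
  thus ?thesis using 2 by (subst DERIV_cong_ev[OF refl _ refl]) (auto simp: flat_exp_def)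
 next
  case 3
  have "((\<lambda>h. (flat_exp m (0 + h) - flat_exp m 0) / h) \<longlongrightarrow> 0) (at 0)"
  proof (rule Lim_transform_eventually[OF flat_exp_tendsto_0])
   show "\<forall>\<^sub>F h in at 0. flat_exp (Suc m) h = (flat_exp m (0 + h) - flat_exp m 0) / h"
    by (auto simp: flat_exp_def eventually_at_filter field_simps)
  qed
  thus ?thesis using 3 by (simp add: DERIV_def flat_exp_def)
 qed
qed

text \<open>Every member of this algebra is differentiable with partial derivatives again in the
 algebra, hence smooth; this spares computing higher derivatives of a concrete bump.\<close>

inductive_set smooth_algebra :: "(real ^ 'n::finite => real) set" where
 const: "(\<lambda>x. c) \<in> smooth_algebra"
| coord: "(\<lambda>x. x $ i) \<in> smooth_algebra"
| add: "p \<in> smooth_algebra ==> q \<in> smooth_algebra ==> (\<lambda>x. p x + q x) \<in> smooth_algebra"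
| mult: "p \<in> smooth_algebra ==> q \<in> smooth_algebra ==> (\<lambda>x. p x * q x) \<in> smooth_algebra"
| flat: "p \<in> smooth_algebra ==> (\<lambda>x. flat_exp m (p x)) \<in> smooth_algebra"

lemma smooth_algebra_has_derivative:
 assumes "p \<in> smooth_algebra"
 shows "\<exists>D. \<forall>x. (p has_derivative D x) (at x) \<and> (\<forall>i. (\<lambda>x. D x (axis i 1)) \<in> smooth_algebra)"
 using assms
proof induction
 case (const c)
 show ?case by (rule exI[of _ "\<lambda>x h. 0"]) (auto intro: smooth_algebra.const)
next
 case (coord j)
 show ?case
  by (rule exI[of _ "\<lambda>x h. h $ j"])
    (auto intro: smooth_algebra.const simp: bounded_linear_vec_nth bounded_linear_imp_has_derivative)
next
 case (add p q)
 then obtain D E where "\<forall>x. (p has_derivative D x) (at x) \<and> (\<forall>i. (\<lambda>x. D x (axis i 1)) \<in> smooth_algebra)"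
  "\<forall>x. (q has_derivative E x) (at x) \<and> (\<forall>i. (\<lambda>x. E x (axis i 1)) \<in> smooth_algebra)" by blast
 thus ?case
  by (intro exI[of _ "\<lambda>x h. D x h + E x h"]) (auto intro!: smooth_algebra.add has_derivative_add)
next
 case (mult p q)
 then obtain D E where D: "\<forall>x. (p has_derivative D x) (at x) \<and> (\<forall>i. (\<lambda>x. D x (axis i 1)) \<in> smooth_algebra)"
  and E: "\<forall>x. (q has_derivative E x) (at x) \<and> (\<forall>i. (\<lambda>x. E x (axis i 1)) \<in> smooth_algebra)" by blast
 show ?case
 proof (intro exI[of _ "\<lambda>x h. p x * E x h + D x h * q x"] allI conjI)
  show "((\<lambda>x. p x * q x) has_derivative (\<lambda>h. p x * E x h + D x h * q x)) (at x)" for x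
   using D E by (intro has_derivative_mult) auto
  show "(\<lambda>x. p x * E x (axis i 1) + D x (axis i 1) * q x) \<in> smooth_algebra" for i
   using D E mult by (intro smooth_algebra.add smooth_algebra.mult) auto
 qed
next
 case (flat p m)
 then obtain D where D: "\<forall>x. (p has_derivative D x) (at x) \<and> (\<forall>i. (\<lambda>x. D x (axis i 1)) \<in> smooth_algebra)"
  by blast
 show ?case
 proof (intro exI[of _ "\<lambda>x h. (flat_exp (m + 2) (p x) + (- real m) * flat_exp (m + 1) (p x)) * D x h"] allI conjI)
  show "((\<lambda>x. flat_exp m (p x)) has_derivative
      (\<lambda>h. (flat_exp (m + 2) (p x) + (- real m) * flat_exp (m + 1) (p x)) * D x h)) (at x)" for x
   using has_derivative_compose[OF D[rule_format, THEN conjunct1]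
     flat_exp_deriv[of m "p x", unfolded has_field_derivative_def]]
   by (simp add: mult.commute)
  show "(\<lambda>x. (flat_exp (m + 2) (p x) + (- real m) * flat_exp (m + 1) (p x)) * D x (axis i 1)) \<in> smooth_algebra" for i
   using D flat by (intro smooth_algebra.add smooth_algebra.mult smooth_algebra.flat smooth_algebra.const) auto
 qed
qed

lemma smooth_algebra_C_times: "p \<in> smooth_algebra ==> C_times k p"
proof (induction k arbitrary: p)
 case 0
 obtain D where "\<forall>x. (p has_derivative D x) (at x)"
  using smooth_algebra_has_derivative[OF 0] by blast
 hence "\<forall>x. isCont p x" using has_derivative_continuous by blast
 thus ?case by (simp add: continuous_at_imp_continuous_on)
next
 case (Suc k)
 obtain D where D: "\<forall>x. (p has_derivative D x) (at x) \<and> (\<forall>i. (\<lambda>x. D x (axis i 1)) \<in> smooth_algebra)"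
  using smooth_algebra_has_derivative[OF Suc.prems] by blast
 have "frechet_derivative p (at x) = D x" for x
  using D frechet_derivative_at by metis
 hence "partial_deriv i p = (\<lambda>x. D x (axis i 1))" for i
  by (auto simp: partial_deriv_def)
 thus ?case using Suc.IH D by (auto simp: differentiable_def)
qed

definition bump :: "real => real ^ 'n::finite => real ^ 'n => real" where
 "bump d a x = flat_exp 0 (d\<^sup>2 - (norm (x - a))\<^sup>2)"

lemma bump_smooth: "bump d a \<in> smooth_algebra"
proof -
 have s: "finite I ==> (\<lambda>x. \<Sum>i\<in>I. (x $ i + - (a $ i)) * (x $ i + - (a $ i))) \<in> smooth_algebra" for I
 proof (induction I rule: finite_induct)
  case (insert j I)
  have "(\<lambda>x. (x $ j + - (a $ j)) * (x $ j + - (a $ j))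
    + (\<Sum>i\<in>I. (x $ i + - (a $ i)) * (x $ i + - (a $ i)))) \<in> smooth_algebra"
   by (intro smooth_algebra.add smooth_algebra.mult smooth_algebra.coord smooth_algebra.const insert.IH)
  thus ?case using insert.hyps by simp
 qed (simp add: smooth_algebra.const)
 have "(\<lambda>x. flat_exp 0 (d\<^sup>2 + (-1) * (\<Sum>i\<in>UNIV. (x $ i + - (a $ i)) * (x $ i + - (a $ i))))) \<in> smooth_algebra"
  by (rule smooth_algebra.flat smooth_algebra.add smooth_algebra.const smooth_algebra.mult s finite)+
 moreover have "(norm (x - a))\<^sup>2 = (\<Sum>i\<in>UNIV. (x $ i + - (a $ i)) * (x $ i + - (a $ i)))" for x
  by (subst power2_norm_eq_inner) (simp add: inner_vec_def)
 ultimately show ?thesis unfolding bump_def[abs_def] by simp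
qed

lemma bump_nonneg: "0 \<le> bump d a x"
 by (simp add: bump_def flat_exp_nonneg)

lemma bump_pos_iff:
 assumes "d > 0" shows "bump d a x > 0 \<longleftrightarrow> dist a x < d"
proof -
 have "(norm (x - a))\<^sup>2 < d\<^sup>2 \<longleftrightarrow> norm (x - a) < d"
  using abs_le_square_iff[of d "norm (x - a)"] assms by (simp flip: not_le)
 thus ?thesis by (simp add: bump_def flat_exp_def dist_norm norm_minus_commute)
qed

lemma bump_eq_0: "d > 0 ==> dist a x \<ge> d ==> bump d a x = 0"
 using bump_pos_iff[of d a x] bump_nonneg[of d a x] by linarith

lemma bump_sym: "bump d a x = bump d x a"
 by (simp add: bump_def norm_minus_commute)

lemma bump_shift: "bump d (a + z) (x + z) = bump d a x"
 by (simp add: bump_def)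

lemma bump_le_1: "bump d a x \<le> 1"
 by (simp add: bump_def flat_exp_def)

lemma bump_test:
 assumes "d > 0" "cball a d \<subseteq> \<Omega>"
 shows "bump d a \<in> test_functions \<Omega>"
proof -
 have "{x. bump d a x \<noteq> 0} \<subseteq> cball a d"
  using bump_eq_0[OF assms(1)] by (force simp: not_less)
 hence sub: "closure {x. bump d a x \<noteq> 0} \<subseteq> cball a d"
  by (rule closure_minimal) auto
 hence "compact (closure {x. bump d a x \<noteq> 0})"
  by (meson bounded_cball bounded_subset closed_closure compact_eq_bounded_closed)
 thus ?thesis using sub assms smooth_algebra_C_times[OF bump_smooth]
  by (auto simp: test_functions_def)
qed

section \<open>Directional derivatives and integration by parts\<close>

text \<open>Functions only need a derivative along each coordinate direction: this suffices for integration by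
 parts, and unlike Frechet differentiability it is immediate for mollified functions and kernels.\<close>

definition ddiff :: "'n => (real ^ 'n::finite => real) => (real ^ 'n => real) => bool" where
 "ddiff i X X' \<longleftrightarrow> (\<forall>x. ((\<lambda>t. X (x + t *\<^sub>R axis i 1)) has_real_derivative X' x) (at 0))"

lemma ddiff_line:
 assumes "ddiff i X X'"
 shows "((\<lambda>t. X (x + t *\<^sub>R axis i 1)) has_real_derivative X' (x + s *\<^sub>R axis i 1)) (at s)"
proof -
 have "((\<lambda>t. X ((x + s *\<^sub>R axis i 1) + t *\<^sub>R axis i 1)) has_real_derivative X' (x + s *\<^sub>R axis i 1)) (at 0)"
  using assms unfolding ddiff_def by blast
 hence "((\<lambda>t. X (x + (t + s) *\<^sub>R axis i 1)) has_real_derivative X' (x + s *\<^sub>R axis i 1)) (at 0)"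
  by (simp add: algebra_simps)
 thus ?thesis
  using DERIV_shift[of "\<lambda>t. X (x + t *\<^sub>R axis i 1)" "X' (x + s *\<^sub>R axis i 1)" 0 s] by simp
qed

lemma ddiff_lipschitz:
 assumes "ddiff i X X'" "\<And>x. \<bar>X' x\<bar> \<le> C"
 shows "\<bar>X (x + t *\<^sub>R axis i 1) - X x\<bar> \<le> C * \<bar>t\<bar>"
proof -
 have "norm ((\<lambda>t. X (x + t *\<^sub>R axis i 1)) t - (\<lambda>t. X (x + t *\<^sub>R axis i 1)) 0) \<le> C * norm (t - 0)"
  by (rule field_differentiable_bound[where f' = "\<lambda>s. X' (x + s *\<^sub>R axis i 1)" and S = UNIV])
    (use ddiff_line[OF assms(1)] assms(2) in auto)
 thus ?thesis by simp
qed

lemma ddiff_mult: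
 assumes "ddiff i X X'" "ddiff i Y Y'"
 shows "ddiff i (\<lambda>x. X x * Y x) (\<lambda>x. X' x * Y x + X x * Y' x)"
 using assms unfolding ddiff_def
 by (auto intro!: derivative_eq_intros)

lemma ddiff_compose:
 assumes "ddiff i X X'" "\<And>t. (F has_real_derivative F' t) (at t)"
 shows "ddiff i (\<lambda>x. F (X x)) (\<lambda>x. F' (X x) * X' x)"
 unfolding ddiff_def
proof
 fix x
 have "((\<lambda>t. X (x + t *\<^sub>R axis i 1)) has_real_derivative X' x) (at 0)"
  using assms(1) unfolding ddiff_def by blast
 from DERIV_chain2[OF _ this, of F] assms(2)
 show "((\<lambda>t. F (X (x + t *\<^sub>R axis i 1))) has_real_derivative F' (X x) * X' x) (at 0)"
  by simp
qed

lemma differentiable_ddiff: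
 assumes "\<And>x. f differentiable (at x)"
 shows "ddiff i f (partial_deriv i f)"
 unfolding ddiff_def
proof
 fix x
 have f: "(f has_derivative frechet_derivative f (at x)) (at x)"
  using assms frechet_derivative_works by blast
 have l: "((\<lambda>t. x + t *\<^sub>R axis i 1) has_derivative (\<lambda>t. t *\<^sub>R axis i 1)) (at (0::real))"
  by (auto intro!: derivative_eq_intros)
 have "((\<lambda>t. f (x + t *\<^sub>R axis i 1)) has_derivative (\<lambda>t. frechet_derivative f (at x) (t *\<^sub>R axis i 1))) (at (0::real))"
  using has_derivative_compose[OF l, of f "frechet_derivative f (at x)"] f by simp
 moreover have "frechet_derivative f (at x) (t *\<^sub>R axis i 1) = partial_deriv i f x * t" for t
  using linear_frechet_derivative[OF assms] by (simp add: linear_scale partial_deriv_def)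
 ultimately show "((\<lambda>t. f (x + t *\<^sub>R axis i 1)) has_real_derivative partial_deriv i f x) (at 0)"
  by (simp add: has_field_derivative_def mult_commute_abs)
qed

lemma test_functionD:
 assumes "\<phi> \<in> test_functions \<Omega>"
 shows "\<phi> \<in> Borel" "partial_deriv i \<phi> \<in> Borel"
  "ddiff i \<phi> (partial_deriv i \<phi>)"
  "\<exists>R C. \<forall>x. \<bar>\<phi> x\<bar> \<le> C \<and> \<bar>partial_deriv i \<phi> x\<bar> \<le> C \<and> (norm x > R --> \<phi> x = 0 \<and> partial_deriv i \<phi> x = 0)"
  "x \<notin> \<Omega> ==> \<phi> x = 0" "x \<notin> \<Omega> ==> partial_deriv i \<phi> x = 0"
proof -
 have "C_times (Suc 0) \<phi>" "C_times 0 \<phi>" using assms unfolding test_functions_def by blast+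
 hence d: "\<And>x. \<phi> differentiable (at x)" and c: "continuous_on UNIV \<phi>" "continuous_on UNIV (partial_deriv i \<phi>)"
  by auto
 show "\<phi> \<in> Borel" "partial_deriv i \<phi> \<in> Borel"
  using c by (auto intro: borel_measurable_continuous_onI)
 show dd: "ddiff i \<phi> (partial_deriv i \<phi>)" using d by (rule differentiable_ddiff)
 let ?K = "closure {x. \<phi> x \<noteq> 0}"
 have K: "compact ?K" "?K \<subseteq> \<Omega>" using assms unfolding test_functions_def by blast+
 have z: "\<phi> x = 0" "partial_deriv i \<phi> x = 0" if "x \<notin> ?K" for x
 proof -
  show "\<phi> x = 0" using that closure_subset[of "{x. \<phi> x \<noteq> 0}"] by blast
  have "eventually (\<lambda>y. y \<in> - ?K) (nhds x)" using that by (intro eventually_nhds_in_open) auto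
  hence "eventually (\<lambda>y. \<phi> y = 0) (nhds x)"
   by eventually_elim (use closure_subset[of "{x. \<phi> x \<noteq> 0}"] in blast)
  hence "(\<phi> has_derivative (\<lambda>h. 0)) (at x)"
   by (intro has_derivative_transform_eventually[OF has_derivative_const[of 0 "at x"]])
     (use \<open>\<phi> x = 0\<close> in \<open>auto simp: eventually_at_filter elim: eventually_mono\<close>)
  thus "partial_deriv i \<phi> x = 0" by (metis frechet_derivative_at partial_deriv_def)
 qed
 show "x \<notin> \<Omega> ==> \<phi> x = 0" "x \<notin> \<Omega> ==> partial_deriv i \<phi> x = 0" using z[of x] K(2) by blast+
 have "compact (\<phi> ` ?K)" "compact (partial_deriv i \<phi> ` ?K)"
  using K c by (auto intro!: compact_continuous_image intro: continuous_on_subset)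
 hence "bounded (\<phi> ` ?K)" "bounded (partial_deriv i \<phi> ` ?K)" by (auto intro: compact_imp_bounded)
 then obtain C1 C2 where C: "\<forall>x\<in>?K. norm (\<phi> x) \<le> C1" "\<forall>x\<in>?K. norm (partial_deriv i \<phi> x) \<le> C2"
  unfolding bounded_iff by auto
 obtain R where R: "\<forall>x\<in>?K. norm x \<le> R" using compact_imp_bounded[OF K(1)] unfolding bounded_iff by auto
 show "\<exists>R C. \<forall>x. \<bar>\<phi> x\<bar> \<le> C \<and> \<bar>partial_deriv i \<phi> x\<bar> \<le> C \<and> (norm x > R --> \<phi> x = 0 \<and> partial_deriv i \<phi> x = 0)"
 proof (intro exI allI)
  fix x
  show "\<bar>\<phi> x\<bar> \<le> max 0 (max C1 C2) \<and> \<bar>partial_deriv i \<phi> x\<bar> \<le> max 0 (max C1 C2) \<and> (norm x > R --> \<phi> x = 0 \<and> partial_deriv i \<phi> x = 0)"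
  proof (cases "x \<in> ?K")
   case True
   hence "\<bar>\<phi> x\<bar> \<le> C1" "\<bar>partial_deriv i \<phi> x\<bar> \<le> C2" "norm x \<le> R"
    using C(1)[THEN bspec, OF True] C(2)[THEN bspec, OF True] R[THEN bspec, OF True] by simp_all
   thus ?thesis by linarith
  next
   case False
   thus ?thesis using z[OF False] by simp
  qed
 qed
qed

section \<open>Translations of the Lebesgue measure\<close>

lemma nn_integral_lborel_shift:
 fixes f :: "'a::euclidean_space => ennreal"
 assumes [measurable]: "f \<in> Borel"
 shows "(NNINT x. f (x + a)) = (NNINT x. f x)"
proof -
 have "(NNINT x. f x) = (\<integral>\<^sup>+x. f x \<partial>distr lborel borel ((+) a))"
  by (simp add: lborel_distr_plus)
 also have "... = (NNINT x. f (a + x))" by (rule nn_integral_distr) auto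
 finally show ?thesis by (simp add: add.commute)
qed

lemma lborel_distr_reflect:
 fixes a :: "'a::euclidean_space"
 shows "distr lborel borel (\<lambda>x. a - x) = lborel"
 using lborel_affine[of "-1" a] by (simp add: density_1)

lemma nn_integral_lborel_reflect:
 fixes f :: "'a::euclidean_space => ennreal"
 assumes [measurable]: "f \<in> Borel"
 shows "(NNINT x. f (a - x)) = (NNINT x. f x)"
proof -
 have "(NNINT x. f x) = (\<integral>\<^sup>+x. f x \<partial>distr lborel borel (\<lambda>x. a - x))"
  by (simp add: lborel_distr_reflect)
 also have "... = (NNINT x. f (a - x))" by (rule nn_integral_distr) auto
 finally show ?thesis by simp
qed

lemma integral_lborel_shift:
 fixes f :: "'a::euclidean_space => real"
 assumes [measurable]: "f \<in> Borel"
 shows "(LBINT x. f (x + a)) = (LBINT x. f x)"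
  "integrable lborel (\<lambda>x. f (x + a)) \<longleftrightarrow> integrable lborel f"
proof -
 have "(LBINT x. f x) = (LINT x|distr lborel borel ((+) a). f x)"
  by (simp add: lborel_distr_plus)
 also have "... = (LBINT x. f (a + x))" by (rule integral_distr) auto
 finally show "(LBINT x. f (x + a)) = (LBINT x. f x)" by (simp add: add.commute)
 have "integrable lborel f \<longleftrightarrow> integrable (distr lborel borel ((+) a)) f"
  by (simp add: lborel_distr_plus)
 also have "... \<longleftrightarrow> integrable lborel (\<lambda>x. f (a + x))" by (rule integrable_distr_eq) auto
 finally show "integrable lborel (\<lambda>x. f (x + a)) \<longleftrightarrow> integrable lborel f" by (simp add: add.commute)
qed

lemma integrable_indicator_cball:
 "integrable lborel (indicator (cball c R) :: 'a::euclidean_space => real)"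
 by (rule integrable_real_indicator) (simp_all add: emeasure_lborel_cball_finite[unfolded infinity_ennreal_def])

lemma integrable_bounded_support:
 fixes f :: "'a::euclidean_space => real"
 assumes [measurable]: "f \<in> Borel"
  and "\<And>x. \<bar>f x\<bar> \<le> C" "\<And>x. norm x > R ==> f x = 0"
 shows "integrable lborel f"
proof (rule integrable_dominated)
 show "integrable lborel (\<lambda>x::'a. C * indicator (cball 0 R) x)"
  by (intro integrable_mult_right integrable_indicator_cball)
 show "AE x in lborel. norm (f x) \<le> norm (C * indicator (cball 0 R) x)"
 proof (rule AE_I2)
  fix x
  have "0 \<le> C" using assms(2)[of x] by linarith
  thus "norm (f x) \<le> norm (C * indicator (cball 0 R) x)"
   using assms(2)[of x] assms(3)[of x] by (cases "norm x \<le> R") (auto simp: indicator_def)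
 qed
qed simp

text \<open>Difference quotients have vanishing integral by translation invariance.\<close>

lemma integral_ddiff_eq_0:
 fixes X :: "'n::finite sfun"
 assumes [measurable]: "X \<in> Borel"
  and d: "ddiff i X X'" and X': "\<And>x. \<bar>X' x\<bar> \<le> C" and X: "\<And>x. \<bar>X x\<bar> \<le> C"
  and R: "\<And>x. norm x > R ==> X x = 0"
  and X'_meas [measurable]: "X' \<in> Borel"
 shows "integrable lborel X'" "(LBINT x. X' x) = 0"
proof -
 let ?e = "axis i 1 :: real ^ 'n"
 define t where "t n = inverse (real (Suc n))" for n
 have t: "t n > 0" "t n \<le> 1" for n by (auto simp: t_def field_simps)
 have t0: "t \<longlonglongrightarrow> 0" unfolding t_def by (rule LIMSEQ_inverse_real_of_nat)
 define q where "q n x = (X (x + t n *\<^sub>R ?e) - X x) / t n" for n x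
 have [measurable]: "q n \<in> Borel" for n
  unfolding q_def by measurable
 have lim: "(\<lambda>n. q n x) \<longlonglongrightarrow> X' x" for x
 proof -
  have "((\<lambda>h. (X (x + h *\<^sub>R ?e) - X x) / h) \<longlongrightarrow> X' x) (at 0)"
   using d[unfolded ddiff_def, rule_format, of x] by (simp add: DERIV_def)
  moreover have "filterlim t (at 0) sequentially"
   using t t0 by (auto simp: filterlim_at intro!: always_eventually) (metis less_irrefl)
  ultimately show ?thesis unfolding q_def by (rule filterlim_compose)
 qed
 have bd: "norm (q n x) \<le> C * indicator (cball 0 (R + 1)) x" for n x
 proof (cases "norm x \<le> R + 1")
  case True
  have "\<bar>X (x + t n *\<^sub>R ?e) - X x\<bar> \<le> C * \<bar>t n\<bar>" by (rule ddiff_lipschitz[OF d X'])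
  thus ?thesis using t[of n] True by (simp add: q_def field_simps)
 next
  case False
  have "norm (t n *\<^sub>R ?e) \<le> 1" using t[of n] by simp
  hence "norm (x + t n *\<^sub>R ?e) > R" using False norm_triangle_ineq2[of x "- t n *\<^sub>R ?e"] by simp
  thus ?thesis using False R by (simp add: q_def)
 qed
 have iX: "integrable lborel X" by (rule integrable_bounded_support[OF _ X R]) auto
 have I0: "(LBINT x. q n x) = 0" for n
 proof -
  have "(LBINT x. q n x) = ((LBINT x. X (x + t n *\<^sub>R ?e)) - (LBINT x. X x)) / t n"
   unfolding q_def using iX by (simp add: integral_lborel_shift)
  thus ?thesis by (simp add: integral_lborel_shift)
 qed
 have w: "integrable lborel (\<lambda>x. C * indicator (cball 0 (R + 1)) x :: real)"
  by (intro integrable_mult_right integrable_indicator_cball)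
 show "integrable lborel X'"
  by (rule integrable_dominated_convergence[where s = q, OF _ _ w]) (use lim bd in auto)
 have "(\<lambda>n. LBINT x. q n x) \<longlonglongrightarrow> (LBINT x. X' x)"
  by (rule integral_dominated_convergence[where s = q, OF _ _ w]) (use lim bd in auto)
 thus "(LBINT x. X' x) = 0" by (simp add: I0 LIMSEQ_const_iff)
qed

text \<open>The product has bounded support, so its derivative integrates to zero.\<close>

lemma integral_by_parts_ddiff:
 fixes X Y :: "'n::finite sfun"
 assumes [measurable]: "X \<in> Borel" "X' \<in> Borel"
   "Y \<in> Borel" "Y' \<in> Borel"
  and d: "ddiff i X X'" "ddiff i Y Y'"
  and X: "\<And>x. \<bar>X x\<bar> \<le> C" "\<And>x. \<bar>X' x\<bar> \<le> C" "\<And>x. norm x > R ==> X x = 0 \<and> X' x = 0"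
  and Y: "\<And>x. norm x \<le> R ==> \<bar>Y x\<bar> \<le> C" "\<And>x. norm x \<le> R ==> \<bar>Y' x\<bar> \<le> C"
 shows "(LBINT x. X' x * Y x) = - (LBINT x. X x * Y' x)"
proof -
 have C: "C \<ge> 0" using X(1)[of 0] by linarith
 have b: "\<bar>X x * Y x\<bar> \<le> C * C \<and> \<bar>X' x * Y x\<bar> \<le> C * C \<and> \<bar>X x * Y' x\<bar> \<le> C * C" for x
  using X(1,2)[of x] X(3)[of x] Y[of x] C
  by (cases "norm x \<le> R") (auto simp: abs_mult intro!: mult_mono)
 have i1: "integrable lborel (\<lambda>x. X' x * Y x)" "integrable lborel (\<lambda>x. X x * Y' x)"
  using b X(3) by (auto intro!: integrable_bounded_support[where C = "C * C" and R = R])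
 have "(LBINT x. X' x * Y x + X x * Y' x) = 0"
 proof (rule integral_ddiff_eq_0(2)[OF _ ddiff_mult[OF d], where C = "C * C + C * C" and R = R])
  fix x
  show "\<bar>X' x * Y x + X x * Y' x\<bar> \<le> C * C + C * C" "\<bar>X x * Y x\<bar> \<le> C * C + C * C"
   using b[of x] C mult_nonneg_nonneg[OF C C] by linarith+
 qed (use X(3) in auto)
 thus ?thesis using i1 by simp
qed

section \<open>Mollification\<close>

lemma tendsto_translation_indicator:
 fixes A :: "'a::euclidean_space set"
 assumes A: "A \<in> sets borel" "emeasure lborel A < \<infinity>" and "e > 0"
 shows "\<exists>\<delta>>0. \<forall>z. norm z < \<delta> -->
  (NNINT x. ennreal \<bar>indicator A (x + z) - indicator A x\<bar>) \<le> ennreal e"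
proof -
 have "e / 2 > 0" using assms by simp
 obtain U where U: "open U" "A \<subseteq> U" "emeasure lborel (U - A) < ennreal (e / 8)"
  using outer_regular_lborel[OF A(1), of "e / 8"] assms(3) by auto
 obtain D where D: "closed D" "D \<subseteq> A" "emeasure lebesgue (A - D) < ennreal (e / 8)"
  by (rule sets_lebesgue_inner_closed[of A "e / 8"]) (use A(1) \<open>e / 2 > 0\<close> in \<open>simp_all add: sets_completionI_sets\<close>)
 have D': "emeasure lborel (A - D) < ennreal (e / 8)"
  using D A by simp
 have "(\<lambda>n. emeasure lborel (A - cball 0 (real n))) \<longlonglongrightarrow> emeasure lborel (\<Inter>n. A - cball 0 (real n))"
 proof (intro Lim_emeasure_decseq)
  show "emeasure lborel (A - cball 0 (real n)) \<noteq> \<infinity>" for n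
  proof -
   have "emeasure lborel (A - cball 0 (real n)) \<le> emeasure lborel A" using A by (intro emeasure_mono) auto
   thus ?thesis using A(2) by auto
  qed
 qed (use A in \<open>auto simp: decseq_def\<close>)
 moreover have "(\<Inter>n. A - cball 0 (real n)) = {}"
  using real_arch_simple by fastforce
 ultimately have "(\<lambda>n. emeasure lborel (A - cball 0 (real n))) \<longlonglongrightarrow> 0"
  by (simp only: emeasure_empty)
 hence "eventually (\<lambda>n. emeasure lborel (A - cball 0 (real n)) < ennreal (e / 8)) sequentially"
  using assms(3) by (intro order_tendstoD) (auto simp: ennreal_less_zero_iff)
 then obtain n where n: "emeasure lborel (A - cball 0 (real n)) < ennreal (e / 8)"
  by (auto dest!: eventually_happens)
 define K where "K = D \<inter> cball 0 (real n)"
 have K: "compact K" "K \<subseteq> A" using D by (auto simp: K_def intro: closed_Int_compact)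
 have [measurable]: "K \<in> sets borel" "U \<in> sets borel" "D \<in> sets borel" "A \<in> sets borel"
  using K U D A by (auto intro: borel_compact)
 have UK: "emeasure lborel (U - K) \<le> ennreal (e / 2)"
 proof -
  have "U - K \<subseteq> (U - A) \<union> (A - D) \<union> (A - cball 0 (real n))" by (auto simp: K_def)
  hence "emeasure lborel (U - K) \<le> emeasure lborel ((U - A) \<union> (A - D) \<union> (A - cball 0 (real n)))"
   by (intro emeasure_mono) auto
  also have "... \<le> emeasure lborel ((U - A) \<union> (A - D)) + emeasure lborel (A - cball 0 (real n))"
   by (rule emeasure_subadditive) auto
  also have "... \<le> emeasure lborel (U - A) + emeasure lborel (A - D) + emeasure lborel (A - cball 0 (real n))"
   by (intro add_right_mono emeasure_subadditive) auto
  also have "... \<le> ennreal (e / 8) + ennreal (e / 8) + ennreal (e / 8)"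
   using U D' n by (intro add_mono) auto
  also have "... = ennreal (e / 8 + e / 8 + e / 8)" using assms(3) by (simp flip: ennreal_plus)
  also have "... \<le> ennreal (e / 2)" using assms(3) by (intro ennreal_leI) simp
  finally show ?thesis .
 qed
 obtain \<delta> where \<delta>: "\<delta> > 0" "\<forall>x\<in>K. \<forall>y\<in>-U. \<delta> \<le> dist x y"
  using separate_compact_closed[of K "- U"] K U by auto
 show ?thesis
 proof (intro exI[of _ \<delta>] conjI allI impI)
  fix z :: 'a assume z: "norm z < \<delta>"
  have pt: "ennreal \<bar>indicator A (x + z) - indicator A x\<bar> \<le> indicator (U - K) x + indicator (U - K) (x + z)" for x
  proof -
   have 1: "x + z \<in> U" if "x \<in> K" using \<delta> z that by (force simp: dist_norm)
   have 2: "x \<in> U" if "x + z \<in> K" using \<delta> z that by (force simp: dist_norm)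
   show ?thesis using 1 2 K(2) U(2) by (auto simp: indicator_def)
  qed
  have "(NNINT x. ennreal \<bar>indicator A (x + z) - indicator A x\<bar>)
    \<le> (NNINT x. indicator (U - K) x + indicator (U - K) (x + z))"
   by (intro nn_integral_mono pt)
  also have "... = emeasure lborel (U - K) + emeasure lborel (U - K)"
   by (subst nn_integral_add) (simp_all add: nn_integral_lborel_shift)
  also have "... \<le> ennreal (e / 2) + ennreal (e / 2)" by (intro add_mono UK)
  also have "... = ennreal e" using assms(3) by (simp flip: ennreal_plus)
  finally show "(NNINT x. ennreal \<bar>indicator A (x + z) - indicator A x\<bar>) \<le> ennreal e" .
 qed (use \<delta> in auto)
qed

text \<open>The class of integrable functions with continuous translations contains the indicators of sets of
 finite measure and is closed under linear combinations and limits in the mean.\<close>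

lemma tendsto_translation_L1:
 fixes u :: "'a::euclidean_space => real"
 assumes "integrable lborel u" "e > 0"
 shows "\<exists>\<delta>>0. \<forall>z. norm z < \<delta> --> (NNINT x. ennreal \<bar>u (x + z) - u x\<bar>) \<le> ennreal e"
 using assms
proof (induction arbitrary: e)
 case (base A c)
 define e' where "e' = e / (\<bar>c\<bar> + 1)"
 have e': "e' > 0" using base by (simp add: e'_def)
 obtain \<delta> where \<delta>: "\<delta> > 0" "\<And>z. norm z < \<delta> ==>
   (NNINT x. ennreal \<bar>indicator A (x + z) - indicator A x\<bar>) \<le> ennreal e'"
  using tendsto_translation_indicator[of A e'] base e' by auto
 have [measurable]: "A \<in> sets borel" using base by simp
 show ?case
 proof (intro exI[of _ \<delta>] conjI allI impI)
  fix z :: 'a assume z: "norm z < \<delta>"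
  have "(NNINT x. ennreal \<bar>indicator A (x + z) *\<^sub>R c - indicator A x *\<^sub>R c\<bar>)
    = (NNINT x. ennreal \<bar>c\<bar> * ennreal \<bar>indicator A (x + z) - indicator A x\<bar>)"
   by (intro nn_integral_cong) (auto simp: indicator_def)
  also have "... = ennreal \<bar>c\<bar> * (NNINT x. ennreal \<bar>indicator A (x + z) - indicator A x\<bar>)"
   by (rule nn_integral_cmult) simp
  also have "... \<le> ennreal \<bar>c\<bar> * ennreal e'" by (intro mult_left_mono \<delta> z) auto
  also have "... \<le> ennreal e" using base.prems
   by (auto simp: e'_def field_simps simp flip: ennreal_mult intro!: ennreal_leI)
  finally show "(NNINT x. ennreal \<bar>indicator A (x + z) *\<^sub>R c - indicator A x *\<^sub>R c\<bar>) \<le> ennreal e" .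
 qed fact
next
 case (add f g)
 have [measurable]: "f \<in> Borel" "g \<in> Borel"
  using add by auto
 obtain \<delta>1 \<delta>2 where \<delta>: "\<delta>1 > 0" "\<delta>2 > 0" 
  "\<And>z. norm z < \<delta>1 ==> (NNINT x. ennreal \<bar>f (x + z) - f x\<bar>) \<le> ennreal (e / 2)"
  "\<And>z. norm z < \<delta>2 ==> (NNINT x. ennreal \<bar>g (x + z) - g x\<bar>) \<le> ennreal (e / 2)"
  using add.IH[of "e / 2"] add.prems by auto
 show ?case
 proof (intro exI[of _ "min \<delta>1 \<delta>2"] conjI allI impI)
  fix z :: 'a assume z: "norm z < min \<delta>1 \<delta>2"
  have "(NNINT x. ennreal \<bar>f (x + z) + g (x + z) - (f x + g x)\<bar>)
    \<le> (NNINT x. ennreal \<bar>f (x + z) - f x\<bar> + ennreal \<bar>g (x + z) - g x\<bar>)"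
   by (intro nn_integral_mono) (auto simp flip: ennreal_plus intro!: ennreal_leI)
  also have "... = (NNINT x. ennreal \<bar>f (x + z) - f x\<bar>) + (NNINT x. ennreal \<bar>g (x + z) - g x\<bar>)"
   by (rule nn_integral_add) auto
  also have "... \<le> ennreal (e / 2) + ennreal (e / 2)" using z by (intro add_mono \<delta>) auto
  also have "... = ennreal e" using add.prems by (simp flip: ennreal_plus)
  finally show "(NNINT x. ennreal \<bar>f (x + z) + g (x + z) - (f x + g x)\<bar>) \<le> ennreal e" .
 qed (use \<delta> in auto)
next
 case (lim f s)
 have [measurable]: "f \<in> Borel" "\<And>i. s i \<in> Borel"
  using lim by auto
 have "(\<lambda>i. \<integral>\<^sup>+x. ennreal (norm (f x - s i x)) \<partial>lborel) \<longlonglongrightarrow> 0"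
 proof (rule nn_integral_dominated_convergence_norm[where w = "\<lambda>x. 2 * norm (f x)"])
  show "(NNINT x. ennreal (2 * norm (f x))) < \<infinity>"
   using lim.hyps(4) by (simp add: nn_integral_cmult ennreal_mult ennreal_mult_less_top integrable_iff_bounded)
 qed (use lim in auto)
 hence "(\<lambda>i. \<integral>\<^sup>+x. ennreal (norm (s i x - f x)) \<partial>lborel) \<longlonglongrightarrow> 0"
  by (simp add: abs_minus_commute)
 hence "eventually (\<lambda>i. (NNINT x. ennreal (norm (s i x - f x))) < ennreal (e / 3)) sequentially"
  using lim.prems by (intro order_tendstoD) auto
 then obtain i where i: "(NNINT x. ennreal \<bar>s i x - f x\<bar>) < ennreal (e / 3)"
  by (auto dest!: eventually_happens)
 obtain \<delta> where \<delta>: "\<delta> > 0" "\<And>z. norm z < \<delta> ==> (NNINT x. ennreal \<bar>s i (x + z) - s i x\<bar>) \<le> ennreal (e / 3)"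
  using lim.IH[of "e / 3" i] lim.prems by auto
 show ?case
 proof (intro exI[of _ \<delta>] conjI allI impI)
  fix z :: 'a assume z: "norm z < \<delta>"
  have "(NNINT x. ennreal \<bar>f (x + z) - f x\<bar>)
    \<le> (NNINT x. ennreal \<bar>s i (x + z) - f (x + z)\<bar> + (ennreal \<bar>s i (x + z) - s i x\<bar> + ennreal \<bar>s i x - f x\<bar>))"
   by (intro nn_integral_mono) (auto simp flip: ennreal_plus intro!: ennreal_leI)
  also have "... = (NNINT x. ennreal \<bar>s i (x + z) - f (x + z)\<bar>) +
    ((NNINT x. ennreal \<bar>s i (x + z) - s i x\<bar>) + (NNINT x. ennreal \<bar>s i x - f x\<bar>))"
   by (subst nn_integral_add, simp, simp, subst nn_integral_add) auto
  also have "... \<le> ennreal (e / 3) + (ennreal (e / 3) + ennreal (e / 3))"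
   using i nn_integral_lborel_shift[of "\<lambda>x. ennreal \<bar>s i x - f x\<bar>" z]
   by (intro add_mono \<delta> z) auto
  also have "... = ennreal e" using lim.prems by (simp flip: ennreal_plus)
  finally show "(NNINT x. ennreal \<bar>f (x + z) - f x\<bar>) \<le> ennreal e" .
 qed fact
qed

text \<open>Integrability on all balls about the origin stands for local integrability; the function itself is
 required to be Borel, so that it can be integrated against Lebesgue-Borel measure.\<close>

definition locint :: "(real ^ 'n::finite => real) => bool" where
 "locint u \<longleftrightarrow> u \<in> Borel \<and> (\<forall>R. integrable lborel (\<lambda>x. indicator (cball 0 R) x * u x))"

lemma locint_meas: "locint u ==> u \<in> Borel"
 by (simp add: locint_def)

lemma locint_integrable: "locint u ==> integrable lborel (\<lambda>x. indicator (cball 0 R) x * u x)"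
 by (simp add: locint_def)

lemma integrable_locint: "integrable lborel u ==> locint u"
 using integrable_mult_indicator[of _ lborel u] by (auto simp: locint_def)

lemma locint_mult_bounded:
 assumes "locint u" and [measurable]: "f \<in> Borel"
  and f: "\<And>x. \<bar>f x\<bar> \<le> C" "\<And>x. norm x > R ==> f x = 0"
 shows "integrable lborel (\<lambda>x. f x * u x)" "integrable lborel (\<lambda>x. u x * f x)"
proof -
 have [measurable]: "u \<in> Borel" using assms(1) by (rule locint_meas)
 show "integrable lborel (\<lambda>x. f x * u x)"
 proof (rule integrable_dominated)
  show "integrable lborel (\<lambda>x. C * (indicator (cball 0 R) x * u x))"
   by (intro integrable_mult_right locint_integrable assms)
  show "AE x in lborel. norm (f x * u x) \<le> norm (C * (indicator (cball 0 R) x * u x))"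
  proof (rule AE_I2)
   fix x
   have "0 \<le> C" using f(1)[of x] by linarith
   thus "norm (f x * u x) \<le> norm (C * (indicator (cball 0 R) x * u x))"
    using f(1)[of x] f(2)[of x]
    by (cases "norm x \<le> R") (auto simp: indicator_def abs_mult mult_right_mono)
  qed
 qed simp
 thus "integrable lborel (\<lambda>x. u x * f x)" by (simp add: mult.commute)
qed

lemma flat_exp_measurable [measurable]: "flat_exp m \<in> Borel"
 unfolding flat_exp_def[abs_def] by measurable

lemma bump_measurable [measurable (raw)]:
 assumes [measurable]: "f \<in> borel_measurable M" "g \<in> borel_measurable M"
 shows "(\<lambda>x. bump d (f x) (g x :: real ^ 'n::finite)) \<in> borel_measurable M"
 unfolding bump_def by measurable

definition bump_mass :: "real => 'n::finite itself => real" where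
 "bump_mass d _ = (LBINT y. bump d (0 :: real ^ 'n) y)"

lemma bump_integrable:
 assumes "d > 0" shows "integrable lborel (bump d (a :: real ^ 'n::finite))"
proof (rule integrable_bounded_support[where C = 1 and R = "norm a + d"])
 show "bump d a x = 0" if "norm x > norm a + d" for x
  using that assms norm_triangle_ineq[of a "x - a"]
  by (intro bump_eq_0) (auto simp: dist_norm norm_minus_commute)
qed (auto simp: bump_nonneg bump_le_1)

lemma bump_mass_pos:
 assumes "d > 0" shows "bump_mass d TYPE('n::finite) > 0"
proof -
 have "bump_mass d TYPE('n) \<noteq> 0"
 proof
  assume "bump_mass d TYPE('n) = 0"
  hence "AE y in lborel. bump d (0 :: real ^ 'n) y = 0"
   using integral_nonneg_eq_0_iff_AE[OF bump_integrable[OF assms, of 0]] bump_nonneg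
   by (auto simp: bump_mass_def)
  hence "AE y in lborel. (y :: real ^ 'n) \<notin> ball 0 d"
   by eventually_elim (use bump_pos_iff[OF assms, of 0] in force)
  hence "emeasure lborel (ball (0 :: real ^ 'n) d) = 0"
   by (subst (asm) AE_iff_measurable[of "ball 0 d"]) auto
  moreover have "measure lborel (ball (0 :: real ^ 'n) d) > 0" using assms by simp
  ultimately show False by (simp add: measure_def)
 qed
 moreover have "bump_mass d TYPE('n) \<ge> 0"
  unfolding bump_mass_def by (intro integral_nonneg_AE) (auto simp: bump_nonneg)
 ultimately show ?thesis by linarith
qed

definition moll :: "real => (real ^ 'n::finite => real) => real ^ 'n => real" where
 "moll d u x = (LBINT y. bump d x y * u y) / bump_mass d TYPE('n)"

lemma moll_measurable [measurable]:
 assumes [measurable]: "u \<in> Borel"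
 shows "moll d u \<in> Borel"
 unfolding moll_def[abs_def] by measurable

lemma bump_support_norm:
 "d > 0 ==> bump d x y \<noteq> 0 ==> norm y \<le> norm x + d"
 using bump_pos_iff[of d x y] bump_nonneg[of d x y] norm_triangle_ineq[of x "y - x"]
 by (auto simp: dist_norm norm_minus_commute)

lemma bump_mult_integrable:
 assumes "locint u" "d > 0"
 shows "integrable lborel (\<lambda>y. bump d x y * u y)"
 by (rule locint_mult_bounded(1)[OF assms(1), where C = 1 and R = "norm x + d"])
   (use bump_support_norm[OF assms(2), of x] in \<open>auto simp: bump_nonneg bump_le_1 not_le[symmetric]\<close>)

lemma bump_mass_shift: "(NNINT y. ennreal (bump d x y)) = ennreal (bump_mass d TYPE('n))"
 if "d > 0" for x :: "real ^ 'n::finite"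
proof -
 have "(NNINT y. ennreal (bump d x y)) = (NNINT y. ennreal (bump d x (y + x)))"
  by (subst nn_integral_lborel_shift[of "\<lambda>y. ennreal (bump d x y)"]) auto
 also have "... = (NNINT y. ennreal (bump d 0 (y :: real ^ 'n)))"
  using bump_shift[of d 0 x] by simp
 also have "... = ennreal (bump_mass d TYPE('n))"
  unfolding bump_mass_def by (rule nn_integral_eq_integral[OF bump_integrable[OF that]]) (auto simp: bump_nonneg)
 finally show ?thesis .
qed

lemma moll_L1:
 fixes u :: "'n::finite sfun"
 assumes u: "integrable lborel u" and "e > 0"
 shows "\<exists>\<delta>>0. \<forall>d. 0 < d \<and> d < \<delta> --> (NNINT x. ennreal \<bar>moll d u x - u x\<bar>) \<le> ennreal e"
proof -
 have [measurable]: "u \<in> Borel" using u by auto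
 obtain \<delta> where \<delta>: "\<delta> > 0" "\<And>z. norm z < \<delta> ==> (NNINT x. ennreal \<bar>u (x + z) - u x\<bar>) \<le> ennreal e"
  using tendsto_translation_L1[OF assms] by auto
 show ?thesis
 proof (intro exI[of _ \<delta>] conjI allI impI)
  fix d assume d: "0 < d \<and> d < \<delta>"
  define m where "m = bump_mass d TYPE('n)"
  have m: "m > 0" using bump_mass_pos d by (auto simp: m_def)
  have pt: "ennreal \<bar>moll d u x - u x\<bar> \<le> (NNINT z. ennreal (bump d 0 z / m) * ennreal \<bar>u (x + z) - u x\<bar>)" for x
  proof -
   have i1: "integrable lborel (\<lambda>y. bump d x y * u y)"
    using bump_mult_integrable[OF integrable_locint[OF u]] d by auto
   have i2: "integrable lborel (\<lambda>y. bump d x y * u x)"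
    using bump_integrable d by (intro integrable_mult_left) auto
   have "(LBINT y. bump d x y) = m"
    using bump_mass_shift[of d x] d m nn_integral_eq_integral[OF bump_integrable[of d x]]
    by (simp add: m_def[symmetric] integral_nonneg_AE bump_nonneg)
   hence "moll d u x - u x = (LBINT y. bump d x y * u y) / m - (LBINT y. bump d x y * u x) / m"
    using m by (simp add: moll_def m_def[symmetric])
   also have "... = (LBINT y. (bump d x y * u y - bump d x y * u x) / m)"
    using i1 i2 by (simp add: diff_divide_distrib)
   finally have eq: "moll d u x - u x = (LBINT y. (bump d x y * u y - bump d x y * u x) / m)" .
   have "ennreal (norm (moll d u x - u x)) \<le> (NNINT y. ennreal (norm ((bump d x y * u y - bump d x y * u x) / m)))"
    unfolding eq by (rule integral_norm_bound_ennreal) (use i1 i2 in auto)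
   also have "... = (NNINT y. ennreal (bump d x y / m) * ennreal \<bar>u y - u x\<bar>)"
    using m by (intro nn_integral_cong)
     (simp add: bump_nonneg abs_mult flip: ennreal_mult right_diff_distrib)
   also have "... = (NNINT z. ennreal (bump d x (z + x) / m) * ennreal \<bar>u (z + x) - u x\<bar>)"
    by (subst nn_integral_lborel_shift[symmetric, of _ x]) auto
   also have "... = (NNINT z. ennreal (bump d 0 z / m) * ennreal \<bar>u (x + z) - u x\<bar>)"
    using bump_shift[of d 0 x] by (simp add: add.commute)
   finally show ?thesis by simp
  qed
  have "(NNINT x. ennreal \<bar>moll d u x - u x\<bar>)
   \<le> (NNINT x. (NNINT z. ennreal (bump d 0 z / m) * ennreal \<bar>u (x + z) - u x\<bar>))"
   by (intro nn_integral_mono pt)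
  also have "... = (NNINT z. (NNINT x. ennreal (bump d 0 z / m) * ennreal \<bar>u (x + z) - u x\<bar>))"
   by (rule lborel_pair.Fubini') measurable
  also have "... = (NNINT z. ennreal (bump d 0 z / m) * (NNINT x. ennreal \<bar>u (x + z) - u x\<bar>))"
   by (intro nn_integral_cong nn_integral_cmult) measurable
  also have "... \<le> (NNINT z. ennreal (bump d 0 (z :: real ^ 'n) / m) * ennreal e)"
  proof (intro nn_integral_mono)
   fix z :: "real ^ 'n"
   show "ennreal (bump d 0 z / m) * (NNINT x. ennreal \<bar>u (x + z) - u x\<bar>) \<le> ennreal (bump d 0 z / m) * ennreal e"
    using bump_eq_0[of d 0 z] \<delta>(2)[of z] d
    by (cases "norm z < d") (auto intro!: mult_left_mono)
  qed
  also have "... = (NNINT z. ennreal (bump d 0 (z :: real ^ 'n)) * ennreal (e / m))"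
   using m assms(2) by (intro nn_integral_cong) (simp add: bump_nonneg flip: ennreal_mult)
  also have "... = ennreal m * ennreal (e / m)"
   using bump_mass_shift[of d "0 :: real ^ 'n"] d by (subst nn_integral_multc) (auto simp: m_def)
  also have "... = ennreal e" using m assms(2) by (simp flip: ennreal_mult)
  finally show "(NNINT x. ennreal \<bar>moll d u x - u x\<bar>) \<le> ennreal e" .
 qed fact
qed

lemma moll_L1_local:
 fixes u :: "'n::finite sfun"
 assumes u: "locint u" and "e > 0"
 shows "\<exists>\<delta>>0. \<forall>d. 0 < d \<and> d < \<delta> -->
  (NNINT x. ennreal (indicator (cball 0 R) x * \<bar>moll d u x - u x\<bar>)) \<le> ennreal e"
proof -
 let ?U = "\<lambda>x. indicator (cball 0 (R + 1)) x * u x"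
 obtain \<delta> where \<delta>: "\<delta> > 0" "\<And>d. 0 < d ==> d < \<delta> ==> (NNINT x. ennreal \<bar>moll d ?U x - ?U x\<bar>) \<le> ennreal e"
  using moll_L1[OF locint_integrable[OF u] assms(2)] by blast
 show ?thesis
 proof (intro exI[of _ "min \<delta> 1"] conjI allI impI)
  fix d assume d: "0 < d \<and> d < min \<delta> 1"
  have "ennreal (indicator (cball 0 R) x * \<bar>moll d u x - u x\<bar>) \<le> ennreal \<bar>moll d ?U x - ?U x\<bar>" for x
  proof (cases "norm x \<le> R")
   case True
   have "bump d x y * u y = bump d x y * ?U y" for y
    using bump_support_norm[of d x y] d True by (cases "bump d x y = 0") (auto simp: indicator_def)
   hence "moll d u x = moll d ?U x" unfolding moll_def by presburger
   thus ?thesis using True by (simp add: indicator_def)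
  qed (simp add: indicator_def)
  hence "(NNINT x. ennreal (indicator (cball 0 R) x * \<bar>moll d u x - u x\<bar>))
   \<le> (NNINT x. ennreal \<bar>moll d ?U x - ?U x\<bar>)" by (intro nn_integral_mono)
  also have "... \<le> ennreal e" using \<delta> d by auto
  finally show "(NNINT x. ennreal (indicator (cball 0 R) x * \<bar>moll d u x - u x\<bar>)) \<le> ennreal e" .
 qed (use \<delta> in auto)
qed

lemma moll_bounded:
 fixes u :: "'n::finite sfun"
 assumes u: "locint u" and d: "d > 0"
 shows "\<exists>C. \<forall>x. norm x \<le> R --> \<bar>moll d u x\<bar> \<le> C"
proof (intro exI allI impI)
 fix x :: "real ^ 'n" assume x: "norm x \<le> R"
 have "\<bar>LBINT y. bump d x y * u y\<bar> \<le> (LBINT y. \<bar>indicator (cball 0 (R + d)) y * u y\<bar>)"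
 proof (rule order.trans[OF integral_abs_bound])
  show "(LBINT y. \<bar>bump d x y * u y\<bar>) \<le> (LBINT y. \<bar>indicator (cball 0 (R + d)) y * u y\<bar>)"
  proof (rule integral_mono)
   show "integrable lborel (\<lambda>y. \<bar>bump d x y * u y\<bar>)"
    using bump_mult_integrable[OF u d] by (rule integrable_abs)
   show "integrable lborel (\<lambda>y. \<bar>indicator (cball 0 (R + d)) y * u y\<bar>)"
    using locint_integrable[OF u] by (rule integrable_abs)
   fix y :: "real ^ 'n"
   show "\<bar>bump d x y * u y\<bar> \<le> \<bar>indicator (cball 0 (R + d)) y * u y\<bar>"
    using bump_support_norm[OF d, of x y] x bump_le_1[of d x y] bump_nonneg[of d x y]
    by (cases "bump d x y = 0") (auto simp: indicator_def abs_mult intro!: mult_left_le_one_le)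
  qed
 qed
 thus "\<bar>moll d u x\<bar> \<le> (LBINT y. \<bar>indicator (cball 0 (R + d)) y * u y\<bar>) / bump_mass d TYPE('n)"
  unfolding moll_def using bump_mass_pos[OF d, where 'n = 'n] by (simp add: divide_right_mono)
qed

lemma partial_bump:
 assumes d: "d > 0"
 shows "partial_deriv i (bump d a) x = partial_deriv i (bump d 0) (x - a)"
  "partial_deriv i (bump d 0) (- x) = - partial_deriv i (bump d 0) (x :: real ^ 'n::finite)"
proof -
 have D: "ddiff i (bump d a) (partial_deriv i (bump d a))" for a :: "real ^ 'n"
  by (rule test_functionD(3)[OF bump_test[OF d subset_UNIV]])
 note 0 = D[of 0, unfolded ddiff_def, rule_format]
 have "((\<lambda>t. bump d 0 ((x - a) + t *\<^sub>R axis i 1)) has_real_derivative partial_deriv i (bump d 0) (x - a)) (at 0)"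
  by (rule 0)
 moreover have "bump d 0 ((x - a) + t *\<^sub>R axis i 1) = bump d a (x + t *\<^sub>R axis i 1)" for t
  by (simp add: bump_def algebra_simps)
 ultimately show "partial_deriv i (bump d a) x = partial_deriv i (bump d 0) (x - a)"
  using D[of a, unfolded ddiff_def, rule_format, of x] DERIV_unique by fastforce
 have m: "((\<lambda>t::real. - t) has_real_derivative (-1)) (at 0)" by (auto intro!: derivative_eq_intros)
 have "((\<lambda>t. bump d 0 (x + t *\<^sub>R axis i 1)) has_real_derivative partial_deriv i (bump d 0) x) (at (- 0))"
  using 0[of x] by simp
 from DERIV_chain2[OF this m]
 have "((\<lambda>t. bump d 0 (x + (- t) *\<^sub>R axis i 1)) has_real_derivative - partial_deriv i (bump d 0) x) (at 0)"
  by simp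
 moreover have "bump d 0 (x + (- t) *\<^sub>R axis i 1) = bump d 0 (- x + t *\<^sub>R axis i 1)" for t
  using norm_minus_cancel[of "x - t *\<^sub>R axis i 1"] by (simp add: bump_def)
 ultimately show "partial_deriv i (bump d 0) (- x) = - partial_deriv i (bump d 0) x"
  using 0[of "- x"] DERIV_unique by fastforce
qed

text \<open>The derivative falls on the bump; the difference quotients are dominated because the bump is
 Lipschitz.\<close>

lemma moll_ddiff:
 fixes u :: "'n::finite sfun"
 assumes u: "locint u" and d: "d > 0"
 shows "ddiff i (moll d u) (\<lambda>x. (LBINT y. partial_deriv i (bump d 0) (x - y) * u y) / bump_mass d TYPE('n))"
 unfolding ddiff_def
proof
 fix x :: "real ^ 'n"
 let ?e = "axis i 1 :: real ^ 'n" and ?m = "bump_mass d TYPE('n)" and ?\<beta> = "partial_deriv i (bump d (0 :: real ^ 'n))"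
 have [measurable]: "u \<in> Borel" using u by (rule locint_meas)
 have tb: "bump d a \<in> test_functions UNIV" for a :: "real ^ 'n" by (rule bump_test[OF d subset_UNIV])
 have T2: "ddiff i (bump d a) (partial_deriv i (bump d a))" for a :: "real ^ 'n"
  by (rule test_functionD(3)[OF tb])
 have [measurable]: "?\<beta> \<in> Borel" by (rule test_functionD(2)[OF tb])
 have m: "?m > 0" using bump_mass_pos d by auto
 obtain C where C: "\<And>x. \<bar>?\<beta> x\<bar> \<le> C" using test_functionD(4)[OF tb[of 0], of i] by blast
 have C0: "C \<ge> 0" using C[of 0] by linarith
 have b: "\<bar>bump d (x + t *\<^sub>R ?e) y - bump d x y\<bar> \<le> C * \<bar>t\<bar>" for t y
 proof -
  have "\<bar>bump d y (x + t *\<^sub>R ?e) - bump d y x\<bar> \<le> C * \<bar>t\<bar>"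
   by (rule ddiff_lipschitz[OF T2]) (simp add: partial_bump(1)[OF d, of i y] C)
  thus ?thesis by (simp add: bump_sym)
 qed
 show "((\<lambda>t. moll d u (x + t *\<^sub>R ?e)) has_real_derivative
   (LBINT y. ?\<beta> (x - y) * u y) / ?m) (at 0)"
  unfolding DERIV_def
 proof (subst tendsto_at_iff_sequentially, intro allI impI)
  fix h :: "nat => real" assume h: "\<forall>n. h n \<in> UNIV - {0}" "h \<longlonglongrightarrow> 0"
  have "eventually (\<lambda>n. \<bar>h n\<bar> < 1) sequentially"
   using h(2) by (auto simp: LIMSEQ_def eventually_sequentially dist_real_def intro: zero_less_one)
  then obtain N where N: "\<And>n. n \<ge> N ==> \<bar>h n\<bar> < 1" by (auto simp: eventually_sequentially)
  define q where "q n y = (bump d (x + h (n + N) *\<^sub>R ?e) y - bump d x y) / h (n + N) * u y" for n y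
  have hN: "h n \<noteq> 0" for n using h(1) by auto
  have [measurable]: "q n \<in> Borel" for n unfolding q_def by measurable
  let ?w = "\<lambda>y. C * \<bar>indicator (cball 0 (norm x + 1 + d)) y * u y\<bar>"
  have w: "integrable lborel ?w"
   by (intro integrable_mult_right integrable_abs locint_integrable u)
  have bd: "norm (q n y) \<le> ?w y" for n y
  proof (cases "norm y \<le> norm x + 1 + d")
   case True
   have "\<bar>bump d (x + h (n + N) *\<^sub>R ?e) y - bump d x y\<bar> / \<bar>h (n + N)\<bar> \<le> C"
    using b[of "h (n + N)" y] hN[of "n + N"] by (simp add: field_simps)
   from mult_right_mono[OF this, of "\<bar>u y\<bar>"] show ?thesis using True by (simp add: q_def abs_mult indicator_def)
  next
   case False
   have "norm (x + h (n + N) *\<^sub>R ?e) \<le> norm x + 1"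
    using norm_triangle_ineq[of x "h (n + N) *\<^sub>R ?e"] N[of "n + N"] by simp
   hence "bump d (x + h (n + N) *\<^sub>R ?e) y = 0" "bump d x y = 0"
    using False bump_support_norm[OF d, of "x + h (n + N) *\<^sub>R ?e" y] bump_support_norm[OF d, of x y] by fastforce+
   thus ?thesis using C0 by (simp add: q_def)
  qed
  have lim: "(\<lambda>n. q n y) \<longlonglongrightarrow> ?\<beta> (x - y) * u y" for y
  proof -
   have "((\<lambda>t. (bump d y (x + t *\<^sub>R ?e) - bump d y x) / t) \<longlongrightarrow> ?\<beta> (x - y)) (at 0)"
    using T2[of y, unfolded ddiff_def, rule_format, of x] by (simp add: DERIV_def partial_bump(1)[OF d, of i y])
   hence "(\<lambda>n. (bump d y (x + h n *\<^sub>R ?e) - bump d y x) / h n) \<longlonglongrightarrow> ?\<beta> (x - y)"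
    using h by (subst (asm) tendsto_at_iff_sequentially) (auto simp: o_def)
   from LIMSEQ_ignore_initial_segment[OF this, of N]
   show ?thesis unfolding q_def by (intro tendsto_mult tendsto_const) (simp add: bump_sym)
  qed
  have "(\<lambda>n. LBINT y. q n y) \<longlonglongrightarrow> (LBINT y. ?\<beta> (x - y) * u y)"
   by (rule integral_dominated_convergence[where s = q, OF _ _ w]) (use lim bd in auto)
  hence "(\<lambda>n. (LBINT y. q n y) / ?m) \<longlonglongrightarrow> (LBINT y. ?\<beta> (x - y) * u y) / ?m"
   by (intro tendsto_divide tendsto_const) (use m in auto)
  moreover have "(LBINT y. q n y) / ?m = (moll d u (x + h (n + N) *\<^sub>R ?e) - moll d u x) / h (n + N)" for n
  proof -
   have "(LBINT y. q n y) = (LBINT y. (bump d (x + h (n + N) *\<^sub>R ?e) y * u y - bump d x y * u y) / h (n + N))"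
    by (intro integral_eqI) (auto simp: q_def left_diff_distrib)
   also have "... = ((LBINT y. bump d (x + h (n + N) *\<^sub>R ?e) y * u y) - (LBINT y. bump d x y * u y)) / h (n + N)"
    using bump_mult_integrable[OF u d] by simp
   finally show ?thesis by (simp add: moll_def diff_divide_distrib mult.commute)
  qed
  ultimately have "(\<lambda>n. (moll d u (x + h (n + N) *\<^sub>R ?e) - moll d u x) / h (n + N)) \<longlonglongrightarrow> (LBINT y. ?\<beta> (x - y) * u y) / ?m"
   by simp
  hence "(\<lambda>n. (moll d u (x + h n *\<^sub>R ?e) - moll d u x) / h n) \<longlonglongrightarrow> (LBINT y. ?\<beta> (x - y) * u y) / ?m"
   by (rule LIMSEQ_offset[where k = N])
  thus "((\<lambda>t. (moll d u (x + (0 + t) *\<^sub>R ?e) - moll d u (x + 0 *\<^sub>R ?e)) / t) \<circ> h) \<longlonglongrightarrow> (LBINT y. ?\<beta> (x - y) * u y) / ?m"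
   by (simp add: o_def)
 qed
qed

section \<open>Calculus of weak gradients on the whole space\<close>

lemma indicator_cball_measurable [measurable]:
 "indicator (cball a R :: 'a::euclidean_space set) \<in> Borel"
 by (rule borel_measurable_indicator) simp

text \<open>Weak gradients on the whole space, for Borel representatives.\<close>

definition wgrad :: "(real ^ 'n::finite => real) => (real ^ 'n => real ^ 'n) => bool" where
 "wgrad u v \<longleftrightarrow> locint u \<and> (\<forall>i. locint (\<lambda>x. v x $ i)) \<and>
   (\<forall>\<phi>\<in>test_functions UNIV. \<forall>i.
    (LBINT x. u x * partial_deriv i \<phi> x) = - (LBINT x. v x $ i * \<phi> x))"

lemma wgradD:
 assumes "wgrad u v"
 shows "locint u" "locint (\<lambda>x. v x $ i)" "u \<in> Borel"
  "(\<lambda>x. v x $ i) \<in> Borel"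
  "\<phi> \<in> test_functions UNIV ==>
    (LBINT x. u x * partial_deriv i \<phi> x) = - (LBINT x. v x $ i * \<phi> x)"
 using assms locint_meas unfolding wgrad_def by blast+

lemma borel_measurable_vec_componentwise:
 fixes v :: "'a => real ^ 'n::finite"
 assumes "\<And>i. (\<lambda>x. v x $ i) \<in> borel_measurable M"
 shows "v \<in> borel_measurable M"
 by (rule borel_measurable_euclidean_space[THEN iffD2])
   (auto simp: Basis_vec_def inner_axis assms)

lemma vec_nth_measurable [measurable (raw)]:
 fixes v :: "'a => real ^ 'n::finite"
 assumes "v \<in> borel_measurable M" shows "(\<lambda>x. v x $ i) \<in> borel_measurable M"
 by (rule measurable_compose[OF assms])
   (intro borel_measurable_continuous_onI linear_continuous_on bounded_linear_vec_nth)

lemma wgrad_measurable: "wgrad u v ==> v \<in> Borel"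
 by (rule borel_measurable_vec_componentwise) (rule wgradD)

text \<open>As a function of \<open>y\<close> the bump is a test function, and its derivatives in \<open>x\<close> and \<open>y\<close> differ in sign.\<close>

lemma moll_ddiff_wgrad:
 assumes "wgrad u v" "d > 0"
 shows "ddiff i (moll d u) (moll d (\<lambda>x. v x $ i))"
proof -
 have "(LBINT y. partial_deriv i (bump d 0) (x - y) * u y) = (LBINT y. bump d x y * v y $ i)" for x :: "real ^ 'a"
 proof -
  have "(LBINT y. partial_deriv i (bump d 0) (x - y) * u y)
    = (LBINT y. - (u y * partial_deriv i (bump d x) y))"
  proof (intro integral_eqI refl)
   fix y
   have "partial_deriv i (bump d 0) (x - y) = - partial_deriv i (bump d x) y"
    using partial_bump(2)[OF assms(2), of i "y - x"] partial_bump(1)[OF assms(2), of i x y] by simp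
   thus "partial_deriv i (bump d 0) (x - y) * u y = - (u y * partial_deriv i (bump d x) y)" by simp
  qed
  also have "... = (LBINT y. v y $ i * bump d x y)"
   using wgradD(5)[OF assms(1) bump_test[OF assms(2) subset_UNIV], of i x] by simp
  finally show ?thesis by (simp add: mult.commute)
 qed
 thus ?thesis
  using moll_ddiff[OF wgradD(1)[OF assms(1)] assms(2), of i] by (simp add: moll_def[abs_def])
qed

lemma nn_integral_le_all_eps:
 assumes "\<And>e. e > 0 ==> (I :: ennreal) \<le> ennreal e" shows "I = 0"
 by (metis assms ennreal_less_zero_iff ennreal_eq_0_iff ennreal_le_epsilon add.left_neutral zero_le le_zero_eq)

text \<open>The mollification at a point near which bumps are test functions is zero, and mollifications
 converge to the function in the mean.\<close>

lemma fundamental_lemma: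
 fixes u :: "'n::finite sfun"
 assumes u: "locint u" and z: "\<And>\<phi>. \<phi> \<in> test_functions \<Omega> ==> (LBINT x. u x * \<phi> x) = 0"
  and \<Omega>: "\<And>x. norm x \<le> R ==> cball x r \<subseteq> \<Omega>" "r > 0"
 shows "AE x in lborel. norm x \<le> R --> u x = 0"
proof -
 have [measurable]: "u \<in> Borel" using u by (rule locint_meas)
 have "(NNINT x. ennreal (indicator (cball 0 R) x * \<bar>u x\<bar>)) \<le> ennreal e" if e: "e > 0" for e
 proof -
  obtain \<delta> where \<delta>: "\<delta> > 0" "\<forall>d. 0 < d \<and> d < \<delta> -->
    (NNINT x. ennreal (indicator (cball 0 R) x * \<bar>moll d u x - u x\<bar>)) \<le> ennreal e"
   using moll_L1_local[OF u e] by blast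
  define d where "d = min (\<delta> / 2) r"
  have d: "0 < d" "d < \<delta>" "d \<le> r" using \<delta> \<Omega> by (auto simp: d_def)
  have "moll d u x = 0" if "norm x \<le> R" for x
  proof -
   have "bump d x \<in> test_functions \<Omega>"
    using \<Omega>(1)[OF that] d by (intro bump_test) auto
   from z[OF this] show ?thesis by (simp add: moll_def mult.commute)
  qed
  hence "(NNINT x. ennreal (indicator (cball 0 R) x * \<bar>u x\<bar>))
   = (NNINT x. ennreal (indicator (cball 0 R) x * \<bar>moll d u x - u x\<bar>))"
   by (intro nn_integral_cong) (auto simp: indicator_def)
  thus ?thesis using \<delta>(2) d by auto
 qed
 hence "(NNINT x. ennreal (indicator (cball 0 R) x * \<bar>u x\<bar>)) = 0"
  by (rule nn_integral_le_all_eps)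
 hence "AE x in lborel. ennreal (indicator (cball 0 R) x * \<bar>u x\<bar>) = 0"
  by (subst (asm) nn_integral_0_iff_AE) auto
 thus ?thesis by eventually_elim (auto simp: indicator_def)
qed

lemma AE_norm_le_all:
 assumes "\<And>n::nat. AE x in M. norm (x :: 'a::real_normed_vector) \<le> real n --> P x"
 shows "AE x in M. P x"
proof -
 have "AE x in M. \<forall>n::nat. norm x \<le> real n --> P x" using assms by (subst AE_all_countable) auto
 thus ?thesis by eventually_elim (use real_arch_simple in blast)
qed

lemma fundamental_lemma_UNIV:
 assumes "locint u" "\<And>\<phi>. \<phi> \<in> test_functions UNIV ==> (LBINT x. u x * \<phi> x) = 0"
 shows "AE x in lborel. u x = 0"
 by (rule AE_norm_le_all, rule fundamental_lemma[OF assms(1), where \<Omega> = UNIV and r = 1])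
   (use assms(2) in auto)

lemma test_locint_integrable:
 assumes "locint u" "\<phi> \<in> test_functions \<Omega>"
 shows "integrable lborel (\<lambda>x. u x * \<phi> x)" "integrable lborel (\<lambda>x. u x * partial_deriv i \<phi> x)"
proof -
 note T = test_functionD[OF assms(2)]
 obtain R C where R: "\<forall>x. \<bar>\<phi> x\<bar> \<le> C \<and> \<bar>partial_deriv i \<phi> x\<bar> \<le> C \<and> (norm x > R --> \<phi> x = 0 \<and> partial_deriv i \<phi> x = 0)"
  using T(4)[of i] by blast
 show "integrable lborel (\<lambda>x. u x * \<phi> x)" "integrable lborel (\<lambda>x. u x * partial_deriv i \<phi> x)"
  by (rule locint_mult_bounded(2)[OF assms(1) T(1), where C = C and R = R]; use R in blast)
    (rule locint_mult_bounded(2)[OF assms(1) T(2), where C = C and R = R]; use R in blast)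
qed

lemma wgrad_unique:
 fixes u :: "'n::finite sfun"
 assumes "wgrad u v" "wgrad u' v'" "AE x in lborel. u x = u' x"
 shows "AE x in lborel. v x = v' x"
proof -
 have [measurable]: "u \<in> Borel" "u' \<in> Borel"
  using assms wgradD by blast+
 have "AE x in lborel. v x $ i - v' x $ i = 0" for i
 proof (rule fundamental_lemma_UNIV)
  have l: "locint (\<lambda>x. v x $ i)" "locint (\<lambda>x. v' x $ i)" using assms wgradD(2) by blast+
  have "integrable lborel (\<lambda>x. indicator (cball 0 R) x * v x $ i - indicator (cball 0 R) x * v' x $ i)" for R
   by (intro Bochner_Integration.integrable_diff locint_integrable l)
  thus "locint (\<lambda>x. v x $ i - v' x $ i)" using l locint_meas
   by (auto simp: locint_def right_diff_distrib)
  fix \<phi> :: "'n sfun" assume p: "\<phi> \<in> test_functions UNIV"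
  have [measurable]: "partial_deriv i \<phi> \<in> Borel" using test_functionD(2)[OF p] .
  have "(LBINT x. u x * partial_deriv i \<phi> x) = (LBINT x. u' x * partial_deriv i \<phi> x)"
   by (intro integral_cong_AE) (use assms(3) in auto)
  hence "(LBINT x. v x $ i * \<phi> x) = (LBINT x. v' x $ i * \<phi> x)"
   using wgradD(5)[OF assms(1) p, of i] wgradD(5)[OF assms(2) p, of i] by simp
  thus "(LBINT x. (v x $ i - v' x $ i) * \<phi> x) = 0"
   using test_locint_integrable(1)[OF l(1) p] test_locint_integrable(1)[OF l(2) p]
   by (simp add: left_diff_distrib)
 qed
 hence "AE x in lborel. \<forall>i. v x $ i - v' x $ i = 0"
  by (intro AE_finite_allI[of UNIV, simplified]) auto
 thus ?thesis by eventually_elim (simp add: vec_eq_iff)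
qed

lemma locint_moll:
 assumes "locint u" "d > 0" shows "locint (moll d u)"
 unfolding locint_def
proof (intro conjI allI)
 have [measurable]: "u \<in> Borel" using assms(1) by (rule locint_meas)
 show "moll d u \<in> Borel" by simp
 fix R
 obtain C where "\<forall>x. norm x \<le> R --> \<bar>moll d u x\<bar> \<le> C" using moll_bounded[OF assms] by blast
 thus "integrable lborel (\<lambda>x. indicator (cball 0 R) x * moll d u x)"
  by (intro integrable_bounded_support[where C = "max C 0" and R = R]) (auto simp: indicator_def)
qed

lemma moll_seq_L1_local:
 fixes u :: "'n::finite sfun"
 assumes u: "locint u"
 shows "(\<lambda>n. LBINT x. \<bar>indicator (cball 0 R) x * (moll (inverse (real (Suc n))) u x - u x)\<bar>) \<longlonglongrightarrow> 0"
  "integrable lborel (\<lambda>x. indicator (cball 0 R) x * (moll (inverse (real (Suc n))) u x - u x))"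
proof -
 have [measurable]: "u \<in> Borel" using u by (rule locint_meas)
 show i: "integrable lborel (\<lambda>x. indicator (cball 0 R) x * (moll (inverse (real (Suc n))) u x - u x))" for n
  unfolding right_diff_distrib
  by (intro Bochner_Integration.integrable_diff locint_integrable u locint_moll) auto
 show "(\<lambda>n. LBINT x. \<bar>indicator (cball 0 R) x * (moll (inverse (real (Suc n))) u x - u x)\<bar>) \<longlonglongrightarrow> 0"
 proof (rule LIMSEQ_I)
  fix e :: real assume e: "e > 0"
  obtain \<delta> where \<delta>: "\<delta> > 0" "\<forall>d. 0 < d \<and> d < \<delta> -->
    (NNINT x. ennreal (indicator (cball 0 R) x * \<bar>moll d u x - u x\<bar>)) \<le> ennreal (e / 2)"
   using moll_L1_local[OF u, of "e / 2"] e by auto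
  obtain N where N: "\<And>n. n \<ge> N ==> inverse (real (Suc n)) < \<delta>"
   using order_tendstoD(2)[OF LIMSEQ_inverse_real_of_nat \<delta>(1)] by (auto simp: eventually_sequentially)
  show "\<exists>N. \<forall>n\<ge>N. norm ((LBINT x. \<bar>indicator (cball 0 R) x * (moll (inverse (real (Suc n))) u x - u x)\<bar>) - 0) < e"
  proof (intro exI[of _ N] allI impI)
   fix n assume n: "n \<ge> N"
   let ?f = "\<lambda>x. \<bar>indicator (cball 0 R) x * (moll (inverse (real (Suc n))) u x - u x)\<bar>"
   have "ennreal (LBINT x. ?f x) = (NNINT x. ennreal (?f x))"
    by (rule nn_integral_eq_integral[symmetric]) (use i[of n] in auto)
   also have "... \<le> ennreal (e / 2)"
    using \<delta>(2)[rule_format, of "inverse (real (Suc n))"] N[OF n] by (simp add: abs_mult)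
   finally have "(LBINT x. ?f x) \<le> e / 2" using e by simp
   moreover have "0 \<le> (LBINT x. ?f x)" by simp
   ultimately show "norm ((LBINT x. ?f x) - 0) < e" using e by simp
  qed
 qed
qed

lemma tendsto_integral_L1:
 fixes f h :: "nat => 'a => real" and g :: "'a => real"
 assumes "\<And>n. integrable M (f n)" "integrable M g"
  and "\<And>n x. \<bar>f n x - g x\<bar> \<le> C * \<bar>h n x\<bar>"
  and "\<And>n. integrable M (h n)" "(\<lambda>n. LINT x|M. \<bar>h n x\<bar>) \<longlonglongrightarrow> 0"
 shows "(\<lambda>n. LINT x|M. f n x) \<longlonglongrightarrow> (LINT x|M. g x)"
proof (rule LIM_zero_cancel, rule Lim_null_comparison)
 show "(\<lambda>n. C * (LINT x|M. \<bar>h n x\<bar>)) \<longlonglongrightarrow> 0"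
  using tendsto_mult[OF tendsto_const[of C] assms(5)] by simp
 show "eventually (\<lambda>n. norm ((LINT x|M. f n x) - (LINT x|M. g x)) \<le> C * (LINT x|M. \<bar>h n x\<bar>)) sequentially"
 proof (rule always_eventually, rule allI)
  fix n
  have "norm ((LINT x|M. f n x) - (LINT x|M. g x)) = norm (LINT x|M. f n x - g x)" using assms by simp
  also have "... \<le> (LINT x|M. norm (f n x - g x))" by (rule integral_norm_bound)
  also have "... \<le> (LINT x|M. C * \<bar>h n x\<bar>)"
   using assms by (intro integral_mono) auto
  finally show "norm ((LINT x|M. f n x) - (LINT x|M. g x)) \<le> C * (LINT x|M. \<bar>h n x\<bar>)" by simp
 qed
qed

lemma moll_integral_tendsto:
 fixes u :: "'n::finite sfun"
 assumes u: "locint u" and [measurable]: "f \<in> Borel"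
  and f: "\<And>x. \<bar>f x\<bar> \<le> C" "\<And>x. norm x > R ==> f x = 0"
 shows "(\<lambda>n. LBINT x. moll (inverse (real (Suc n))) u x * f x) \<longlonglongrightarrow> (LBINT x. u x * f x)"
proof (rule tendsto_integral_L1)
 fix n
 let ?m = "moll (inverse (real (Suc n))) u"
 show "integrable lborel (\<lambda>x. ?m x * f x)"
  by (rule locint_mult_bounded(2)[OF locint_moll[OF u] _ f]) auto
 show "integrable lborel (\<lambda>x. u x * f x)"
  by (rule locint_mult_bounded(2)[OF u _ f]) auto
 show "\<bar>?m x * f x - u x * f x\<bar> \<le> C * \<bar>indicator (cball 0 R) x * (?m x - u x)\<bar>" for x
 proof -
  have "?m x * f x - u x * f x = f x * (?m x - u x)" by (simp add: algebra_simps)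
  thus ?thesis
   using f[of x] mult_right_mono[OF f(1)[of x], of "\<bar>?m x - u x\<bar>"]
   by (cases "norm x \<le> R") (auto simp: indicator_def abs_mult)
 qed
qed (use moll_seq_L1_local[OF u] in auto)

lemma ddiff_zero_outside:
 assumes "ddiff i X X'" "\<And>x. norm x > R ==> X x = 0" "norm x > R"
 shows "X' x = 0"
proof -
 have "((\<lambda>t. norm (x + t *\<^sub>R axis i 1)) \<longlongrightarrow> norm (x + 0 *\<^sub>R axis i 1)) (nhds (0::real))"
  by (subst tendsto_at_iff_tendsto_nhds[symmetric]) (intro tendsto_intros)
 hence "eventually (\<lambda>t. norm (x + t *\<^sub>R axis i 1) > R) (nhds (0::real))"
  using assms(3) by (intro order_tendstoD) auto
 hence "eventually (\<lambda>t. X (x + t *\<^sub>R axis i 1) = 0) (nhds (0::real))"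
  by eventually_elim (rule assms(2))
 hence "((\<lambda>t. X (x + t *\<^sub>R axis i 1)) has_real_derivative 0) (at 0)"
  by (subst DERIV_cong_ev[OF refl _ refl]) auto
 thus ?thesis using assms(1) DERIV_unique unfolding ddiff_def by blast
qed

text \<open>Test functions may be replaced by bounded functions of bounded support with bounded directional
 derivatives: integrate by parts against the mollification of \<open>u\<close>, and let the width tend to zero.\<close>

lemma wgrad_test_ddiff:
 fixes u :: "'n::finite sfun"
 assumes u: "wgrad u v"
  and [measurable]: "X \<in> Borel" "X' \<in> Borel"
  and d: "ddiff i X X'"
  and X: "\<And>x. \<bar>X x\<bar> \<le> C" "\<And>x. \<bar>X' x\<bar> \<le> C" "\<And>x. norm x > R ==> X x = 0"
 shows "(LBINT x. u x * X' x) = - (LBINT x. v x $ i * X x)"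
proof -
 have X'0: "\<And>x. norm x > R ==> X' x = 0" by (rule ddiff_zero_outside[OF d X(3)])
 note l = wgradD(1,2)[OF u]
 have [measurable]: "u \<in> Borel" "(\<lambda>x. v x $ i) \<in> Borel" by (rule wgradD[OF u])+
 have "(LBINT x. moll e u x * X' x) = - (LBINT x. moll e (\<lambda>x. v x $ i) x * X x)" if e: "e > 0" for e
 proof -
  obtain C1 where C1: "\<forall>x. norm x \<le> R --> \<bar>moll e u x\<bar> \<le> C1" using moll_bounded[OF l(1) e] by blast
  obtain C2 where C2: "\<forall>x. norm x \<le> R --> \<bar>moll e (\<lambda>x. v x $ i) x\<bar> \<le> C2" using moll_bounded[OF l(2) e] by blast
  have "(LBINT x. X' x * moll e u x) = - (LBINT x. X x * moll e (\<lambda>x. v x $ i) x)"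
   by (rule integral_by_parts_ddiff[OF _ _ _ _ d moll_ddiff_wgrad[OF u e], where C = "max C (max C1 C2)" and R = R])
     (use X X'0 C1 C2 in \<open>auto simp: le_max_iff_disj\<close>)
  thus ?thesis by (simp add: mult.commute)
 qed
 moreover have "(\<lambda>n. LBINT x. moll (inverse (real (Suc n))) u x * X' x) \<longlonglongrightarrow> (LBINT x. u x * X' x)"
  by (rule moll_integral_tendsto[OF l(1) _ X(2) X'0]) auto
 moreover have "(\<lambda>n. LBINT x. moll (inverse (real (Suc n))) (\<lambda>x. v x $ i) x * X x) \<longlonglongrightarrow> (LBINT x. v x $ i * X x)"
  by (rule moll_integral_tendsto[OF l(2) _ X(1) X(3)]) auto
 ultimately show ?thesis
  using LIMSEQ_unique tendsto_minus[of "\<lambda>n. LBINT x. moll (inverse (real (Suc n))) (\<lambda>x. v x $ i) x * X x"]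
  by simp blast
qed

text \<open>The classical chain rule holds for the mollifications, which converge locally in the mean; along an
 almost everywhere convergent subsequence, \<open>F'\<close> of the mollification converges boundedly.\<close>

lemma wgrad_chain:
 fixes u :: "'n::finite sfun"
 assumes u: "wgrad u v"
  and F: "\<And>t. (F has_real_derivative F' t) (at t)" and F'c: "continuous_on UNIV F'"
  and M: "\<And>t. \<bar>F' t\<bar> \<le> M"
 shows "wgrad (\<lambda>x. F (u x)) (\<lambda>x. F' (u x) *\<^sub>R v x)"
proof -
 have M0: "M \<ge> 0" using M[of 0] by linarith
 have Flip: "\<bar>F s - F t\<bar> \<le> M * \<bar>s - t\<bar>" for s t
  using field_differentiable_bound[of UNIV F F' M s t] F M by auto
 have [measurable]: "F' \<in> Borel" using F'c by (rule borel_measurable_continuous_onI)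
 have [measurable]: "F \<in> Borel" 
  using F by (intro borel_measurable_continuous_onI) (auto intro: DERIV_isCont continuous_at_imp_continuous_on)
 have [measurable]: "u \<in> Borel" "\<And>i. (\<lambda>x. v x $ i) \<in> Borel"
  by (rule wgradD[OF u])+
 note l = wgradD(1,2)[OF u]
 have lF: "locint (\<lambda>x. F (w x))" if w: "locint w" for w :: "'n sfun"
  unfolding locint_def
 proof (intro conjI allI)
  have [measurable]: "w \<in> Borel" using w by (rule locint_meas)
  show "(\<lambda>x. F (w x)) \<in> Borel" by simp
  fix R
  show "integrable lborel (\<lambda>x. indicator (cball 0 R) x * F (w x))"
  proof (rule integrable_dominated)
   show "integrable lborel (\<lambda>x. \<bar>F 0\<bar> * indicator (cball 0 R) x + M * \<bar>indicator (cball 0 R) x * w x\<bar>)"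
    by (intro integrable_plus integrable_mult_right integrable_indicator_cball integrable_abs locint_integrable w)
   show "AE x in lborel. norm (indicator (cball 0 R) x * F (w x)) \<le> norm (\<bar>F 0\<bar> * indicator (cball 0 R) x + M * \<bar>indicator (cball 0 R) x * w x\<bar>)"
   proof (rule AE_I2)
    fix x
    have "\<bar>F (w x)\<bar> \<le> \<bar>F 0\<bar> + M * \<bar>w x\<bar>" using Flip[of "w x" 0] by simp
    moreover have "0 \<le> M * \<bar>w x\<bar>" using M0 by simp
    ultimately show "norm (indicator (cball 0 R) x * F (w x)) \<le> norm (\<bar>F 0\<bar> * indicator (cball 0 R) x + M * \<bar>indicator (cball 0 R) x * w x\<bar>)"
     by (auto simp: indicator_def)
   qed
  qed simp
 qed
 have lv: "locint (\<lambda>x. F' (w x) * v x $ i)" if [measurable]: "w \<in> Borel" for w i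
  unfolding locint_def
 proof (intro conjI allI)
  fix R
  show "integrable lborel (\<lambda>x. indicator (cball 0 R) x * (F' (w x) * v x $ i))"
  proof (rule integrable_dominated)
   show "integrable lborel (\<lambda>x. M * (indicator (cball 0 R) x * v x $ i))"
    by (intro integrable_mult_right locint_integrable l)
   show "AE x in lborel. norm (indicator (cball 0 R) x * (F' (w x) * v x $ i)) \<le> norm (M * (indicator (cball 0 R) x * v x $ i))"
    using M M0 by (auto simp: indicator_def abs_mult intro!: mult_right_mono)
  qed simp
 qed simp
 show ?thesis unfolding wgrad_def
 proof (intro conjI ballI allI)
  show "locint (\<lambda>x. F (u x))" by (rule lF[OF l(1)])
  show "locint (\<lambda>x. (F' (u x) *\<^sub>R v x) $ i)" for i using lv by simp
  fix \<phi> :: "'n sfun" and i assume p: "\<phi> \<in> test_functions UNIV"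
  note T = test_functionD[OF p]
  have [measurable]: "\<phi> \<in> Borel" "partial_deriv i \<phi> \<in> Borel" by (rule T)+
  obtain R C where RC: "\<And>x. \<bar>\<phi> x\<bar> \<le> C" "\<And>x. \<bar>partial_deriv i \<phi> x\<bar> \<le> C" "\<And>x. norm x > R ==> \<phi> x = 0"
    "\<And>x. norm x > R ==> partial_deriv i \<phi> x = 0" using T(4)[of i] by blast
  have C0: "C \<ge> 0" using RC(1)[of 0] by linarith
  let ?v = "\<lambda>x. v x $ i"
  obtain r where r: "strict_mono r" and ae: "AE x in lborel. (\<lambda>n. indicator (cball 0 R) x * (moll (inverse (real (Suc (r n)))) u x - u x)) \<longlonglongrightarrow> 0"
   using tendsto_L1_AE_subseq[of lborel "\<lambda>n x. indicator (cball 0 R) x * (moll (inverse (real (Suc n))) u x - u x)"]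
    moll_seq_L1_local[OF l(1), of R] by auto
  define e where "e n = inverse (real (Suc (r n)))" for n
  have e: "e n > 0" for n by (simp add: e_def)
  note sub = LIMSEQ_subseq_LIMSEQ[OF _ r, unfolded o_def]
  have ibp: "(LBINT x. F (moll (e n) u x) * partial_deriv i \<phi> x) = - (LBINT x. F' (moll (e n) u x) * moll (e n) ?v x * \<phi> x)" for n
  proof -
   obtain C1 where C1: "\<forall>x. norm x \<le> R --> \<bar>moll (e n) u x\<bar> \<le> C1" using moll_bounded[OF l(1) e] by blast
   obtain C2 where C2: "\<forall>x. norm x \<le> R --> \<bar>moll (e n) ?v x\<bar> \<le> C2" using moll_bounded[OF l(2) e] by blast
   have b1: "\<bar>F (moll (e n) u x)\<bar> \<le> \<bar>F 0\<bar> + M * C1" if "norm x \<le> R" for x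
   proof -
    have "M * \<bar>moll (e n) u x\<bar> \<le> M * C1" using C1 M0 that by (intro mult_left_mono) auto
    thus ?thesis using Flip[of "moll (e n) u x" 0] by simp
   qed
   have b2: "\<bar>F' (moll (e n) u x) * moll (e n) ?v x\<bar> \<le> M * C2" if "norm x \<le> R" for x
    using C2 M M0 that by (auto simp: abs_mult intro!: mult_mono)
   have "(LBINT x. partial_deriv i \<phi> x * F (moll (e n) u x)) = - (LBINT x. \<phi> x * (F' (moll (e n) u x) * moll (e n) ?v x))"
    by (rule integral_by_parts_ddiff[OF _ _ _ _ T(3) ddiff_compose[OF moll_ddiff_wgrad[OF u e] F],
       where C = "max C (max (\<bar>F 0\<bar> + M * C1) (M * C2))" and R = R])
      (use RC b1 b2 in \<open>auto simp: le_max_iff_disj\<close>)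
   thus ?thesis by (simp add: mult_ac)
  qed
  have lhs: "(\<lambda>n. LBINT x. F (moll (e n) u x) * partial_deriv i \<phi> x) \<longlonglongrightarrow> (LBINT x. F (u x) * partial_deriv i \<phi> x)"
  proof (rule tendsto_integral_L1[where C = "M * C" and h = "\<lambda>n x. indicator (cball 0 R) x * (moll (e n) u x - u x)"])
   fix n x
   have "\<bar>F (moll (e n) u x) - F (u x)\<bar> * \<bar>partial_deriv i \<phi> x\<bar> \<le> (M * \<bar>moll (e n) u x - u x\<bar>) * C"
    using Flip RC M0 by (intro mult_mono) auto
   moreover have "F (moll (e n) u x) * partial_deriv i \<phi> x - F (u x) * partial_deriv i \<phi> x
     = (F (moll (e n) u x) - F (u x)) * partial_deriv i \<phi> x" by (simp add: left_diff_distrib)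
   ultimately show "\<bar>F (moll (e n) u x) * partial_deriv i \<phi> x - F (u x) * partial_deriv i \<phi> x\<bar> \<le> M * C * \<bar>indicator (cball 0 R) x * (moll (e n) u x - u x)\<bar>"
    using RC(4)[of x] by (cases "norm x \<le> R") (auto simp: indicator_def abs_mult mult_ac)
  qed (use moll_seq_L1_local(2)[OF l(1)] sub[OF moll_seq_L1_local(1)[OF l(1)]] RC
     test_locint_integrable(2)[OF lF p] locint_moll[OF l(1)] l(1) e in \<open>auto simp: e_def\<close>)
  have r1: "(\<lambda>n. LBINT x. F' (moll (e n) u x) * (indicator (cball 0 R) x * (moll (e n) ?v x - ?v x)) * \<phi> x) \<longlonglongrightarrow> (LINT x :: real ^ 'n|lborel. 0 :: real)"
  proof (rule tendsto_integral_L1[where g = "\<lambda>_. 0" and C = "M * C" and h = "\<lambda>n x. indicator (cball 0 R) x * (moll (e n) ?v x - ?v x)"])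
   fix n
   have I: "integrable lborel (\<lambda>x. indicator (cball 0 R) x * (moll (e n) ?v x - ?v x))"
    unfolding e_def by (rule moll_seq_L1_local(2)[OF l(2)])
   show "integrable lborel (\<lambda>x. indicator (cball 0 R) x * (moll (e n) ?v x - ?v x))" by (rule I)
   show b: "\<bar>F' (moll (e n) u x) * (indicator (cball 0 R) x * (moll (e n) ?v x - ?v x)) * \<phi> x - 0\<bar>
     \<le> M * C * \<bar>indicator (cball 0 R) x * (moll (e n) ?v x - ?v x)\<bar>" for x
   proof -
    have "\<bar>F' (moll (e n) u x)\<bar> * \<bar>\<phi> x\<bar> * \<bar>indicator (cball 0 R) x * (moll (e n) ?v x - ?v x)\<bar>
     \<le> M * C * \<bar>indicator (cball 0 R) x * (moll (e n) ?v x - ?v x)\<bar>"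
     using M M0 RC by (intro mult_right_mono mult_mono) auto
    thus ?thesis by (simp add: abs_mult mult_ac)
   qed
   show "integrable lborel (\<lambda>x. F' (moll (e n) u x) * (indicator (cball 0 R) x * (moll (e n) ?v x - ?v x)) * \<phi> x)"
    by (rule integrable_dominated[OF integrable_mult_right[OF integrable_abs[OF I], of "M * C"]])
      (use b M0 C0 in \<open>auto intro!: order.trans[OF _ abs_ge_self]\<close>)
  qed (use sub[OF moll_seq_L1_local(1)[OF l(2)]] in \<open>auto simp: e_def\<close>)
  have r2: "(\<lambda>n. LBINT x. F' (moll (e n) u x) * ?v x * \<phi> x) \<longlonglongrightarrow> (LBINT x. F' (u x) * ?v x * \<phi> x)"
  proof (rule integral_dominated_convergence[where w = "\<lambda>x. M * \<bar>?v x * \<phi> x\<bar>"])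
   show "integrable lborel (\<lambda>x. M * \<bar>?v x * \<phi> x\<bar>)"
    by (intro integrable_mult_right integrable_abs test_locint_integrable(1)[OF l(2) p])
   show "AE x in lborel. norm (F' (moll (e n) u x) * ?v x * \<phi> x) \<le> M * \<bar>?v x * \<phi> x\<bar>" for n
   proof (rule AE_I2)
    fix x
    show "norm (F' (moll (e n) u x) * ?v x * \<phi> x) \<le> M * \<bar>?v x * \<phi> x\<bar>"
     using mult_right_mono[OF M[of "moll (e n) u x"], of "\<bar>?v x * \<phi> x\<bar>"] by (simp add: abs_mult mult.assoc)
   qed
   show "AE x in lborel. (\<lambda>n. F' (moll (e n) u x) * ?v x * \<phi> x) \<longlonglongrightarrow> F' (u x) * ?v x * \<phi> x"
    using ae
   proof eventually_elim
    case (elim x)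
    show ?case
    proof (cases "norm x \<le> R")
     case True
     hence "(\<lambda>n. moll (e n) u x - u x) \<longlonglongrightarrow> 0" using elim by (simp add: e_def indicator_def)
     hence "(\<lambda>n. moll (e n) u x) \<longlonglongrightarrow> u x" by (simp add: LIM_zero_iff)
     hence "(\<lambda>n. F' (moll (e n) u x)) \<longlonglongrightarrow> F' (u x)"
      using F'c by (auto intro!: continuous_on_tendsto_compose[of UNIV F'])
     thus ?thesis by (intro tendsto_mult tendsto_const)
    qed (use RC(3)[of x] in auto)
   qed
  qed simp_all
  have "(LBINT x. F' (moll (e n) u x) * moll (e n) ?v x * \<phi> x) =
   (LBINT x. F' (moll (e n) u x) * (indicator (cball 0 R) x * (moll (e n) ?v x - ?v x)) * \<phi> x) +
   (LBINT x. F' (moll (e n) u x) * ?v x * \<phi> x)" for n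
  proof (subst Bochner_Integration.integral_add[symmetric])
   show "integrable lborel (\<lambda>x. F' (moll (e n) u x) * ?v x * \<phi> x)"
    by (rule test_locint_integrable(1)[OF lv p]) simp
   have "integrable lborel (\<lambda>x. (F' (moll (e n) u x) * \<phi> x) * (indicator (cball 0 R) x * (moll (e n) ?v x - ?v x)))"
   proof (rule locint_mult_bounded(1)[where C = "M * C" and R = R])
    show "locint (\<lambda>x. indicator (cball 0 R) x * (moll (e n) ?v x - ?v x))"
     unfolding e_def by (intro integrable_locint moll_seq_L1_local(2)[OF l(2)])
    show "\<bar>F' (moll (e n) u x) * \<phi> x\<bar> \<le> M * C" for x
     using M M0 RC by (auto simp: abs_mult intro!: mult_mono)
   qed (use RC in auto)
   thus "integrable lborel (\<lambda>x. F' (moll (e n) u x) * (indicator (cball 0 R) x * (moll (e n) ?v x - ?v x)) * \<phi> x)"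
    by (simp add: mult_ac)
   show "(LBINT x. F' (moll (e n) u x) * moll (e n) ?v x * \<phi> x) =
    (LBINT x. F' (moll (e n) u x) * (indicator (cball 0 R) x * (moll (e n) ?v x - ?v x)) * \<phi> x + F' (moll (e n) u x) * ?v x * \<phi> x)"
   proof (intro integral_eqI refl)
    fix x
    show "F' (moll (e n) u x) * moll (e n) ?v x * \<phi> x = F' (moll (e n) u x) * (indicator (cball 0 R) x * (moll (e n) ?v x - ?v x)) * \<phi> x + F' (moll (e n) u x) * ?v x * \<phi> x"
     using RC(3)[of x] by (cases "norm x \<le> R") (auto simp: indicator_def algebra_simps)
   qed
  qed
  hence "(\<lambda>n. - (LBINT x. F' (moll (e n) u x) * moll (e n) ?v x * \<phi> x)) \<longlonglongrightarrow> - (LBINT x. F' (u x) * ?v x * \<phi> x)"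
   using tendsto_minus[OF tendsto_add[OF r1 r2]] by simp
  hence "(LBINT x. F (u x) * partial_deriv i \<phi> x) = - (LBINT x. F' (u x) * ?v x * \<phi> x)"
   using lhs ibp LIMSEQ_unique by auto
  thus "(LBINT x. F (u x) * partial_deriv i \<phi> x) = - (LBINT x. (F' (u x) *\<^sub>R v x) $ i * \<phi> x)"
   by simp
 qed
qed


lemma wgrad_lincomb:
 fixes u \<phi> :: "'n::finite sfun"
 assumes "wgrad u v" "wgrad \<phi> \<psi>"
 shows "wgrad (\<lambda>x. u x + t * \<phi> x) (\<lambda>x. v x + t *\<^sub>R \<psi> x)"
proof -
 have l: "locint (\<lambda>x. f x + t * h x)" if "locint f" "locint h" for f h :: "'n sfun"
 proof -
  have "integrable lborel (\<lambda>x. indicator (cball 0 R) x * f x + t * (indicator (cball 0 R) x * h x))" for R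
   by (intro integrable_plus integrable_mult_right locint_integrable that)
  thus ?thesis using that[THEN locint_meas] by (auto simp: locint_def algebra_simps)
 qed
 show ?thesis unfolding wgrad_def
 proof (intro conjI ballI allI)
  show "locint (\<lambda>x. u x + t * \<phi> x)" by (intro l wgradD(1)[OF assms(1)] wgradD(1)[OF assms(2)])
  show "locint (\<lambda>x. (v x + t *\<^sub>R \<psi> x) $ i)" for i
   using l[OF wgradD(2)[OF assms(1)] wgradD(2)[OF assms(2)], of i i] by simp
  fix \<zeta> :: "'n sfun" and i assume z: "\<zeta> \<in> test_functions UNIV"
  note T1 = test_locint_integrable(2)[OF wgradD(1)[OF assms(1)] z, of i]
  note T2 = test_locint_integrable(2)[OF wgradD(1)[OF assms(2)] z, of i]
  note T3 = test_locint_integrable(1)[OF wgradD(2)[OF assms(1), of i] z]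
  note T4 = test_locint_integrable(1)[OF wgradD(2)[OF assms(2), of i] z]
  have "(LBINT x. (u x + t * \<phi> x) * partial_deriv i \<zeta> x)
    = (LBINT x. u x * partial_deriv i \<zeta> x + t * (\<phi> x * partial_deriv i \<zeta> x))"
   by (simp add: algebra_simps)
  also have "... = (LBINT x. u x * partial_deriv i \<zeta> x) + t * (LBINT x. \<phi> x * partial_deriv i \<zeta> x)"
   using T1 T2 by simp
  also have "... = - ((LBINT x. v x $ i * \<zeta> x) + t * (LBINT x. \<psi> x $ i * \<zeta> x))"
   by (simp add: wgradD(5)[OF assms(1) z] wgradD(5)[OF assms(2) z])
  also have "(LBINT x. v x $ i * \<zeta> x) + t * (LBINT x. \<psi> x $ i * \<zeta> x)
    = (LBINT x. v x $ i * \<zeta> x + t * (\<psi> x $ i * \<zeta> x))"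
   using T3 T4 by simp
  also have "... = (LBINT x. (v x + t *\<^sub>R \<psi> x) $ i * \<zeta> x)"
   by (simp add: algebra_simps)
  finally show "(LBINT x. (u x + t * \<phi> x) * partial_deriv i \<zeta> x) = - (LBINT x. (v x + t *\<^sub>R \<psi> x) $ i * \<zeta> x)" .
 qed
qed

text \<open>The functions \<open>arctan (k t) / k\<close> tend to zero uniformly, while their derivatives tend to the
 indicator of \<open>t = 0\<close>. So the restriction of \<open>V\<close> to the zero set is the gradient of the zero function.\<close>

lemma wgrad_zero_set:
 fixes w :: "'n::finite sfun"
 assumes w: "wgrad w V"
 shows "AE x in lborel. w x = 0 --> V x = 0"
proof -
 have [measurable]: "w \<in> Borel" "\<And>i. (\<lambda>x. V x $ i) \<in> Borel"
  by (rule wgradD[OF w])+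
 note l = wgradD(1,2)[OF w]
 define F where "F k t = arctan (real (Suc k) * t) / real (Suc k)" for k t
 define F' where "F' k t = 1 / (1 + (real (Suc k) * t)\<^sup>2)" for k t
 have pos: "1 + (real (Suc k) * t)\<^sup>2 \<ge> 1" for k t by simp
 have F: "(F k has_real_derivative F' k t) (at t)" for k t
  unfolding F_def F'_def
  by (auto intro!: derivative_eq_intros simp: divide_simps power2_eq_square simp del: of_nat_Suc)
 have F'c: "continuous_on UNIV (F' k)" for k
  unfolding F'_def using pos[of k] by (intro continuous_intros) (metis less_le_trans zero_less_one less_irrefl)
 have F'1: "\<bar>F' k t\<bar> \<le> 1" for k t
 proof -
  have "0 < 1 + (real (Suc k) * t)\<^sup>2" using pos[of k t] by linarith
  moreover from this have "1 / (1 + (real (Suc k) * t)\<^sup>2) \<le> 1" by (subst pos_divide_le_eq) auto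
  ultimately show ?thesis by (simp add: F'_def del: of_nat_Suc)
 qed
 have [measurable]: "F' k \<in> Borel" for k by (rule borel_measurable_continuous_onI[OF F'c])
 have Fm [measurable]: "F k \<in> Borel" for k unfolding F_def[abs_def] 
  by (intro borel_measurable_continuous_onI continuous_intros) auto
 have Fb: "\<bar>F k t\<bar> \<le> 2 / real (Suc k)" for k t
  using arctan_bounded[of "real (Suc k) * t"] pi_less_4
  by (auto simp: F_def abs_le_iff intro!: divide_right_mono)
 have "AE x in lborel. (if w x = 0 then V x $ i else 0) = 0" for i
 proof (rule fundamental_lemma_UNIV)
  have "integrable lborel (\<lambda>x. indicator (cball 0 R) x * (if w x = 0 then V x $ i else 0))" for R
   by (rule integrable_dominated[OF locint_integrable[OF l(2)[of i], of R]])
     (auto simp: indicator_def)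
  thus "locint (\<lambda>x. if w x = 0 then V x $ i else 0)" by (simp add: locint_def)
  fix \<phi> :: "'n sfun" assume p: "\<phi> \<in> test_functions UNIV"
  note T = test_functionD[OF p]
  have [measurable]: "\<phi> \<in> Borel" "partial_deriv i \<phi> \<in> Borel" by (rule T)+
  obtain R C where RC: "\<And>x. \<bar>\<phi> x\<bar> \<le> C" "\<And>x. \<bar>partial_deriv i \<phi> x\<bar> \<le> C" "\<And>x. norm x > R ==> \<phi> x = 0"
    "\<And>x. norm x > R ==> partial_deriv i \<phi> x = 0" using T(4)[of i] by blast
  have i1: "integrable lborel (partial_deriv i \<phi>)"
   by (rule integrable_bounded_support[OF _ RC(2) RC(4)]) simp
  have eq: "(LBINT x. F k (w x) * partial_deriv i \<phi> x) = - (LBINT x. F' k (w x) * V x $ i * \<phi> x)" for k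
   using wgradD(5)[OF wgrad_chain[OF w F[of k] F'c[of k] F'1[of k]] p, of i] by simp
  have "(\<lambda>k. LBINT x. F k (w x) * partial_deriv i \<phi> x) \<longlonglongrightarrow> (LINT x :: real ^ 'n|lborel. 0 :: real)"
  proof (rule integral_dominated_convergence[where w = "\<lambda>x. 2 * \<bar>partial_deriv i \<phi> x\<bar>"])
   show "AE x in lborel. (\<lambda>k. F k (w x) * partial_deriv i \<phi> x) \<longlonglongrightarrow> 0"
   proof (rule AE_I2)
    fix x
    have "(\<lambda>k. F k (w x)) \<longlonglongrightarrow> 0"
    proof (rule Lim_null_comparison)
     show "eventually (\<lambda>k. norm (F k (w x)) \<le> 2 * inverse (real (Suc k))) sequentially"
      using Fb by (auto simp: divide_inverse)
     show "(\<lambda>k. 2 * inverse (real (Suc k))) \<longlonglongrightarrow> 0"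
      using tendsto_mult[OF tendsto_const[of 2] LIMSEQ_inverse_real_of_nat] by simp
    qed
    from tendsto_mult[OF this tendsto_const[of "partial_deriv i \<phi> x"]]
    show "(\<lambda>k. F k (w x) * partial_deriv i \<phi> x) \<longlonglongrightarrow> 0" by simp
   qed
   show "AE x in lborel. norm (F k (w x) * partial_deriv i \<phi> x) \<le> 2 * \<bar>partial_deriv i \<phi> x\<bar>" for k
   proof (rule AE_I2)
    fix x
    have "\<bar>F k (w x)\<bar> \<le> 2" using Fb[of k "w x"] by (rule order.trans) (simp add: field_simps)
    thus "norm (F k (w x) * partial_deriv i \<phi> x) \<le> 2 * \<bar>partial_deriv i \<phi> x\<bar>"
     by (simp add: abs_mult mult_right_mono)
   qed
  qed (use i1 in auto)
  moreover have "(\<lambda>k. LBINT x. F' k (w x) * V x $ i * \<phi> x) \<longlonglongrightarrow> (LBINT x. (if w x = 0 then V x $ i else 0) * \<phi> x)"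
  proof (rule integral_dominated_convergence[where w = "\<lambda>x. \<bar>V x $ i * \<phi> x\<bar>"])
   show "integrable lborel (\<lambda>x. \<bar>V x $ i * \<phi> x\<bar>)"
    by (intro integrable_abs test_locint_integrable(1)[OF l(2) p])
   show "AE x in lborel. norm (F' k (w x) * V x $ i * \<phi> x) \<le> \<bar>V x $ i * \<phi> x\<bar>" for k
   proof (rule AE_I2)
    fix x
    show "norm (F' k (w x) * V x $ i * \<phi> x) \<le> \<bar>V x $ i * \<phi> x\<bar>"
     using mult_right_mono[OF F'1[of k "w x"], of "\<bar>V x $ i * \<phi> x\<bar>"] by (simp add: abs_mult mult.assoc)
   qed
   show "AE x in lborel. (\<lambda>k. F' k (w x) * V x $ i * \<phi> x) \<longlonglongrightarrow> (if w x = 0 then V x $ i else 0) * \<phi> x"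
   proof (rule AE_I2)
    fix x
    have "(\<lambda>k. F' k (w x)) \<longlonglongrightarrow> (if w x = 0 then 1 else 0)"
    proof (cases "w x = 0")
     case False
     show ?thesis
     proof (simp add: False, rule Lim_null_comparison)
      show "eventually (\<lambda>k. norm (F' k (w x)) \<le> 1 / (w x)\<^sup>2 * inverse (real (Suc k))) sequentially"
      proof (rule always_eventually, rule allI)
       fix k
       have "(w x)\<^sup>2 * real (Suc k) * 1 \<le> (w x)\<^sup>2 * real (Suc k) * real (Suc k)" by (intro mult_left_mono) auto
       hence "(w x)\<^sup>2 * real (Suc k) \<le> 1 + (real (Suc k) * w x)\<^sup>2"
        by (simp add: power_mult_distrib power2_eq_square mult_ac del: of_nat_Suc)
       moreover have "(w x)\<^sup>2 * real (Suc k) > 0" using False by (simp del: of_nat_Suc)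
       ultimately have "1 / (1 + (real (Suc k) * w x)\<^sup>2) \<le> 1 / ((w x)\<^sup>2 * real (Suc k))"
        by (intro divide_left_mono) (auto intro: mult_pos_pos simp del: of_nat_Suc)
       thus "norm (F' k (w x)) \<le> 1 / (w x)\<^sup>2 * inverse (real (Suc k))"
        using pos[of k "w x"] by (simp add: F'_def divide_inverse del: of_nat_Suc)
      qed
      show "(\<lambda>k. 1 / (w x)\<^sup>2 * inverse (real (Suc k))) \<longlonglongrightarrow> 0"
       using tendsto_mult[OF tendsto_const[of "1 / (w x)\<^sup>2"] LIMSEQ_inverse_real_of_nat] by (simp only: mult_zero_right)
     qed
    qed (simp add: F'_def)
    from tendsto_mult[OF tendsto_mult[OF this tendsto_const[of "V x $ i"]] tendsto_const[of "\<phi> x"]]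
    show "(\<lambda>k. F' k (w x) * V x $ i * \<phi> x) \<longlonglongrightarrow> (if w x = 0 then V x $ i else 0) * \<phi> x"
     by (auto split: if_splits)
   qed
  qed simp_all
  ultimately show "(LBINT x. (if w x = 0 then V x $ i else 0) * \<phi> x) = 0"
   unfolding eq using tendsto_minus[of "\<lambda>k. LBINT x. F' k (w x) * V x $ i * \<phi> x"] LIMSEQ_unique
   by fastforce
 qed
 hence "AE x in lborel. \<forall>i. (if w x = 0 then V x $ i else 0) = 0"
  by (intro AE_finite_allI[of UNIV, simplified]) auto
 thus ?thesis by eventually_elim (auto simp: vec_eq_iff)
qed

text \<open>The square makes the positive part continuously differentiable.\<close>

definition cutoff :: "real => 'n::finite sfun" where
 "cutoff r x = (max 0 (1 - (norm x)\<^sup>2 / r\<^sup>2))\<^sup>2"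

lemma max0_power2_deriv: "((\<lambda>t. (max 0 t)\<^sup>2) has_real_derivative 2 * max 0 t) (at (t::real))"
proof -
 consider "t > 0" | "t < 0" | "t = 0" by linarith
 thus ?thesis
 proof cases
  case 1
  have "eventually (\<lambda>s. s \<in> {0<..}) (nhds t)" using 1 by (intro eventually_nhds_in_open) auto
  hence "eventually (\<lambda>s. (max 0 s)\<^sup>2 = s\<^sup>2) (nhds t)" by eventually_elim auto
  thus ?thesis using 1 by (subst DERIV_cong_ev[OF refl _ refl]) (auto intro!: derivative_eq_intros)
 next
  case 2
  have "eventually (\<lambda>s. s \<in> {..<0}) (nhds t)" using 2 by (intro eventually_nhds_in_open) auto
  hence "eventually (\<lambda>s. (max 0 s)\<^sup>2 = 0) (nhds t)" by eventually_elim auto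
  thus ?thesis using 2 by (subst DERIV_cong_ev[where g = "\<lambda>_. 0", OF refl _ refl]) auto
 next
  case 3
  have "((\<lambda>h. ((max 0 (0 + h))\<^sup>2 - (max 0 0)\<^sup>2) / h) \<longlongrightarrow> 0) (at (0::real))"
  proof (rule Lim_null_comparison)
   show "eventually (\<lambda>h. norm (((max 0 (0 + h))\<^sup>2 - (max 0 0)\<^sup>2) / h) \<le> \<bar>h\<bar>) (at (0::real))"
    by (auto simp: eventually_at_filter max_def power2_eq_square)
   show "((\<lambda>h. \<bar>h\<bar>) \<longlongrightarrow> 0) (at (0::real))" using tendsto_rabs[OF tendsto_ident_at[of 0 UNIV]] by simp
  qed
  thus ?thesis using 3 by (simp add: DERIV_def)
 qed
qed

lemma norm_power2_ddiff: "ddiff i (\<lambda>x :: real ^ 'n::finite. (norm x)\<^sup>2) (\<lambda>x. 2 * x $ i)"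
 unfolding ddiff_def
proof
 fix x :: "real ^ 'n"
 have "(norm (x + t *\<^sub>R axis i 1))\<^sup>2 = (norm x)\<^sup>2 + 2 * t * x $ i + t\<^sup>2" for t
  unfolding power2_norm_eq_inner
  by (simp add: inner_add_left inner_add_right inner_axis inner_axis_axis inner_commute[of "axis i 1" x] power2_eq_square algebra_simps)
 thus "((\<lambda>t. (norm (x + t *\<^sub>R axis i 1))\<^sup>2) has_real_derivative 2 * x $ i) (at 0)"
  by (auto intro!: derivative_eq_intros)
qed

lemma cutoff_props:
 fixes x :: "real ^ 'n::finite"
 assumes r: "r > 0"
 shows "ddiff i (cutoff r :: real ^ 'n => real) (\<lambda>x. 2 * max 0 (1 - (norm x)\<^sup>2 / r\<^sup>2) * (- 2 * x $ i / r\<^sup>2))"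
  "0 \<le> cutoff r x" "cutoff r x \<le> 1" "norm x > r ==> cutoff r x = 0"
  "\<bar>2 * max 0 (1 - (norm x)\<^sup>2 / r\<^sup>2) * (- 2 * x $ i / r\<^sup>2)\<bar> \<le> 4 / r"
proof -
 have g: "((\<lambda>s. (max 0 (1 - s / r\<^sup>2))\<^sup>2) has_real_derivative 2 * max 0 (1 - s / r\<^sup>2) * (- 1 / r\<^sup>2)) (at s)" for s
  by (rule DERIV_chain2[OF max0_power2_deriv]) (use r in \<open>auto intro!: derivative_eq_intros simp: field_simps eval_nat_numeral\<close>)
 show "ddiff i (cutoff r :: real ^ 'n => real) (\<lambda>x. 2 * max 0 (1 - (norm x)\<^sup>2 / r\<^sup>2) * (- 2 * x $ i / r\<^sup>2))"
  using ddiff_compose[OF norm_power2_ddiff[of i] g] by (simp add: cutoff_def[abs_def] mult.assoc)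
 show "0 \<le> cutoff r x" by (simp add: cutoff_def)
 have m: "0 \<le> max 0 (1 - (norm x)\<^sup>2 / r\<^sup>2)" "max 0 (1 - (norm x)\<^sup>2 / r\<^sup>2) \<le> 1" by auto
 show "cutoff r x \<le> 1" using power_mono[OF m(2,1), of 2] by (simp add: cutoff_def)
 have z: "max 0 (1 - (norm x)\<^sup>2 / r\<^sup>2) = 0" if "norm x > r"
  using that r power_strict_mono[of r "norm x" 2] by (simp add: field_simps)
 thus "norm x > r ==> cutoff r x = 0" by (simp add: cutoff_def)
 show "\<bar>2 * max 0 (1 - (norm x)\<^sup>2 / r\<^sup>2) * (- 2 * x $ i / r\<^sup>2)\<bar> \<le> 4 / r"
 proof (cases "norm x > r")
  case False
  have "max 0 (1 - (norm x)\<^sup>2 / r\<^sup>2) * \<bar>x $ i\<bar> \<le> 1 * r"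
   using m False component_le_norm_cart[of x i] by (intro mult_mono) auto
  hence "4 * (max 0 (1 - (norm x)\<^sup>2 / r\<^sup>2) * \<bar>x $ i\<bar>) / r\<^sup>2 \<le> 4 * r / r\<^sup>2"
   using r by (intro divide_right_mono) auto
  thus ?thesis using r m(1) by (simp add: abs_mult power2_eq_square)
 qed (use z r in simp)
qed

text \<open>For an integrable function with integrable gradient the test function need not decay: a cutoff at
 radius \<open>r\<close> has gradient of order \<open>1 / r\<close>, and its contribution vanishes in the limit.\<close>

lemma wgrad_test_bounded:
 fixes u :: "'n::finite sfun"
 assumes u: "wgrad u v" and iu: "integrable lborel u" and iv: "integrable lborel (\<lambda>x. v x $ i)"
  and [measurable]: "X \<in> Borel" "X' \<in> Borel"
  and d: "ddiff i X X'"
  and X: "\<And>x. \<bar>X x\<bar> \<le> C" "\<And>x. \<bar>X' x\<bar> \<le> C"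
 shows "(LBINT x. u x * X' x) = - (LBINT x. v x $ i * X x)"
proof -
 have C0: "C \<ge> 0" using X(1)[of 0] by linarith
 have [measurable]: "u \<in> Borel" "(\<lambda>x. v x $ i) \<in> Borel"
  by (rule wgradD[OF u])+
 define c where "c n = (cutoff (real (Suc n)) :: real ^ 'n => real)" for n
 define c' where "c' n x = 2 * max 0 (1 - (norm x)\<^sup>2 / (real (Suc n))\<^sup>2) * (- 2 * x $ i / (real (Suc n))\<^sup>2)" for n and x :: "real ^ 'n"
 have c: "ddiff i (c n) (c' n)" "0 \<le> c n x" "c n x \<le> 1" "norm x > real (Suc n) ==> c n x = 0" "\<bar>c' n x\<bar> \<le> 4 / real (Suc n)" for n x
  unfolding c_def c'_def using cutoff_props[of "real (Suc n)"] by auto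
 have [measurable]: "c n \<in> Borel" "c' n \<in> Borel" for n
  unfolding c_def c'_def cutoff_def[abs_def] by measurable
 have c'0: "c' n x = 0" if "norm x > real (Suc n)" for n x
  by (rule ddiff_zero_outside[OF c(1) c(4) that])
 have c'4: "\<bar>c' n x\<bar> \<le> 4" for n x
  using c(5)[of n x] by (rule order.trans) (simp add: field_simps)
 have eq: "(LBINT x. u x * (X' x * c n x + X x * c' n x)) = - (LBINT x. v x $ i * (X x * c n x))" for n
 proof (rule wgrad_test_ddiff[OF u _ _ ddiff_mult[OF d c(1)], where C = "C + C * 4" and R = "real (Suc n)"])
  fix x
  have 1: "\<bar>X x * c n x\<bar> \<le> C * 1" "\<bar>X' x * c n x\<bar> \<le> C * 1" "\<bar>X x * c' n x\<bar> \<le> C * 4"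
   unfolding abs_mult using X c(2,3) c'4 C0 by (intro mult_mono; auto)+
  thus "\<bar>X x * c n x\<bar> \<le> C + C * 4" "\<bar>X' x * c n x + X x * c' n x\<bar> \<le> C + C * 4" using C0 by linarith+
  show "norm x > real (Suc n) ==> X x * c n x = 0" using c(4) by simp
 qed auto
 have cl: "(\<lambda>n. c n x) \<longlonglongrightarrow> 1" for x
 proof -
  have "(\<lambda>n. (max 0 (1 - (norm x)\<^sup>2 * (inverse (real (Suc n)))\<^sup>2))\<^sup>2) \<longlonglongrightarrow> (max 0 (1 - (norm x)\<^sup>2 * 0\<^sup>2))\<^sup>2"
   by (intro tendsto_intros LIMSEQ_inverse_real_of_nat tendsto_max)
  thus ?thesis by (simp add: c_def cutoff_def divide_inverse power_inverse)
 qed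
 have c'l: "(\<lambda>n. c' n x) \<longlonglongrightarrow> 0" for x
 proof (rule Lim_null_comparison)
  show "eventually (\<lambda>n. norm (c' n x) \<le> 4 * inverse (real (Suc n))) sequentially"
   using c(5) by (auto simp: divide_inverse)
  show "(\<lambda>n. 4 * inverse (real (Suc n))) \<longlonglongrightarrow> 0"
   using tendsto_mult[OF tendsto_const[of 4] LIMSEQ_inverse_real_of_nat] by simp
 qed
 have "(\<lambda>n. LBINT x. u x * (X' x * c n x + X x * c' n x)) \<longlonglongrightarrow> (LBINT x. u x * X' x)"
 proof (rule integral_dominated_convergence[where w = "\<lambda>x. (C + C * 4) * \<bar>u x\<bar>"])
  show "AE x in lborel. (\<lambda>n. u x * (X' x * c n x + X x * c' n x)) \<longlonglongrightarrow> u x * X' x"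
  proof (rule AE_I2)
   fix x
   have "(\<lambda>n. u x * (X' x * c n x + X x * c' n x)) \<longlonglongrightarrow> u x * (X' x * 1 + X x * 0)"
    by (intro tendsto_intros cl c'l)
   thus "(\<lambda>n. u x * (X' x * c n x + X x * c' n x)) \<longlonglongrightarrow> u x * X' x" by simp
  qed
  show "AE x in lborel. norm (u x * (X' x * c n x + X x * c' n x)) \<le> (C + C * 4) * \<bar>u x\<bar>" for n
  proof (rule AE_I2)
   fix x
   have "\<bar>X' x * c n x\<bar> \<le> C * 1" "\<bar>X x * c' n x\<bar> \<le> C * 4"
    unfolding abs_mult using X c(2,3) c'4 C0 by (intro mult_mono; auto)+
   hence "\<bar>X' x * c n x + X x * c' n x\<bar> \<le> C + C * 4" by linarith
   from mult_right_mono[OF this, of "\<bar>u x\<bar>"]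
   show "norm (u x * (X' x * c n x + X x * c' n x)) \<le> (C + C * 4) * \<bar>u x\<bar>" by (simp add: abs_mult mult.commute)
  qed
 qed (use iu in auto)
 moreover have "(\<lambda>n. LBINT x. v x $ i * (X x * c n x)) \<longlonglongrightarrow> (LBINT x. v x $ i * X x)"
 proof (rule integral_dominated_convergence[where w = "\<lambda>x. C * \<bar>v x $ i\<bar>"])
  show "AE x in lborel. (\<lambda>n. v x $ i * (X x * c n x)) \<longlonglongrightarrow> v x $ i * X x"
  proof (rule AE_I2)
   fix x
   have "(\<lambda>n. v x $ i * (X x * c n x)) \<longlonglongrightarrow> v x $ i * (X x * 1)" by (intro tendsto_intros cl)
   thus "(\<lambda>n. v x $ i * (X x * c n x)) \<longlonglongrightarrow> v x $ i * X x" by simp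
  qed
  show "AE x in lborel. norm (v x $ i * (X x * c n x)) \<le> C * \<bar>v x $ i\<bar>" for n
  proof (rule AE_I2)
   fix x
   have "\<bar>X x\<bar> * \<bar>c n x\<bar> \<le> C * 1" using X c(2,3) C0 by (intro mult_mono) auto
   from mult_right_mono[OF this, of "\<bar>v x $ i\<bar>"]
   show "norm (v x $ i * (X x * c n x)) \<le> C * \<bar>v x $ i\<bar>" by (simp add: abs_mult mult_ac)
  qed
 qed (use iv in auto)
 ultimately show ?thesis unfolding eq
  using tendsto_minus[of "\<lambda>n. LBINT x. v x $ i * (X x * c n x)"] LIMSEQ_unique by blast
qed

section \<open>Kernels\<close>

lemma ball_borel [measurable]: "ball a r \<in> sets borel" "cball a r \<in> sets borel"
 by auto

lemma dyadic_shell: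
 fixes r \<rho> :: real
 assumes "0 < r" "r < \<rho>"
 shows "\<exists>j. \<rho> / 2 ^ Suc j \<le> r \<and> r < \<rho> / 2 ^ j"
proof -
 have "\<exists>n. (1/2) ^ n < r / \<rho>" using assms by (intro real_arch_pow_inv) auto
 then obtain n where "(1/2) ^ n < r / \<rho>" by blast
 hence "\<rho> / 2 ^ n \<le> r" using assms by (simp add: field_simps power_one_over)
 hence ex: "\<exists>n. \<rho> / 2 ^ n \<le> r" by blast
 define m where "m = (LEAST n. \<rho> / 2 ^ n \<le> r)"
 have m: "\<rho> / 2 ^ m \<le> r" unfolding m_def using ex by (rule LeastI_ex)
 have "m \<noteq> 0" using m assms by (auto intro: ccontr)
 then obtain j where j: "m = Suc j" by (cases m) auto
 have "\<not> \<rho> / 2 ^ j \<le> r" using not_less_Least[of j "\<lambda>n. \<rho> / 2 ^ n \<le> r"] j by (simp add: m_def)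
 thus ?thesis using m j by (intro exI[of _ j]) auto
qed

text \<open>On the shell between radii \<open>\<rho> / 2 ^ (j + 1)\<close> and \<open>\<rho> / 2 ^ j\<close> the integrand is comparable to a power
 of \<open>2 ^ j / \<rho>\<close>, and the contributions form a geometric series.\<close>

lemma nn_integral_norm_powr_ball:
 fixes s :: real
 assumes s: "0 \<le> s" "s < real CARD('n::finite)"
 shows "\<exists>C\<ge>0. \<forall>\<rho>>0. (\<integral>\<^sup>+z\<in>ball 0 \<rho>. ennreal (norm (z :: real ^ 'n) powr (- s)) \<partial>lborel)
   \<le> ennreal (C * \<rho> powr (real CARD('n) - s))"
proof -
 let ?N = "CARD('n)" and ?\<omega> = "unit_ball_vol (real CARD('n))"
 define q where "q = 2 powr (s - real ?N)"
 have q: "0 < q" "q < 1" using s by (auto simp: q_def powr_less_one)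
 show ?thesis
 proof (intro exI[of _ "?\<omega> * 2 powr s * (1 / (1 - q))"] conjI allI impI)
  show "0 \<le> ?\<omega> * 2 powr s * (1 / (1 - q))" using q by simp
  fix \<rho> :: real assume \<rho>: "\<rho> > 0"
  have pt: "ennreal (norm z powr (- s)) * indicator (ball 0 \<rho>) z
    \<le> (\<Sum>j. ennreal ((\<rho> / 2 ^ Suc j) powr (- s)) * indicator (ball 0 (\<rho> / 2 ^ j)) z)" for z :: "real ^ 'n"
  proof (cases "z \<noteq> 0 \<and> norm z < \<rho>")
   case True
   then obtain j where j: "\<rho> / 2 ^ Suc j \<le> norm z" "norm z < \<rho> / 2 ^ j"
    using dyadic_shell[of "norm z" \<rho>] by auto
   have "norm z powr (- s) \<le> (\<rho> / 2 ^ Suc j) powr (- s)"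
    using j(1) \<rho> s True by (intro powr_mono2') auto
   hence "ennreal (norm z powr (- s)) * indicator (ball 0 \<rho>) z
     \<le> ennreal ((\<rho> / 2 ^ Suc j) powr (- s)) * indicator (ball 0 (\<rho> / 2 ^ j)) z"
    using True j(2) by (simp add: ennreal_leI)
   also have "... \<le> (\<Sum>j. ennreal ((\<rho> / 2 ^ Suc j) powr (- s)) * indicator (ball 0 (\<rho> / 2 ^ j)) z)"
   proof -
    define f where "f = (\<lambda>j. ennreal ((\<rho> / 2 ^ Suc j) powr (- s)) * indicator (ball 0 (\<rho> / 2 ^ j)) z)"
    have "sum f {j} \<le> suminf f" by (rule sum_le_suminf) auto
    hence "f j \<le> suminf f" by simp
    thus ?thesis by (simp only: f_def)
   qed
   finally show ?thesis .
  qed (auto simp: indicator_def)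
  have val: "(\<rho> / 2 ^ Suc j) powr (- s) * (?\<omega> * (\<rho> / 2 ^ j) ^ ?N) = ?\<omega> * 2 powr s * \<rho> powr (real ?N - s) * q ^ j" for j
  proof -
   have p: "(2::real) ^ k = 2 powr real k" for k by (simp add: powr_realpow)
   have 1: "(\<rho> / 2 ^ Suc j) powr (- s) = \<rho> powr (- s) * 2 powr (s * real (Suc j))"
    unfolding p using \<rho> by (simp add: powr_divide powr_minus_divide powr_powr mult.commute del: of_nat_Suc)
   have 2: "(\<rho> / 2 ^ j) ^ ?N = \<rho> powr real ?N * 2 powr (- (real ?N * real j))"
    unfolding p using \<rho> by (simp add: powr_divide powr_minus_divide powr_powr mult.commute flip: powr_realpow)
   have 3: "q ^ j = 2 powr ((s - real ?N) * real j)"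
    by (simp add: q_def powr_powr flip: powr_realpow)
   have "2 powr (s * real (Suc j)) * 2 powr (- (real ?N * real j)) = 2 powr s * 2 powr ((s - real ?N) * real j)"
    by (simp add: algebra_simps flip: powr_add)
   moreover have "\<rho> powr (- s) * \<rho> powr real ?N = \<rho> powr (real ?N - s)"
    by (simp flip: powr_add)
   ultimately show ?thesis unfolding 1 2 3 by (simp add: mult_ac)
  qed
  have "(\<integral>\<^sup>+z\<in>ball 0 \<rho>. ennreal (norm (z :: real ^ 'n) powr (- s)) \<partial>lborel)
   \<le> (NNINT z. (\<Sum>j. ennreal ((\<rho> / 2 ^ Suc j) powr (- s)) * indicator (ball 0 (\<rho> / 2 ^ j)) (z :: real ^ 'n)))"
   by (intro nn_integral_mono pt)
  also have "... = (\<Sum>j. \<integral>\<^sup>+z. ennreal ((\<rho> / 2 ^ Suc j) powr (- s)) * indicator (ball 0 (\<rho> / 2 ^ j)) (z :: real ^ 'n) \<partial>lborel)"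
   by (rule nn_integral_suminf) measurable
  also have "... = (\<Sum>j. ennreal ((\<rho> / 2 ^ Suc j) powr (- s) * (?\<omega> * (\<rho> / 2 ^ j) ^ ?N)))"
  proof (intro suminf_cong)
   fix j
   have "(NNINT z. ennreal ((\<rho> / 2 ^ Suc j) powr (- s)) * indicator (ball 0 (\<rho> / 2 ^ j)) (z :: real ^ 'n))
    = ennreal ((\<rho> / 2 ^ Suc j) powr (- s)) * emeasure lborel (ball (0 :: real ^ 'n) (\<rho> / 2 ^ j))"
    by (rule nn_integral_cmult_indicator) simp
   also have "... = ennreal ((\<rho> / 2 ^ Suc j) powr (- s)) * ennreal (?\<omega> * (\<rho> / 2 ^ j) ^ ?N)"
    using \<rho> by (subst emeasure_ball) auto
   also have "... = ennreal ((\<rho> / 2 ^ Suc j) powr (- s) * (?\<omega> * (\<rho> / 2 ^ j) ^ ?N))"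
    using \<rho> by (intro ennreal_mult[symmetric] mult_nonneg_nonneg) auto
   finally show "(NNINT z. ennreal ((\<rho> / 2 ^ Suc j) powr (- s)) * indicator (ball 0 (\<rho> / 2 ^ j)) (z :: real ^ 'n))
    = ennreal ((\<rho> / 2 ^ Suc j) powr (- s) * (?\<omega> * (\<rho> / 2 ^ j) ^ ?N))" .
  qed
  also have "... = (\<Sum>j. ennreal (?\<omega> * 2 powr s * \<rho> powr (real ?N - s) * q ^ j))"
   unfolding val ..
  also have "... = ennreal (\<Sum>j. ?\<omega> * 2 powr s * \<rho> powr (real ?N - s) * q ^ j)"
   using q by (intro suminf_ennreal2) (auto intro!: summable_mult summable_geometric)
  also have "(\<Sum>j. ?\<omega> * 2 powr s * \<rho> powr (real ?N - s) * q ^ j) = ?\<omega> * 2 powr s * \<rho> powr (real ?N - s) * (1 / (1 - q))"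
   using q by (subst suminf_mult) (auto intro!: summable_geometric simp: suminf_geometric)
  finally show "(\<integral>\<^sup>+z\<in>ball 0 \<rho>. ennreal (norm (z :: real ^ 'n) powr (- s)) \<partial>lborel)
    \<le> ennreal (?\<omega> * 2 powr s * (1 / (1 - q)) * \<rho> powr (real ?N - s))" by (simp add: mult_ac)
 qed
qed

text \<open>For \<open>s = 1\<close> this regularises the gradient of the logarithm, for \<open>s = N / 2\<close> a multiple of the gradient of the
 fundamental solution of the Laplacian. The functions \<open>kern'\<close> and \<open>kdiv\<close> below are its partial derivatives
 and its divergence.\<close>

definition kern :: "real => real => real ^ 'n::finite => real ^ 'n" where
 "kern s e z = (rsq e z) powr (- s) *\<^sub>R z"

definition kern' :: "real => real => 'n => 'n::finite sfun" where
 "kern' s e i z = (rsq e z) powr (- s) - 2 * s * (z $ i)\<^sup>2 * (rsq e z) powr (- s - 1)"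

definition kdiv :: "real => real => 'n::finite sfun" where
 "kdiv s e z = ((real CARD('n) - 2 * s) * (norm z)\<^sup>2 + real CARD('n) * e\<^sup>2) * (rsq e z) powr (- s - 1)"

lemma kern_measurable [measurable]:
 "kern s e \<in> Borel" "kern' s e i \<in> Borel" "kdiv s e \<in> Borel"
 unfolding kern_def[abs_def] kern'_def[abs_def] kdiv_def[abs_def] by measurable

lemma coord_ddiff: "ddiff i (\<lambda>x :: real ^ 'n::finite. x $ i) (\<lambda>x. 1)"
 unfolding ddiff_def by (auto intro!: derivative_eq_intros)

lemma norm_powr_ddiff:
 assumes "e > 0"
 shows "ddiff i (\<lambda>z :: real ^ 'n::finite. (rsq e z) powr a)
   (\<lambda>z. a * (rsq e z) powr (a - 1) * (2 * z $ i))"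
proof -
 have "ddiff i (\<lambda>z :: real ^ 'n. (max 0 ((norm z)\<^sup>2) + e\<^sup>2) powr a) (\<lambda>z. a * (max 0 ((norm z)\<^sup>2) + e\<^sup>2) powr (a - 1) * (2 * z $ i))"
  unfolding ddiff_def
 proof
  fix x :: "real ^ 'n"
  have p: "(norm x)\<^sup>2 + e\<^sup>2 > 0" using assms by (intro add_nonneg_pos) auto
  have "((\<lambda>t. (norm (x + t *\<^sub>R axis i 1))\<^sup>2 + e\<^sup>2) has_real_derivative 2 * x $ i) (at 0)"
   using DERIV_add[OF norm_power2_ddiff[of i, unfolded ddiff_def, rule_format, of x] DERIV_const[of "e\<^sup>2"]] by simp
  from has_real_derivative_powr'[OF this, of "\<lambda>_. a" 0] p
  show "((\<lambda>t. (max 0 ((norm (x + t *\<^sub>R axis i 1))\<^sup>2) + e\<^sup>2) powr a) has_real_derivative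
    a * (max 0 ((norm x)\<^sup>2) + e\<^sup>2) powr (a - 1) * (2 * x $ i)) (at 0)"
   by (simp add: powr_diff field_simps max_def)
 qed
 thus ?thesis by simp
qed

lemma kern_ddiff:
 assumes "e > 0"
 shows "ddiff i (\<lambda>z :: real ^ 'n::finite. kern s e z $ i) (kern' s e i)"
proof -
 have "ddiff i (\<lambda>z :: real ^ 'n. (rsq e z) powr (- s) * z $ i)
   (\<lambda>z. (- s) * (rsq e z) powr (- s - 1) * (2 * z $ i) * z $ i + (rsq e z) powr (- s) * 1)"
  by (rule ddiff_mult[OF norm_powr_ddiff[OF assms] coord_ddiff])
 moreover have "(- s) * (rsq e z) powr (- s - 1) * (2 * z $ i) * z $ i + (rsq e z) powr (- s) * 1
   = kern' s e i z" for z :: "real ^ 'n"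
  by (simp add: kern'_def power2_eq_square)
 ultimately show ?thesis by (simp add: kern_def)
qed

lemma ddiff_shift: "ddiff i X X' ==> ddiff i (\<lambda>y. X (y - x)) (\<lambda>y. X' (y - x))"
 unfolding ddiff_def by (simp add: diff_add_eq[symmetric])

lemma kern'_sum: "(\<Sum>i\<in>UNIV. kern' s e i z) = kdiv s e (z :: real ^ 'n::finite)" if "e > 0"
proof -
 have p: "(norm z)\<^sup>2 + e\<^sup>2 > 0" using that by (intro add_nonneg_pos) auto
 have n: "(\<Sum>i\<in>UNIV. (z $ i)\<^sup>2) = (norm z)\<^sup>2"
  unfolding power2_norm_eq_inner by (simp add: inner_vec_def power2_eq_square)
 have "(rsq e z) powr (- s) = (rsq e z) * (rsq e z) powr (- s - 1)"
  using p powr_mult_base[of "(norm z)\<^sup>2 + e\<^sup>2" "- s - 1"] by simp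
 moreover have "(\<Sum>i\<in>UNIV. kern' s e i z) = real CARD('n) * (rsq e z) powr (- s)
   - 2 * s * (norm z)\<^sup>2 * (rsq e z) powr (- s - 1)"
  by (simp add: kern'_def sum_subtractf n flip: sum_distrib_left sum_distrib_right)
 ultimately show ?thesis by (simp add: kdiv_def algebra_simps)
qed

lemma kern_norm_le:
 assumes "e > 0" shows "norm (kern s e z) \<le> (rsq e z) powr (1 / 2 - s)"
proof -
 have p: "(norm z)\<^sup>2 + e\<^sup>2 > 0" using assms by (intro add_nonneg_pos) auto
 have "norm z \<le> sqrt (rsq e z)" by (intro real_le_rsqrt) simp
 hence "norm z \<le> (rsq e z) powr (1 / 2)" using p by (simp add: powr_half_sqrt)
 hence "norm (kern s e z) \<le> (rsq e z) powr (- s) * (rsq e z) powr (1 / 2)"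
  by (simp add: kern_def mult_left_mono)
 also have "... = (rsq e z) powr (1 / 2 - s)" by (simp flip: powr_add)
 finally show ?thesis .
qed

lemma kern_bounded:
 assumes e: "e > 0" and s: "s \<ge> 1 / 2"
 shows "\<bar>kern s e z $ i\<bar> \<le> (e\<^sup>2) powr (1 / 2 - s)" "\<bar>kern' s e i z\<bar> \<le> (1 + 2 * s) * (e\<^sup>2) powr (- s)"
proof -
 have p: "(norm z)\<^sup>2 + e\<^sup>2 > 0" "e\<^sup>2 > 0" using e by (auto intro: add_nonneg_pos)
 have "\<bar>kern s e z $ i\<bar> \<le> norm (kern s e z)" by (rule component_le_norm_cart)
 also have "... \<le> (rsq e z) powr (1 / 2 - s)" by (rule kern_norm_le[OF e])
 also have "... \<le> (e\<^sup>2) powr (1 / 2 - s)" using p s by (intro powr_mono2') auto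
 finally show "\<bar>kern s e z $ i\<bar> \<le> (e\<^sup>2) powr (1 / 2 - s)" .
 have "(z $ i)\<^sup>2 \<le> (norm z)\<^sup>2" using component_le_norm_cart[of z i] by (rule abs_le_square_iff[THEN iffD1, of "z $ i" "norm z", simplified])
 hence "(z $ i)\<^sup>2 * (rsq e z) powr (- s - 1) \<le> (rsq e z) * (rsq e z) powr (- s - 1)"
  using p by (intro mult_right_mono add_increasing2) auto
 also have "... = (rsq e z) powr (- s)"
  using p powr_mult_base[of "(norm z)\<^sup>2 + e\<^sup>2" "- s - 1"] by simp
 finally have 1: "2 * s * ((z $ i)\<^sup>2 * (rsq e z) powr (- s - 1)) \<le> 2 * s * (rsq e z) powr (- s)"
  using s by (intro mult_left_mono) auto
 have 2: "0 \<le> 2 * s * ((z $ i)\<^sup>2 * (rsq e z) powr (- s - 1))" using s by simp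
 have 3: "(rsq e z) powr (- s) \<le> (e\<^sup>2) powr (- s)" using p s by (intro powr_mono2') auto
 have "\<bar>kern' s e i z\<bar> \<le> (rsq e z) powr (- s) + 2 * s * (rsq e z) powr (- s)"
 proof -
  have "kern' s e i z = (rsq e z) powr (- s) - 2 * s * ((z $ i)\<^sup>2 * (rsq e z) powr (- s - 1))"
   by (simp add: kern'_def mult.assoc)
  thus ?thesis using 1 2 powr_ge_zero[of "(norm z)\<^sup>2 + e\<^sup>2" "- s"] by linarith
 qed
 also have "... = (1 + 2 * s) * (rsq e z) powr (- s)" by (simp add: algebra_simps)
 also have "... \<le> (1 + 2 * s) * (e\<^sup>2) powr (- s)" using 3 s by (intro mult_left_mono) auto
 finally show "\<bar>kern' s e i z\<bar> \<le> (1 + 2 * s) * (e\<^sup>2) powr (- s)" .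
qed

lemma integrable_vec_nth:
 fixes V :: "'a => real ^ 'n::finite"
 assumes "integrable M V" shows "integrable M (\<lambda>x. V x $ i)"
 by (rule integrable_bounded_linear[OF bounded_linear_vec_nth assms])

lemma integrable_bounded_mult:
 fixes f g :: "'a => real"
 assumes "integrable M f" "g \<in> borel_measurable M" "\<And>x. \<bar>g x\<bar> \<le> C"
 shows "integrable M (\<lambda>x. f x * g x)"
proof (rule integrable_dominated[OF integrable_mult_right[OF integrable_abs[OF assms(1)], of C]])
 show "(\<lambda>x. f x * g x) \<in> borel_measurable M" using assms by (intro borel_measurable_times) auto
 show "AE x in M. norm (f x * g x) \<le> norm (C * \<bar>f x\<bar>)"
 proof (rule AE_I2)
  fix x
  have "0 \<le> C" using assms(3)[of x] by linarith
  thus "norm (f x * g x) \<le> norm (C * \<bar>f x\<bar>)"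
   using mult_right_mono[OF assms(3)[of x], of "\<bar>f x\<bar>"] by (simp add: abs_mult mult.commute)
 qed
qed

text \<open>Integration by parts against the bounded field \<open>kern\<close>, summed over the components.\<close>

lemma wgrad_kern_identity:
 fixes v :: "'n::finite sfun"
 assumes v: "wgrad v V" "integrable lborel v" "integrable lborel V" and e: "e > 0" and s: "s \<ge> 1 / 2"
 shows "(LBINT y. v y * kdiv s e (y - x)) = - (LBINT y. V y \<bullet> kern s e (y - x))"
  "integrable lborel (\<lambda>y. v y * kdiv s e (y - x))" "integrable lborel (\<lambda>y. V y \<bullet> kern s e (y - x))"
proof -
 note b = kern_bounded[OF e s]
 have i1: "integrable lborel (\<lambda>y. v y * kern' s e i (y - x))" for i
  by (rule integrable_bounded_mult[OF v(2)]) (use b in auto)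
 have i2: "integrable lborel (\<lambda>y. V y $ i * kern s e (y - x) $ i)" for i
  by (rule integrable_bounded_mult[OF integrable_vec_nth[OF v(3)]]) (use b in auto)
 have 1: "(\<lambda>y. v y * kdiv s e (y - x)) = (\<lambda>y. \<Sum>i\<in>UNIV. v y * kern' s e i (y - x))"
  by (simp add: kern'_sum[OF e, symmetric] sum_distrib_left)
 have 2: "(\<lambda>y. V y \<bullet> kern s e (y - x)) = (\<lambda>y. \<Sum>i\<in>UNIV. V y $ i * kern s e (y - x) $ i)"
  by (simp add: inner_vec_def)
 show "integrable lborel (\<lambda>y. v y * kdiv s e (y - x))" "integrable lborel (\<lambda>y. V y \<bullet> kern s e (y - x))"
  unfolding 1 2 using i1 i2 by auto
 have "(LBINT y. v y * kern' s e i (y - x)) = - (LBINT y. V y $ i * kern s e (y - x) $ i)" for i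
  by (rule wgrad_test_bounded[OF v(1,2) integrable_vec_nth[OF v(3)] _ _ ddiff_shift[OF kern_ddiff[OF e]],
     where C = "max ((e\<^sup>2) powr (1 / 2 - s)) ((1 + 2 * s) * (e\<^sup>2) powr (- s))"])
    (use b in \<open>auto simp: le_max_iff_disj\<close>)
 thus "(LBINT y. v y * kdiv s e (y - x)) = - (LBINT y. V y \<bullet> kern s e (y - x))"
  unfolding 1 2 using i1 i2 by (simp add: sum_negf)
qed

section \<open>A weak isoperimetric inequality\<close>

text \<open>The points of a set of finite measure mostly have close neighbours in the set, by continuity
 of translations.\<close>

lemma autocorrelation_lower_bound:
 fixes A :: "(real ^ 'n::finite) set"
 assumes A [measurable]: "A \<in> sets borel" and fin: "emeasure lborel A < \<infinity>" and pos: "measure lborel A > 0"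
 shows "\<exists>\<delta>>0. \<forall>e. 0 < e \<and> e < \<delta> -->
  ennreal (unit_ball_vol (real CARD('n)) * e ^ CARD('n) * (measure lborel A / 2))
   \<le> (NNINT x. indicator A x * (NNINT y. indicator A y * indicator (cball 0 e) (y - x)))"
proof -
 define m where "m = measure lborel A"
 have m: "emeasure lborel A = ennreal m" "m > 0" using fin pos
  unfolding m_def by (auto intro!: emeasure_eq_ennreal_measure)
 obtain \<delta> where \<delta>: "\<delta> > 0" "\<And>z. norm z < \<delta> ==>
   (NNINT x. ennreal \<bar>indicator A (x + z) - indicator A x\<bar>) \<le> ennreal (m / 2)"
  using tendsto_translation_indicator[OF A fin, of "m / 2"] m by auto
 have low: "ennreal (m / 2) \<le> (NNINT x. indicator A x * indicator A (x + z))" if z: "norm z < \<delta>" for z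
 proof -
  have "ennreal (m / 2) + ennreal (m / 2) = (NNINT x. indicator A x)"
   using m by (simp flip: ennreal_plus)
  also have "... \<le> (NNINT x. indicator A x * indicator A (x + z) + ennreal \<bar>indicator A (x + z) - indicator A x\<bar>)"
   by (intro nn_integral_mono) (auto simp: indicator_def)
  also have "... = (NNINT x. indicator A x * indicator A (x + z)) + (NNINT x. ennreal \<bar>indicator A (x + z) - indicator A x\<bar>)"
   by (rule nn_integral_add) auto
  also have "... \<le> (NNINT x. indicator A x * indicator A (x + z)) + ennreal (m / 2)"
   by (intro add_left_mono \<delta> z)
  finally show ?thesis by (simp add: ennreal_add_left_cancel_le add.commute)
 qed
 show ?thesis
 proof (intro exI[of _ \<delta>] conjI allI impI)
  fix e assume e: "0 < e \<and> e < \<delta>"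
  have "ennreal (unit_ball_vol (real CARD('n)) * e ^ CARD('n) * (m / 2)) = (NNINT z. ennreal (m / 2) * indicator (cball 0 e) (z :: real ^ 'n))"
   using e m by (subst nn_integral_cmult_indicator, simp, subst emeasure_cball)
    (simp_all add: mult.commute flip: ennreal_mult)
  also have "... \<le> (NNINT z. indicator (cball 0 e) z * (NNINT x. indicator A x * indicator A (x + z)))"
   using e low by (intro nn_integral_mono) (auto simp: indicator_def)
  also have "... = (NNINT z. (NNINT x. indicator (cball 0 e) z * (indicator A x * indicator A (x + z))))"
   by (intro nn_integral_cong nn_integral_cmult[symmetric]) measurable
  also have "... = (NNINT x. (NNINT z. indicator (cball 0 e) z * (indicator A x * indicator A (x + z))))"
   by (rule lborel_pair.Fubini') measurable
  also have "... = (NNINT x. (NNINT y. indicator (cball 0 e) (y - x) * (indicator A x * indicator A y)))"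
  proof (rule nn_integral_cong)
   fix x :: "real ^ 'n"
   show "(\<integral>\<^sup>+z. indicator (cball 0 e) z * (indicator A x * indicator A (x + z)) \<partial>lborel :: ennreal)
    = (NNINT y. indicator (cball 0 e) (y - x) * (indicator A x * indicator A y))"
    by (subst nn_integral_lborel_shift[of "\<lambda>y. indicator (cball 0 e) (y - x) * (indicator A x * indicator A y)" x, symmetric])
      (auto simp: add.commute)
  qed
  also have "... = (NNINT x. (NNINT y. indicator A x * (indicator A y * indicator (cball 0 e) (y - x))))"
   by (simp add: mult_ac)
  also have "... = (NNINT x. indicator A x * (NNINT y. indicator A y * indicator (cball 0 e) (y - x)))"
   by (intro nn_integral_cong nn_integral_cmult) measurable
  finally show "ennreal (unit_ball_vol (real CARD('n)) * e ^ CARD('n) * (measure lborel A / 2))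
   \<le> (NNINT x. indicator A x * (NNINT y. indicator A y * indicator (cball 0 e) (y - x)))"
   by (simp add: m_def)
 qed fact
qed

text \<open>Among sets of given measure \<open>m\<close> nothing is lost, up to a constant, by comparing with the ball of
 radius \<open>m powr (1 / N)\<close>: inside that ball the kernel is integrable, outside it is bounded.\<close>

lemma riesz_potential_of_set:
 assumes N: "CARD('n::finite) \<ge> 2"
 shows "\<exists>C>0. \<forall>(A :: (real ^ 'n) set) y. A \<in> sets borel \<and> emeasure lborel A < \<infinity> \<and> measure lborel A > 0 -->
  (NNINT x. indicator A x * ennreal (norm (y - x) powr (1 - real CARD('n))))
   \<le> ennreal (C * measure lborel A powr (1 / real CARD('n)))"
proof -
 let ?N = "real CARD('n)"
 obtain C where C: "C \<ge> 0" "\<And>\<rho>. \<rho> > 0 ==> (\<integral>\<^sup>+z\<in>ball 0 \<rho>. ennreal (norm (z :: real ^ 'n) powr (- (?N - 1))) \<partial>lborel)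
   \<le> ennreal (C * \<rho> powr (?N - (?N - 1)))"
  using nn_integral_norm_powr_ball[of "?N - 1", where 'n = 'n] N by auto
 show ?thesis
 proof (intro exI[of _ "C + 1"] conjI allI impI)
  show "0 < C + 1" using C by simp
  fix A :: "(real ^ 'n) set" and y
  assume A: "A \<in> sets borel \<and> emeasure lborel A < \<infinity> \<and> measure lborel A > 0"
  hence [measurable]: "A \<in> sets borel" by simp
  define m where "m = measure lborel A"
  have m: "emeasure lborel A = ennreal m" "m > 0" using A
   unfolding m_def by (auto intro!: emeasure_eq_ennreal_measure)
  define \<rho> where "\<rho> = m powr (1 / ?N)"
  have \<rho>: "\<rho> > 0" using m by (simp add: \<rho>_def)
  have \<rho>N: "\<rho> powr ?N = m" using m N by (simp add: \<rho>_def powr_powr)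
  have "(NNINT x. indicator A x * ennreal (norm (y - x) powr (1 - ?N)))
   \<le> (NNINT x. ennreal (norm (y - x) powr (- (?N - 1))) * indicator (ball 0 \<rho>) (y - x) + ennreal (\<rho> powr (1 - ?N)) * indicator A x)"
  proof (intro nn_integral_mono)
   fix x
   have "norm (y - x) powr (1 - ?N) \<le> \<rho> powr (1 - ?N)" if "norm (y - x) \<ge> \<rho>"
    using that \<rho> N by (intro powr_mono2') auto
   thus "indicator A x * ennreal (norm (y - x) powr (1 - ?N))
     \<le> ennreal (norm (y - x) powr (- (?N - 1))) * indicator (ball 0 \<rho>) (y - x) + ennreal (\<rho> powr (1 - ?N)) * indicator A x"
    by (cases "norm (y - x) < \<rho>") (auto simp: indicator_def intro!: ennreal_leI)
  qed
  also have "... = (NNINT x. ennreal (norm (y - x) powr (- (?N - 1))) * indicator (ball 0 \<rho>) (y - x)) + (NNINT x. ennreal (\<rho> powr (1 - ?N)) * indicator A x)"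
   by (rule nn_integral_add) auto
  also have "(NNINT x. ennreal (norm (y - x) powr (- (?N - 1))) * indicator (ball 0 \<rho>) (y - x))
    = (\<integral>\<^sup>+z\<in>ball 0 \<rho>. ennreal (norm (z :: real ^ 'n) powr (- (?N - 1))) \<partial>lborel)"
   by (rule nn_integral_lborel_reflect[of "\<lambda>z. ennreal (norm (z :: real ^ 'n) powr (- (?N - 1))) * indicator (ball 0 \<rho>) z"]) auto
  also have "(NNINT x. ennreal (\<rho> powr (1 - ?N)) * indicator A x) = ennreal (\<rho> powr (1 - ?N) * m)"
   using m by (simp add: nn_integral_cmult_indicator ennreal_mult)
  also have "\<rho> powr (1 - ?N) * m = \<rho>"
   unfolding \<rho>N[symmetric] using \<rho> by (simp flip: powr_add)
  also have "(\<integral>\<^sup>+z\<in>ball 0 \<rho>. ennreal (norm (z :: real ^ 'n) powr (- (?N - 1))) \<partial>lborel) + ennreal \<rho> \<le> ennreal (C * \<rho>) + ennreal \<rho>"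
   using C(2)[OF \<rho>] \<rho> by (intro add_right_mono) simp
  also have "... = ennreal ((C + 1) * m powr (1 / ?N))"
   using C(1) \<rho> by (simp add: \<rho>_def algebra_simps flip: ennreal_plus)
  finally show "(NNINT x. indicator A x * ennreal (norm (y - x) powr (1 - ?N))) \<le> ennreal ((C + 1) * measure lborel A powr (1 / ?N))"
   by (simp add: m_def)
 qed
qed

text \<open>For \<open>s = N / 2\<close> the divergence of \<open>kern\<close> is nonnegative and of size \<open>e powr (- N)\<close> on the ball of radius \<open>e\<close>,
 while the field is bounded by \<open>|z| powr (1 - N)\<close>. Integrating the resulting pointwise bound over \<open>A\<close>,
 the left side is of the order of the measure of \<open>A\<close> by \<open>autocorrelation_lower_bound\<close> and the right side is
 controlled by \<open>riesz_potential_of_set\<close>. The constant is far from optimal; only the exponent matters.\<close>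

lemma weak_isoperimetric:
 assumes N: "CARD('n::finite) \<ge> 2"
 shows "\<exists>C>0. \<forall>(v :: real ^ 'n => real) V A. wgrad v V \<and> integrable lborel v \<and> integrable lborel V \<and>
   (\<forall>x. 0 \<le> v x) \<and> A \<in> sets borel \<and> emeasure lborel A < \<infinity> \<and> (\<forall>x\<in>A. 1 \<le> v x) -->
   measure lborel A powr (1 - 1 / real CARD('n)) \<le> C * (LBINT x. norm (V x))"
proof -
 let ?N = "real CARD('n)" and ?\<omega> = "unit_ball_vol (real CARD('n))"
 obtain C1 where C1: "C1 > 0" "\<And>(A :: (real ^ 'n) set) y. A \<in> sets borel ==> emeasure lborel A < \<infinity> ==> measure lborel A > 0 ==>
  (NNINT x. indicator A x * ennreal (norm (y - x) powr (1 - ?N))) \<le> ennreal (C1 * measure lborel A powr (1 / ?N))"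
  using riesz_potential_of_set[OF N] by blast
 \<comment> \<open>The value of \<open>e powr N * kdiv (N / 2) e\<close> at distance \<open>e\<close> from the origin.\<close>
 define c where "c = ?N * 2 powr (- (?N / 2) - 1)"
 have c: "c > 0" using N by (simp add: c_def)
 have \<omega>: "?\<omega> > 0" by simp
 show ?thesis
 proof (intro exI[of _ "2 * C1 / (c * ?\<omega>)"] conjI allI impI)
  show "0 < 2 * C1 / (c * ?\<omega>)" using C1 c \<omega> by simp
  fix v :: "'n sfun" and V A
  assume *: "wgrad v V \<and> integrable lborel v \<and> integrable lborel V \<and>
   (\<forall>x. 0 \<le> v x) \<and> A \<in> sets borel \<and> emeasure lborel A < \<infinity> \<and> (\<forall>x\<in>A. 1 \<le> v x)"
  hence v: "wgrad v V" "integrable lborel v" "integrable lborel V" and v0: "\<And>x. 0 \<le> v x"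
   and A [measurable]: "A \<in> sets borel" and fin: "emeasure lborel A < \<infinity>" and v1: "\<And>x. x \<in> A ==> 1 \<le> v x" by auto
  have [measurable]: "v \<in> Borel" "V \<in> Borel"
   using wgradD(3)[OF v(1)] wgrad_measurable[OF v(1)] .
  define m where "m = measure lborel A"
  define I where "I = (LBINT x. norm (V x))"
  have I: "(NNINT x. ennreal (norm (V x))) = ennreal I" "I \<ge> 0"
   unfolding I_def using nn_integral_eq_integral[OF integrable_norm[OF v(3)]] by auto
  show "measure lborel A powr (1 - 1 / ?N) \<le> 2 * C1 / (c * ?\<omega>) * (LBINT x. norm (V x))"
  proof (cases "m > 0")
   case False
   hence "measure lborel A = 0" using measure_nonneg[of lborel A] by (simp add: m_def)
   thus ?thesis using C1 c \<omega> by simp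
  next
   case True
   obtain \<delta> where \<delta>: "\<delta> > 0" "\<And>e. 0 < e ==> e < \<delta> ==> ennreal (?\<omega> * e ^ CARD('n) * (m / 2))
    \<le> (NNINT x. indicator A x * (NNINT y. indicator A y * indicator (cball 0 e) (y - x)))"
    using autocorrelation_lower_bound[OF A fin] True unfolding m_def by blast
   define e where "e = \<delta> / 2"
   have e: "e > 0" "e < \<delta>" using \<delta> by (auto simp: e_def)
   define k where "k = c * e powr (- ?N)"
   have k: "k > 0" using c e by (simp add: k_def)
   have pt: "ennreal k * (NNINT y. indicator A y * indicator (cball 0 e) (y - x))
     \<le> (NNINT y. ennreal (norm (V y)) * ennreal (norm (y - x) powr (1 - ?N)))" for x
   proof -
    note id = wgrad_kern_identity[OF v e(1), of "?N / 2" x]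
    have s: "1 / 2 \<le> ?N / 2" using N by simp
    have kd: "kdiv (?N / 2) e z = ?N * e\<^sup>2 * (rsq e z) powr (- (?N / 2) - 1)" for z :: "real ^ 'n"
     by (simp add: kdiv_def)
    have kd0: "kdiv (?N / 2) e z \<ge> 0" for z :: "real ^ 'n" unfolding kd by simp
    have kk: "k \<le> kdiv (?N / 2) e z" if "norm z \<le> e" for z :: "real ^ 'n"
    proof -
     have "(norm z)\<^sup>2 \<le> e\<^sup>2" using that by (intro power_mono) auto
     hence "(2 * e\<^sup>2) powr (- (?N / 2) - 1) \<le> (rsq e z) powr (- (?N / 2) - 1)"
      using e N by (intro powr_mono2') (auto intro: add_nonneg_pos)
     moreover have "(2 * e\<^sup>2) powr (- (?N / 2) - 1) = 2 powr (- (?N / 2) - 1) * (e powr (- ?N) / e\<^sup>2)"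
      using e by (simp add: powr_mult powr_powr powr_diff field_simps flip: powr_numeral powr_add)
     ultimately have "?N * e\<^sup>2 * (2 powr (- (?N / 2) - 1) * (e powr (- ?N) / e\<^sup>2)) \<le> kdiv (?N / 2) e z"
      unfolding kd by (intro mult_left_mono) auto
     thus ?thesis using e by (simp add: k_def c_def)
    qed
    have Kn: "norm (kern (?N / 2) e z) \<le> norm z powr (1 - ?N)" for z :: "real ^ 'n"
    proof (cases "z = 0")
     case False
     have "norm (kern (?N / 2) e z) \<le> (rsq e z) powr (1 / 2 - ?N / 2)" by (rule kern_norm_le[OF e(1)])
     also have "... \<le> ((norm z)\<^sup>2) powr (1 / 2 - ?N / 2)" using False N by (intro powr_mono2') auto
     also have "... = norm z powr (2 * (1 / 2 - ?N / 2))" using False by (simp add: powr_powr flip: powr_numeral)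
     also have "2 * (1 / 2 - ?N / 2) = 1 - ?N" by (simp add: field_simps)
     finally show ?thesis .
    qed (simp add: kern_def)
    have "ennreal k * (NNINT y. indicator A y * indicator (cball 0 e) (y - x))
     = (NNINT y. ennreal k * (indicator A y * indicator (cball 0 e) (y - x)))"
     by (rule nn_integral_cmult[symmetric]) measurable
    also have "... \<le> (NNINT y. ennreal (v y * kdiv (?N / 2) e (y - x)))"
    proof (intro nn_integral_mono)
     fix y
     show "ennreal k * (indicator A y * indicator (cball 0 e) (y - x)) \<le> ennreal (v y * kdiv (?N / 2) e (y - x))"
     proof (cases "y \<in> A \<and> norm (y - x) \<le> e")
      case True
      have "1 * k \<le> v y * kdiv (?N / 2) e (y - x)"
       using v1[of y] kk[of "y - x"] True k by (intro mult_mono) auto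
      thus ?thesis using True by (simp add: ennreal_leI)
     qed (auto simp: indicator_def)
    qed
    also have "... = ennreal (LBINT y. v y * kdiv (?N / 2) e (y - x))"
     by (rule nn_integral_eq_integral) (use id s v0 kd0 in auto)
    also have "... = ennreal (- (LBINT y. V y \<bullet> kern (?N / 2) e (y - x)))"
     using id s by simp
    also have "... \<le> ennreal (norm (LBINT y. V y \<bullet> kern (?N / 2) e (y - x)))"
     by (intro ennreal_leI) simp
    also have "... \<le> (NNINT y. ennreal (norm (V y \<bullet> kern (?N / 2) e (y - x))))"
     by (rule integral_norm_bound_ennreal) (use id s in auto)
    also have "... \<le> (NNINT y. ennreal (norm (V y)) * ennreal (norm (y - x) powr (1 - ?N)))"
    proof (intro nn_integral_mono)
     fix y
     have "\<bar>V y \<bullet> kern (?N / 2) e (y - x)\<bar> \<le> norm (V y) * norm (kern (?N / 2) e (y - x))"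
      by (rule Cauchy_Schwarz_ineq2)
     also have "... \<le> norm (V y) * norm (y - x) powr (1 - ?N)" by (intro mult_left_mono Kn) auto
     finally show "ennreal (norm (V y \<bullet> kern (?N / 2) e (y - x))) \<le> ennreal (norm (V y)) * ennreal (norm (y - x) powr (1 - ?N))"
      by (simp add: ennreal_leI flip: ennreal_mult)
    qed
    finally show ?thesis .
   qed
   have "ennreal (k * (?\<omega> * e ^ CARD('n) * (m / 2))) = ennreal k * ennreal (?\<omega> * e ^ CARD('n) * (m / 2))"
    using k True e by (intro ennreal_mult mult_nonneg_nonneg) auto
   also have "... \<le> ennreal k * (NNINT x. indicator A x * (NNINT y. indicator A y * indicator (cball 0 e) (y - x)))"
    by (intro mult_left_mono \<delta>(2) e) auto
   also have "... = (NNINT x. ennreal k * (indicator A x * (NNINT y. indicator A y * indicator (cball 0 e) (y - x))))"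
    by (rule nn_integral_cmult[symmetric]) measurable
   also have "... \<le> (NNINT x. indicator A x * (NNINT y. ennreal (norm (V y)) * ennreal (norm (y - x) powr (1 - ?N))))"
   proof (intro nn_integral_mono)
    fix x
    show "ennreal k * (indicator A x * (NNINT y. indicator A y * indicator (cball 0 e) (y - x)))
     \<le> indicator A x * (NNINT y. ennreal (norm (V y)) * ennreal (norm (y - x) powr (1 - ?N)))"
     using mult_left_mono[OF pt[of x], of "indicator A x"] by (simp add: mult.left_commute)
   qed
   also have "... = (NNINT x. (NNINT y. indicator A x * (ennreal (norm (V y)) * ennreal (norm (y - x) powr (1 - ?N)))))"
    by (intro nn_integral_cong nn_integral_cmult[symmetric]) measurable
   also have "... = (NNINT y. (NNINT x. indicator A x * (ennreal (norm (V y)) * ennreal (norm (y - x) powr (1 - ?N)))))"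
    by (rule lborel_pair.Fubini') measurable
   also have "... = (NNINT y. (NNINT x. ennreal (norm (V y)) * (indicator A x * ennreal (norm (y - x) powr (1 - ?N)))))"
    by (simp add: mult.left_commute)
   also have "... = (NNINT y. ennreal (norm (V y)) * (NNINT x. indicator A x * ennreal (norm (y - x) powr (1 - ?N))))"
    by (intro nn_integral_cong nn_integral_cmult) measurable
   also have "... \<le> (NNINT y. ennreal (norm (V y)) * ennreal (C1 * m powr (1 / ?N)))"
    using C1(2)[OF A fin] True by (intro nn_integral_mono mult_left_mono) (auto simp: m_def)
   also have "... = ennreal I * ennreal (C1 * m powr (1 / ?N))"
    by (subst nn_integral_multc) (auto simp: I)
   also have "... = ennreal (I * (C1 * m powr (1 / ?N)))" using I by (simp add: ennreal_mult')
   finally have "k * (?\<omega> * e ^ CARD('n) * (m / 2)) \<le> I * (C1 * m powr (1 / ?N))"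
    using I C1 by (subst (asm) ennreal_le_iff) auto
   moreover have "k * (?\<omega> * e ^ CARD('n) * (m / 2)) = c * ?\<omega> / 2 * (m powr (1 / ?N) * m powr (1 - 1 / ?N))"
   proof -
    have "e powr (- ?N) * e ^ CARD('n) = 1" using e by (simp add: powr_minus powr_realpow)
    moreover have "m powr (1 / ?N) * m powr (1 - 1 / ?N) = m" using True by (simp flip: powr_add)
    ultimately show ?thesis by (simp add: k_def field_simps)
   qed
   ultimately have "c * ?\<omega> / 2 * (m powr (1 / ?N) * m powr (1 - 1 / ?N)) \<le> I * (C1 * m powr (1 / ?N))"
    by linarith
   hence "m powr (1 / ?N) * (c * ?\<omega> / 2 * m powr (1 - 1 / ?N)) \<le> m powr (1 / ?N) * (C1 * I)"
    by (simp only: mult_ac)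
   hence "c * ?\<omega> / 2 * m powr (1 - 1 / ?N) \<le> C1 * I" using True by simp
   thus ?thesis using c \<omega> by (simp add: m_def I_def field_simps)
  qed
 qed
qed

section \<open>Exponential integrability\<close>

text \<open>A continuously differentiable spline from 0 to 1.\<close>

definition step :: "real => real" where
 "step x = 2 * (max 0 x)\<^sup>2 - 4 * (max 0 (x - 1 / 2))\<^sup>2 + 2 * (max 0 (x - 1))\<^sup>2"

definition step' :: "real => real" where
 "step' x = 4 * max 0 x - 8 * max 0 (x - 1 / 2) + 4 * max 0 (x - 1)"

lemma step_deriv: "(step has_real_derivative step' x) (at x)"
proof -
 have s: "((\<lambda>x. (max 0 (x - c))\<^sup>2) has_real_derivative 2 * max 0 (x - c)) (at x)" for c
 proof -
  have "((\<lambda>x. x - c) has_real_derivative 1) (at x)" by (auto intro!: derivative_eq_intros)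
  from DERIV_chain2[where f = "\<lambda>x. (max 0 x)\<^sup>2", OF max0_power2_deriv this] show ?thesis by simp
 qed
 show ?thesis unfolding step_def[abs_def] step'_def
  using DERIV_add[OF DERIV_diff[OF DERIV_cmult[OF s[of 0], of 2] DERIV_cmult[OF s[of "1 / 2"], of 4]] DERIV_cmult[OF s[of 1], of 2]]
  by simp
qed

lemma step'_continuous: "continuous_on UNIV step'"
 unfolding step'_def[abs_def] by (intro continuous_intros)

lemma step'_bounds: "0 \<le> step' x" "step' x \<le> 2" "x \<le> 0 \<or> 1 \<le> x ==> step' x = 0"
 by (auto simp: step'_def max_def)

lemma step_le_0: "x \<le> 0 ==> step x = 0"
 by (simp add: step_def)

lemma step_ge_1: "x \<ge> 1 ==> step x = 1"
 by (simp add: step_def power2_eq_square algebra_simps)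

lemma step_bounds: "0 \<le> step x" "step x \<le> 1"
proof -
 have mono: "step x \<le> step y" if "x \<le> y" for x y
  by (rule DERIV_nonneg_imp_nondecreasing[OF that]) (use step_deriv step'_bounds in blast)
 show "0 \<le> step x" using mono[of "min x 0" x] step_le_0[of "min x 0"] by simp
 show "step x \<le> 1" using mono[of x "max x 1"] step_ge_1[of "max x 1"] by simp
qed

lemma step_measurable [measurable]: "step \<in> Borel" "step' \<in> Borel"
 unfolding step_def[abs_def] step'_def[abs_def] by measurable

lemma le_one_plus_power: "0 \<le> x ==> n \<ge> 1 ==> x \<le> 1 + x ^ n" for x :: real
 using self_le_power[of x n] by (cases "x \<ge> 1") (auto intro: add_increasing2)

text \<open>Members of \<open>W\<close> with exponent \<open>N\<close>, paired with a gradient and given by Borel representatives.\<close>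

definition sobolev_fun :: "(real ^ 'n::finite => real) => (real ^ 'n => real ^ 'n) => bool" where
 "sobolev_fun u v \<longleftrightarrow> wgrad u v \<and> integrable lborel (\<lambda>x. \<bar>u x\<bar> ^ CARD('n)) \<and>
   integrable lborel (\<lambda>x. norm (v x) ^ CARD('n))"

lemma sobolev_funD:
 fixes u :: "'n::finite sfun"
 assumes "sobolev_fun u v"
 shows "wgrad u v" "integrable lborel (\<lambda>x. \<bar>u x\<bar> ^ CARD('n))" "integrable lborel (\<lambda>x. norm (v x) ^ CARD('n))"
  "u \<in> Borel" "v \<in> Borel"
 using assms wgrad_measurable wgradD(3) unfolding sobolev_fun_def by blast+

lemma superlevel_finite:
 fixes u :: "'n::finite sfun"
 assumes "integrable lborel (\<lambda>x. \<bar>u x\<bar> ^ CARD('n))" and [measurable]: "u \<in> Borel" and t: "t > 0"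
 shows "emeasure lborel {x. t \<le> u x} < \<infinity>"
proof -
 have "ennreal (t ^ CARD('n)) * emeasure lborel {x. t \<le> u x} = (NNINT x. ennreal (t ^ CARD('n)) * indicator {x. t \<le> u x} x)"
  by (rule nn_integral_cmult_indicator[symmetric]) simp
 also have "... \<le> (NNINT x. ennreal (\<bar>u x\<bar> ^ CARD('n)))"
  using t by (intro nn_integral_mono) (auto simp: indicator_def intro!: ennreal_leI power_mono)
 also have "... < \<infinity>" using assms(1) by (simp add: integrable_iff_bounded)
 finally have "ennreal (t ^ CARD('n)) * emeasure lborel {x. t \<le> u x} < \<infinity>" .
 thus ?thesis using t by (auto simp: ennreal_mult_less_top ennreal_mult_eq_top_iff less_top)
qed

text \<open>Truncate \<open>u\<close> between the levels \<open>t\<close> and \<open>t + h\<close> and apply the isoperimetric inequality. By Young's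
 inequality the gradient in the mean is bounded by the measure of the superlevel set at \<open>t\<close> and the
 gradient energy of the slab; were the higher superlevel set more than half as large, the small
 energy would contradict the inequality.\<close>

lemma superlevel_halving:
 assumes N: "CARD('n::finite) \<ge> 2"
 shows "\<exists>\<kappa>>0. \<forall>(u :: real ^ 'n => real) v t h. sobolev_fun u v \<and> 0 < t \<and> 0 < h \<and>
   (LBINT x. indicator {x. t < u x \<and> u x < t + h} x * norm (v x) ^ CARD('n)) \<le> \<kappa> * h ^ CARD('n) -->
   measure lborel {x. t + h \<le> u x} \<le> measure lborel {x. t \<le> u x} / 2"
proof -
 let ?n = "CARD('n)" let ?N = "real ?n"
 obtain C where C: "C > 0" "\<And>(v :: real ^ 'n => real) V A. wgrad v V ==> integrable lborel v ==> integrable lborel V ==>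
   (\<And>x. 0 \<le> v x) ==> A \<in> sets borel ==> emeasure lborel A < \<infinity> ==> (\<And>x. x\<in>A ==> 1 \<le> v x) ==>
   measure lborel A powr (1 - 1 / ?N) \<le> C * (LBINT x. norm (V x))"
  using weak_isoperimetric[OF N] by blast
 \<comment> \<open>The constant is small enough to absorb both terms of the optimised Young inequality.\<close>
 define \<theta> where "\<theta> = 1 / (8 * C)"
 have \<theta>: "\<theta> > 0" using C by (simp add: \<theta>_def)
 show ?thesis
 proof (intro exI[of _ "\<theta> ^ ?n"] conjI allI impI)
  show "0 < \<theta> ^ ?n" using \<theta> by simp
  fix u :: "'n sfun" and v t h
  assume *: "sobolev_fun u v \<and> 0 < t \<and> 0 < h \<and>
   (LBINT x. indicator {x. t < u x \<and> u x < t + h} x * norm (v x) ^ CARD('n)) \<le> \<theta> ^ ?n * h ^ ?n"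
  hence u: "sobolev_fun u v" and t: "0 < t" and h: "0 < h" by auto
  note U = sobolev_funD[OF u]
  note [measurable] = U(4,5)
  let ?P = "{x. t < u x \<and> u x < t + h}"
  define E where "E = (LBINT x. indicator ?P x * norm (v x) ^ ?n)"
  have E: "E \<le> \<theta> ^ ?n * h ^ ?n" using * by (simp add: E_def)
  let ?F = "\<lambda>s. step ((s - t) / h)" and ?F' = "\<lambda>s. step' ((s - t) / h) / h"
  have F: "(?F has_real_derivative ?F' s) (at s)" for s
  proof -
   have "((\<lambda>s. (s - t) / h) has_real_derivative 1 / h) (at s)" using h by (auto intro!: derivative_eq_intros)
   from DERIV_chain2[where f = step, OF step_deriv this] show ?thesis by simp
  qed
  have F'c: "continuous_on UNIV ?F'"
   using h by (intro continuous_intros continuous_on_compose2[OF step'_continuous]) auto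
  have F'b: "\<bar>?F' s\<bar> \<le> 2 / h" for s using step'_bounds(1,2)[of "(s - t) / h"] h by (simp add: divide_right_mono)
  let ?V = "\<lambda>x. ?F' (u x) *\<^sub>R v x"
  have W: "wgrad (\<lambda>x. ?F (u x)) ?V" by (rule wgrad_chain[OF U(1) F F'c F'b])
  have i1: "integrable lborel (\<lambda>x. ?F (u x))"
  proof (rule integrable_dominated[OF integrable_mult_right[OF U(2), of "1 / t ^ ?n"]])
   show "AE x in lborel. norm (?F (u x)) \<le> norm (1 / t ^ ?n * \<bar>u x\<bar> ^ ?n)"
   proof (rule AE_I2)
    fix x
    show "norm (?F (u x)) \<le> norm (1 / t ^ ?n * \<bar>u x\<bar> ^ ?n)"
    proof (cases "u x \<le> t")
     case False
     hence "t ^ ?n \<le> \<bar>u x\<bar> ^ ?n" using t by (intro power_mono) auto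
     hence "1 \<le> 1 / t ^ ?n * \<bar>u x\<bar> ^ ?n" using t by simp
     hence "1 \<le> norm (1 / t ^ ?n * \<bar>u x\<bar> ^ ?n)" using t by simp
     moreover have "norm (?F (u x)) \<le> 1" using step_bounds[of "(u x - t) / h"] by simp
     ultimately show ?thesis by linarith
    qed (use h in \<open>simp add: step_le_0 divide_le_0_iff\<close>)
   qed
  qed simp
  have Vb: "norm (?V x) \<le> 2 / h * (indicator ?P x * norm (v x))" for x
  proof (cases "x \<in> ?P")
   case True
   thus ?thesis using mult_right_mono[OF F'b[of "u x"], of "norm (v x)"] by simp
  next
   case False
   hence "(u x - t) / h \<le> 0 \<or> 1 \<le> (u x - t) / h" using h by (auto simp: field_simps)
   thus ?thesis using False step'_bounds(3)[of "(u x - t) / h"] by simp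
  qed
  have iP: "integrable lborel (\<lambda>x. indicator ?P x * norm (v x) ^ ?n)"
   by (rule integrable_dominated[OF U(3)]) (auto simp: indicator_def)
  have Pfin: "emeasure lborel ?P < \<infinity>"
   by (rule le_less_trans[OF emeasure_mono superlevel_finite[OF U(2) U(4) t]]) auto
  have iP1: "integrable lborel (indicator ?P :: _ => real)" using Pfin by simp
  have young: "indicator ?P x * norm (v x) \<le> l * indicator ?P x + l / l ^ ?n * (indicator ?P x * norm (v x) ^ ?n)"
   if l: "l > 0" for l x
  proof -
   have "norm (v x) / l \<le> 1 + (norm (v x) / l) ^ ?n" using l by (intro le_one_plus_power) auto
   hence "l * (norm (v x) / l) \<le> l * (1 + (norm (v x) / l) ^ ?n)" using l by (intro mult_left_mono) auto
   hence "norm (v x) \<le> l + l / l ^ ?n * norm (v x) ^ ?n" using l by (simp add: power_divide algebra_simps)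
   thus ?thesis by (auto simp: indicator_def)
  qed
  have iV1: "integrable lborel (\<lambda>x. indicator ?P x * norm (v x))"
   by (rule integrable_dominated[OF integrable_plus[OF integrable_mult_right[OF iP1, of 1] integrable_mult_right[OF iP, of "1 / 1 ^ ?n"]]])
     (use young[of 1] in \<open>auto intro!: order.trans[OF _ abs_ge_self]\<close>)
  have iV: "integrable lborel ?V"
  proof (rule integrable_dominated[OF integrable_mult_right[OF iV1, of "2 / h"]])
   show "AE x in lborel. norm (?V x) \<le> norm (2 / h * (indicator ?P x * norm (v x)))"
    unfolding real_norm_def by (rule AE_I2) (rule order.trans[OF Vb abs_ge_self])
  qed measurable
  define M where "M = measure lborel {x. t \<le> u x}"
  define M' where "M' = measure lborel {x. t + h \<le> u x}"
  have fin: "emeasure lborel {x. t \<le> u x} < \<infinity>" by (rule superlevel_finite[OF U(2) U(4) t])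
  have fin': "emeasure lborel {x. t + h \<le> u x} < \<infinity>" using t h by (intro superlevel_finite[OF U(2) U(4)]) auto
  have M'M: "M' \<le> M" unfolding M_def M'_def
   by (rule measure_mono_fmeasurable) (use h fin in \<open>auto simp: fmeasurable_def\<close>)
  have PM: "measure lborel ?P \<le> M" unfolding M_def
   by (rule measure_mono_fmeasurable) (use h fin in \<open>auto simp: fmeasurable_def\<close>)
  have "M' \<le> M / 2"
  proof (rule ccontr)
   assume neg: "\<not> M' \<le> M / 2"
   hence M0: "M > 0" using M'M by (auto simp: M_def) 
   define a where "a = 1 - 1 / ?N"
   have a: "0 < a" "a \<le> 1" using N by (auto simp: a_def field_simps)
   define l where "l = \<theta> * h * M powr (- 1 / ?N)"
   have l: "l > 0" using \<theta> h M0 by (simp add: l_def)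
   have lN: "l ^ ?n = \<theta> ^ ?n * h ^ ?n / M"
   proof -
    have "(M powr (- 1 / ?N)) ^ ?n = (M powr (- 1 / ?N)) powr ?N" using M0 by (subst powr_realpow) auto
    also have "... = M powr (- 1)" unfolding powr_powr by simp
    also have "... = 1 / M" using M0 by (simp add: powr_minus_divide)
    finally show ?thesis by (simp add: l_def power_mult_distrib)
   qed
   have lM: "l * M = \<theta> * h * M powr a"
    using M0 powr_mult_base[of M "- 1 / ?N"] by (simp add: l_def a_def mult.assoc mult.commute[of _ M])
   have "M' powr a \<le> C * (LBINT x. norm (?V x))"
    unfolding M'_def a_def
   proof (rule C(2)[OF W i1 iV _ _ fin'])
    show "1 \<le> ?F (u x)" if "x \<in> {x. t + h \<le> u x}" for x
     using that h step_ge_1[of "(u x - t) / h"] by (simp add: field_simps)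
   qed (use step_bounds in auto)
   also have "(LBINT x. norm (?V x)) \<le> (LBINT x. 2 / h * (indicator ?P x * norm (v x)))"
    by (intro integral_mono integrable_norm iV integrable_mult_right iV1 Vb)
   also have "... = 2 / h * (LBINT x. indicator ?P x * norm (v x))" by simp
   also have "(LBINT x. indicator ?P x * norm (v x)) \<le> (LBINT x. l * indicator ?P x + l / l ^ ?n * (indicator ?P x * norm (v x) ^ ?n))"
    by (intro integral_mono iV1 young[OF l] integrable_plus integrable_mult_right iP1 iP)
   also have "... = l * measure lborel ?P + l / l ^ ?n * E"
    using iP iP1 by (simp add: E_def)
   also have "... \<le> l * M + l / l ^ ?n * (\<theta> ^ ?n * h ^ ?n)"
    using l PM E by (intro add_mono mult_left_mono) auto
   also have "l / l ^ ?n * (\<theta> ^ ?n * h ^ ?n) = l * M"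
    unfolding lN using \<theta> h M0 by simp
   finally have "M' powr a \<le> C * (2 / h * (l * M + l * M))"
    by (rule meta_mp) (use C(1) h in \<open>auto intro!: divide_right_mono mult_left_mono\<close>)
   also have "... = M powr a / 2" unfolding lM using C h by (simp add: \<theta>_def field_simps)
   finally have 1: "M' powr a \<le> M powr a / 2" .
   have "M / 2 < M'" using neg by simp
   hence "(M / 2) powr a < M' powr a" using M0 a by (intro powr_less_mono2) auto
   moreover have "M powr a / 2 \<le> (M / 2) powr a"
   proof -
    have "(2::real) powr a \<le> 2 powr 1" using a by (intro powr_mono) auto
    hence "M powr a / 2 \<le> M powr a / 2 powr a" by (intro divide_left_mono) auto
    thus ?thesis using M0 by (simp add: powr_divide)
   qed
   ultimately show False using 1 by linarith
  qed
  thus "measure lborel {x. t + h \<le> u x} \<le> measure lborel {x. t \<le> u x} / 2"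
   by (simp add: M_def M'_def)
 qed
qed

text \<open>Of \<open>n\<close> slabs of height \<open>s / n\<close>, at most half carry energy above the threshold of
 \<open>superlevel_halving\<close>, for otherwise the total would exceed \<open>\<epsilon>\<close>.\<close>

lemma superlevel_decay_steps:
 assumes N: "CARD('n::finite) \<ge> 2"
 shows "\<exists>\<kappa>>0. \<forall>(u :: real ^ 'n => real) v T s \<epsilon> n. sobolev_fun u v \<and> 0 < T \<and> 0 < s \<and>
   (LBINT x. indicator {x. T < u x} x * norm (v x) ^ CARD('n)) \<le> \<epsilon> \<and>
   2 * \<epsilon> * real n ^ (CARD('n) - 1) \<le> \<kappa> * s ^ CARD('n) -->
   measure lborel {x. T + s \<le> u x} \<le> measure lborel {x. T \<le> u x} * 2 powr (- real n / 2)"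
proof -
 let ?d = "CARD('n)"
 obtain \<kappa> where \<kappa>: "\<kappa> > 0" "\<And>(u :: real ^ 'n => real) v t h. sobolev_fun u v ==> 0 < t ==> 0 < h ==>
   (LBINT x. indicator {x. t < u x \<and> u x < t + h} x * norm (v x) ^ CARD('n)) \<le> \<kappa> * h ^ CARD('n) ==>
   measure lborel {x. t + h \<le> u x} \<le> measure lborel {x. t \<le> u x} / 2"
  using superlevel_halving[OF N] by blast
 show ?thesis
 proof (intro exI[of _ \<kappa>] conjI allI impI)
  fix u :: "'n sfun" and v T s \<epsilon> and n :: nat
  assume *: "sobolev_fun u v \<and> 0 < T \<and> 0 < s \<and>
   (LBINT x. indicator {x. T < u x} x * norm (v x) ^ CARD('n)) \<le> \<epsilon> \<and>
   2 * \<epsilon> * real n ^ (CARD('n) - 1) \<le> \<kappa> * s ^ CARD('n)"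
  hence u: "sobolev_fun u v" and T: "0 < T" and s: "0 < s" by auto
  note U = sobolev_funD[OF u]
  note [measurable] = U(4,5)
  define \<mu> where "\<mu> t = measure lborel {x. t \<le> u x}" for t
  have \<mu>mono: "\<mu> t' \<le> \<mu> t" if "0 < t" "t \<le> t'" for t t'
   unfolding \<mu>_def
   by (rule measure_mono_fmeasurable) (use that superlevel_finite[OF U(2) U(4) that(1)] in \<open>auto simp: fmeasurable_def\<close>)
  have \<mu>0: "\<mu> t \<ge> 0" for t by (simp add: \<mu>_def)
  show "measure lborel {x. T + s \<le> u x} \<le> measure lborel {x. T \<le> u x} * 2 powr (- real n / 2)"
  proof (cases "n = 0")
   case True
   thus ?thesis using \<mu>mono[of T "T + s"] T s by (simp add: \<mu>_def)
  next
   case False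
   define h where "h = s / real n"
   have h: "h > 0" using s False by (simp add: h_def)
   define t where "t k = T + real k * h" for k
   have t: "t k > 0" "t (Suc k) = t k + h" for k using T h by (auto simp: t_def algebra_simps add_pos_nonneg)
   define P where "P k = {x. t k < u x \<and> u x < t k + h}" for k
   have [measurable]: "P k \<in> sets borel" for k unfolding P_def by measurable
   define E where "E k = (LBINT x. indicator (P k) x * norm (v x) ^ ?d)" for k
   have iE: "integrable lborel (\<lambda>x. indicator (P k) x * norm (v x) ^ ?d)" for k
    by (rule integrable_dominated[OF U(3)]) (auto simp: indicator_def)
   have E0: "E k \<ge> 0" for k unfolding E_def by (intro integral_nonneg_AE) auto
   have ind: "(\<Sum>k<m. indicator (P k) x) \<le> (indicator {x. T < u x \<and> u x < t m} x :: real)" for m x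
   proof (induction m)
    case (Suc m)
    have "(indicator {x. T < u x \<and> u x < t m} x :: real) + indicator (P m) x \<le> indicator {x. T < u x \<and> u x < t (Suc m)} x"
    proof -
     have "0 \<le> real m * h" using h by simp
     hence "T \<le> t m" by (simp add: t_def)
     thus ?thesis using t(2)[of m] h by (auto simp: indicator_def P_def)
    qed
    thus ?case using Suc by simp
   qed simp
   have "(\<Sum>k<n. E k) = (LBINT x. (\<Sum>k<n. indicator (P k) x * norm (v x) ^ ?d))"
    unfolding E_def by (rule Bochner_Integration.integral_sum[symmetric]) (rule iE)
   also have "... \<le> (LBINT x. indicator {x. T < u x} x * norm (v x) ^ ?d)"
   proof (rule integral_mono)
    show "integrable lborel (\<lambda>x. \<Sum>k<n. indicator (P k) x * norm (v x) ^ ?d)"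
     by (rule Bochner_Integration.integrable_sum) (rule iE)
    show "integrable lborel (\<lambda>x. indicator {x. T < u x} x * norm (v x) ^ ?d)"
     by (rule integrable_dominated[OF U(3)]) (auto simp: indicator_def)
    fix x
    have "(\<Sum>k<n. indicator (P k) x) \<le> (indicator {x. T < u x} x :: real)"
     by (rule order.trans[OF ind]) (auto simp: indicator_def)
    thus "(\<Sum>k<n. indicator (P k) x * norm (v x) ^ ?d) \<le> indicator {x. T < u x} x * norm (v x) ^ ?d"
     unfolding sum_distrib_right[symmetric] by (intro mult_right_mono) auto
   qed
   also have "... \<le> \<epsilon>" using * by simp
   finally have sumE: "(\<Sum>k<n. E k) \<le> \<epsilon>" .
   define good where "good k \<longleftrightarrow> E k \<le> \<kappa> * h ^ ?d" for k
   have half: "\<mu> (t (Suc k)) \<le> \<mu> (t k) / 2" if "good k" for k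
    using \<kappa>(2)[OF u t(1)[of k] h] that by (simp add: \<mu>_def t(2) good_def E_def P_def)
   have dec: "\<mu> (t m) \<le> \<mu> T * (1 / 2) ^ card {k. k < m \<and> good k}" for m
   proof (induction m)
    case 0 thus ?case by (simp add: t_def)
   next
    case (Suc m)
    show ?case
    proof (cases "good m")
     case True
     have "{k. k < Suc m \<and> good k} = insert m {k. k < m \<and> good k}" using True by (auto simp: less_Suc_eq)
     hence "card {k. k < Suc m \<and> good k} = Suc (card {k. k < m \<and> good k})" by simp
     thus ?thesis using half[OF True] Suc by simp
    next
     case False
     hence "{k. k < Suc m \<and> good k} = {k. k < m \<and> good k}" by (auto simp: less_Suc_eq)
     moreover have "\<mu> (t (Suc m)) \<le> \<mu> (t m)" using t[of m] h by (intro \<mu>mono) auto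
     ultimately show ?thesis using Suc by simp
    qed
   qed
   define b where "b = card {k. k < n \<and> \<not> good k}"
   define gd where "gd = card {k. k < n \<and> good k}"
   have bg: "b + gd = n"
   proof -
    have "card ({k. k < n \<and> \<not> good k} \<union> {k. k < n \<and> good k}) = b + gd"
     unfolding b_def gd_def by (rule card_Un_disjoint) auto
    moreover have "{k. k < n \<and> \<not> good k} \<union> {k. k < n \<and> good k} = {..<n}" by auto
    ultimately show ?thesis by simp
   qed
   have "real b * (\<kappa> * h ^ ?d) = (\<Sum>k\<in>{k. k < n \<and> \<not> good k}. \<kappa> * h ^ ?d)" by (simp add: b_def)
   also have "... \<le> (\<Sum>k\<in>{k. k < n \<and> \<not> good k}. E k)" by (intro sum_mono) (auto simp: good_def)
   also have "... \<le> (\<Sum>k<n. E k)" using E0 by (intro sum_mono2) auto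
   finally have 1: "real b * (\<kappa> * h ^ ?d) \<le> \<epsilon>" using sumE by linarith
   have hd: "h ^ ?d * (real n * real n ^ (?d - 1)) = s ^ ?d"
   proof -
    have "real n * real n ^ (?d - 1) = real n ^ ?d" using N by (cases ?d) auto
    thus ?thesis using False by (simp add: h_def power_divide)
   qed
   have "real b * (\<kappa> * h ^ ?d) * (2 * real n ^ (?d - 1)) \<le> \<epsilon> * (2 * real n ^ (?d - 1))"
    using 1 by (intro mult_right_mono) auto
   also have "... \<le> \<kappa> * s ^ ?d" using * by (simp add: mult_ac)
   also have "... = real n * (\<kappa> * h ^ ?d * real n ^ (?d - 1))" unfolding hd[symmetric] by (simp add: mult_ac)
   finally have "(2 * real b) * (\<kappa> * h ^ ?d * real n ^ (?d - 1)) \<le> real n * (\<kappa> * h ^ ?d * real n ^ (?d - 1))"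
    by (simp add: mult_ac)
   hence "2 * real b \<le> real n" using \<kappa>(1) h False by (subst (asm) mult_le_cancel_right_pos) auto
   hence "real n / 2 \<le> real gd" using bg by linarith
   hence "2 powr (- real gd) \<le> 2 powr (- real n / 2)" by (intro powr_mono) auto
   moreover have "(1 / 2 :: real) ^ gd = 2 powr (- real gd)"
    by (simp add: powr_minus_divide powr_realpow power_one_over)
   ultimately have "\<mu> T * (1 / 2) ^ gd \<le> \<mu> T * 2 powr (- real n / 2)" using \<mu>0 by (intro mult_left_mono) auto
   moreover have "t n = T + s" using False by (simp add: t_def h_def)
   ultimately show ?thesis using dec[of n] by (simp add: \<mu>_def gd_def)
  qed
 qed (use \<kappa> in auto)
qed

lemma gradient_tail_small:
 fixes u :: "'n::finite sfun"
 assumes u: "sobolev_fun u v" and e: "\<epsilon> > 0"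
 shows "\<exists>T>0. (LBINT x. indicator {x. T < u x} x * norm (v x) ^ CARD('n)) \<le> \<epsilon>"
proof -
 note U = sobolev_funD[OF u]
 note [measurable] = U(4,5)
 have "(\<lambda>k. LBINT x. indicator {x. real (Suc k) < u x} x * norm (v x) ^ CARD('n)) \<longlonglongrightarrow> (LINT x :: real ^ 'n|lborel. 0 :: real)"
 proof (rule integral_dominated_convergence[OF _ _ U(3)])
  show "AE x in lborel. (\<lambda>k. indicator {x. real (Suc k) < u x} x * norm (v x) ^ CARD('n)) \<longlonglongrightarrow> 0"
  proof (rule AE_I2)
   fix x
   obtain m where m: "u x \<le> real m" using real_arch_simple by blast
   have "eventually (\<lambda>k. indicator {x. real (Suc k) < u x} x * norm (v x) ^ CARD('n) = 0) sequentially"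
    unfolding eventually_sequentially by (rule exI[of _ m]) (use m in auto)
   thus "(\<lambda>k. indicator {x. real (Suc k) < u x} x * norm (v x) ^ CARD('n)) \<longlonglongrightarrow> 0"
    by (rule tendsto_eventually)
  qed
 qed (auto simp: indicator_def)
 hence "eventually (\<lambda>k. (LBINT x. indicator {x. real (Suc k) < u x} x * norm (v x) ^ CARD('n)) < \<epsilon>) sequentially"
  using e by (intro order_tendstoD) auto
 then obtain k where "(LBINT x. indicator {x. real (Suc k) < u x} x * norm (v x) ^ CARD('n)) < \<epsilon>"
  by (auto dest!: eventually_happens)
 thus ?thesis by (intro exI[of _ "real (Suc k)"]) auto
qed

text \<open>The rate \<open>\<Lambda>\<close> is arbitrary because the gradient energy above level \<open>T\<close> tends to zero.\<close>

lemma superlevel_decay: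
 fixes u :: "'n::finite sfun"
 assumes N: "CARD('n) \<ge> 2" and u: "sobolev_fun u v" and L: "\<Lambda> > 0"
 shows "\<exists>T>0. \<forall>s>0. measure lborel {x. T + s \<le> u x} \<le>
  measure lborel {x. T \<le> u x} * (2 * 2 powr (- (\<Lambda> * s powr (real CARD('n) / (real CARD('n) - 1)) / 2)))"
proof -
 let ?d = "CARD('n)" let ?p = "real ?d / (real ?d - 1)"
 obtain \<kappa> where \<kappa>: "\<kappa> > 0" "\<And>(u :: real ^ 'n => real) v T s \<epsilon> n. sobolev_fun u v ==> 0 < T ==> 0 < s ==>
   (LBINT x. indicator {x. T < u x} x * norm (v x) ^ CARD('n)) \<le> \<epsilon> ==>
   2 * \<epsilon> * real n ^ (CARD('n) - 1) \<le> \<kappa> * s ^ CARD('n) ==>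
   measure lborel {x. T + s \<le> u x} \<le> measure lborel {x. T \<le> u x} * 2 powr (- real n / 2)"
  using superlevel_decay_steps[OF N] by blast
 define \<epsilon> where "\<epsilon> = \<kappa> / (2 * \<Lambda> ^ (?d - 1))"
 have \<epsilon>: "\<epsilon> > 0" using \<kappa> L by (simp add: \<epsilon>_def)
 obtain T where T: "T > 0" "(LBINT x. indicator {x. T < u x} x * norm (v x) ^ CARD('n)) \<le> \<epsilon>"
  using gradient_tail_small[OF u \<epsilon>] by blast
 show ?thesis
 proof (intro exI[of _ T] conjI allI impI)
  fix s :: real assume s: "s > 0"
  \<comment> \<open>With this number of steps the energy condition reduces to the choice of \<open>\<epsilon>\<close>.\<close>
  define n where "n = nat \<lfloor>\<Lambda> * s powr ?p\<rfloor>"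
  have n0: "0 \<le> \<Lambda> * s powr ?p" using L by simp
  have n1: "real n \<le> \<Lambda> * s powr ?p" "\<Lambda> * s powr ?p - 1 \<le> real n" using n0 unfolding n_def by linarith+
  have "real n ^ (?d - 1) \<le> (\<Lambda> * s powr ?p) ^ (?d - 1)" using n1 by (intro power_mono) auto
  also have "... = \<Lambda> ^ (?d - 1) * s ^ ?d"
  proof -
   have "(s powr ?p) ^ (?d - 1) = s powr (real (?d - 1) * ?p)" using s by (simp add: powr_power)
   also have "real (?d - 1) * ?p = real ?d" using N by (simp add: of_nat_diff)
   finally show ?thesis using s by (simp add: power_mult_distrib powr_realpow)
  qed
  finally have "2 * \<epsilon> * real n ^ (?d - 1) \<le> 2 * \<epsilon> * (\<Lambda> ^ (?d - 1) * s ^ ?d)"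
   using \<epsilon> by (intro mult_left_mono) auto
  also have "... = \<kappa> * s ^ ?d" using L by (simp add: \<epsilon>_def)
  finally have "measure lborel {x. T + s \<le> u x} \<le> measure lborel {x. T \<le> u x} * 2 powr (- real n / 2)"
   by (intro \<kappa>(2)[OF u T(1) s T(2)])
  also have "... \<le> measure lborel {x. T \<le> u x} * (2 * 2 powr (- (\<Lambda> * s powr ?p / 2)))"
  proof (intro mult_left_mono)
   have "2 powr (- real n / 2) \<le> 2 powr (1 + - (\<Lambda> * s powr ?p / 2))" using n1 by (intro powr_mono) auto
   thus "2 powr (- real n / 2) \<le> 2 * 2 powr (- (\<Lambda> * s powr ?p / 2))" by (simp only: powr_add powr_one_gt_zero_iff) simp
  qed simp
  finally show "measure lborel {x. T + s \<le> u x} \<le> measure lborel {x. T \<le> u x} * (2 * 2 powr (- (\<Lambda> * s powr ?p / 2)))" .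
 qed fact
qed

text \<open>Summation over unit steps of the levels, with \<open>\<Lambda>\<close> so large that the decay of the superlevel sets
 beats the growth of the exponential.\<close>

lemma exp_integrable_superlevel:
 fixes u :: "'n::finite sfun"
 assumes N: "CARD('n) \<ge> 2" and u: "sobolev_fun u v" and a: "a > 0"
 shows "\<exists>T>0. (NNINT x. ennreal (indicator {x. T \<le> u x} x * exp (a * \<bar>u x\<bar> powr (real CARD('n) / (real CARD('n) - 1))))) < \<infinity>"
proof -
 let ?d = "CARD('n)" let ?p = "real ?d / (real ?d - 1)"
 have p: "?p \<ge> 1" using N by (simp add: field_simps)
 note U = sobolev_funD[OF u]
 note [measurable] = U(4,5)
 \<comment> \<open>Makes \<open>2 powr (- \<Lambda> s / 2) = exp (- (a 2 powr p + 1) s)\<close>; the factor \<open>2 powr p\<close> pays for \<open>|u| \<le> 2 (u - T)\<close>.\<close>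
 define \<Lambda> where "\<Lambda> = 2 * (a * 2 powr ?p + 1) / ln 2"
 have L: "\<Lambda> > 0" using a by (auto simp: \<Lambda>_def intro!: divide_pos_pos add_pos_pos)
 obtain T where T: "T > 0" "\<And>s. s > 0 ==> measure lborel {x. T + s \<le> u x} \<le>
  measure lborel {x. T \<le> u x} * (2 * 2 powr (- (\<Lambda> * s powr ?p / 2)))"
  using superlevel_decay[OF N u L] by blast
 define m where "m = measure lborel {x. T \<le> u x}"
 have m: "m \<ge> 0" by (simp add: m_def)
 obtain J :: nat where J: "T + 1 \<le> real J" using real_arch_simple by blast
 let ?f = "\<lambda>x. indicator {x. T + real J \<le> u x} x * exp (a * \<bar>u x\<bar> powr ?p)"
 let ?c = "\<lambda>j. exp (a * (2 * real (j + J)) powr ?p)"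
 have pt: "ennreal (?f x) \<le> (\<Sum>j. ennreal (?c j) * indicator {x. T + real (j + J) \<le> u x} x)" for x
 proof (cases "T + real J \<le> u x")
  case True
  define k where "k = nat \<lfloor>u x - T\<rfloor>"
  have k: "real k \<le> u x - T" "u x - T < real k + 1" using True unfolding k_def by linarith+
  have kJ: "J \<le> k" using True unfolding k_def by linarith
  define j where "j = k - J"
  have j: "j + J = k" using kJ by (simp add: j_def)
  have "\<bar>u x\<bar> \<le> 2 * real k" using k J kJ T by linarith
  hence "\<bar>u x\<bar> powr ?p \<le> (2 * real k) powr ?p" using p by (intro powr_mono2) auto
  hence "?f x \<le> ?c j * indicator {x. T + real (j + J) \<le> u x} x" unfolding j using a k True by simp
  hence "ennreal (?f x) \<le> ennreal (?c j * indicator {x. T + real (j + J) \<le> u x} x)" by (rule ennreal_leI)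
  also have "... = ennreal (?c j) * indicator {x. T + real (j + J) \<le> u x} x" by (auto simp: indicator_def)
  also have "... \<le> (\<Sum>j. ennreal (?c j) * indicator {x. T + real (j + J) \<le> u x} x)"
  proof -
   define f where "f = (\<lambda>j. ennreal (?c j) * indicator {x. T + real (j + J) \<le> u x} x)"
   have "sum f {j} \<le> suminf f" by (rule sum_le_suminf) auto
   hence "f j \<le> suminf f" by simp
   thus ?thesis by (simp only: f_def)
  qed
  finally show ?thesis .
 qed simp
 have shell: "(NNINT x. ennreal (?c j) * indicator {x. T + real (j + J) \<le> u x} x) \<le> ennreal (2 * m * exp (- 1) ^ j)" for j
 proof -
  define k where "k = j + J"
  have k: "real k > 0" "real k \<ge> 1" using J T by (auto simp: k_def)
  have fin: "emeasure lborel {x. T + real k \<le> u x} < \<infinity>" using T k by (intro superlevel_finite[OF U(2)]) auto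
  have "(NNINT x. ennreal (?c j) * indicator {x. T + real (j + J) \<le> u x} x) = ennreal (?c j) * emeasure lborel {x. T + real k \<le> u x}"
   unfolding k_def by (rule nn_integral_cmult_indicator) simp
  also have "... = ennreal (?c j * measure lborel {x. T + real k \<le> u x})"
   using fin by (simp add: emeasure_eq_ennreal_measure ennreal_mult less_top)
  also have "... \<le> ennreal (2 * m * exp (- 1) ^ j)"
  proof (rule ennreal_leI)
   have "?c j * measure lborel {x. T + real k \<le> u x} \<le> ?c j * (m * (2 * 2 powr (- (\<Lambda> * real k powr ?p / 2))))"
    using T(2)[OF k(1)] by (intro mult_left_mono) (auto simp: m_def)
   also have "... = 2 * m * (exp (a * (2 * real k) powr ?p) * 2 powr (- (\<Lambda> * real k powr ?p / 2)))"
    by (simp add: k_def)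
   also have "exp (a * (2 * real k) powr ?p) * 2 powr (- (\<Lambda> * real k powr ?p / 2)) = exp (- (real k powr ?p))"
   proof -
    have "(2 * real k) powr ?p = 2 powr ?p * real k powr ?p" by (simp add: powr_mult)
    moreover have "2 powr (- (\<Lambda> * real k powr ?p / 2)) = exp (- ((a * 2 powr ?p + 1) * real k powr ?p))"
     by (simp add: powr_def \<Lambda>_def)
    ultimately show ?thesis by (simp add: algebra_simps flip: exp_add)
   qed
   also have "exp (- (real k powr ?p)) \<le> exp (- 1) ^ j"
   proof -
    have "real k powr 1 \<le> real k powr ?p" using k p by (intro powr_mono) auto
    hence "real j \<le> real k powr ?p" using k by (simp add: k_def)
    thus ?thesis by (simp flip: exp_of_nat_mult)
   qed
   finally show "?c j * measure lborel {x. T + real k \<le> u x} \<le> 2 * m * exp (- 1) ^ j"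
    using m by (simp add: mult_left_mono)
  qed
  finally show ?thesis .
 qed
 have "(NNINT x. ennreal (?f x)) \<le> (NNINT x. (\<Sum>j. ennreal (?c j) * indicator {x. T + real (j + J) \<le> u x} x))"
  by (intro nn_integral_mono pt)
 also have "... = (\<Sum>j. \<integral>\<^sup>+x. ennreal (?c j) * indicator {x. T + real (j + J) \<le> u x} x \<partial>lborel)"
  by (rule nn_integral_suminf) measurable
 also have "... \<le> (\<Sum>j. ennreal (2 * m * exp (- 1) ^ j))"
  by (intro suminf_le shell) auto
 also have "... = ennreal (\<Sum>j. 2 * m * exp (- 1) ^ j)"
  using m by (intro suminf_ennreal2) (auto intro!: summable_mult summable_geometric)
 also have "... < \<infinity>" by simp
 finally have "(NNINT x. ennreal (?f x)) < \<infinity>" .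
 thus ?thesis using T by (intro exI[of _ "T + real J"]) auto
qed

lemma sobolev_fun_minus:
 fixes u :: "'n::finite sfun"
 assumes "sobolev_fun u v" shows "sobolev_fun (\<lambda>x. - u x) (\<lambda>x. - v x)"
proof -
 have "wgrad (\<lambda>x. (\<lambda>t. - t) (u x)) (\<lambda>x. (\<lambda>t. - 1) (u x) *\<^sub>R v x)"
  by (rule wgrad_chain[OF sobolev_funD(1)[OF assms], where M = 1]) (auto intro!: derivative_eq_intros)
 thus ?thesis using sobolev_funD(2,3)[OF assms] by (simp add: sobolev_fun_def)
qed

text \<open>Far above \<open>\<tau>\<close> the previous estimate applies to \<open>u\<close> and \<open>- u\<close>; in between, the exponential is bounded on a
 set of finite measure.\<close>

theorem trudinger:
 fixes u :: "'n::finite sfun"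
 assumes N: "CARD('n) \<ge> 2" and u: "sobolev_fun u v" and a: "a > 0" and \<tau>: "\<tau> > 0"
 shows "integrable lborel (\<lambda>x. indicator {x. \<tau> < \<bar>u x\<bar>} x * exp (a * \<bar>u x\<bar> powr (real CARD('n) / (real CARD('n) - 1))))"
proof -
 let ?d = "CARD('n)" let ?p = "real ?d / (real ?d - 1)" let ?e = "\<lambda>x. exp (a * \<bar>u x\<bar> powr ?p)"
 have p: "?p \<ge> 0" using N by (simp add: field_simps)
 note U = sobolev_funD[OF u]
 note [measurable] = U(4,5)
 obtain T1 where T1: "T1 > 0" "(NNINT x. ennreal (indicator {x. T1 \<le> u x} x * ?e x)) < \<infinity>"
  using exp_integrable_superlevel[OF N u a] by blast
 obtain T2 where T2: "T2 > 0" "(NNINT x. ennreal (indicator {x. T2 \<le> - u x} x * ?e x)) < \<infinity>"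
  using exp_integrable_superlevel[OF N sobolev_fun_minus[OF u] a] by auto
 define T where "T = max T1 T2"
 let ?K = "exp (a * T powr ?p) / \<tau> ^ ?d"
 show ?thesis
 proof (rule integrable_dominated)
  have i: "integrable lborel (\<lambda>x. indicator {x. T1 \<le> u x} x * ?e x)" "integrable lborel (\<lambda>x. indicator {x. T2 \<le> - u x} x * ?e x)"
   using T1 T2 by (auto intro!: integrableI_nonneg)
  show "integrable lborel (\<lambda>x. ?K * \<bar>u x\<bar> ^ ?d + indicator {x. T1 \<le> u x} x * ?e x + indicator {x. T2 \<le> - u x} x * ?e x)"
   by (intro integrable_plus integrable_mult_right U i)
  show "AE x in lborel. norm (indicator {x. \<tau> < \<bar>u x\<bar>} x * ?e x) \<le> norm (?K * \<bar>u x\<bar> ^ ?d + indicator {x. T1 \<le> u x} x * ?e x + indicator {x. T2 \<le> - u x} x * ?e x)"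
  proof (rule AE_I2)
   fix x
   have K: "0 \<le> ?K * \<bar>u x\<bar> ^ ?d" using \<tau> by simp
   have I: "0 \<le> indicator {x. T1 \<le> u x} x * ?e x" "0 \<le> indicator {x. T2 \<le> - u x} x * ?e x" by auto
   have "indicator {x. \<tau> < \<bar>u x\<bar>} x * ?e x \<le> ?K * \<bar>u x\<bar> ^ ?d + indicator {x. T1 \<le> u x} x * ?e x + indicator {x. T2 \<le> - u x} x * ?e x"
   proof (cases "T1 \<le> u x \<or> T2 \<le> - u x")
    case True
    thus ?thesis using K I by (auto simp: indicator_def)
   next
    case False
    show ?thesis
    proof (cases "\<tau> < \<bar>u x\<bar>")
     case True
     have "\<bar>u x\<bar> powr ?p \<le> T powr ?p" using False p by (intro powr_mono2) (auto simp: T_def)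
     hence e: "?e x \<le> exp (a * T powr ?p)" using a by simp
     have "\<tau> ^ ?d \<le> \<bar>u x\<bar> ^ ?d" using True \<tau> by (intro power_mono) auto
     hence "1 \<le> \<bar>u x\<bar> ^ ?d / \<tau> ^ ?d" using \<tau> by simp
     from mult_mono[OF e this] have "?e x \<le> ?K * \<bar>u x\<bar> ^ ?d" by simp
     moreover have "indicator {x. \<tau> < \<bar>u x\<bar>} x * ?e x = ?e x" using True by simp
     ultimately show ?thesis using I by linarith
    qed (use K I in \<open>simp add: indicator_def\<close>)
   qed
   thus "norm (indicator {x. \<tau> < \<bar>u x\<bar>} x * ?e x) \<le> norm (?K * \<bar>u x\<bar> ^ ?d + indicator {x. T1 \<le> u x} x * ?e x + indicator {x. T2 \<le> - u x} x * ?e x)"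
    using K I by simp
  qed
 qed simp
qed

section \<open>The logarithmic energy\<close>

abbreviation ln_near :: "'n::finite sfun" where "ln_near z \<equiv> ln_plus (1 / norm z)"
abbreviation ln_far :: "'n::finite sfun" where "ln_far z \<equiv> ln_plus (norm z)"

text \<open>Unlike \<open>ln_far (x - y)\<close> it depends on one point only; two such weights bound \<open>ln_far\<close>, which makes the double
 integrals of the far part products of single ones.\<close>

definition ln_weight :: "'n::finite sfun" where "ln_weight x = ln (1 + norm x)"

lemma ln_plus_nonneg: "0 \<le> ln_plus t"
 by (simp add: ln_plus_def)

lemma ln_plus_measurable [measurable]: "ln_plus \<in> Borel"
 unfolding ln_plus_def[abs_def] by measurable

lemma log_kernel_measurable [measurable]: "log_kernel \<in> Borel"
 unfolding log_kernel_def[abs_def] by measurable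

lemma ln_weight_measurable [measurable]: "ln_weight \<in> Borel"
 unfolding ln_weight_def[abs_def] by measurable

lemma ln_weight_nonneg: "0 \<le> ln_weight x"
 by (simp add: ln_weight_def)

lemma log_kernel_split: "log_kernel z = ln_near z - ln_far z"
 by (cases "z = 0") (auto simp: log_kernel_def ln_plus_def ln_div max_def)

lemma log_kernel_abs: "\<bar>log_kernel z\<bar> = ln_near z + ln_far z"
 by (cases "z = 0") (auto simp: log_kernel_def ln_plus_def ln_div max_def)

lemma log_kernel_minus: "log_kernel (x - y) = log_kernel (y - x)"
 by (simp add: log_kernel_def norm_minus_commute)

lemma ln_far_le_weight: "ln_far (x - y) \<le> ln_weight x + ln_weight y"
proof -
 have "0 \<le> norm x * norm y" by simp
 moreover have "(1 + norm x) * (1 + norm y) = 1 + norm x + norm y + norm x * norm y" by (simp add: algebra_simps)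
 ultimately have "norm (x - y) \<le> (1 + norm x) * (1 + norm y)" using norm_triangle_ineq4[of x y] by linarith
 hence "ln (norm (x - y)) \<le> ln ((1 + norm x) * (1 + norm y))" if "x \<noteq> y"
  using that by (intro ln_mono) auto
 moreover have "ln ((1 + norm x) * (1 + norm y)) = ln_weight x + ln_weight y"
  unfolding ln_weight_def by (rule ln_mult_pos) (auto intro: add_pos_nonneg)
 ultimately show ?thesis using ln_weight_nonneg[of x] ln_weight_nonneg[of y]
  by (cases "x = y") (auto simp: ln_plus_def)
qed

lemma ln_weight_le_far: "ln_weight y \<le> ln_weight x + ln 2 + ln_far (x - y)"
proof -
 let ?r = "norm (x - y)"
 have "0 \<le> norm x * ?r" by simp
 moreover have "(1 + norm x) * (1 + ?r) = 1 + norm x + ?r + norm x * ?r" by (simp add: algebra_simps)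
 moreover have "norm y \<le> norm x + ?r" using norm_triangle_ineq3[of y x] by (simp add: norm_minus_commute)
 ultimately have "1 + norm y \<le> (1 + norm x) * (1 + ?r)" by linarith
 hence "ln (1 + norm y) \<le> ln ((1 + norm x) * (1 + ?r))" by (intro ln_mono) (auto intro: add_pos_nonneg)
 also have "... = ln (1 + norm x) + ln (1 + ?r)" by (rule ln_mult_pos) (auto intro: add_pos_nonneg)
 also have "ln (1 + ?r) \<le> ln 2 + ln_plus ?r"
 proof (cases "?r \<le> 1")
  case True
  have "ln (1 + ?r) \<le> ln 2" using True by (intro ln_mono) (auto intro: add_pos_nonneg)
  thus ?thesis using ln_plus_nonneg[of ?r] by linarith
 next
  case False
  have "ln (1 + ?r) \<le> ln (2 * ?r)" using False by (intro ln_mono) auto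
  also have "... = ln 2 + ln ?r" using False by (intro ln_mult_pos) auto
  finally show ?thesis by (simp add: ln_plus_def)
 qed
 finally show ?thesis by (simp add: ln_weight_def)
qed

lemma ln_near_le_powr:
 "ln_near z \<le> 2 * norm z powr (- (1 / 2))" "ln_near z = 0 \<or> (z \<noteq> 0 \<and> norm z < 1)"
proof -
 show "ln_near z = 0 \<or> (z \<noteq> 0 \<and> norm z < 1)"
  by (cases "z = 0") (auto simp: ln_plus_def max_def ln_div not_less intro: ln_ge_zero)
 show "ln_near z \<le> 2 * norm z powr (- (1 / 2))"
 proof (cases "z = 0 \<or> norm z \<ge> 1")
  case True
  hence "ln_near z = 0" by (auto simp: ln_plus_def ln_div)
  thus ?thesis by simp
 next
  case False
  hence "ln (1 / norm z) \<le> (1 / norm z) powr (1 / 2) / (1 / 2)" by (intro ln_powr_bound) auto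
  also have "... = 2 * norm z powr (- (1 / 2))" using False by (simp add: powr_divide powr_minus_divide)
  finally show ?thesis by (simp add: ln_plus_def)
 qed
qed

lemma ln_near_integrals:
 assumes N: "CARD('n::finite) \<ge> 2"
 shows "(NNINT z. ennreal (ln_near (z :: real ^ 'n))) < \<infinity>"
  "(NNINT z. ennreal ((ln_near (z :: real ^ 'n))\<^sup>2)) < \<infinity>"
proof -
 have *: "(\<integral>\<^sup>+z\<in>ball 0 1. ennreal (norm (z :: real ^ 'n) powr (- s)) \<partial>lborel) < \<infinity>" if s: "0 \<le> s" "s \<le> 1" for s
 proof -
  have "s < real CARD('n)" using N s by linarith
  then obtain C where C: "\<forall>\<rho>>0. (\<integral>\<^sup>+z\<in>ball 0 \<rho>. ennreal (norm (z :: real ^ 'n) powr (- s)) \<partial>lborel) \<le> ennreal (C * \<rho> powr (real CARD('n) - s))"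
   using nn_integral_norm_powr_ball[OF s(1), where 'n = 'n] by blast
  have "(\<integral>\<^sup>+z\<in>ball 0 1. ennreal (norm (z :: real ^ 'n) powr (- s)) \<partial>lborel) \<le> ennreal (C * 1 powr (real CARD('n) - s))"
   using C by (rule allE[of _ 1]) simp
  also have "... < \<infinity>" by simp
  finally show ?thesis .
 qed
 have "(NNINT z. ennreal (ln_near (z :: real ^ 'n))) \<le> (NNINT z. 2 * (ennreal (norm (z :: real ^ 'n) powr (- (1/2))) * indicator (ball 0 1) z))"
 proof (rule nn_integral_mono)
  fix z :: "real ^ 'n"
  show "ennreal (ln_near z) \<le> 2 * (ennreal (norm z powr (- (1/2))) * indicator (ball 0 1) z)"
  proof (cases "ln_near z = 0")
   case False
   hence "norm z < 1" using ln_near_le_powr(2)[of z] by simp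
   moreover have "ennreal (ln_near z) \<le> ennreal (2 * norm z powr (- (1/2)))" by (intro ennreal_leI ln_near_le_powr)
   ultimately show ?thesis by (simp add: ennreal_mult)
  qed simp
 qed
 also have "... = 2 * (\<integral>\<^sup>+z\<in>ball 0 1. ennreal (norm (z :: real ^ 'n) powr (- (1/2))) \<partial>lborel)"
  by (rule nn_integral_cmult) simp
 also have "... < \<infinity>" using *[of "1/2"] by (simp add: ennreal_mult_less_top)
 finally show "(NNINT z. ennreal (ln_near (z :: real ^ 'n))) < \<infinity>" .
 have "(NNINT z. ennreal ((ln_near (z :: real ^ 'n))\<^sup>2)) \<le> (NNINT z. 4 * (ennreal (norm (z :: real ^ 'n) powr (- 1)) * indicator (ball 0 1) z))"
 proof (rule nn_integral_mono)
  fix z :: "real ^ 'n"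
  show "ennreal ((ln_near z)\<^sup>2) \<le> 4 * (ennreal (norm z powr (- 1)) * indicator (ball 0 1) z)"
  proof (cases "ln_near z = 0")
   case False
   hence z: "norm z < 1" "z \<noteq> 0" using ln_near_le_powr(2)[of z] by simp_all
   have "(ln_near z)\<^sup>2 \<le> (2 * norm z powr (- (1/2)))\<^sup>2" by (intro power_mono ln_near_le_powr ln_plus_nonneg)
   also have "... = 4 * norm z powr (- 1)" by (simp add: power_mult_distrib power2_eq_square flip: powr_add)
   finally have "ennreal ((ln_near z)\<^sup>2) \<le> ennreal (4 * norm z powr (- 1))" by (rule ennreal_leI)
   also have "... = 4 * ennreal (norm z powr (- 1))" by (subst ennreal_mult) auto
   finally show ?thesis using z by simp
  qed simp
 qed
 also have "... = 4 * (\<integral>\<^sup>+z\<in>ball 0 1. ennreal (norm (z :: real ^ 'n) powr (- 1)) \<partial>lborel)"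
  by (rule nn_integral_cmult) simp
 also have "... < \<infinity>" using *[of 1] by (simp add: ennreal_mult_less_top)
 finally show "(NNINT z. ennreal ((ln_near (z :: real ^ 'n))\<^sup>2)) < \<infinity>" .
qed

text \<open>A class on which the logarithmic energy is a finite bilinear form: the square controls the near
 part of the kernel, the logarithmic weight the far part.\<close>

definition log_class :: "(real ^ 'n::finite => real) => bool" where
 "log_class F \<longleftrightarrow> integrable lborel F \<and> integrable lborel (\<lambda>x. (F x)\<^sup>2) \<and> integrable lborel (\<lambda>x. ln_weight x * F x)"

lemma log_classD:
 fixes F :: "'n::finite sfun"
 assumes "log_class F"
 shows "integrable lborel F" "integrable lborel (\<lambda>x. (F x)\<^sup>2)" "integrable lborel (\<lambda>x. ln_weight x * F x)"
  "F \<in> Borel"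
 using assms borel_measurable_integrable[of lborel F] by (auto simp: log_class_def)

lemma log_class_bound:
 assumes F: "log_class F" and [measurable]: "H \<in> Borel" and b: "\<And>x. \<bar>H x\<bar> \<le> \<bar>F x\<bar>"
 shows "log_class H"
 unfolding log_class_def
proof (intro conjI)
 show "integrable lborel H"
  by (rule integrable_dominated[OF log_classD(1)[OF F]]) (use b in auto)
 show "integrable lborel (\<lambda>x. (H x)\<^sup>2)"
  by (rule integrable_dominated[OF log_classD(2)[OF F]]) (use b in \<open>auto simp: abs_le_square_iff\<close>)
 show "integrable lborel (\<lambda>x. ln_weight x * H x)"
  by (rule integrable_dominated[OF log_classD(3)[OF F]])
    (use b ln_weight_nonneg in \<open>auto simp: abs_mult intro!: mult_left_mono\<close>)
qed

lemma log_class_add: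
 fixes F H :: "'n::finite sfun"
 assumes F: "log_class F" and H: "log_class H"
 shows "log_class (\<lambda>x. F x + H x)"
 unfolding log_class_def
proof (intro conjI)
 note f = log_classD[OF F] and h = log_classD[OF H]
 have [measurable]: "F \<in> Borel" "H \<in> Borel" using f h by auto
 show "integrable lborel (\<lambda>x. F x + H x)" using f h by simp
 show "integrable lborel (\<lambda>x. (F x + H x)\<^sup>2)"
 proof (rule integrable_dominated)
  show "integrable lborel (\<lambda>x. 2 * (F x)\<^sup>2 + 2 * (H x)\<^sup>2)" using f h by simp
  show "AE x in lborel. norm ((F x + H x)\<^sup>2) \<le> norm (2 * (F x)\<^sup>2 + 2 * (H x)\<^sup>2)"
  proof (rule AE_I2)
   fix x
   have "0 \<le> (F x - H x)\<^sup>2" by simp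
   hence "(F x + H x)\<^sup>2 \<le> 2 * (F x)\<^sup>2 + 2 * (H x)\<^sup>2" by (simp add: power2_sum power2_diff)
   thus "norm ((F x + H x)\<^sup>2) \<le> norm (2 * (F x)\<^sup>2 + 2 * (H x)\<^sup>2)" by simp
  qed
 qed simp
 show "integrable lborel (\<lambda>x. ln_weight x * (F x + H x))"
  using f h by (simp add: distrib_left)
qed

text \<open>The squares of \<open>F\<close> and \<open>H\<close> dominate their product, and \<open>ln_near\<close> is integrable.\<close>

lemma near_integrable2:
 fixes F H :: "'n::finite sfun"
 assumes N: "CARD('n) \<ge> 2" and F: "log_class F" and H: "log_class H"
 shows "integrable (lborel \<Otimes>\<^sub>M lborel) (\<lambda>(x, y). ln_near (x - y) * (F x * H y))"
proof (rule integrableI_bounded)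
 note f = log_classD[OF F] and h = log_classD[OF H]
 have [measurable]: "F \<in> Borel" "H \<in> Borel" using f h by auto
 show "(\<lambda>(x, y). ln_near (x - y) * (F x * H y)) \<in> borel_measurable (lborel \<Otimes>\<^sub>M lborel)" by measurable
 let ?I = "(NNINT z. ennreal (ln_near (z :: real ^ 'n)))"
 have I: "?I < \<infinity>" by (rule ln_near_integrals[OF N])
 have r: "(NNINT y. ennreal (ln_near (x - y))) = ?I" for x :: "real ^ 'n"
  by (rule nn_integral_lborel_reflect[of "\<lambda>z. ennreal (ln_near z)"]) simp
 have r': "(NNINT x. ennreal (ln_near (x - y))) = ?I" for y :: "real ^ 'n"
  using r[of y] by (simp add: norm_minus_commute)
 have "(\<integral>\<^sup>+ p. ennreal (norm (case p of (x, y) => ln_near (x - y) * (F x * H y))) \<partial>(lborel \<Otimes>\<^sub>M lborel))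
   = (NNINT x. (NNINT y. ennreal (norm (ln_near (x - y) * (F x * H y)))))"
  by (subst lborel.nn_integral_fst[symmetric]) auto
 also have "... \<le> (NNINT x. (NNINT y. ennreal ((F x)\<^sup>2) * ennreal (ln_near (x - y)) + ennreal (ln_near (x - y)) * ennreal ((H y)\<^sup>2)))"
 proof (intro nn_integral_mono)
  fix x y
  have "2 * \<bar>F x\<bar> * \<bar>H y\<bar> \<le> \<bar>F x\<bar>\<^sup>2 + \<bar>H y\<bar>\<^sup>2" by (rule sum_squares_bound)
  moreover have "0 \<le> \<bar>F x\<bar> * \<bar>H y\<bar>" by simp
  ultimately have "\<bar>F x\<bar> * \<bar>H y\<bar> \<le> \<bar>F x\<bar>\<^sup>2 + \<bar>H y\<bar>\<^sup>2" by linarith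
  hence "\<bar>F x * H y\<bar> \<le> (F x)\<^sup>2 + (H y)\<^sup>2" by (simp add: abs_mult)
  from mult_left_mono[OF this ln_plus_nonneg[of "1 / norm (x - y)"]]
  have "norm (ln_near (x - y) * (F x * H y)) \<le> (F x)\<^sup>2 * ln_near (x - y) + ln_near (x - y) * (H y)\<^sup>2"
   using ln_plus_nonneg[of "1 / norm (x - y)"] by (simp add: abs_mult algebra_simps)
  thus "ennreal (norm (ln_near (x - y) * (F x * H y))) \<le> ennreal ((F x)\<^sup>2) * ennreal (ln_near (x - y)) + ennreal (ln_near (x - y)) * ennreal ((H y)\<^sup>2)"
   by (simp add: ln_plus_nonneg ennreal_leI flip: ennreal_mult ennreal_plus)
 qed
 also have "... = (NNINT x. (NNINT y. ennreal ((F x)\<^sup>2) * ennreal (ln_near (x - y))) + (NNINT y. ennreal (ln_near (x - y)) * ennreal ((H y)\<^sup>2)))"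
  by (intro nn_integral_cong nn_integral_add) auto
 also have "... = (NNINT x. (NNINT y. ennreal ((F x)\<^sup>2) * ennreal (ln_near (x - y)))) + (NNINT x. (NNINT y. ennreal (ln_near (x - y)) * ennreal ((H y)\<^sup>2)))"
  by (rule nn_integral_add) auto
 also have "(NNINT x. (NNINT y. ennreal ((F x)\<^sup>2) * ennreal (ln_near (x - y)))) = (NNINT x. ennreal ((F x)\<^sup>2) * ?I)"
  by (intro nn_integral_cong) (simp add: nn_integral_cmult r)
 also have "... = (NNINT x. ennreal ((F x)\<^sup>2)) * ?I" by (rule nn_integral_multc) simp
 also have "(NNINT x. (NNINT y. ennreal (ln_near (x - y)) * ennreal ((H y)\<^sup>2))) = (NNINT y. (NNINT x. ennreal (ln_near (x - y)) * ennreal ((H y)\<^sup>2)))"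
  by (rule lborel_pair.Fubini') measurable
 also have "... = (NNINT y. ?I * ennreal ((H y)\<^sup>2))"
  by (intro nn_integral_cong) (simp add: nn_integral_multc r')
 also have "... = ?I * (NNINT y. ennreal ((H y)\<^sup>2))" by (rule nn_integral_cmult) simp
 also have "(NNINT x. ennreal ((F x)\<^sup>2)) * ?I + ?I * (NNINT y. ennreal ((H y)\<^sup>2)) < \<infinity>"
  using I f(2) h(2) by (auto simp: integrable_iff_bounded ennreal_mult_less_top)
 finally show "(\<integral>\<^sup>+ p. ennreal (norm (case p of (x, y) => ln_near (x - y) * (F x * H y))) \<partial>(lborel \<Otimes>\<^sub>M lborel)) < \<infinity>" .
qed

lemma far_integrable2:
 fixes F H :: "'n::finite sfun"
 assumes F: "log_class F" and H: "log_class H"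
 shows "integrable (lborel \<Otimes>\<^sub>M lborel) (\<lambda>(x, y). ln_far (x - y) * (F x * H y))"
proof (rule integrableI_bounded)
 note f = log_classD[OF F] and h = log_classD[OF H]
 have [measurable]: "F \<in> Borel" "H \<in> Borel" using f h by auto
 show "(\<lambda>(x, y). ln_far (x - y) * (F x * H y)) \<in> borel_measurable (lborel \<Otimes>\<^sub>M lborel)" by measurable
 let ?n = "\<lambda>F. \<integral>\<^sup>+x. ennreal \<bar>F x\<bar> \<partial>lborel"
 have "(\<integral>\<^sup>+ p. ennreal (norm (case p of (x, y) => ln_far (x - y) * (F x * H y))) \<partial>(lborel \<Otimes>\<^sub>M lborel))
   = (NNINT x. (NNINT y. ennreal (norm (ln_far (x - y) * (F x * H y)))))"
  by (subst lborel.nn_integral_fst[symmetric]) auto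
 also have "... \<le> (NNINT x. (NNINT y. ennreal \<bar>ln_weight x * F x\<bar> * ennreal \<bar>H y\<bar> + ennreal \<bar>F x\<bar> * ennreal \<bar>ln_weight y * H y\<bar>))"
 proof (intro nn_integral_mono)
  fix x y
  have "ln_far (x - y) * (\<bar>F x\<bar> * \<bar>H y\<bar>) \<le> (ln_weight x + ln_weight y) * (\<bar>F x\<bar> * \<bar>H y\<bar>)"
   by (intro mult_right_mono ln_far_le_weight) auto
  hence "norm (ln_far (x - y) * (F x * H y)) \<le> \<bar>ln_weight x * F x\<bar> * \<bar>H y\<bar> + \<bar>F x\<bar> * \<bar>ln_weight y * H y\<bar>"
   using ln_plus_nonneg[of "norm (x - y)"] ln_weight_nonneg[of x] ln_weight_nonneg[of y] by (simp add: abs_mult algebra_simps)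
  thus "ennreal (norm (ln_far (x - y) * (F x * H y))) \<le> ennreal \<bar>ln_weight x * F x\<bar> * ennreal \<bar>H y\<bar> + ennreal \<bar>F x\<bar> * ennreal \<bar>ln_weight y * H y\<bar>"
   by (simp add: ennreal_leI flip: ennreal_mult ennreal_plus)
 qed
 also have "... = (NNINT x. (NNINT y. ennreal \<bar>ln_weight x * F x\<bar> * ennreal \<bar>H y\<bar>) + (NNINT y. ennreal \<bar>F x\<bar> * ennreal \<bar>ln_weight y * H y\<bar>))"
  by (intro nn_integral_cong nn_integral_add) auto
 also have "... = (NNINT x. ennreal \<bar>ln_weight x * F x\<bar> * ?n H + ennreal \<bar>F x\<bar> * ?n (\<lambda>y. ln_weight y * H y))"
  by (intro nn_integral_cong) (simp add: nn_integral_cmult)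
 also have "... = (NNINT x. ennreal \<bar>ln_weight x * F x\<bar> * ?n H) + (NNINT x. ennreal \<bar>F x\<bar> * ?n (\<lambda>y. ln_weight y * H y))"
  by (rule nn_integral_add) auto
 also have "... = ?n (\<lambda>x. ln_weight x * F x) * ?n H + ?n F * ?n (\<lambda>y. ln_weight y * H y)"
  by (simp add: nn_integral_multc)
 also have "... < \<infinity>"
  using f(1,3) h(1,3) by (auto simp: integrable_iff_bounded ennreal_mult_less_top)
 finally show "(\<integral>\<^sup>+ p. ennreal (norm (case p of (x, y) => ln_far (x - y) * (F x * H y))) \<partial>(lborel \<Otimes>\<^sub>M lborel)) < \<infinity>" .
qed

lemma log_integrable2:
 fixes F H :: "'n::finite sfun"
 assumes "CARD('n) \<ge> 2" "log_class F" "log_class H"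
 shows "integrable (lborel \<Otimes>\<^sub>M lborel) (\<lambda>(x, y). log_kernel (x - y) * (F x * H y))"
proof -
 have "(\<lambda>(x, y). log_kernel (x - y) * (F x * H y)) =
   (\<lambda>p. (case p of (x, y) => ln_near (x - y) * (F x * H y)) - (case p of (x, y) => ln_far (x - y) * (F x * H y)))"
  by (auto simp: fun_eq_iff log_kernel_split left_diff_distrib)
 thus ?thesis
  by (simp only:) (rule Bochner_Integration.integrable_diff[OF near_integrable2[OF assms] far_integrable2[OF assms(2,3)]])
qed

definition log_form :: "(real ^ 'n::finite => real) => (real ^ 'n => real) => real" where
 "log_form F H = (LINT (x, y)|(lborel \<Otimes>\<^sub>M lborel). log_kernel (x - y) * (F x * H y))"

definition log_potential :: "(real ^ 'n::finite => real) => real ^ 'n => real" where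
 "log_potential H x = (LBINT y. log_kernel (x - y) * H y)"

lemma log_potential_measurable [measurable]:
 assumes [measurable]: "H \<in> Borel"
 shows "log_potential H \<in> Borel"
 unfolding log_potential_def[abs_def] by measurable

text \<open>Near \<open>x\<close> use \<open>ln_near * H \<le> ln_near\<^sup>2 + H\<^sup>2\<close>, far from it the weight.\<close>

lemma log_potential_bound:
 fixes H :: "'n::finite sfun"
 assumes N: "CARD('n) \<ge> 2" and H: "log_class H"
 shows "integrable lborel (\<lambda>y. log_kernel (x - y) * H y)"
  "\<exists>C\<ge>0. \<forall>x. (NNINT y. ennreal \<bar>log_kernel (x - y) * H y\<bar>) \<le> ennreal (C * (1 + ln_weight x))"
  "\<exists>C\<ge>0. \<forall>x. \<bar>log_potential H x\<bar> \<le> C * (1 + ln_weight x)"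
proof -
 note h = log_classD[OF H]
 have [measurable]: "H \<in> Borel" using h by auto
 let ?I = "(NNINT z. ennreal ((ln_near (z :: real ^ 'n))\<^sup>2))"
 obtain I where I: "?I = ennreal I" "I \<ge> 0" using ln_near_integrals(2)[OF N] by (cases ?I) auto
 define C where "C = I + (LBINT y. (H y)\<^sup>2) + (LBINT y. \<bar>H y\<bar>) + (LBINT y. \<bar>ln_weight y * H y\<bar>)"
 have C0: "C \<ge> 0" using I by (auto simp: C_def intro!: add_nonneg_nonneg integral_nonneg_AE)
 have bd: "(NNINT y. ennreal \<bar>log_kernel (x - y) * H y\<bar>) \<le> ennreal (C * (1 + ln_weight x))" for x
 proof -
  have "(NNINT y. ennreal \<bar>log_kernel (x - y) * H y\<bar>)
    \<le> (NNINT y. ennreal ((ln_near (x - y))\<^sup>2) + ennreal ((H y)\<^sup>2 + (ln_weight x * \<bar>H y\<bar> + \<bar>ln_weight y * H y\<bar>)))"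
  proof (intro nn_integral_mono)
   fix y
   have "ln_near (x - y) * \<bar>H y\<bar> \<le> (ln_near (x - y))\<^sup>2 + \<bar>H y\<bar>\<^sup>2"
   proof -
    have "0 \<le> ln_near (x - y) * \<bar>H y\<bar>" by (intro mult_nonneg_nonneg ln_plus_nonneg) simp
    thus ?thesis using sum_squares_bound[of "ln_near (x - y)" "\<bar>H y\<bar>"] by linarith
   qed
   moreover have "ln_far (x - y) * \<bar>H y\<bar> \<le> (ln_weight x + ln_weight y) * \<bar>H y\<bar>"
    by (intro mult_right_mono ln_far_le_weight) auto
   ultimately have "\<bar>log_kernel (x - y) * H y\<bar> \<le> (ln_near (x - y))\<^sup>2 + ((H y)\<^sup>2 + (ln_weight x * \<bar>H y\<bar> + \<bar>ln_weight y * H y\<bar>))"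
    using ln_weight_nonneg[of y] by (simp add: abs_mult log_kernel_abs algebra_simps)
   hence "ennreal \<bar>log_kernel (x - y) * H y\<bar> \<le> ennreal ((ln_near (x - y))\<^sup>2 + ((H y)\<^sup>2 + (ln_weight x * \<bar>H y\<bar> + \<bar>ln_weight y * H y\<bar>)))"
    by (rule ennreal_leI)
   also have "... = ennreal ((ln_near (x - y))\<^sup>2) + ennreal ((H y)\<^sup>2 + (ln_weight x * \<bar>H y\<bar> + \<bar>ln_weight y * H y\<bar>))"
    by (rule ennreal_plus) (auto intro!: add_nonneg_nonneg mult_nonneg_nonneg ln_weight_nonneg)
   finally show "ennreal \<bar>log_kernel (x - y) * H y\<bar> \<le> ennreal ((ln_near (x - y))\<^sup>2) + ennreal ((H y)\<^sup>2 + (ln_weight x * \<bar>H y\<bar> + \<bar>ln_weight y * H y\<bar>))" .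
  qed
  also have "... = (NNINT y. ennreal ((ln_near (x - y))\<^sup>2)) + (NNINT y. ennreal ((H y)\<^sup>2 + (ln_weight x * \<bar>H y\<bar> + \<bar>ln_weight y * H y\<bar>)))"
   by (rule nn_integral_add) auto
  also have "(NNINT y. ennreal ((ln_near (x - y))\<^sup>2)) = ennreal I"
   unfolding I(1)[symmetric] by (rule nn_integral_lborel_reflect[of "\<lambda>z. ennreal ((ln_near z)\<^sup>2)"]) simp
  also have "(NNINT y. ennreal ((H y)\<^sup>2 + (ln_weight x * \<bar>H y\<bar> + \<bar>ln_weight y * H y\<bar>)))
    = ennreal (LBINT y. (H y)\<^sup>2 + (ln_weight x * \<bar>H y\<bar> + \<bar>ln_weight y * H y\<bar>))"
   using h ln_weight_nonneg[of x] by (intro nn_integral_eq_integral) auto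
  also have "(LBINT y. (H y)\<^sup>2 + (ln_weight x * \<bar>H y\<bar> + \<bar>ln_weight y * H y\<bar>))
    = (LBINT y. (H y)\<^sup>2) + (ln_weight x * (LBINT y. \<bar>H y\<bar>) + (LBINT y. \<bar>ln_weight y * H y\<bar>))"
   using h by simp
  also have "ennreal I + ennreal ... = ennreal (I + ...)"
   using I ln_weight_nonneg[of x] by (intro ennreal_plus[symmetric]) (auto intro!: add_nonneg_nonneg mult_nonneg_nonneg integral_nonneg_AE)
  also have "... \<le> ennreal (C * (1 + ln_weight x))"
  proof (rule ennreal_leI)
   have "0 \<le> ln_weight x * I" "0 \<le> ln_weight x * (LBINT y. (H y)\<^sup>2)" "0 \<le> ln_weight x * (LBINT y. \<bar>ln_weight y * H y\<bar>)"
     "0 \<le> (LBINT y. \<bar>H y\<bar>)"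
    using I ln_weight_nonneg[of x] by (auto intro!: mult_nonneg_nonneg integral_nonneg_AE)
   thus "I + ((LBINT y. (H y)\<^sup>2) + (ln_weight x * (LBINT y. \<bar>H y\<bar>) + (LBINT y. \<bar>ln_weight y * H y\<bar>))) \<le> C * (1 + ln_weight x)"
    by (simp add: C_def algebra_simps)
  qed
  finally show ?thesis .
 qed
 show int: "integrable lborel (\<lambda>y. log_kernel (x - y) * H y)" for x
  by (rule integrableI_bounded) (auto intro: le_less_trans[OF bd])
 show "\<exists>C\<ge>0. \<forall>x. (NNINT y. ennreal \<bar>log_kernel (x - y) * H y\<bar>) \<le> ennreal (C * (1 + ln_weight x))"
  using bd C0 by blast
 have "\<bar>log_potential H x\<bar> \<le> C * (1 + ln_weight x)" for x
 proof -
  have "ennreal (norm (log_potential H x)) \<le> (NNINT y. ennreal (norm (log_kernel (x - y) * H y)))"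
   unfolding log_potential_def by (rule integral_norm_bound_ennreal[OF int])
  also have "... \<le> ennreal (C * (1 + ln_weight x))" using bd by simp
  finally show ?thesis using C0 ln_weight_nonneg[of x] by (subst (asm) ennreal_le_iff) auto
 qed
 thus "\<exists>C\<ge>0. \<forall>x. \<bar>log_potential H x\<bar> \<le> C * (1 + ln_weight x)" using C0 by blast
qed

lemma log_form_potential:
 fixes F H :: "'n::finite sfun"
 assumes "CARD('n) \<ge> 2" "log_class F" "log_class H"
 shows "log_form F H = (LBINT x. log_potential H x * F x)"
proof -
 have "log_form F H = (LBINT x. LBINT y. log_kernel (x - y) * (F x * H y))"
  unfolding log_form_def by (rule lborel_pair.integral_fst[OF log_integrable2[OF assms], symmetric])
 also have "... = (LBINT x. log_potential H x * F x)"
  by (intro integral_eqI refl)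
    (simp add: log_potential_def mult_ac flip: integral_mult_right_zero)
 finally show ?thesis .
qed

lemma log_form_sym:
 fixes F H :: "'n::finite sfun"
 assumes "CARD('n) \<ge> 2" "log_class F" "log_class H"
 shows "log_form F H = log_form H F"
proof -
 have "log_form F H = (LBINT y. LBINT x. log_kernel (x - y) * (F x * H y))"
  unfolding log_form_def by (rule lborel_pair.integral_snd[OF log_integrable2[OF assms], symmetric])
 also have "... = (LBINT x. LBINT y. log_kernel (x - y) * (H x * F y))"
  by (simp add: log_kernel_minus mult_ac)
 also have "... = log_form H F"
  unfolding log_form_def by (rule lborel_pair.integral_fst[OF log_integrable2[OF assms(1,3,2)]])
 finally show ?thesis .
qed

lemma log_form_add:
 fixes F H :: "'n::finite sfun"
 assumes N: "CARD('n) \<ge> 2" and F: "log_class F" and H: "log_class H"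
 shows "log_form (\<lambda>x. F x + H x) (\<lambda>x. F x + H x) = log_form F F + 2 * (LBINT x. log_potential F x * H x) + log_form H H"
proof -
 let ?k = "\<lambda>A B. (\<lambda>(x, y). log_kernel (x - y) * (A x * B y))"
 have "(\<lambda>(x, y). log_kernel (x - y) * ((F x + H x) * (F y + H y)))
   = (\<lambda>p. (?k F F p + ?k F H p) + (?k H F p + ?k H H p))"
  by (auto simp: fun_eq_iff algebra_simps)
 hence "log_form (\<lambda>x. F x + H x) (\<lambda>x. F x + H x) = (log_form F F + log_form F H) + (log_form H F + log_form H H)"
  unfolding log_form_def
  using log_integrable2[OF N F F] log_integrable2[OF N F H] log_integrable2[OF N H F] log_integrable2[OF N H H] by simp
 thus ?thesis using log_form_sym[OF N F H] log_form_potential[OF N H F] by simp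
qed

text \<open>The form is quadratic in its argument; \<open>K\<close> is its value for the modulus of the kernel and \<open>|D|\<close>.\<close>

lemma log_form_bound:
 fixes D :: "'n::finite sfun"
 assumes N: "CARD('n) \<ge> 2" and D: "log_class D"
 shows "\<exists>K. \<forall>h t. h \<in> Borel \<and> (\<forall>x. \<bar>h x\<bar> \<le> \<bar>t\<bar> * \<bar>D x\<bar>) --> \<bar>log_form h h\<bar> \<le> t\<^sup>2 * K"
proof (intro exI allI impI)
 fix h :: "'n sfun" and t :: real
 assume h: "h \<in> Borel \<and> (\<forall>x. \<bar>h x\<bar> \<le> \<bar>t\<bar> * \<bar>D x\<bar>)"
 have tD: "log_class (\<lambda>x. t * D x)"
  using log_classD[OF D] by (auto simp: log_class_def power_mult_distrib mult.left_commute[of _ t])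
 have hc: "log_class h" by (rule log_class_bound[OF tD]) (use h in \<open>auto simp: abs_mult\<close>)
 let ?g = "\<lambda>p. \<bar>case p of (x, y) => log_kernel (x - y) * (D x * D y)\<bar>"
 have ig: "integrable (lborel \<Otimes>\<^sub>M lborel) ?g" by (rule integrable_abs[OF log_integrable2[OF N D D]])
 have "\<bar>log_form h h\<bar> \<le> (LINT p|(lborel \<Otimes>\<^sub>M lborel). \<bar>case p of (x, y) => log_kernel (x - y) * (h x * h y)\<bar>)"
  unfolding log_form_def by (rule integral_abs_bound)
 also have "... \<le> (LINT p|(lborel \<Otimes>\<^sub>M lborel). t\<^sup>2 * ?g p)"
 proof (rule integral_mono)
  show "integrable (lborel \<Otimes>\<^sub>M lborel) (\<lambda>p. \<bar>case p of (x, y) => log_kernel (x - y) * (h x * h y)\<bar>)"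
   by (rule integrable_abs[OF log_integrable2[OF N hc hc]])
  show "integrable (lborel \<Otimes>\<^sub>M lborel) (\<lambda>p. t\<^sup>2 * ?g p)" by (rule integrable_mult_right[OF ig])
  fix p :: "(real ^ 'n) \<times> (real ^ 'n)"
  obtain x y where p: "p = (x, y)" by (cases p)
  have "\<bar>h x\<bar> * \<bar>h y\<bar> \<le> (\<bar>t\<bar> * \<bar>D x\<bar>) * (\<bar>t\<bar> * \<bar>D y\<bar>)" using h by (intro mult_mono) auto
  also have "... = t\<^sup>2 * (\<bar>D x\<bar> * \<bar>D y\<bar>)" by (simp add: power2_eq_square)
  finally have "\<bar>log_kernel (x - y)\<bar> * (\<bar>h x\<bar> * \<bar>h y\<bar>) \<le> \<bar>log_kernel (x - y)\<bar> * (t\<^sup>2 * (\<bar>D x\<bar> * \<bar>D y\<bar>))"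
   by (intro mult_left_mono) auto
  thus "\<bar>case p of (x, y) => log_kernel (x - y) * (h x * h y)\<bar> \<le> t\<^sup>2 * ?g p"
   by (simp add: p abs_mult mult_ac)
 qed
 also have "... = t\<^sup>2 * (LINT p|(lborel \<Otimes>\<^sub>M lborel). ?g p)" by simp
 finally show "\<bar>log_form h h\<bar> \<le> t\<^sup>2 * (LINT p|(lborel \<Otimes>\<^sub>M lborel). ?g p)" .
qed

lemma energy_as_lborel:
 fixes u :: "'n::finite sfun"
 assumes ae: "AE x in lborel. indicator \<Omega> x * G (u x) = F x" and K: "\<And>z. 0 \<le> K z" and G: "\<And>t. 0 \<le> G t"
 shows "(\<integral>\<^sup>+x\<in>\<Omega>. (\<integral>\<^sup>+y\<in>\<Omega>. ennreal (K (x - y) * G (u x) * G (u y)) \<partial>lebesgue) \<partial>lebesgue)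
  = (NNINT x. (NNINT y. ennreal (K (x - y) * (F x * F y))))"
proof -
 have "(\<integral>\<^sup>+x\<in>\<Omega>. (\<integral>\<^sup>+y\<in>\<Omega>. ennreal (K (x - y) * G (u x) * G (u y)) \<partial>lebesgue) \<partial>lebesgue)
   = (\<integral>\<^sup>+x\<in>\<Omega>. (\<integral>\<^sup>+y\<in>\<Omega>. ennreal (K (x - y) * G (u x) * G (u y)) \<partial>lborel) \<partial>lborel)"
  by (simp add: nn_integral_completion)
 also have "... = (NNINT x. (NNINT y. ennreal (K (x - y) * (F x * F y))))"
 proof (rule nn_integral_cong_AE)
  show "AE x in lborel. (\<integral>\<^sup>+y\<in>\<Omega>. ennreal (K (x - y) * G (u x) * G (u y)) \<partial>lborel) * indicator \<Omega> x
    = (NNINT y. ennreal (K (x - y) * (F x * F y)))"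
   using ae
  proof eventually_elim
   case (elim x)
   show ?case
   proof (cases "x \<in> \<Omega>")
    case True
    have "(\<integral>\<^sup>+y\<in>\<Omega>. ennreal (K (x - y) * G (u x) * G (u y)) \<partial>lborel) = (NNINT y. ennreal (K (x - y) * (F x * F y)))"
     by (rule nn_integral_cong_AE) (use ae elim True in \<open>auto elim!: eventually_mono simp: indicator_def mult.assoc split: if_splits\<close>)
    thus ?thesis using True by simp
   qed (use elim in simp)
  qed
 qed
 finally show ?thesis .
qed

lemma log_energy_eq_form:
 fixes u :: "'n::finite sfun"
 assumes N: "CARD('n) \<ge> 2" and ae: "AE x in lborel. indicator \<Omega> x * G (u x) = F x"
  and G: "\<And>t. 0 \<le> G t" and F: "log_class F" and F0: "\<And>x. 0 \<le> F x"
 shows "log_energy \<Omega> G u = ereal (log_form F F)"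
proof -
 have [measurable]: "F \<in> Borel" using log_classD[OF F] by auto
 note ip = near_integrable2[OF N F F] and im = far_integrable2[OF F F]
 define P where "P = (LINT (x, y)|(lborel \<Otimes>\<^sub>M lborel). ln_near (x - y) * (F x * F y))"
 define Q where "Q = (LINT (x, y)|(lborel \<Otimes>\<^sub>M lborel). ln_far (x - y) * (F x * F y))"
 have pos: "P \<ge> 0" "Q \<ge> 0" unfolding P_def Q_def using F0
  by (auto intro!: integral_nonneg_AE mult_nonneg_nonneg ln_plus_nonneg)
 have "energy_pos \<Omega> G u = (NNINT x. (NNINT y. ennreal (ln_near (x - y) * (F x * F y))))"
  unfolding energy_pos_def by (rule energy_as_lborel[OF ae _ G, where K = ln_near]) (rule ln_plus_nonneg)
 also have "... = (\<integral>\<^sup>+p. ennreal (case p of (x, y) => ln_near (x - y) * (F x * F y)) \<partial>(lborel \<Otimes>\<^sub>M lborel))"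
  by (subst lborel.nn_integral_fst[symmetric]) auto
 also have "... = ennreal P" unfolding P_def
  by (rule nn_integral_eq_integral[OF ip]) (use F0 in \<open>auto intro!: mult_nonneg_nonneg ln_plus_nonneg\<close>)
 finally have P: "energy_pos \<Omega> G u = ennreal P" .
 have "energy_neg \<Omega> G u = (NNINT x. (NNINT y. ennreal (ln_far (x - y) * (F x * F y))))"
  unfolding energy_neg_def by (rule energy_as_lborel[OF ae _ G, where K = ln_far]) (rule ln_plus_nonneg)
 also have "... = (\<integral>\<^sup>+p. ennreal (case p of (x, y) => ln_far (x - y) * (F x * F y)) \<partial>(lborel \<Otimes>\<^sub>M lborel))"
  by (subst lborel.nn_integral_fst[symmetric]) auto
 also have "... = ennreal Q" unfolding Q_def
  by (rule nn_integral_eq_integral[OF im]) (use F0 in \<open>auto intro!: mult_nonneg_nonneg ln_plus_nonneg\<close>)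
 finally have Q: "energy_neg \<Omega> G u = ennreal Q" .
 have "log_form F F = P - Q"
 proof -
  have "(\<lambda>(x, y). log_kernel (x - y) * (F x * F y)) =
    (\<lambda>p. (case p of (x, y) => ln_near (x - y) * (F x * F y)) - (case p of (x, y) => ln_far (x - y) * (F x * F y)))"
   by (auto simp: fun_eq_iff log_kernel_split left_diff_distrib)
  thus ?thesis unfolding log_form_def P_def Q_def
   by (simp only:) (rule Bochner_Integration.integral_diff[OF ip im])
 qed
 thus ?thesis unfolding log_energy_def P Q using pos by simp
qed

text \<open>If the double integral is finite, so is the inner integral at some point \<open>x\<close> with \<open>F x > 0\<close>. Away from
 \<open>x\<close> the kernel is bounded below by a positive constant and comparable to the weight.\<close>

lemma energy_neg_finite_imp:
 fixes u :: "'n::finite sfun"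
 assumes ae: "AE x in lborel. indicator \<Omega> x * G (u x) = F x" and G: "\<And>t. 0 \<le> G t"
  and F0: "\<And>x. 0 \<le> F x" and F: "locint F" and fin: "energy_neg \<Omega> G u \<noteq> \<infinity>"
 shows "integrable lborel F" "integrable lborel (\<lambda>x. ln_weight x * F x)"
proof -
 have [measurable]: "F \<in> Borel" using F by (rule locint_meas)
 have "energy_neg \<Omega> G u = (NNINT x. (NNINT y. ennreal (ln_far (x - y) * (F x * F y))))"
  unfolding energy_neg_def by (rule energy_as_lborel[OF ae _ G, where K = ln_far]) (rule ln_plus_nonneg)
 hence ae2: "AE x in lborel. (NNINT y. ennreal (ln_far (x - y) * (F x * F y))) \<noteq> \<infinity>"
  using fin by (intro nn_integral_PInf_AE) auto
 have "integrable lborel F \<and> integrable lborel (\<lambda>x. ln_weight x * F x)"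
 proof (cases "AE x in lborel. F x = 0")
  case True
  have "integrable lborel F \<longleftrightarrow> integrable lborel (\<lambda>x :: real ^ 'n. 0 :: real)"
   by (rule integrable_cong_AE) (use True in auto)
  moreover have "integrable lborel (\<lambda>x. ln_weight x * F x) \<longleftrightarrow> integrable lborel (\<lambda>x :: real ^ 'n. 0 :: real)"
   by (rule integrable_cong_AE) (use True in auto)
  ultimately show ?thesis by simp
 next
  case False
  have "\<exists>x. (NNINT y. ennreal (ln_far (x - y) * (F x * F y))) \<noteq> \<infinity> \<and> F x \<noteq> 0"
  proof (rule ccontr)
   assume "\<not> ?thesis"
   hence "(NNINT y. ennreal (ln_far (x - y) * (F x * F y))) \<noteq> \<infinity> --> F x = 0" for x by blast
   hence "AE x in lborel. F x = 0" using ae2 by (elim eventually_mono) blast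
   thus False using False by simp
  qed
  then obtain x where x: "(NNINT y. ennreal (ln_far (x - y) * (F x * F y))) \<noteq> \<infinity>" "F x \<noteq> 0"
   by blast
  have Fx: "F x > 0" using x(2) F0[of x] by simp
  have "integrable lborel (\<lambda>y. ln_far (x - y) * (F x * F y))"
   by (rule integrableI_nonneg) (use x(1) F0 in \<open>auto intro!: mult_nonneg_nonneg ln_plus_nonneg simp: less_top\<close>)
  hence "integrable lborel (\<lambda>y. 1 / F x * (ln_far (x - y) * (F x * F y)))" by (rule integrable_mult_right)
  hence i1: "integrable lborel (\<lambda>y. ln_far (x - y) * F y)" using Fx by simp
  have i2: "integrable lborel (\<lambda>y. indicator (cball 0 (norm x + 3)) y * F y)" by (rule locint_integrable[OF F])
  have i3: "integrable lborel F"
  proof (rule integrable_dominated[OF integrable_plus[OF i2 i1]])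
   show "AE y in lborel. norm (F y) \<le> norm (indicator (cball 0 (norm x + 3)) y * F y + ln_far (x - y) * F y)"
   proof (rule AE_I2)
    fix y
    have n: "0 \<le> ln_far (x - y) * F y" using F0 by (intro mult_nonneg_nonneg ln_plus_nonneg)
    show "norm (F y) \<le> norm (indicator (cball 0 (norm x + 3)) y * F y + ln_far (x - y) * F y)"
    proof (cases "norm y \<le> norm x + 3")
     case True
     thus ?thesis using n F0[of y] by simp
    next
     case False
     have "norm (x - y) \<ge> 3" using False norm_triangle_ineq3[of y x] by (simp add: norm_minus_commute)
     moreover have "exp 1 \<le> (3::real)" by (rule exp_le)
     ultimately have "ln (exp 1) \<le> ln (norm (x - y))" by (intro ln_mono) auto
     hence "1 \<le> ln_far (x - y)" by (simp add: ln_plus_def)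
     hence "1 * F y \<le> ln_far (x - y) * F y" using F0 by (intro mult_right_mono) auto
     thus ?thesis using False F0[of y] n by simp
    qed
   qed
  qed simp
  have "integrable lborel (\<lambda>y. ln_weight y * F y)"
  proof (rule integrable_dominated[OF integrable_plus[OF integrable_mult_right[OF i3, of "ln_weight x + ln 2"] i1]])
   show "AE y in lborel. norm (ln_weight y * F y) \<le> norm ((ln_weight x + ln 2) * F y + ln_far (x - y) * F y)"
   proof (rule AE_I2)
    fix y
    have "ln_weight y * F y \<le> (ln_weight x + ln 2 + ln_far (x - y)) * F y"
     by (intro mult_right_mono ln_weight_le_far F0)
    thus "norm (ln_weight y * F y) \<le> norm ((ln_weight x + ln 2) * F y + ln_far (x - y) * F y)"
     using ln_weight_nonneg[of y] F0[of y] by (simp add: algebra_simps)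
   qed
  qed simp
  thus ?thesis using i3 by simp
 qed
 thus "integrable lborel F" "integrable lborel (\<lambda>x. ln_weight x * F x)" by auto
qed

section \<open>The logarithmic potential is weakly differentiable and superharmonic\<close>

text \<open>The negative gradient of \<open>log_kernel\<close>.\<close>

definition inv_field :: "real ^ 'n::finite => real ^ 'n" where
 "inv_field z = (1 / (norm z)\<^sup>2) *\<^sub>R z"

lemma inv_field_measurable [measurable]: "inv_field \<in> Borel"
 unfolding inv_field_def[abs_def] by measurable

lemma norm_inv_field: "norm (inv_field z) = 1 / norm z"
 by (cases "z = 0") (simp_all add: inv_field_def power2_eq_square)

lemma kern1_eq: "e > 0 ==> kern 1 e z = (1 / (rsq e z)) *\<^sub>R z"
 by (simp add: kern_def powr_minus_divide add_nonneg_pos)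

lemma norm_kern1_le:
 assumes "e > 0" shows "norm (kern 1 e z) \<le> 1 / norm z"
proof (cases "z = 0")
 case False
 have "norm (kern 1 e z) = norm z / (rsq e z)"
  using assms by (simp add: kern1_eq add_nonneg_pos)
 also have "... \<le> norm z / (norm z)\<^sup>2" using False assms by (intro divide_left_mono) (auto intro!: mult_pos_pos add_pos_pos)
 also have "... = 1 / norm z" using False by (simp add: power2_eq_square)
 finally show ?thesis .
qed (simp add: kern_def)

lemma kern1_tendsto: "(\<lambda>n. kern 1 (inverse (real (Suc n))) z) \<longlonglongrightarrow> inv_field z"
proof (cases "z = 0")
 case False
 have "(\<lambda>n. (1 / ((norm z)\<^sup>2 + (inverse (real (Suc n)))\<^sup>2)) *\<^sub>R z) \<longlonglongrightarrow> (1 / (rsq 0 z)) *\<^sub>R z"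
  using False by (intro tendsto_intros LIMSEQ_inverse_real_of_nat) auto
 moreover have "kern 1 (inverse (real (Suc n))) z = (1 / ((norm z)\<^sup>2 + (inverse (real (Suc n)))\<^sup>2)) *\<^sub>R z" for n
  by (rule kern1_eq) simp
 ultimately show ?thesis by (simp add: inv_field_def)
qed (simp add: kern_def inv_field_def)

text \<open>By Young's inequality \<open>|f| / |z| \<le> |z| powr (- 3 / 2) + |f| ^ 3\<close> near the singularity, and the power
 is integrable there since \<open>N \<ge> 2\<close>.\<close>

lemma riesz_bound:
 fixes f :: "'n::finite sfun"
 assumes N: "CARD('n) \<ge> 2" and f: "integrable lborel f" "integrable lborel (\<lambda>x. \<bar>f x\<bar> ^ 3)"
 shows "\<exists>B\<ge>0. \<forall>x. (NNINT y. ennreal (\<bar>f y\<bar> / norm (x - y))) \<le> ennreal B"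
proof -
 have [measurable]: "f \<in> Borel" using f by auto
 have "3 / 2 < real CARD('n)" using N by linarith
 then obtain C where C: "C \<ge> 0" "\<forall>\<rho>>0. (\<integral>\<^sup>+z\<in>ball 0 \<rho>. ennreal (norm (z :: real ^ 'n) powr (- (3/2))) \<partial>lborel) \<le> ennreal (C * \<rho> powr (real CARD('n) - 3/2))"
  using nn_integral_norm_powr_ball[of "3/2", where 'n = 'n] by auto
 have C1: "(\<integral>\<^sup>+z\<in>ball 0 1. ennreal (norm (z :: real ^ 'n) powr (- (3/2))) \<partial>lborel) \<le> ennreal C"
  using C(2)[rule_format, of 1] by simp
 define B where "B = C + ((LBINT y. \<bar>f y\<bar> ^ 3) + (LBINT y. \<bar>f y\<bar>))"
 show ?thesis
 proof (intro exI[of _ B] conjI allI)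
  show "B \<ge> 0" unfolding B_def using C by (auto intro!: add_nonneg_nonneg integral_nonneg_AE)
  fix x :: "real ^ 'n"
  have pt: "ennreal (\<bar>f y\<bar> / norm (x - y)) \<le> ennreal (norm (x - y) powr (- (3/2))) * indicator (ball 0 1) (x - y) + ennreal (\<bar>f y\<bar> ^ 3 + \<bar>f y\<bar>)" for y
  proof (cases "norm (x - y) < 1")
   case False
   have "\<bar>f y\<bar> / norm (x - y) \<le> \<bar>f y\<bar> / 1" using False by (intro divide_left_mono) auto
   hence "\<bar>f y\<bar> / norm (x - y) \<le> \<bar>f y\<bar> ^ 3 + \<bar>f y\<bar>" by (simp add: add_increasing)
   thus ?thesis using False by (simp add: ennreal_leI del: ennreal_plus)
  next
   case True
   define r where "r = norm (x - y)"
   define b where "b = \<bar>f y\<bar>"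
   have b0: "b \<ge> 0" by (simp add: b_def)
   have "b / r \<le> r powr (- (3/2)) + b ^ 3"
   proof (cases "r = 0")
    case r0: False
    hence r: "r > 0" by (simp add: r_def)
    show ?thesis
    proof (cases "b \<le> r powr (- (1/2))")
     case True
     have "b / r \<le> r powr (- (1/2)) / r" using True r by (simp add: divide_right_mono)
     also have "... = r powr (- (1/2)) * r powr (- 1)" using r by (simp add: powr_minus_divide)
     also have "... = r powr (- (3/2))" by (subst powr_add[symmetric]) simp
     finally show ?thesis using b0 by (simp add: add_increasing2)
    next
     case False
     hence "(r powr (- (1/2)))\<^sup>2 \<le> b\<^sup>2" by (intro power_mono) auto
     moreover have "(r powr (- (1/2)))\<^sup>2 = 1 / r" using r by (simp add: power2_eq_square powr_minus_divide flip: powr_add)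
     ultimately have "b * (1 / r) \<le> b * b\<^sup>2" using b0 by (intro mult_left_mono) auto
     thus ?thesis by (simp add: power3_eq_cube power2_eq_square add_increasing)
    qed
   qed (use b0 in simp)
   hence "b / r \<le> r powr (- (3/2)) + (b ^ 3 + b)" using b0 by linarith
   hence "ennreal (b / r) \<le> ennreal (r powr (- (3/2)) + (b ^ 3 + b))" by (rule ennreal_leI)
   also have "... = ennreal (r powr (- (3/2))) + ennreal (b ^ 3 + b)" using b0 by (intro ennreal_plus) auto
   finally show ?thesis using True by (simp add: r_def b_def del: ennreal_plus)
  qed
  have "(NNINT y. ennreal (\<bar>f y\<bar> / norm (x - y)))
   \<le> (NNINT y. ennreal (norm (x - y) powr (- (3/2))) * indicator (ball 0 1) (x - y) + ennreal (\<bar>f y\<bar> ^ 3 + \<bar>f y\<bar>))"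
   by (intro nn_integral_mono pt)
  also have "... = (NNINT y. ennreal (norm (x - y) powr (- (3/2))) * indicator (ball 0 1) (x - y)) + (NNINT y. ennreal (\<bar>f y\<bar> ^ 3 + \<bar>f y\<bar>))"
   by (rule nn_integral_add) measurable
  also have "(NNINT y. ennreal (norm (x - y) powr (- (3/2))) * indicator (ball 0 1) (x - y))
    = (\<integral>\<^sup>+z\<in>ball 0 1. ennreal (norm (z :: real ^ 'n) powr (- (3/2))) \<partial>lborel)"
   by (rule nn_integral_lborel_reflect[of "\<lambda>z. ennreal (norm (z :: real ^ 'n) powr (- (3/2))) * indicator (ball 0 1) z"]) measurable
  also have "(NNINT y. ennreal (\<bar>f y\<bar> ^ 3 + \<bar>f y\<bar>)) = ennreal (LBINT y. \<bar>f y\<bar> ^ 3 + \<bar>f y\<bar>)"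
   using f by (intro nn_integral_eq_integral) auto
  also have "(LBINT y. \<bar>f y\<bar> ^ 3 + \<bar>f y\<bar>) = (LBINT y. \<bar>f y\<bar> ^ 3) + (LBINT y. \<bar>f y\<bar>)"
   using f by simp
  also have "(\<integral>\<^sup>+z\<in>ball 0 1. ennreal (norm (z :: real ^ 'n) powr (- (3/2))) \<partial>lborel) + ennreal ((LBINT y. \<bar>f y\<bar> ^ 3) + (LBINT y. \<bar>f y\<bar>))
    \<le> ennreal C + ennreal ((LBINT y. \<bar>f y\<bar> ^ 3) + (LBINT y. \<bar>f y\<bar>))"
   by (intro add_right_mono C1)
  also have "... = ennreal B" unfolding B_def using C
   by (intro ennreal_plus[symmetric]) (auto intro!: add_nonneg_nonneg integral_nonneg_AE)
  finally show "(NNINT y. ennreal (\<bar>f y\<bar> / norm (x - y))) \<le> ennreal B" .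
 qed
qed

lemma inv_norm_locally_integrable:
 assumes N: "CARD('n::finite) \<ge> 2"
 shows "integrable lborel (\<lambda>z :: real ^ 'n. indicator (cball 0 R) z * (1 / norm z))"
proof (rule integrableI_nonneg)
 have "1 < real CARD('n)" using N by linarith
 then obtain C where C: "\<forall>\<rho>>0. (\<integral>\<^sup>+z\<in>ball 0 \<rho>. ennreal (norm (z :: real ^ 'n) powr (- 1)) \<partial>lborel) \<le> ennreal (C * \<rho> powr (real CARD('n) - 1))"
  using nn_integral_norm_powr_ball[of 1, where 'n = 'n] by auto
 have "(NNINT z. ennreal (indicator (cball 0 R) z * (1 / norm (z :: real ^ 'n))))
   \<le> (\<integral>\<^sup>+z\<in>ball 0 (\<bar>R\<bar> + 1). ennreal (norm (z :: real ^ 'n) powr (- 1)) \<partial>lborel)"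
  by (intro nn_integral_mono) (auto simp: indicator_def powr_minus_divide)
 also have "... \<le> ennreal (C * (\<bar>R\<bar> + 1) powr (real CARD('n) - 1))" using C[rule_format, of "\<bar>R\<bar> + 1"] by simp
 also have "... < \<infinity>" by simp
 finally show "(NNINT z. ennreal (indicator (cball 0 R) z * (1 / norm (z :: real ^ 'n)))) < \<infinity>" .
qed auto

text \<open>Integration by parts for \<open>ln\<close> of the regularised modulus, whose gradient is \<open>kern 1\<close> up to sign, followed by dominated
 convergence as the regularisation is removed.\<close>

lemma log_kernel_weak_derivative:
 fixes X :: "'n::finite sfun"
 assumes N: "CARD('n) \<ge> 2"
  and [measurable]: "X \<in> Borel" "X' \<in> Borel"
  and d: "ddiff i X X'"
  and X: "\<And>x. \<bar>X x\<bar> \<le> C" "\<And>x. \<bar>X' x\<bar> \<le> C" "\<And>x. norm x > R ==> X x = 0"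
 shows "(LBINT x. log_kernel x * X' x) = (LBINT x. inv_field x $ i * X x)"
proof -
 have C0: "C \<ge> 0" using X(1)[of 0] by linarith
 have X'0: "\<And>x. norm x > R ==> X' x = 0" by (rule ddiff_zero_outside[OF d X(3)])
 define e where "e n = inverse (real (Suc n))" for n
 have e: "e n > 0" "e n \<le> 1" for n by (auto simp: e_def field_simps)
 define k where "k n z = - (1/2) * ln (rsq (e n) z)" for n and z :: "real ^ 'n"
 have [measurable]: "k n \<in> Borel" for n unfolding k_def[abs_def] by measurable
 have pos: "(norm z)\<^sup>2 + (e n)\<^sup>2 > 0" for n and z :: "real ^ 'n" using e[of n] by (intro add_nonneg_pos) auto
 have kd: "ddiff i (k n) (\<lambda>z. - (kern 1 (e n) z $ i))" for n
  unfolding ddiff_def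
 proof
  fix x :: "real ^ 'n"
  have "((\<lambda>t. (norm (x + t *\<^sub>R axis i 1))\<^sup>2 + (e n)\<^sup>2) has_real_derivative 2 * x $ i) (at 0)"
   using DERIV_add[OF norm_power2_ddiff[of i, unfolded ddiff_def, rule_format, of x] DERIV_const[of "(e n)\<^sup>2"]] by simp
  hence "((\<lambda>t. ln ((norm (x + t *\<^sub>R axis i 1))\<^sup>2 + (e n)\<^sup>2)) has_real_derivative inverse ((norm (x + 0 *\<^sub>R axis i 1))\<^sup>2 + (e n)\<^sup>2) * (2 * x $ i)) (at 0)"
   by (intro DERIV_chain2[where f = ln, OF DERIV_ln] pos)
  from DERIV_cmult[OF this, of "- (1/2)"]
  show "((\<lambda>t. k n (x + t *\<^sub>R axis i 1)) has_real_derivative - (kern 1 (e n) x $ i)) (at 0)"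
   using pos[of x n] e[of n] by (simp add: k_def kern1_eq field_simps)
 qed
 have kb: "\<bar>k n z\<bar> \<le> ln_near z + ln 2 + ln_far z" if z: "z \<noteq> 0" for n and z :: "real ^ 'n"
 proof -
  have "ln ((norm z)\<^sup>2) \<le> ln (rsq (e n) z)" using z pos by (intro ln_mono) auto
  moreover have "ln ((norm z)\<^sup>2) = 2 * ln (norm z)" using z by (simp add: ln_realpow)
  moreover have "ln (1 / norm z) = - ln (norm z)" using z by (simp add: ln_div)
  moreover have "ln (1 / norm z) \<le> ln_near z" by (simp add: ln_plus_def)
  ultimately have u: "k n z \<le> ln_near z" by (simp add: k_def)
  have "(norm z)\<^sup>2 + (e n)\<^sup>2 \<le> (1 + norm z)\<^sup>2"
   using power_mono[OF e(2)[of n], of 2] e(1)[of n] by (simp add: power2_sum add_increasing2)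
  hence "ln (rsq (e n) z) \<le> ln ((1 + norm z)\<^sup>2)" using pos[of z n] by (intro ln_mono) auto
  also have "... = 2 * ln_weight z" by (simp add: ln_realpow ln_weight_def add_pos_nonneg)
  finally have "- k n z \<le> ln_weight z" by (simp add: k_def)
  also have "... \<le> ln 2 + ln_far z" using ln_weight_le_far[of z 0] by (simp add: ln_weight_def)
  finally have "- k n z \<le> ln 2 + ln_far z" .
  moreover have "0 \<le> ln (2::real)" by simp
  ultimately show ?thesis using u ln_plus_nonneg[of "1 / norm z"] ln_plus_nonneg[of "norm z"] by linarith
 qed
 have ne: "AE z in lborel. (z :: real ^ 'n) \<noteq> 0" by (rule AE_lborel_singleton)
 have ibp: "(LBINT x. k n x * X' x) = (LBINT x. kern 1 (e n) x $ i * X x)" for n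
 proof -
  have b: "\<bar>kern 1 (e n) z $ i\<bar> \<le> ((e n)\<^sup>2) powr (1 / 2 - 1)" for z :: "real ^ 'n"
   by (rule kern_bounded(1)[OF e(1)]) simp
  define M where "M = \<bar>ln ((e n)\<^sup>2)\<bar> + \<bar>ln (R\<^sup>2 + (e n)\<^sup>2)\<bar>"
  have kb': "\<bar>k n x\<bar> \<le> M" if "norm x \<le> R" for x
  proof -
   have "(norm x)\<^sup>2 \<le> R\<^sup>2" using that by (intro power_mono) auto
   hence "ln ((e n)\<^sup>2) \<le> ln (rsq (e n) x)" "ln (rsq (e n) x) \<le> ln (R\<^sup>2 + (e n)\<^sup>2)"
    using pos[of x n] e(1)[of n] by (auto intro!: ln_mono)
   thus ?thesis unfolding k_def M_def by (simp add: abs_mult)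
  qed
  have "(LBINT x. X' x * k n x) = - (LBINT x. X x * - (kern 1 (e n) x $ i))"
   by (rule integral_by_parts_ddiff[OF _ _ _ _ d kd, where C = "max C (max M (((e n)\<^sup>2) powr (1 / 2 - 1)))" and R = R])
     (use X X'0 kb' b in \<open>auto simp: le_max_iff_disj\<close>)
  thus ?thesis by (simp add: mult.commute)
 qed
 have l1: "(\<lambda>n. LBINT x. k n x * X' x) \<longlonglongrightarrow> (LBINT x. log_kernel x * X' x)"
 proof (rule integral_dominated_convergence[where w = "\<lambda>x. C * ln_near x + C * (ln 2 + \<bar>ln_plus R\<bar>) * indicator (cball 0 R) x"])
  show "integrable lborel (\<lambda>x :: real ^ 'n. C * ln_near x + C * (ln 2 + \<bar>ln_plus R\<bar>) * indicator (cball 0 R) x)"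
   using ln_near_integrals(1)[OF N]
   by (intro integrable_plus integrable_mult_right integrable_indicator_cball integrableI_nonneg)
     (auto simp: ln_plus_nonneg)
  show "AE x in lborel. norm (k n x * X' x) \<le> C * ln_near x + C * (ln 2 + \<bar>ln_plus R\<bar>) * indicator (cball 0 R) x" for n
   using ne
  proof eventually_elim
   case (elim x)
   show ?case
   proof (cases "norm x \<le> R")
    case True
    have "ln_far x \<le> ln_plus R" using True elim by (auto simp: ln_plus_def max_def intro: ln_mono)
    hence "\<bar>k n x\<bar> \<le> ln_near x + (ln 2 + \<bar>ln_plus R\<bar>)" using kb[OF elim, of n] by linarith
    hence "\<bar>k n x\<bar> * \<bar>X' x\<bar> \<le> (ln_near x + (ln 2 + \<bar>ln_plus R\<bar>)) * C"
     using X(2)[of x] ln_plus_nonneg[of "1 / norm x"] by (intro mult_mono) auto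
    thus ?thesis using True by (simp add: abs_mult algebra_simps)
   next
    case False
    thus ?thesis using X'0[of x] C0 ln_plus_nonneg[of "1 / norm x"] by simp
   qed
  qed
  show "AE x in lborel. (\<lambda>n. k n x * X' x) \<longlonglongrightarrow> log_kernel x * X' x"
   using ne
  proof eventually_elim
   case (elim x)
   have "(\<lambda>n. - (1/2) * ln (rsq (e n) x)) \<longlonglongrightarrow> - (1/2) * ln (rsq 0 x)"
    unfolding e_def using elim by (intro tendsto_intros LIMSEQ_inverse_real_of_nat) auto
   moreover have "- (1/2) * ln (rsq 0 x) = log_kernel x"
    using elim by (simp add: log_kernel_def ln_div ln_realpow)
   ultimately show ?case by (intro tendsto_mult tendsto_const) (simp add: k_def)
  qed
 qed measurable
 have l2: "(\<lambda>n. LBINT x. kern 1 (e n) x $ i * X x) \<longlonglongrightarrow> (LBINT x. inv_field x $ i * X x)"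
 proof (rule integral_dominated_convergence[where w = "\<lambda>x. C * (indicator (cball 0 R) x * (1 / norm x))"])
  show "integrable lborel (\<lambda>x :: real ^ 'n. C * (indicator (cball 0 R) x * (1 / norm x)))"
   by (intro integrable_mult_right inv_norm_locally_integrable[OF N])
  show "AE x in lborel. norm (kern 1 (e n) x $ i * X x) \<le> C * (indicator (cball 0 R) x * (1 / norm x))" for n
  proof (rule AE_I2)
   fix x :: "real ^ 'n"
   have "\<bar>kern 1 (e n) x $ i\<bar> \<le> 1 / norm x"
    by (rule order.trans[OF component_le_norm_cart norm_kern1_le[OF e(1)]])
   hence "\<bar>kern 1 (e n) x $ i\<bar> * \<bar>X x\<bar> \<le> (1 / norm x) * C" using X(1)[of x] by (intro mult_mono) auto
   thus "norm (kern 1 (e n) x $ i * X x) \<le> C * (indicator (cball 0 R) x * (1 / norm x))"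
    using X(3)[of x] by (cases "norm x \<le> R") (auto simp: abs_mult mult.commute)
  qed
  show "AE x in lborel. (\<lambda>n. kern 1 (e n) x $ i * X x) \<longlonglongrightarrow> inv_field x $ i * X x"
   unfolding e_def by (intro AE_I2 tendsto_mult tendsto_const tendsto_vec_nth kern1_tendsto)
 qed measurable
 show ?thesis using LIMSEQ_unique[OF l1[unfolded ibp] l2] .
qed

definition log_field :: "(real ^ 'n::finite => real) => real ^ 'n => real ^ 'n" where
 "log_field f x = (LBINT y. f y *\<^sub>R inv_field (x - y))"

lemma log_field_measurable [measurable]:
 assumes [measurable]: "f \<in> Borel" shows "log_field f \<in> Borel"
 unfolding log_field_def[abs_def] by measurable

lemma log_field_integrable:
 fixes f :: "'n::finite sfun"
 assumes N: "CARD('n) \<ge> 2" and f: "integrable lborel f" "integrable lborel (\<lambda>x. \<bar>f x\<bar> ^ 3)"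
 shows "integrable lborel (\<lambda>y. f y *\<^sub>R inv_field (x - y))"
  "integrable lborel \<Phi> ==> integrable (lborel \<Otimes>\<^sub>M lborel) (\<lambda>(x, y). \<bar>f y\<bar> * (\<bar>\<Phi> x\<bar> / norm (x - y)))"
  "\<exists>B. \<forall>x. norm (log_field f x) \<le> B"
proof -
 have [measurable]: "f \<in> Borel" using f by auto
 obtain B where B: "B \<ge> 0" "\<And>x. (NNINT y. ennreal (\<bar>f y\<bar> / norm (x - y))) \<le> ennreal B"
  using riesz_bound[OF N f] by blast
 show i: "integrable lborel (\<lambda>y. f y *\<^sub>R inv_field (x - y))" for x
  by (rule integrableI_bounded) (auto simp: norm_inv_field intro: le_less_trans[OF B(2)])
 have "norm (log_field f x) \<le> B" for x
 proof -
  have "ennreal (norm (log_field f x)) \<le> (NNINT y. ennreal (norm (f y *\<^sub>R inv_field (x - y))))"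
   unfolding log_field_def by (rule integral_norm_bound_ennreal[OF i])
  also have "... \<le> ennreal B" using B(2)[of x] by (simp add: norm_inv_field)
  finally show ?thesis using B(1) by simp
 qed
 thus "\<exists>B. \<forall>x. norm (log_field f x) \<le> B" by blast
 assume \<Phi>: "integrable lborel \<Phi>"
 hence [measurable]: "\<Phi> \<in> Borel" by auto
 show "integrable (lborel \<Otimes>\<^sub>M lborel) (\<lambda>(x, y). \<bar>f y\<bar> * (\<bar>\<Phi> x\<bar> / norm (x - y)))"
 proof (rule integrableI_nonneg)
  have "(\<integral>\<^sup>+p. ennreal (case p of (x, y) => \<bar>f y\<bar> * (\<bar>\<Phi> x\<bar> / norm (x - y))) \<partial>(lborel \<Otimes>\<^sub>M lborel))
   = (NNINT x. (NNINT y. ennreal (\<bar>f y\<bar> * (\<bar>\<Phi> x\<bar> / norm (x - y)))))"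
   by (subst lborel.nn_integral_fst[symmetric]) auto
  also have "... = (NNINT x. (NNINT y. ennreal \<bar>\<Phi> x\<bar> * ennreal (\<bar>f y\<bar> / norm (x - y))))"
   by (intro nn_integral_cong) (simp add: mult.commute flip: ennreal_mult)
  also have "... = (NNINT x. ennreal \<bar>\<Phi> x\<bar> * (NNINT y. ennreal (\<bar>f y\<bar> / norm (x - y))))"
   by (intro nn_integral_cong nn_integral_cmult) measurable
  also have "... \<le> (NNINT x. ennreal \<bar>\<Phi> x\<bar> * ennreal B)"
   by (intro nn_integral_mono mult_left_mono B) auto
  also have "... = (NNINT x. ennreal \<bar>\<Phi> x\<bar>) * ennreal B" by (rule nn_integral_multc) measurable
  also have "... < \<infinity>" using \<Phi> by (auto simp: integrable_iff_bounded ennreal_mult_less_top)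
  finally show "(\<integral>\<^sup>+p. ennreal (case p of (x, y) => \<bar>f y\<bar> * (\<bar>\<Phi> x\<bar> / norm (x - y))) \<partial>(lborel \<Otimes>\<^sub>M lborel)) < \<infinity>" .
 qed auto
qed

lemma bounded_locint:
 assumes [measurable]: "w \<in> Borel" and b: "\<And>R. \<exists>C. \<forall>x. norm x \<le> R --> \<bar>w x\<bar> \<le> C"
 shows "locint w"
 unfolding locint_def
proof (intro conjI allI)
 fix R
 obtain C where "\<forall>x. norm x \<le> R --> \<bar>w x\<bar> \<le> C" using b by blast
 thus "integrable lborel (\<lambda>x. indicator (cball 0 R) x * w x)"
  by (intro integrable_bounded_support[where C = "max C 0" and R = R]) (auto simp: indicator_def)
qed simp

lemma ln_weight_mono: "norm x \<le> R ==> ln_weight x \<le> ln (1 + R)"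
 unfolding ln_weight_def by (intro ln_mono) (auto intro: add_pos_nonneg)

lemma log_potential_locally_bounded:
 fixes f :: "'n::finite sfun"
 assumes N: "CARD('n) \<ge> 2" and f: "log_class f"
 shows "\<exists>C\<ge>0. \<forall>x. norm x \<le> R --> \<bar>log_potential f x\<bar> \<le> C"
proof -
 obtain C where C: "C \<ge> 0" "\<And>x. \<bar>log_potential f x\<bar> \<le> C * (1 + ln_weight x)" using log_potential_bound(3)[OF N f] by blast
 show ?thesis
 proof (intro exI[of _ "C * (1 + ln (1 + \<bar>R\<bar>))"] conjI allI impI)
  show "0 \<le> C * (1 + ln (1 + \<bar>R\<bar>))" using C by simp
  fix x :: "real ^ 'n" assume "norm x \<le> R"
  hence "ln_weight x \<le> ln (1 + \<bar>R\<bar>)" by (intro ln_weight_mono) auto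
  hence "C * (1 + ln_weight x) \<le> C * (1 + ln (1 + \<bar>R\<bar>))" using C by (intro mult_left_mono) auto
  thus "\<bar>log_potential f x\<bar> \<le> C * (1 + ln (1 + \<bar>R\<bar>))" using C(2)[of x] by linarith
 qed
qed

lemma bounded_support_log_class:
 fixes F :: "'n::finite sfun"
 assumes "integrable lborel (\<lambda>x. (F x)\<^sup>2)" and [measurable]: "F \<in> Borel"
  and R: "\<And>x. norm x > R ==> F x = 0"
 shows "log_class F"
proof -
 have "integrable lborel (\<lambda>x. indicator (cball 0 R) x + (F x)\<^sup>2)"
  by (intro integrable_plus integrable_indicator_cball assms)
 hence i: "integrable lborel F"
 proof (rule integrable_dominated)
  show "AE x in lborel. norm (F x) \<le> norm (indicator (cball 0 R) x + (F x)\<^sup>2 :: real)"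
  proof (rule AE_I2)
   fix x
   have "\<bar>F x\<bar> \<le> 1 + \<bar>F x\<bar> ^ 2" by (rule le_one_plus_power) auto
   thus "norm (F x) \<le> norm (indicator (cball 0 R) x + (F x)\<^sup>2 :: real)"
    using R[of x] by (cases "norm x \<le> R") auto
  qed
 qed simp
 have "integrable lborel (\<lambda>x. ln_weight x * F x)"
 proof (rule integrable_dominated[OF integrable_mult_right[OF i, of "ln (1 + \<bar>R\<bar>)"]])
  show "AE x in lborel. norm (ln_weight x * F x) \<le> norm (ln (1 + \<bar>R\<bar>) * F x)"
  proof (rule AE_I2)
   fix x :: "real ^ 'n"
   show "norm (ln_weight x * F x) \<le> norm (ln (1 + \<bar>R\<bar>) * F x)"
   proof (cases "norm x \<le> R")
    case True
    hence "ln_weight x \<le> ln (1 + \<bar>R\<bar>)" by (intro ln_weight_mono) auto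
    thus ?thesis using ln_weight_nonneg[of x] by (simp add: abs_mult mult_right_mono)
   qed (simp add: R)
  qed
 qed simp
 thus ?thesis using i assms by (simp add: log_class_def)
qed

lemma wgrad_log_potential:
 fixes f :: "'n::finite sfun"
 assumes N: "CARD('n) \<ge> 2" and f: "log_class f" and f3: "integrable lborel (\<lambda>x. \<bar>f x\<bar> ^ 3)"
 shows "wgrad (log_potential f) (\<lambda>x. - log_field f x)"
proof -
 note L = log_classD[OF f]
 have [measurable]: "f \<in> Borel" using L by auto
 note I = log_field_integrable[OF N L(1) f3]
 obtain B where B: "\<And>x. norm (log_field f x) \<le> B" using I(3) by blast
 show ?thesis unfolding wgrad_def
 proof (intro conjI ballI allI)
  show "locint (log_potential f)"
   using log_potential_locally_bounded[OF N f] by (intro bounded_locint) auto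
  show "locint (\<lambda>x. (- log_field f x) $ i)" for i
  proof (rule bounded_locint)
   show "\<exists>C. \<forall>x. norm x \<le> R --> \<bar>(- log_field f x) $ i\<bar> \<le> C" for R
    using order.trans[OF component_le_norm_cart[of "- log_field f _" i]] B by (intro exI[of _ B]) auto
  qed measurable
  fix \<phi> :: "'n sfun" and i assume p: "\<phi> \<in> test_functions UNIV"
  note T = test_functionD[OF p]
  have [measurable]: "\<phi> \<in> Borel" "partial_deriv i \<phi> \<in> Borel" by (rule T)+
  obtain R C where RC: "\<And>x. \<bar>\<phi> x\<bar> \<le> C" "\<And>x. \<bar>partial_deriv i \<phi> x\<bar> \<le> C" "\<And>x. norm x > R ==> \<phi> x = 0"
    "\<And>x. norm x > R ==> partial_deriv i \<phi> x = 0" using T(4)[of i] by blast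
  have bs: "log_class F" if [measurable]: "F \<in> Borel" and F: "\<And>x. \<bar>F x\<bar> \<le> C" "\<And>x. norm x > R ==> F x = 0"
   for F :: "'n sfun"
  proof (rule bounded_support_log_class[OF _ _ F(2)])
   show "integrable lborel (\<lambda>x. (F x)\<^sup>2)"
   proof (rule integrable_bounded_support[where C = "C\<^sup>2" and R = R])
    show "\<bar>(F x)\<^sup>2\<bar> \<le> C\<^sup>2" for x using power_mono[OF F(1)[of x], of 2] by simp
   qed (use F in auto)
  qed auto
  have c1: "log_class (partial_deriv i \<phi>)" by (rule bs) (use RC in auto)
  have c2: "integrable lborel \<phi>" by (rule log_classD(1)[OF bs]) (use RC in auto)
  have shift: "(LBINT x. log_kernel (x - y) * partial_deriv i \<phi> x) = (LBINT x. inv_field (x - y) $ i * \<phi> x)" for y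
  proof -
   have "(LBINT x. log_kernel (x - y) * partial_deriv i \<phi> x) = (LBINT x. log_kernel x * partial_deriv i \<phi> (x + y))"
    using integral_lborel_shift(1)[of "\<lambda>x. log_kernel (x - y) * partial_deriv i \<phi> x" y] by simp
   also have "... = (LBINT x. inv_field x $ i * \<phi> (x + y))"
   proof (rule log_kernel_weak_derivative[OF N, where C = C and R = "R + norm y"])
    show "ddiff i (\<lambda>x. \<phi> (x + y)) (\<lambda>x. partial_deriv i \<phi> (x + y))"
     using ddiff_shift[OF T(3), of i "- y"] by simp
    show "\<phi> (x + y) = 0" if "norm x > R + norm y" for x
     using that norm_triangle_ineq4[of "x + y" y] by (intro RC) simp
   qed (use RC in auto)
   also have "... = (LBINT x. inv_field (x - y) $ i * \<phi> x)"
    using integral_lborel_shift(1)[of "\<lambda>x. inv_field (x - y) $ i * \<phi> x" y] by simp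
   finally show ?thesis .
  qed
  have "(LBINT x. log_potential f x * partial_deriv i \<phi> x) = log_form (partial_deriv i \<phi>) f"
   by (rule log_form_potential[OF N c1 f, symmetric])
  also have "... = (LBINT y. LBINT x. log_kernel (x - y) * (partial_deriv i \<phi> x * f y))"
   unfolding log_form_def by (rule lborel_pair.integral_snd[OF log_integrable2[OF N c1 f], symmetric])
  also have "... = (LBINT y. f y * (LBINT x. log_kernel (x - y) * partial_deriv i \<phi> x))"
   by (simp add: mult_ac flip: integral_mult_right_zero)
  also have "... = (LBINT y. LBINT x. f y * (inv_field (x - y) $ i * \<phi> x))"
   unfolding shift by simp
  also have "... = (LBINT x. LBINT y. f y * (inv_field (x - y) $ i * \<phi> x))"
  proof (rule lborel_pair.Fubini_integral)
   show "integrable (lborel \<Otimes>\<^sub>M lborel) (\<lambda>(x, y). f y * (inv_field (x - y) $ i * \<phi> x))"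
   proof (rule integrable_dominated[OF I(2)[OF c2]])
    show "AE p in lborel \<Otimes>\<^sub>M lborel. norm (case p of (x, y) => f y * (inv_field (x - y) $ i * \<phi> x))
      \<le> norm (case p of (x, y) => \<bar>f y\<bar> * (\<bar>\<phi> x\<bar> / norm (x - y)))"
    proof (rule AE_I2, clarify)
     fix x y :: "real ^ 'n"
     have "\<bar>inv_field (x - y) $ i\<bar> \<le> 1 / norm (x - y)"
      using component_le_norm_cart[of "inv_field (x - y)" i] by (simp add: norm_inv_field)
     from mult_right_mono[OF this, of "\<bar>f y\<bar> * \<bar>\<phi> x\<bar>"]
     show "norm (f y * (inv_field (x - y) $ i * \<phi> x)) \<le> norm (\<bar>f y\<bar> * (\<bar>\<phi> x\<bar> / norm (x - y)))"
      by (simp add: abs_mult mult_ac)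
    qed
   qed measurable
  qed
  also have "... = (LBINT x. log_field f x $ i * \<phi> x)"
  proof (intro integral_eqI refl)
   fix x
   have "log_field f x $ i = (LBINT y. (f y *\<^sub>R inv_field (x - y)) $ i)"
    unfolding log_field_def by (rule integral_bounded_linear[OF bounded_linear_vec_nth I(1), symmetric])
   thus "(LBINT y. f y * (inv_field (x - y) $ i * \<phi> x)) = log_field f x $ i * \<phi> x"
    by (simp add: mult_ac flip: integral_mult_right_zero)
  qed
  finally show "(LBINT x. log_potential f x * partial_deriv i \<phi> x) = - (LBINT x. (- log_field f x) $ i * \<phi> x)"
   by simp
 qed
qed

section \<open>Nondegeneracy\<close>

lemma kdiv1_nonneg: "CARD('n::finite) \<ge> 2 ==> 0 \<le> kdiv 1 e (z :: real ^ 'n)"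
 unfolding kdiv_def by (intro mult_nonneg_nonneg add_nonneg_nonneg) auto

text \<open>In dimension two \<open>kdiv 1\<close> concentrates at the origin and the mass is supplied by
 \<open>autocorrelation_lower_bound\<close>; in higher dimensions it stays bounded below on bounded sets.\<close>

lemma kdiv1_double_integral_lower:
 fixes A :: "(real ^ 'n::finite) set"
 assumes N: "CARD('n) \<ge> 2" and A [measurable]: "A \<in> sets borel" and fin: "emeasure lborel A < \<infinity>"
  and pos: "measure lborel A > 0" and R: "\<And>x. x \<in> A ==> norm x \<le> R"
 shows "\<exists>c>0. \<exists>\<delta>>0. \<forall>e. 0 < e \<and> e < \<delta> -->
  ennreal c \<le> (NNINT x. indicator A x * (NNINT y. indicator A y * ennreal (kdiv 1 e (y - x))))"
proof -
 define m where "m = measure lborel A"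
 have m: "emeasure lborel A = ennreal m" "m > 0" using fin pos unfolding m_def by (auto intro!: emeasure_eq_ennreal_measure)
 have sq: "(rsq e z) powr (- 1 - 1) = 1 / (rsq e z)\<^sup>2" if "e > 0" for e and z :: "real ^ 'n"
 proof -
  have p: "(norm z)\<^sup>2 + e\<^sup>2 > 0" using that by (intro add_nonneg_pos) auto
  have "(rsq e z) powr (- 1 - 1) = 1 / (rsq e z) powr 2" by (simp add: powr_minus_divide)
  thus ?thesis using p by (simp add: powr_numeral)
 qed
 show ?thesis
 proof (cases "CARD('n) = 2")
  case True
  obtain \<delta> where \<delta>: "\<delta> > 0" "\<And>e. 0 < e ==> e < \<delta> ==>
    ennreal (unit_ball_vol (real CARD('n)) * e ^ CARD('n) * (measure lborel A / 2))
    \<le> (NNINT x. indicator A x * (NNINT y. indicator A y * indicator (cball 0 e) (y - x)))"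
   using autocorrelation_lower_bound[OF A fin pos] by blast
  let ?c = "unit_ball_vol (real CARD('n)) * m / 4"
  show ?thesis
  proof (rule exI[of _ ?c], rule conjI[rotated], rule exI[of _ \<delta>], intro conjI allI impI)
   show "0 < ?c" using m by simp
   fix e assume e: "0 < e \<and> e < \<delta>"
   have kk: "1 / (2 * e\<^sup>2) \<le> kdiv 1 e z" if "norm z \<le> e" for z :: "real ^ 'n"
   proof -
    have p: "(norm z)\<^sup>2 + e\<^sup>2 > 0" using e by (intro add_nonneg_pos) auto
    have "(norm z)\<^sup>2 \<le> e\<^sup>2" using that by (intro power_mono) auto
    hence "(rsq e z)\<^sup>2 \<le> (2 * e\<^sup>2)\<^sup>2" using p by (intro power_mono) auto
    hence "2 * e\<^sup>2 / (2 * e\<^sup>2)\<^sup>2 \<le> 2 * e\<^sup>2 / (rsq e z)\<^sup>2"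
     using e p by (intro divide_left_mono) auto
    moreover have "2 * e\<^sup>2 / (2 * e\<^sup>2)\<^sup>2 = 1 / (2 * e\<^sup>2)" using e by (simp add: power2_eq_square)
    moreover have "kdiv 1 e z = 2 * e\<^sup>2 / (rsq e z)\<^sup>2"
     using sq[of e z] e True by (simp add: kdiv_def)
    ultimately show ?thesis by simp
   qed
   have "ennreal ?c = ennreal (1 / (2 * e\<^sup>2)) * ennreal (unit_ball_vol (real CARD('n)) * e ^ CARD('n) * (m / 2))"
    using e m True by (subst ennreal_mult[symmetric]) (auto simp: field_simps)
   also have "... \<le> ennreal (1 / (2 * e\<^sup>2)) * (NNINT x. indicator A x * (NNINT y. indicator A y * indicator (cball 0 e) (y - x)))"
    using \<delta>(2)[of e] e by (intro mult_left_mono) (auto simp: m_def)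
   also have "... = (NNINT x. ennreal (1 / (2 * e\<^sup>2)) * (indicator A x * (NNINT y. indicator A y * indicator (cball 0 e) (y - x))))"
    by (rule nn_integral_cmult[symmetric]) measurable
   also have "... \<le> (NNINT x. indicator A x * (NNINT y. indicator A y * ennreal (kdiv 1 e (y - x))))"
   proof (rule nn_integral_mono)
    fix x :: "real ^ 'n"
    have "ennreal (1 / (2 * e\<^sup>2)) * (NNINT y. indicator A y * indicator (cball 0 e) (y - x))
      = (NNINT y. ennreal (1 / (2 * e\<^sup>2)) * (indicator A y * indicator (cball 0 e) (y - x)))"
     by (rule nn_integral_cmult[symmetric]) measurable
    also have "... \<le> (NNINT y. indicator A y * ennreal (kdiv 1 e (y - x)))"
     using kk by (intro nn_integral_mono) (auto simp: indicator_def intro!: ennreal_leI)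
    finally have "indicator A x * (ennreal (1 / (2 * e\<^sup>2)) * (NNINT y. indicator A y * indicator (cball 0 e) (y - x)))
      \<le> indicator A x * (NNINT y. indicator A y * ennreal (kdiv 1 e (y - x)))" by (intro mult_left_mono) auto
    thus "ennreal (1 / (2 * e\<^sup>2)) * (indicator A x * (NNINT y. indicator A y * indicator (cball 0 e) (y - x)))
      \<le> indicator A x * (NNINT y. indicator A y * ennreal (kdiv 1 e (y - x)))"
     by (simp only: mult.left_commute)
   qed
   finally show "ennreal ?c \<le> (NNINT x. indicator A x * (NNINT y. indicator A y * ennreal (kdiv 1 e (y - x))))" .
  qed (use \<delta> in auto)
 next
  case False
  hence N3: "real CARD('n) \<ge> 3" using N by linarith
  let ?k = "1 / ((2 * R)\<^sup>2 + 1)" let ?c = "?k * (m * m)"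
  have kp: "?k > 0" by (intro divide_pos_pos add_nonneg_pos) auto
  show ?thesis
  proof (rule exI[of _ ?c], rule conjI[rotated], rule exI[of _ 1], intro conjI allI impI)
   show "0 < ?c" using m kp by simp
   fix e :: real assume e: "0 < e \<and> e < 1"
   have kk: "?k \<le> kdiv 1 e (y - x)" if "x \<in> A" "y \<in> A" for x y
   proof -
    let ?z = "y - x"
    have p: "(norm ?z)\<^sup>2 + e\<^sup>2 > 0" using e by (intro add_nonneg_pos) auto
    have "norm ?z \<le> 2 * R" using R[OF that(1)] R[OF that(2)] norm_triangle_ineq4[of y x] by linarith
    hence "(norm ?z)\<^sup>2 \<le> (2 * R)\<^sup>2" by (intro power_mono) auto
    moreover have "e\<^sup>2 \<le> 1" using e by (simp add: power_le_one)
    ultimately have "?k \<le> 1 / ((norm ?z)\<^sup>2 + e\<^sup>2)" using p kp by (intro divide_left_mono) (auto intro: mult_pos_pos add_nonneg_pos)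
    also have "... = ((norm ?z)\<^sup>2 + e\<^sup>2) * (1 / ((norm ?z)\<^sup>2 + e\<^sup>2)\<^sup>2)" using p by (simp add: power2_eq_square)
    also have "... \<le> kdiv 1 e ?z"
     unfolding kdiv_def using e N3
    proof (subst sq, simp, intro mult_right_mono)
     have "1 * (norm ?z)\<^sup>2 \<le> (real CARD('n) - 2 * 1) * (norm ?z)\<^sup>2" using N3 by (intro mult_right_mono) auto
     moreover have "1 * e\<^sup>2 \<le> real CARD('n) * e\<^sup>2" using N3 by (intro mult_right_mono) auto
     ultimately show "(norm ?z)\<^sup>2 + e\<^sup>2 \<le> (real CARD('n) - 2 * 1) * (norm ?z)\<^sup>2 + real CARD('n) * e\<^sup>2" by linarith
    qed simp
    finally show ?thesis .
   qed
   have "ennreal ?c = (NNINT x. indicator A x * (ennreal ?k * ennreal m))"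
    using m kp by (subst nn_integral_multc) (auto simp: mult_ac ennreal_mult[symmetric])
   also have "... \<le> (NNINT x. indicator A x * (NNINT y. indicator A y * ennreal (kdiv 1 e (y - x))))"
   proof (rule nn_integral_mono)
    fix x
    show "indicator A x * (ennreal ?k * ennreal m) \<le> indicator A x * (NNINT y. indicator A y * ennreal (kdiv 1 e (y - x)))"
    proof (cases "x \<in> A")
     case True
     have "ennreal ?k * ennreal m = (NNINT y. ennreal ?k * indicator A y)"
      unfolding m(1)[symmetric] by (rule nn_integral_cmult_indicator[symmetric]) simp
     also have "... \<le> (NNINT y. indicator A y * ennreal (kdiv 1 e (y - x)))"
      using kk[OF True] by (intro nn_integral_mono) (auto simp: indicator_def intro!: ennreal_leI)
     finally show ?thesis using True by simp
    qed simp
   qed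
   finally show "ennreal ?c \<le> (NNINT x. indicator A x * (NNINT y. indicator A y * ennreal (kdiv 1 e (y - x))))" .
  qed simp
 qed
qed

lemma positivity_set:
 fixes \<psi> f :: "'n::finite sfun"
 assumes [measurable]: "\<psi> \<in> Borel" "f \<in> Borel"
  and \<psi>0: "\<And>x. 0 \<le> \<psi> x" and sup: "AE x in lborel. \<psi> x > 0 --> f x > 0"
  and neg: "\<not> (AE x in lborel. \<psi> x = 0)"
 shows "\<exists>k::nat. measure lborel {x. inverse (real (Suc k)) < \<psi> x \<and> inverse (real (Suc k)) < f x \<and> norm x \<le> real k} > 0"
proof (rule ccontr)
 define A where "A k = {x :: real ^ 'n. inverse (real (Suc k)) < \<psi> x \<and> inverse (real (Suc k)) < f x \<and> norm x \<le> real k}" for k :: nat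
 have [measurable]: "A k \<in> sets borel" for k unfolding A_def by measurable
 have fin: "emeasure lborel (A k) < \<infinity>" for k
 proof -
  have "emeasure lborel (A k) \<le> emeasure lborel (cball (0 :: real ^ 'n) (real k))" by (rule emeasure_mono) (auto simp: A_def)
  thus ?thesis using emeasure_lborel_cball_finite[of "0 :: real ^ 'n" "real k"] by (rule le_less_trans)
 qed
 assume "\<not> ?thesis"
 hence "\<not> measure lborel (A k) > 0" for k unfolding A_def by blast
 hence "measure lborel (A k) = 0" for k using measure_nonneg[of lborel "A k"] by (metis less_eq_real_def)
 hence "emeasure lborel (A k) = 0" for k using fin[of k] by (simp add: emeasure_eq_ennreal_measure less_top)
 hence "A k \<in> null_sets lborel" for k by (intro null_setsI) auto
 hence "AE x in lborel. x \<notin> A k" for k by (rule AE_not_in)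
 hence "AE x in lborel. \<forall>k. x \<notin> A k" by (subst AE_all_countable) auto
 hence "AE x in lborel. \<psi> x = 0" using sup
 proof eventually_elim
  case (elim x)
  show ?case
  proof (rule ccontr)
   assume "\<psi> x \<noteq> 0"
   hence p: "\<psi> x > 0" "f x > 0" using \<psi>0[of x] elim(2) by auto
   obtain k1 where k1: "\<And>n. n \<ge> k1 ==> inverse (real (Suc n)) < \<psi> x"
    using order_tendstoD(2)[OF LIMSEQ_inverse_real_of_nat p(1)] by (auto simp: eventually_sequentially)
   obtain k2 where k2: "\<And>n. n \<ge> k2 ==> inverse (real (Suc n)) < f x"
    using order_tendstoD(2)[OF LIMSEQ_inverse_real_of_nat p(2)] by (auto simp: eventually_sequentially)
   obtain k3 where k3: "norm x \<le> real k3" using real_arch_simple by blast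
   define k where "k = max k1 (max k2 k3)"
   have "norm x \<le> real k" using k3 by (rule order.trans) (simp add: k_def)
   hence "x \<in> A k" unfolding A_def using k1[of k] k2[of k] by (simp add: k_def)
   thus False using elim(1) by blast
  qed
 qed
 thus False using neg by simp
qed

text \<open>The integral of \<open>\<Psi> \<bullet> log_field f\<close> is the limit of minus the double integrals of \<open>\<psi> f\<close> against \<open>kdiv 1\<close>. These
 stay away from zero if \<open>\<psi>\<close> and \<open>f\<close> exceed a positive constant on a common set of positive measure.\<close>

lemma superharmonic_pairing:
 fixes f \<psi> :: "'n::finite sfun"
 assumes N: "CARD('n) \<ge> 2" and f: "integrable lborel f" "integrable lborel (\<lambda>x. \<bar>f x\<bar> ^ 3)" and f0: "\<And>x. 0 \<le> f x"
  and \<psi>: "wgrad \<psi> \<Psi>" "integrable lborel \<psi>" "integrable lborel \<Psi>" and \<psi>0: "\<And>x. 0 \<le> \<psi> x"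
  and orth: "AE x in lborel. \<Psi> x \<bullet> log_field f x = 0"
  and sup: "AE x in lborel. \<psi> x > 0 --> f x > 0"
 shows "AE x in lborel. \<psi> x = 0"
proof (rule ccontr)
 assume neg: "\<not> (AE x in lborel. \<psi> x = 0)"
 have [measurable]: "f \<in> Borel" "\<psi> \<in> Borel" "\<Psi> \<in> Borel"
  using f \<psi> by auto
 obtain k where k: "measure lborel {x. inverse (real (Suc k)) < \<psi> x \<and> inverse (real (Suc k)) < f x \<and> norm x \<le> real k} > 0"
  using positivity_set[OF _ _ \<psi>0 sup neg] by auto
 define \<tau> where "\<tau> = inverse (real (Suc k))"
 have \<tau>: "\<tau> > 0" by (simp add: \<tau>_def)
 define A where "A = {x. \<tau> < \<psi> x \<and> \<tau> < f x \<and> norm x \<le> real k}"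
 have [measurable]: "A \<in> sets borel" unfolding A_def by measurable
 have Afin: "emeasure lborel A < \<infinity>"
 proof -
  have "emeasure lborel A \<le> emeasure lborel (cball (0 :: real ^ 'n) (real k))" by (rule emeasure_mono) (auto simp: A_def)
  thus ?thesis using emeasure_lborel_cball_finite[of "0 :: real ^ 'n" "real k"] by (rule le_less_trans)
 qed
 have Ab: "A \<in> sets borel" and Apos: "measure lborel A > 0" and AR: "\<And>x. x \<in> A ==> norm x \<le> real k"
  using k by (simp_all add: A_def \<tau>_def)
 obtain c \<delta> where c: "c > 0" "\<delta> > 0" "\<And>e. 0 < e ==> e < \<delta> ==>
  ennreal c \<le> (NNINT x. indicator A x * (NNINT y. indicator A y * ennreal (kdiv 1 e (y - x))))"
  using kdiv1_double_integral_lower[OF N Ab Afin Apos AR] by blast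
 define e where "e n = inverse (real (Suc n))" for n
 have e: "e n > 0" for n by (simp add: e_def)
 have \<Psi>n: "integrable lborel (\<lambda>x. norm (\<Psi> x))" by (rule integrable_norm[OF \<psi>(3)])
 note dom = log_field_integrable(2)[OF N f \<Psi>n]
 define h where "h n = (\<lambda>(x, y). f y * (\<Psi> x \<bullet> kern 1 (e n) (x - y)))" for n
 define h0 where "h0 = (\<lambda>(x, y). f y * (\<Psi> x \<bullet> inv_field (x - y)))"
 have [measurable]: "h n \<in> borel_measurable (lborel \<Otimes>\<^sub>M lborel)" for n unfolding h_def by measurable
 have [measurable]: "h0 \<in> borel_measurable (lborel \<Otimes>\<^sub>M lborel)" unfolding h0_def by measurable
 have b: "norm (h n p) \<le> (\<lambda>(x, y). \<bar>f y\<bar> * (\<bar>norm (\<Psi> x)\<bar> / norm (x - y))) p" for n p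
 proof -
  obtain x y where p: "p = (x, y)" by (cases p)
  have "\<bar>\<Psi> x \<bullet> kern 1 (e n) (x - y)\<bar> \<le> norm (\<Psi> x) * norm (kern 1 (e n) (x - y))" by (rule Cauchy_Schwarz_ineq2)
  also have "... \<le> norm (\<Psi> x) * (1 / norm (x - y))" by (intro mult_left_mono norm_kern1_le e) auto
  finally have "\<bar>f y\<bar> * \<bar>\<Psi> x \<bullet> kern 1 (e n) (x - y)\<bar> \<le> \<bar>f y\<bar> * (norm (\<Psi> x) * (1 / norm (x - y)))" by (intro mult_left_mono) auto
  thus ?thesis by (simp add: p abs_mult h_def)
 qed
 have lim: "(\<lambda>n. h n p) \<longlonglongrightarrow> h0 p" for p
 proof -
  obtain x y where p: "p = (x, y)" by (cases p)
  show ?thesis unfolding p e_def h_def h0_def by (auto intro!: tendsto_intros kern1_tendsto simp del: of_nat_Suc)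
 qed
 have ih: "integrable (lborel \<Otimes>\<^sub>M lborel) (h n)" for n
  by (rule integrable_dominated[OF dom]) (use b in \<open>auto intro!: AE_I2 intro: order.trans[OF _ abs_ge_self]\<close>)
 have ih0: "integrable (lborel \<Otimes>\<^sub>M lborel) h0"
  by (rule integrable_dominated_convergence[where s = h, OF _ _ dom]) (use lim b in auto)
 have L: "(\<lambda>n. integral\<^sup>L (lborel \<Otimes>\<^sub>M lborel) (h n)) \<longlonglongrightarrow> integral\<^sup>L (lborel \<Otimes>\<^sub>M lborel) h0"
  by (rule integral_dominated_convergence[where s = h, OF _ _ dom]) (use lim b in auto)
 have "integral\<^sup>L (lborel \<Otimes>\<^sub>M lborel) h0 = (LBINT x. LBINT y. f y * (\<Psi> x \<bullet> inv_field (x - y)))"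
  unfolding h0_def by (rule lborel_pair.integral_fst[OF ih0[unfolded h0_def], symmetric])
 also have "... = (LBINT x. \<Psi> x \<bullet> log_field f x)"
 proof (intro integral_eqI refl)
  fix x
  have "(LBINT y. \<Psi> x \<bullet> (f y *\<^sub>R inv_field (x - y))) = \<Psi> x \<bullet> log_field f x"
   unfolding log_field_def by (rule integral_inner_right) (rule log_field_integrable(1)[OF N f])
  thus "(LBINT y. f y * (\<Psi> x \<bullet> inv_field (x - y))) = \<Psi> x \<bullet> log_field f x" by simp
 qed
 also have "... = 0" by (rule integral_eq_zero_AE[OF orth])
 finally have L0: "(\<lambda>n. integral\<^sup>L (lborel \<Otimes>\<^sub>M lborel) (h n)) \<longlonglongrightarrow> 0" using L by simp
 have low: "\<tau> * (\<tau> * c) \<le> - integral\<^sup>L (lborel \<Otimes>\<^sub>M lborel) (h n)" if n: "e n < \<delta>" for n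
 proof -
  note id = wgrad_kern_identity[OF \<psi> e[of n], of 1]
  have sw: "(LBINT x. f y * (\<Psi> x \<bullet> kern 1 (e n) (x - y))) = - (f y * (LBINT x. \<psi> x * kdiv 1 (e n) (x - y)))" for y
   using id(1)[of y] by simp
  have r: "integral\<^sup>L (lborel \<Otimes>\<^sub>M lborel) (h n) = (LBINT y. - (f y * (LBINT x. \<psi> x * kdiv 1 (e n) (x - y))))"
   using lborel_pair.integral_snd[OF ih[of n, unfolded h_def]] unfolding sw h_def by simp
  have ir: "integrable lborel (\<lambda>y. - (f y * (LBINT x. \<psi> x * kdiv 1 (e n) (x - y))))"
   using lborel_pair.integrable_snd[OF ih[of n, unfolded h_def]] unfolding sw by simp
  hence ir': "integrable lborel (\<lambda>y. f y * (LBINT x. \<psi> x * kdiv 1 (e n) (x - y)))" by simp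
  have i0: "0 \<le> (LBINT x. \<psi> x * kdiv 1 (e n) (x - y))" for y
   using \<psi>0 kdiv1_nonneg[OF N] by (intro integral_nonneg_AE) auto
  have "ennreal (\<tau> * (\<tau> * c)) = ennreal \<tau> * (ennreal \<tau> * ennreal c)" using \<tau> c by (simp add: ennreal_mult)
  also have "... \<le> ennreal \<tau> * (ennreal \<tau> * (NNINT y. indicator A y * (NNINT x. indicator A x * ennreal (kdiv 1 (e n) (x - y)))))"
   by (intro mult_left_mono c(3) e n) auto
  also have "... = ennreal \<tau> * (NNINT y. ennreal \<tau> * (indicator A y * (NNINT x. indicator A x * ennreal (kdiv 1 (e n) (x - y)))))"
   by (subst nn_integral_cmult) auto
  also have "... = (NNINT y. ennreal \<tau> * (ennreal \<tau> * (indicator A y * (NNINT x. indicator A x * ennreal (kdiv 1 (e n) (x - y))))))"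
   by (rule nn_integral_cmult[symmetric]) measurable
  also have "... \<le> (NNINT y. ennreal (f y * (LBINT x. \<psi> x * kdiv 1 (e n) (x - y))))"
  proof (rule nn_integral_mono)
   fix y
   show "ennreal \<tau> * (ennreal \<tau> * (indicator A y * (NNINT x. indicator A x * ennreal (kdiv 1 (e n) (x - y)))))
     \<le> ennreal (f y * (LBINT x. \<psi> x * kdiv 1 (e n) (x - y)))"
   proof (cases "y \<in> A")
    case True
    have "ennreal \<tau> * (NNINT x. indicator A x * ennreal (kdiv 1 (e n) (x - y)))
     = (NNINT x. ennreal \<tau> * (indicator A x * ennreal (kdiv 1 (e n) (x - y))))"
     by (rule nn_integral_cmult[symmetric]) measurable
    also have "... \<le> (NNINT x. ennreal (\<psi> x * kdiv 1 (e n) (x - y)))"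
    proof (rule nn_integral_mono)
     fix x
     show "ennreal \<tau> * (indicator A x * ennreal (kdiv 1 (e n) (x - y))) \<le> ennreal (\<psi> x * kdiv 1 (e n) (x - y))"
      using kdiv1_nonneg[OF N, of "e n" "x - y"] \<tau>
      by (cases "x \<in> A") (auto simp: A_def ennreal_mult[symmetric] intro!: ennreal_leI mult_right_mono)
    qed
    also have "... = ennreal (LBINT x. \<psi> x * kdiv 1 (e n) (x - y))"
     using id(2)[of y] \<psi>0 kdiv1_nonneg[OF N] by (intro nn_integral_eq_integral) auto
    finally have "ennreal \<tau> * (ennreal \<tau> * (NNINT x. indicator A x * ennreal (kdiv 1 (e n) (x - y))))
      \<le> ennreal (f y) * ennreal (LBINT x. \<psi> x * kdiv 1 (e n) (x - y))"
     using True by (intro mult_mono ennreal_leI) (auto simp: A_def)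
    also have "... = ennreal (f y * (LBINT x. \<psi> x * kdiv 1 (e n) (x - y)))"
     by (rule ennreal_mult[OF f0 i0, symmetric])
    finally show ?thesis using True by simp
   qed simp
  qed
  also have "... = ennreal (LBINT y. f y * (LBINT x. \<psi> x * kdiv 1 (e n) (x - y)))"
   by (rule nn_integral_eq_integral[OF ir']) (use f0 i0 in auto)
  also have "(LBINT y. f y * (LBINT x. \<psi> x * kdiv 1 (e n) (x - y))) = - integral\<^sup>L (lborel \<Otimes>\<^sub>M lborel) (h n)"
   unfolding r by simp
  finally have le: "ennreal (\<tau> * (\<tau> * c)) \<le> ennreal (- integral\<^sup>L (lborel \<Otimes>\<^sub>M lborel) (h n))" .
  show ?thesis
  proof (cases "0 \<le> - integral\<^sup>L (lborel \<Otimes>\<^sub>M lborel) (h n)")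
   case True
   thus ?thesis using le by (subst (asm) ennreal_le_iff) auto
  next
   case False
   hence "ennreal (\<tau> * (\<tau> * c)) = 0" using le by (simp add: ennreal_neg)
   thus ?thesis using \<tau> c(1) by (simp add: mult_le_0_iff)
  qed
 qed
 have cp: "\<tau> * (\<tau> * c) > 0" using \<tau> c by simp
 have "eventually (\<lambda>n. e n < \<delta>) sequentially"
  unfolding e_def by (rule order_tendstoD(2)[OF LIMSEQ_inverse_real_of_nat c(2)])
 moreover have "eventually (\<lambda>n. integral\<^sup>L (lborel \<Otimes>\<^sub>M lborel) (h n) > - (\<tau> * (\<tau> * c))) sequentially"
  using cp by (intro order_tendstoD(1)[OF L0]) auto
 ultimately have "eventually (\<lambda>n::nat. False) sequentially"
  by eventually_elim (use low in force)
 thus False by simp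
qed

lemma continuous_bounded_on_interval:
 fixes f :: "real => real"
 assumes "continuous_on UNIV f" "\<And>t. t \<notin> {a..b} ==> f t = 0"
 shows "\<exists>M. \<forall>t. \<bar>f t\<bar> \<le> M"
proof -
 have "compact (f ` {a..b})" using assms(1) by (intro compact_continuous_image) (auto intro: continuous_on_subset)
 hence "bounded (f ` {a..b})" by (rule compact_imp_bounded)
 then obtain M where "\<forall>t\<in>{a..b}. \<bar>f t\<bar> \<le> M" unfolding bounded_iff by auto
 hence "\<bar>f t\<bar> \<le> max M 0" for t using assms(2)[of t] by (cases "t \<in> {a..b}") (auto simp: le_max_iff_disj)
 thus ?thesis by blast
qed

text \<open>The truncation lives where \<open>|u| \<ge> \<tau>\<close>, a set of finite measure.\<close>

lemma truncation_sobolev: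
 fixes u :: "'n::finite sfun"
 assumes N: "CARD('n) \<ge> 2" and u: "sobolev_fun u v"
  and F: "\<And>t. (F has_real_derivative F' t) (at t)" and F'c: "continuous_on UNIV F'"
  and M: "\<And>t. \<bar>F' t\<bar> \<le> M" "\<And>t. \<bar>F t\<bar> \<le> M" and \<tau>: "\<tau> > 0" "\<And>t. \<bar>t\<bar> < \<tau> ==> F t = 0 \<and> F' t = 0"
 shows "wgrad (\<lambda>x. F (u x)) (\<lambda>x. F' (u x) *\<^sub>R v x)" "integrable lborel (\<lambda>x. F (u x))"
  "integrable lborel (\<lambda>x. F' (u x) *\<^sub>R v x)"
proof -
 let ?n = "CARD('n)"
 note U = sobolev_funD[OF u]
 note [measurable] = U(4,5)
 have [measurable]: "F' \<in> Borel" using F'c by (rule borel_measurable_continuous_onI)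
 have [measurable]: "F \<in> Borel"
  using F by (intro borel_measurable_continuous_onI) (auto intro: DERIV_isCont continuous_at_imp_continuous_on)
 have M0: "M \<ge> 0" using M(1)[of 0] by linarith
 show "wgrad (\<lambda>x. F (u x)) (\<lambda>x. F' (u x) *\<^sub>R v x)" by (rule wgrad_chain[OF U(1) F F'c M(1)])
 have lev: "1 \<le> 1 / \<tau> ^ ?n * \<bar>u x\<bar> ^ ?n" if "\<not> \<bar>u x\<bar> < \<tau>" for x
  using power_mono[of \<tau> "\<bar>u x\<bar>" ?n] that \<tau>(1) by simp
 show "integrable lborel (\<lambda>x. F (u x))"
 proof (rule integrable_dominated[OF integrable_mult_right[OF U(2), of "M * (1 / \<tau> ^ ?n)"]])
  show "AE x in lborel. norm (F (u x)) \<le> norm (M * (1 / \<tau> ^ ?n) * \<bar>u x\<bar> ^ ?n)"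
  proof (rule AE_I2)
   fix x
   show "norm (F (u x)) \<le> norm (M * (1 / \<tau> ^ ?n) * \<bar>u x\<bar> ^ ?n)"
   proof (cases "\<bar>u x\<bar> < \<tau>")
    case False
    have "\<bar>F (u x)\<bar> * 1 \<le> M * (1 / \<tau> ^ ?n * \<bar>u x\<bar> ^ ?n)" using M(2) lev[OF False] M0 by (intro mult_mono) auto
    also have "... \<le> norm (M * (1 / \<tau> ^ ?n) * \<bar>u x\<bar> ^ ?n)"
     unfolding real_norm_def mult.assoc by (rule abs_ge_self)
    finally show ?thesis by simp
   qed (use \<tau>(2)[of "u x"] in simp)
  qed
 qed simp
 show "integrable lborel (\<lambda>x. F' (u x) *\<^sub>R v x)"
 proof (rule integrable_dominated)
  show "integrable lborel (\<lambda>x. M * (1 / \<tau> ^ ?n * \<bar>u x\<bar> ^ ?n + norm (v x) ^ ?n))"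
   by (intro integrable_mult_right integrable_plus U)
  show "AE x in lborel. norm (F' (u x) *\<^sub>R v x) \<le> norm (M * (1 / \<tau> ^ ?n * \<bar>u x\<bar> ^ ?n + norm (v x) ^ ?n))"
  proof (rule AE_I2)
   fix x
   show "norm (F' (u x) *\<^sub>R v x) \<le> norm (M * (1 / \<tau> ^ ?n * \<bar>u x\<bar> ^ ?n + norm (v x) ^ ?n))"
   proof (cases "\<bar>u x\<bar> < \<tau>")
    case False
    have "norm (v x) \<le> 1 + norm (v x) ^ ?n" using N by (intro le_one_plus_power) auto
    hence "norm (v x) \<le> 1 / \<tau> ^ ?n * \<bar>u x\<bar> ^ ?n + norm (v x) ^ ?n" using lev[OF False] by linarith
    hence "\<bar>F' (u x)\<bar> * norm (v x) \<le> M * (1 / \<tau> ^ ?n * \<bar>u x\<bar> ^ ?n + norm (v x) ^ ?n)" using M M0 by (intro mult_mono) auto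
    also have "... \<le> norm (M * (1 / \<tau> ^ ?n * \<bar>u x\<bar> ^ ?n + norm (v x) ^ ?n))"
     unfolding real_norm_def by (rule abs_ge_self)
    finally show ?thesis by simp
   qed (use \<tau>(2)[of "u x"] in simp)
  qed
 qed simp
qed

text \<open>A continuously differentiable function that is positive exactly between \<open>a\<close> and \<open>b\<close>.\<close>

definition hat :: "real => real => real => real" where
 "hat a b t = (max 0 (t - a))\<^sup>2 * (max 0 (b - t))\<^sup>2"

definition hat' :: "real => real => real => real" where
 "hat' a b t = 2 * max 0 (t - a) * (max 0 (b - t))\<^sup>2 - (max 0 (t - a))\<^sup>2 * (2 * max 0 (b - t))"

lemma hat_deriv: "(hat a b has_real_derivative hat' a b t) (at t)"
proof -
 have 1: "((\<lambda>x. x - a) has_real_derivative 1) (at t)" "((\<lambda>x. b - x) has_real_derivative - 1) (at t)"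
  by (auto intro!: derivative_eq_intros)
 have "((\<lambda>x. (max 0 (x - a))\<^sup>2) has_real_derivative 2 * max 0 (t - a)) (at t)"
  using DERIV_chain2[where f = "\<lambda>x. (max 0 x)\<^sup>2", OF max0_power2_deriv 1(1)] by simp
 moreover have "((\<lambda>x. (max 0 (b - x))\<^sup>2) has_real_derivative - (2 * max 0 (b - t))) (at t)"
  using DERIV_chain2[where f = "\<lambda>x. (max 0 x)\<^sup>2", OF max0_power2_deriv 1(2)] by simp
 ultimately show ?thesis unfolding hat_def[abs_def] hat'_def
  using DERIV_mult[of "\<lambda>x. (max 0 (x - a))\<^sup>2" "2 * max 0 (t - a)" t UNIV "\<lambda>x. (max 0 (b - x))\<^sup>2" "- (2 * max 0 (b - t))"]
  by (simp add: algebra_simps)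
qed

lemma hat_props:
 "continuous_on UNIV (hat a b)" "continuous_on UNIV (hat' a b)" "t \<notin> {a..b} ==> hat a b t = 0 \<and> hat' a b t = 0"
 "0 \<le> hat a b t" "a < t ==> t < b ==> hat a b t > 0"
 by (auto simp: hat_def[abs_def] hat'_def[abs_def] intro!: continuous_intros)

text \<open>On an interval of values without zeros of \<open>g\<close> the potential and hence its gradient vanish, so
 \<open>superharmonic_pairing\<close> excludes these values; therefore \<open>g(u) = 0\<close>. Then a truncation of \<open>G(u)\<close> has zero
 gradient, and \<open>weak_isoperimetric\<close> makes every superlevel set null.\<close>

theorem potential_nondegenerate:
 fixes u :: "'n::finite sfun" and G g :: "real => real"
 assumes N: "CARD('n) \<ge> 2" and u: "sobolev_fun u v"
  and f: "log_class f" "integrable lborel (\<lambda>x. \<bar>f x\<bar> ^ 3)" and f0: "\<And>x. 0 \<le> f x"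
  and sup: "AE x in lborel. u x \<noteq> 0 --> f x > 0"
  and G: "\<And>t. (G has_real_derivative g t) (at t)" and gc: "continuous_on UNIV g" and g0: "g 0 = 0"
  and even: "\<And>t. G (- t) = G t" and mono: "strict_mono_on {0..} G"
  and crit: "AE x in lborel. log_potential f x * g (u x) = 0"
 shows "AE x in lborel. u x = 0"
proof -
 note U = sobolev_funD[OF u]
 note [measurable] = U(4,5)
 have z: "AE x in lborel. log_potential f x = 0 --> log_field f x = 0"
  using wgrad_zero_set[OF wgrad_log_potential[OF N f]] by simp
 have step1: "AE x in lborel. \<not> (a < u x \<and> u x < b)"
  if ab: "a < b" "\<And>t. t \<in> {a..b} ==> t \<noteq> 0 \<and> g t \<noteq> 0" for a b
 proof -
  have s: "a > 0 \<or> b < 0"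
  proof (rule ccontr)
   assume "\<not> (a > 0 \<or> b < 0)"
   hence "0 \<in> {a..b}" by auto
   thus False using ab(2) by blast
  qed
  \<comment> \<open>The interval avoids zero, so it keeps a positive distance from it.\<close>
  define \<tau> where "\<tau> = (if a > 0 then a else - b)"
  have \<tau>: "\<tau> > 0" "\<And>t. \<bar>t\<bar> < \<tau> ==> t \<notin> {a..b}" using s ab(1) by (auto simp: \<tau>_def split: if_splits)
  obtain M1 where M1: "\<And>t. \<bar>hat a b t\<bar> \<le> M1" using continuous_bounded_on_interval[OF hat_props(1)] hat_props(3) by metis
  obtain M2 where M2: "\<And>t. \<bar>hat' a b t\<bar> \<le> M2" using continuous_bounded_on_interval[OF hat_props(2)] hat_props(3) by metis
  note W = truncation_sobolev[OF N u hat_deriv hat_props(2), of a b "max M1 M2" \<tau>]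
  have p: "\<And>t. \<bar>hat' a b t\<bar> \<le> max M1 M2" "\<And>t. \<bar>hat a b t\<bar> \<le> max M1 M2" "\<And>t. \<bar>t\<bar> < \<tau> ==> hat a b t = 0 \<and> hat' a b t = 0"
   using M1 M2 \<tau>(2) hat_props(3)[of _ a b] by (auto simp: le_max_iff_disj)
  have "AE x in lborel. hat a b (u x) = 0"
  proof (rule superharmonic_pairing[OF N log_classD(1)[OF f(1)] f(2) f0 W(1)[OF p(1,2) \<tau>(1) p(3)] W(2)[OF p(1,2) \<tau>(1) p(3)] W(3)[OF p(1,2) \<tau>(1) p(3)]])
   show "0 \<le> hat a b (u x)" for x by (rule hat_props(4))
   show "AE x in lborel. (hat' a b (u x) *\<^sub>R v x) \<bullet> log_field f x = 0"
    using z crit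
   proof eventually_elim
    case (elim x)
    show ?case
    proof (cases "u x \<in> {a..b}")
     case True
     hence "g (u x) \<noteq> 0" using ab(2) by blast
     thus ?thesis using elim by simp
    qed (simp add: hat_props(3))
   qed
   show "AE x in lborel. 0 < hat a b (u x) --> 0 < f x"
    using sup
   proof eventually_elim
    case (elim x)
    show ?case
    proof
     assume "0 < hat a b (u x)"
     hence "u x \<in> {a..b}" using hat_props(3)[of "u x" a b] by fastforce
     hence "u x \<noteq> 0" using ab(2) by blast
     thus "0 < f x" using elim by blast
    qed
   qed
  qed
  thus ?thesis by eventually_elim (use hat_props(5) in fastforce)
 qed
 have gu: "AE x in lborel. g (u x) = 0"
 proof -
  \<comment> \<open>Countably many rational intervals cover the open set where \<open>g\<close> is nonzero.\<close>
  have "AE x in lborel. \<forall>p :: rat \<times> rat. (of_rat (fst p) < (of_rat (snd p) :: real) \<and> (\<forall>t\<in>{of_rat (fst p)..of_rat (snd p)}. t \<noteq> 0 \<and> g t \<noteq> 0))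
    --> \<not> (of_rat (fst p) < u x \<and> u x < of_rat (snd p))"
  proof (subst AE_all_countable, rule allI)
   fix p :: "rat \<times> rat"
   show "AE x in lborel. (of_rat (fst p) < (of_rat (snd p) :: real) \<and> (\<forall>t\<in>{of_rat (fst p)..of_rat (snd p)}. t \<noteq> 0 \<and> g t \<noteq> 0))
    --> \<not> (of_rat (fst p) < u x \<and> u x < of_rat (snd p))"
   proof (cases "of_rat (fst p) < (of_rat (snd p) :: real) \<and> (\<forall>t\<in>{of_rat (fst p)..of_rat (snd p)}. t \<noteq> 0 \<and> g t \<noteq> 0)")
    case True
    thus ?thesis using step1[of "of_rat (fst p)" "of_rat (snd p)"] by auto
   next
    case False
    show ?thesis by (rule AE_I2) (use False in blast)
   qed
  qed
  thus ?thesis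
  proof eventually_elim
   case (elim x)
   show ?case
   proof (rule ccontr)
    assume ne: "g (u x) \<noteq> 0"
    define S where "S = {t. g t \<noteq> 0} \<inter> - {0}"
    have "open {t. g t \<noteq> 0}" by (rule open_Collect_neq) (use gc in auto)
    hence "open S" unfolding S_def by (intro open_Int) auto
    moreover have "u x \<in> S" using ne g0 by (auto simp: S_def)
    ultimately obtain d where d: "d > 0" "cball (u x) d \<subseteq> S" using open_contains_cball by blast
    obtain r1 where r1: "u x - d < of_rat r1" "of_rat r1 < u x" using of_rat_dense[of "u x - d" "u x"] d by auto
    obtain r2 where r2: "u x < of_rat r2" "of_rat r2 < u x + d" using of_rat_dense[of "u x" "u x + d"] d by auto
    have "{of_rat r1..of_rat r2} \<subseteq> S" using d(2) r1 r2 by (auto simp: subset_iff dist_real_def)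
    hence "\<forall>t\<in>{of_rat r1..of_rat r2}. t \<noteq> 0 \<and> g t \<noteq> 0" by (auto simp: S_def)
    thus False using elim[rule_format, of "(r1, r2)"] r1 r2 by auto
   qed
  qed
 qed
 obtain C where C: "C > 0" "\<And>(v :: real ^ 'n => real) V A. wgrad v V ==> integrable lborel v ==> integrable lborel V ==>
   (\<And>x. 0 \<le> v x) ==> A \<in> sets borel ==> emeasure lborel A < \<infinity> ==> (\<And>x. x\<in>A ==> 1 \<le> v x) ==>
   measure lborel A powr (1 - 1 / real CARD('n)) \<le> C * (LBINT x. norm (V x))"
  using weak_isoperimetric[OF N] by blast
 have Gabs: "G \<bar>t\<bar> = G t" for t using even[of t] by (cases "t \<ge> 0") auto
 have small: "AE x in lborel. \<not> (2 * \<tau> \<le> \<bar>u x\<bar>)" if \<tau>: "\<tau> > 0" for \<tau>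
 proof -
  \<comment> \<open>Only the values of \<open>|u|\<close> between \<open>\<tau>\<close> and \<open>2 \<tau>\<close> carry gradient of the truncation.\<close>
  define h where "h = G (2 * \<tau>) - G \<tau>"
  have h: "h > 0" using strict_mono_onD[OF mono, of \<tau> "2 * \<tau>"] \<tau> by (simp add: h_def)
  let ?F = "\<lambda>t. step ((G t - G \<tau>) / h)" and ?F' = "\<lambda>t. step' ((G t - G \<tau>) / h) * (g t / h)"
  have Gc: "continuous_on UNIV G" using G by (auto intro: DERIV_isCont continuous_at_imp_continuous_on)
  have D: "(?F has_real_derivative ?F' t) (at t)" for t
  proof -
   have "((\<lambda>s. (G s - G \<tau>) / h) has_real_derivative g t / h) (at t)"
    using DERIV_cdivide[OF DERIV_diff[OF G DERIV_const[of "G \<tau>"]], of h t] by simp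
   from DERIV_chain2[where f = step, OF step_deriv this] show ?thesis by simp
  qed
  have F'c: "continuous_on UNIV ?F'"
   using h by (intro continuous_intros continuous_on_compose2[OF step'_continuous] Gc gc) auto
  have lowG: "G t \<le> G \<tau>" if "\<bar>t\<bar> \<le> \<tau>" for t
   using strict_mono_on_leD[OF mono, of "\<bar>t\<bar>" \<tau>] that Gabs[of t] by simp
  have highG: "G (2 * \<tau>) \<le> G t" if "2 * \<tau> \<le> \<bar>t\<bar>" for t
   using strict_mono_on_leD[OF mono, of "2 * \<tau>" "\<bar>t\<bar>"] that Gabs[of t] \<tau> by simp
  have low: "?F t = 0 \<and> ?F' t = 0" if "\<bar>t\<bar> \<le> \<tau>" for t
  proof -
   have "(G t - G \<tau>) / h \<le> 0" using lowG[OF that] h by (simp add: divide_le_0_iff)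
   thus ?thesis using step_le_0 step'_bounds(3) by simp
  qed
  have high: "?F t = 1" "?F' t = 0" if "2 * \<tau> \<le> \<bar>t\<bar>" for t
  proof -
   have "1 \<le> (G t - G \<tau>) / h" using highG[OF that] h by (simp add: h_def)
   thus "?F t = 1" "?F' t = 0" using step_ge_1 step'_bounds(3) by simp_all
  qed
  have "?F' t = 0" if "t \<notin> {- (2 * \<tau>)..2 * \<tau>}" for t
   by (rule high(2)) (use that in auto)
  then obtain M1 where M1: "\<forall>t. \<bar>?F' t\<bar> \<le> M1"
   using continuous_bounded_on_interval[OF F'c] by blast
  have p: "\<And>t. \<bar>?F' t\<bar> \<le> max M1 1" "\<And>t. \<bar>?F t\<bar> \<le> max M1 1" "\<And>t. \<bar>t\<bar> < \<tau> ==> ?F t = 0 \<and> ?F' t = 0"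
   using M1 step_bounds low by (auto simp: le_max_iff_disj)
  note W = truncation_sobolev[OF N u D F'c p(1,2) \<tau> p(3)]
  let ?A = "{x. 2 * \<tau> \<le> \<bar>u x\<bar>}"
  have fin: "emeasure lborel ?A < \<infinity>"
   using superlevel_finite[of "\<lambda>x. \<bar>u x\<bar>" "2 * \<tau>"] U(2) \<tau> by simp
  have "measure lborel ?A powr (1 - 1 / real CARD('n)) \<le> C * (LBINT x. norm (?F' (u x) *\<^sub>R v x))"
   by (rule C(2)[OF W]) (use fin high step_bounds in auto)
  also have "(LBINT x. norm (?F' (u x) *\<^sub>R v x)) = 0"
   by (rule integral_eq_zero_AE) (use gu in \<open>auto elim!: eventually_mono\<close>)
  finally have "measure lborel ?A = 0" by (simp add: powr_eq_0_iff)
  hence "emeasure lborel ?A = 0" using fin by (simp add: emeasure_eq_ennreal_measure less_top)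
  hence "?A \<in> null_sets lborel" by (intro null_setsI) auto
  from AE_not_in[OF this] show ?thesis by simp
 qed
 have "AE x in lborel. \<forall>n. \<not> (2 * inverse (real (Suc n)) \<le> \<bar>u x\<bar>)"
  by (subst AE_all_countable) (auto intro!: small simp del: of_nat_Suc)
 thus ?thesis
 proof eventually_elim
  case (elim x)
  show ?case
  proof (rule ccontr)
   assume "u x \<noteq> 0"
   hence "0 < \<bar>u x\<bar> / 2" by simp
   from eventually_happens[OF order_tendstoD(2)[OF LIMSEQ_inverse_real_of_nat this]]
   obtain n where "inverse (real (Suc n)) < \<bar>u x\<bar> / 2" by auto
   thus False using elim[rule_format, of n] by linarith
  qed
 qed
qed

section \<open>First variations\<close>

lemma power_diff_bound:
 fixes x y :: real
 assumes "0 \<le> x" "x \<le> M" "0 \<le> y" "y \<le> M"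
 shows "\<bar>x ^ n - y ^ n\<bar> \<le> real n * M ^ (n - 1) * \<bar>x - y\<bar>"
proof (induction n)
 case (Suc n)
 have M: "0 \<le> M" using assms by linarith
 have "x ^ Suc n - y ^ Suc n = x * (x ^ n - y ^ n) + y ^ n * (x - y)" by (simp add: algebra_simps)
 hence "\<bar>x ^ Suc n - y ^ Suc n\<bar> \<le> \<bar>x * (x ^ n - y ^ n)\<bar> + \<bar>y ^ n * (x - y)\<bar>" by simp
 also have "... = x * \<bar>x ^ n - y ^ n\<bar> + y ^ n * \<bar>x - y\<bar>" using assms by (simp add: abs_mult)
 also have "... \<le> M * (real n * M ^ (n - 1) * \<bar>x - y\<bar>) + M ^ n * \<bar>x - y\<bar>"
  using assms M Suc by (intro add_mono mult_mono power_mono) auto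
 also have "... = real (Suc n) * M ^ n * \<bar>x - y\<bar>"
  by (cases n) (simp_all add: algebra_simps)
 finally show ?case by simp
qed simp

lemma add_power_le:
 fixes x y :: real
 assumes "0 \<le> x" "0 \<le> y" shows "(x + y) ^ n \<le> 2 ^ n * (x ^ n + y ^ n)"
proof -
 have "(x + y) ^ n \<le> (2 * max x y) ^ n" using assms by (intro power_mono) auto
 also have "... = 2 ^ n * (max x y) ^ n" by (rule power_mult_distrib)
 also have "(max x y) ^ n \<le> x ^ n + y ^ n" using assms by (cases "x \<le> y") auto
 finally show ?thesis by simp
qed

lemma norm_power_quotient_bound:
 fixes a b :: "'a::euclidean_space"
 assumes n: "n \<ge> 1" and t: "0 < t" "t \<le> 1"
 shows "\<bar>(norm (a + t *\<^sub>R b) ^ n - norm a ^ n) / t\<bar> \<le> real n * 2 ^ n * (norm a ^ n + norm b ^ n)"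
proof -
 let ?M = "norm a + norm b"
 have tb: "norm (t *\<^sub>R b) \<le> norm b" using t by (simp add: mult_left_le_one_le)
 have "norm (a + t *\<^sub>R b) \<le> ?M" using norm_triangle_ineq[of a "t *\<^sub>R b"] tb by linarith
 hence "\<bar>norm (a + t *\<^sub>R b) ^ n - norm a ^ n\<bar> \<le> real n * ?M ^ (n - 1) * \<bar>norm (a + t *\<^sub>R b) - norm a\<bar>"
  by (intro power_diff_bound) auto
 also have "\<bar>norm (a + t *\<^sub>R b) - norm a\<bar> \<le> norm (t *\<^sub>R b)" using norm_triangle_ineq3[of "a + t *\<^sub>R b" a] by simp
 also have "norm (t *\<^sub>R b) = t * norm b" using t by simp
 also have "real n * ?M ^ (n - 1) * (t * norm b) \<le> real n * ?M ^ (n - 1) * (t * ?M)"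
  using t by (intro mult_left_mono) auto
 also have "... = t * (real n * ?M ^ n)" using n by (cases n) auto
 also have "?M ^ n \<le> 2 ^ n * (norm a ^ n + norm b ^ n)" by (rule add_power_le) auto
 finally have "\<bar>norm (a + t *\<^sub>R b) ^ n - norm a ^ n\<bar> \<le> t * (real n * (2 ^ n * (norm a ^ n + norm b ^ n)))"
  using t by (simp add: mult_left_mono)
 thus ?thesis using t by (simp add: field_simps abs_mult)
qed

lemma norm_power_quotient_tendsto:
 fixes a b :: "'a::euclidean_space"
 assumes n: "n \<ge> 2"
 shows "(\<lambda>k. (norm (a + inverse (real (Suc k)) *\<^sub>R b) ^ n - norm a ^ n) / inverse (real (Suc k)))
  \<longlonglongrightarrow> real n * (norm a ^ (n - 2) * (a \<bullet> b))"
proof (cases "a = 0")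
 case True
 have "n = Suc (Suc (n - 2))" using n by simp
 then obtain m where m: "n = Suc (Suc m)" by blast
 have l: "(\<lambda>k. inverse (real (Suc k)) ^ Suc m * norm b ^ n) \<longlonglongrightarrow> 0 ^ Suc m * norm b ^ n"
  by (intro tendsto_intros LIMSEQ_inverse_real_of_nat)
 have eq: "inverse (real (Suc k)) ^ Suc m * norm b ^ n = (norm (a + inverse (real (Suc k)) *\<^sub>R b) ^ n - norm a ^ n) / inverse (real (Suc k))" for k
  using True by (simp add: m power_mult_distrib del: of_nat_Suc)
 have z: "real n * (norm a ^ (n - 2) * (a \<bullet> b)) = 0 ^ Suc m * norm b ^ n" using True by simp
 show ?thesis unfolding z using l unfolding eq .
next
 case False
 have l: "((\<lambda>t. a + t *\<^sub>R b) has_derivative (\<lambda>t. t *\<^sub>R b)) (at (0::real))" by (auto intro!: derivative_eq_intros)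
 have nd: "(norm has_derivative (\<lambda>h. h \<bullet> sgn a)) (at (a + 0 *\<^sub>R b))" using has_derivative_norm[of a] False by simp
 have "((\<lambda>t. norm (a + t *\<^sub>R b)) has_derivative (\<lambda>t. (t *\<^sub>R b) \<bullet> sgn a)) (at (0::real))"
  by (rule has_derivative_compose[OF l nd])
 hence "((\<lambda>t. norm (a + t *\<^sub>R b)) has_real_derivative (b \<bullet> sgn a)) (at 0)"
  by (simp add: has_field_derivative_def mult_commute_abs)
 from DERIV_power[OF this, of n]
 have "((\<lambda>t. norm (a + t *\<^sub>R b) ^ n) has_real_derivative real n * (norm a ^ (n - 1) * (b \<bullet> sgn a))) (at 0)"
  by (simp add: mult.commute mult.left_commute)
 moreover have "norm a ^ (n - 1) * (b \<bullet> sgn a) = norm a ^ (n - 2) * (a \<bullet> b)"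
 proof -
  have "n = Suc (Suc (n - 2))" using n by simp
 then obtain m where m: "n = Suc (Suc m)" by blast
  show ?thesis using False by (simp add: m sgn_div_norm inner_commute)
 qed
 ultimately have "((\<lambda>t. (norm (a + t *\<^sub>R b) ^ n - norm a ^ n) / t) \<longlongrightarrow> real n * (norm a ^ (n - 2) * (a \<bullet> b))) (at 0)"
  by (simp add: DERIV_def)
 moreover have "filterlim (\<lambda>k. inverse (real (Suc k))) (at 0) sequentially"
  using LIMSEQ_inverse_real_of_nat by (auto simp: filterlim_at)
 ultimately show ?thesis by (rule filterlim_compose)
qed

lemma norm_power_inner_bound:
 fixes a b :: "'a::euclidean_space"
 assumes n: "n \<ge> 2"
 shows "\<bar>norm a ^ (n - 2) * (a \<bullet> b)\<bar> \<le> norm a ^ n + norm b ^ n"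
proof -
 have "n = Suc (Suc (n - 2))" using n by simp
 then obtain m where m: "n = Suc (Suc m)" by blast
 let ?M = "max (norm a) (norm b)"
 have "\<bar>norm a ^ (n - 2) * (a \<bullet> b)\<bar> \<le> norm a ^ m * (norm a * norm b)"
  by (simp add: m abs_mult Cauchy_Schwarz_ineq2 mult_left_mono)
 also have "... \<le> ?M ^ m * (?M * ?M)" by (intro mult_mono power_mono) (auto simp: le_max_iff_disj)
 also have "... = ?M ^ n" by (simp add: m)
 also have "... \<le> norm a ^ n + norm b ^ n" by (cases "norm a \<le> norm b") auto
 finally show ?thesis .
qed

text \<open>Dominated convergence of the difference quotients along \<open>1 / (k + 1)\<close>; a sequence suffices for the
 first-order argument at the maximizer.\<close>

lemma integral_norm_power_variation:
 fixes a b :: "'a => 'b::euclidean_space"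
 assumes n: "n \<ge> 2" and [measurable]: "a \<in> borel_measurable M" "b \<in> borel_measurable M"
  and i: "integrable M (\<lambda>x. norm (a x) ^ n)" "integrable M (\<lambda>x. norm (b x) ^ n)"
 shows "integrable M (\<lambda>x. norm (a x + t *\<^sub>R b x) ^ n)" "integrable M (\<lambda>x. norm (a x) ^ (n - 2) * (a x \<bullet> b x))"
  "(\<lambda>k. ((LINT x|M. norm (a x + inverse (real (Suc k)) *\<^sub>R b x) ^ n) - (LINT x|M. norm (a x) ^ n)) / inverse (real (Suc k)))
   \<longlonglongrightarrow> real n * (LINT x|M. norm (a x) ^ (n - 2) * (a x \<bullet> b x))"
proof -
 show it: "integrable M (\<lambda>x. norm (a x + t *\<^sub>R b x) ^ n)" for t
 proof (rule integrable_dominated)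
  show "integrable M (\<lambda>x. 2 ^ n * (norm (a x) ^ n + \<bar>t\<bar> ^ n * norm (b x) ^ n))"
   by (intro integrable_mult_right integrable_plus i)
  show "AE x in M. norm (norm (a x + t *\<^sub>R b x) ^ n) \<le> norm (2 ^ n * (norm (a x) ^ n + \<bar>t\<bar> ^ n * norm (b x) ^ n))"
  proof (rule AE_I2)
   fix x
   have "norm (a x + t *\<^sub>R b x) ^ n \<le> (norm (a x) + \<bar>t\<bar> * norm (b x)) ^ n"
    using norm_triangle_ineq[of "a x" "t *\<^sub>R b x"] by (intro power_mono) auto
   also have "... \<le> 2 ^ n * (norm (a x) ^ n + (\<bar>t\<bar> * norm (b x)) ^ n)" by (rule add_power_le) auto
   finally show "norm (norm (a x + t *\<^sub>R b x) ^ n) \<le> norm (2 ^ n * (norm (a x) ^ n + \<bar>t\<bar> ^ n * norm (b x) ^ n))"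
    by (simp add: power_mult_distrib)
  qed
 qed measurable
 show iB: "integrable M (\<lambda>x. norm (a x) ^ (n - 2) * (a x \<bullet> b x))"
  by (rule integrable_dominated[OF integrable_plus[OF i]])
    (use norm_power_inner_bound[OF n] in \<open>auto intro!: AE_I2\<close>)
 have "(\<lambda>k. LINT x|M. (norm (a x + inverse (real (Suc k)) *\<^sub>R b x) ^ n - norm (a x) ^ n) / inverse (real (Suc k)))
   \<longlonglongrightarrow> (LINT x|M. real n * (norm (a x) ^ (n - 2) * (a x \<bullet> b x)))"
 proof (rule integral_dominated_convergence[where w = "\<lambda>x. real n * 2 ^ n * (norm (a x) ^ n + norm (b x) ^ n)"])
  show "integrable M (\<lambda>x. real n * 2 ^ n * (norm (a x) ^ n + norm (b x) ^ n))"
   by (intro integrable_mult_right integrable_plus i)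
  show "AE x in M. norm ((norm (a x + inverse (real (Suc k)) *\<^sub>R b x) ^ n - norm (a x) ^ n) / inverse (real (Suc k)))
    \<le> real n * 2 ^ n * (norm (a x) ^ n + norm (b x) ^ n)" for k
   unfolding real_norm_def using n by (intro AE_I2 norm_power_quotient_bound) (auto simp: field_simps)
  show "AE x in M. (\<lambda>k. (norm (a x + inverse (real (Suc k)) *\<^sub>R b x) ^ n - norm (a x) ^ n) / inverse (real (Suc k)))
    \<longlonglongrightarrow> real n * (norm (a x) ^ (n - 2) * (a x \<bullet> b x))"
   by (intro AE_I2 norm_power_quotient_tendsto n)
 qed measurable
 moreover have "(LINT x|M. (norm (a x + inverse (real (Suc k)) *\<^sub>R b x) ^ n - norm (a x) ^ n) / inverse (real (Suc k)))
   = ((LINT x|M. norm (a x + inverse (real (Suc k)) *\<^sub>R b x) ^ n) - (LINT x|M. norm (a x) ^ n)) / inverse (real (Suc k))" for k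
  using it[of "inverse (real (Suc k))"] i(1) by (simp only: integral_divide_zero Bochner_Integration.integral_diff)
 ultimately show "(\<lambda>k. ((LINT x|M. norm (a x + inverse (real (Suc k)) *\<^sub>R b x) ^ n) - (LINT x|M. norm (a x) ^ n)) / inverse (real (Suc k)))
   \<longlonglongrightarrow> real n * (LINT x|M. norm (a x) ^ (n - 2) * (a x \<bullet> b x))" by simp
qed

lemma exp_locally_integrable:
 fixes u :: "'n::finite sfun"
 assumes N: "CARD('n) \<ge> 2" and u: "sobolev_fun u v" and a: "a > 0"
 shows "integrable lborel (\<lambda>x. indicator (cball 0 R) x * exp (a * \<bar>u x\<bar> powr (real CARD('n) / (real CARD('n) - 1))))"
proof -
 let ?p = "real CARD('n) / (real CARD('n) - 1)"
 have p: "?p \<ge> 0" using N by (simp add: field_simps)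
 note [measurable] = sobolev_funD(4,5)[OF u]
 note T = trudinger[OF N u a, of 1]
 show ?thesis
 proof (rule integrable_dominated)
  show "integrable lborel (\<lambda>x. exp a * indicator (cball 0 R) x + indicator {x. 1 < \<bar>u x\<bar>} x * exp (a * \<bar>u x\<bar> powr ?p))"
   by (intro integrable_plus integrable_mult_right integrable_indicator_cball T) simp
  show "AE x in lborel. norm (indicator (cball 0 R) x * exp (a * \<bar>u x\<bar> powr ?p))
    \<le> norm (exp a * indicator (cball 0 R) x + indicator {x. 1 < \<bar>u x\<bar>} x * exp (a * \<bar>u x\<bar> powr ?p))"
  proof (rule AE_I2)
   fix x
   have "exp (a * \<bar>u x\<bar> powr ?p) \<le> exp a" if "\<not> 1 < \<bar>u x\<bar>"
    using powr_mono2[OF p, of "\<bar>u x\<bar>" 1] that a by (simp add: mult_left_le)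
   thus "norm (indicator (cball 0 R) x * exp (a * \<bar>u x\<bar> powr ?p))
    \<le> norm (exp a * indicator (cball 0 R) x + indicator {x. 1 < \<bar>u x\<bar>} x * exp (a * \<bar>u x\<bar> powr ?p))"
    by (auto simp: indicator_def)
  qed
 qed measurable
qed

lemma le_exp_powr: "p \<ge> 1 ==> \<bar>s\<bar> \<le> exp (\<bar>s\<bar> powr p)" for s p :: real
proof -
 assume p: "p \<ge> 1"
 show ?thesis
 proof (cases "\<bar>s\<bar> \<le> 1")
  case True
  thus ?thesis by (rule order.trans) simp
 next
  case False
  hence "\<bar>s\<bar> powr 1 \<le> \<bar>s\<bar> powr p" using p by (intro powr_mono) auto
  hence "\<bar>s\<bar> \<le> \<bar>s\<bar> powr p" by simp
  thus ?thesis using exp_ge_add_one_self[of "\<bar>s\<bar> powr p"] by linarith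
 qed
qed

lemma add_powr_le:
 fixes a b p :: real
 assumes "0 \<le> a" "0 \<le> b" "p \<ge> 0" shows "(a + b) powr p \<le> 2 powr p * (a powr p + b powr p)"
proof -
 have "(a + b) powr p \<le> (2 * max a b) powr p" using assms by (intro powr_mono2) auto
 also have "... = 2 powr p * (max a b) powr p" using assms by (simp add: powr_mult)
 also have "(max a b) powr p \<le> a powr p + b powr p" by (cases "a \<le> b") auto
 finally show ?thesis by simp
qed

text \<open>A bound for the difference quotients of \<open>G\<close> at \<open>s\<close> in direction \<open>r\<close>, from the mean value theorem and the
 convexity bound \<open>(a + b) powr p \<le> 2 powr p * (a powr p + b powr p)\<close>.\<close>

definition variation_dominator :: "real => real => real => real => real => real" where
 "variation_dominator p \<alpha> c s r = c * exp (\<alpha> * 2 powr p * (\<bar>s\<bar> powr p + \<bar>r\<bar> powr p)) * \<bar>r\<bar>"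

lemma G_variation_bound:
 fixes G g :: "real => real"
 assumes G: "\<And>t. (G has_real_derivative g t) (at t)" and c: "c > 0" "\<alpha> > 0" and p: "p \<ge> 1"
  and g: "\<And>t. \<bar>g t\<bar> \<le> c * exp (\<alpha> * \<bar>t\<bar> powr p)" and t: "\<bar>t\<bar> \<le> 1"
 shows "\<bar>G (s + t * r) - G s\<bar> \<le> \<bar>t\<bar> * variation_dominator p \<alpha> c s r"
proof -
 let ?K = "c * exp (\<alpha> * 2 powr p * (\<bar>s\<bar> powr p + \<bar>r\<bar> powr p))"
 have gb: "norm (g x) \<le> ?K" if x: "x \<in> closed_segment s (s + t * r)" for x
 proof -
  obtain w where w: "0 \<le> w" "w \<le> 1" "x = s + w * (t * r)" using x by (auto simp: closed_segment_def algebra_simps)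
  have "\<bar>w * (t * r)\<bar> \<le> \<bar>r\<bar>"
  proof -
   have "\<bar>w\<bar> * \<bar>t\<bar> \<le> 1 * 1" using w t by (intro mult_mono) auto
   hence "(\<bar>w\<bar> * \<bar>t\<bar>) * \<bar>r\<bar> \<le> 1 * \<bar>r\<bar>" by (intro mult_right_mono) auto
   thus ?thesis by (simp add: abs_mult mult.assoc)
  qed
  hence "\<bar>x\<bar> \<le> \<bar>s\<bar> + \<bar>r\<bar>" using w(3) by linarith
  hence "\<bar>x\<bar> powr p \<le> (\<bar>s\<bar> + \<bar>r\<bar>) powr p" using p by (intro powr_mono2) auto
  also have "... \<le> 2 powr p * (\<bar>s\<bar> powr p + \<bar>r\<bar> powr p)" using p by (intro add_powr_le) auto
  finally have "\<alpha> * \<bar>x\<bar> powr p \<le> \<alpha> * (2 powr p * (\<bar>s\<bar> powr p + \<bar>r\<bar> powr p))" using c by (intro mult_left_mono) auto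
  hence "c * exp (\<alpha> * \<bar>x\<bar> powr p) \<le> ?K" using c by (simp add: mult.assoc)
  thus ?thesis using g[of x] by simp
 qed
 have "norm (G (s + t * r) - G s) \<le> ?K * norm (s + t * r - s)"
  by (rule field_differentiable_bound[where S = "closed_segment s (s + t * r)" and f' = g])
    (use G gb in \<open>auto intro: has_field_derivative_at_within\<close>)
 thus ?thesis by (simp add: variation_dominator_def abs_mult mult_ac)
qed

lemma variation_dominator_log_class:
 fixes u \<phi> :: "'n::finite sfun"
 assumes N: "CARD('n) \<ge> 2" and u: "sobolev_fun u v" and \<phi>: "sobolev_fun \<phi> \<psi>"
  and R: "\<And>x. norm x > R ==> \<phi> x = 0" and c: "c > 0" "\<alpha> > 0"
 shows "log_class (\<lambda>x. variation_dominator (real CARD('n) / (real CARD('n) - 1)) \<alpha> c (u x) (\<phi> x))"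
proof -
 let ?p = "real CARD('n) / (real CARD('n) - 1)"
 have p: "?p \<ge> 1" using N by (simp add: field_simps)
 have [measurable]: "u \<in> Borel" "\<phi> \<in> Borel"
  by (rule sobolev_funD[OF u], rule sobolev_funD[OF \<phi>])
 let ?D = "\<lambda>x. variation_dominator ?p \<alpha> c (u x) (\<phi> x)"
 have Dm [measurable]: "?D \<in> Borel" unfolding variation_dominator_def by measurable
 define a where "a = 4 * (\<alpha> * 2 powr ?p)"
 have a: "a > 0" using c by (simp add: a_def)
 show ?thesis
 proof (rule bounded_support_log_class[OF _ Dm])
  show "?D x = 0" if "norm x > R" for x using R[OF that] by (simp add: variation_dominator_def)
  show "integrable lborel (\<lambda>x. (?D x)\<^sup>2)"
  proof (rule integrable_dominated)
   show "integrable lborel (\<lambda>x. c\<^sup>2 * (indicator (cball 0 R) x * exp (a * \<bar>u x\<bar> powr ?p) + indicator (cball 0 R) x * exp ((a + 4) * \<bar>\<phi> x\<bar> powr ?p)))"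
    using a by (intro integrable_mult_right integrable_plus exp_locally_integrable[OF N u] exp_locally_integrable[OF N \<phi>]) auto
   show "AE x in lborel. norm ((?D x)\<^sup>2) \<le> norm (c\<^sup>2 * (indicator (cball 0 R) x * exp (a * \<bar>u x\<bar> powr ?p) + indicator (cball 0 R) x * exp ((a + 4) * \<bar>\<phi> x\<bar> powr ?p)))"
   proof (rule AE_I2)
    fix x
    show "norm ((?D x)\<^sup>2) \<le> norm (c\<^sup>2 * (indicator (cball 0 R) x * exp (a * \<bar>u x\<bar> powr ?p) + indicator (cball 0 R) x * exp ((a + 4) * \<bar>\<phi> x\<bar> powr ?p)))"
    proof (cases "norm x \<le> R")
     case True
     define A where "A = exp (a / 2 * \<bar>u x\<bar> powr ?p)"
     define B where "B = exp (a / 2 * \<bar>\<phi> x\<bar> powr ?p) * exp (2 * \<bar>\<phi> x\<bar> powr ?p)"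
     have AB: "A \<ge> 0" "B \<ge> 0" by (auto simp: A_def B_def)
     have phi2: "\<bar>\<phi> x\<bar>\<^sup>2 \<le> exp (2 * \<bar>\<phi> x\<bar> powr ?p)"
      using power_mono[OF le_exp_powr[OF p, of "\<phi> x"], of 2] by (simp add: exp_double)
     have "(?D x)\<^sup>2 = c\<^sup>2 * (A * (exp (a / 2 * \<bar>\<phi> x\<bar> powr ?p) * \<bar>\<phi> x\<bar>\<^sup>2))"
      by (simp add: variation_dominator_def power_mult_distrib A_def a_def algebra_simps power2_eq_square flip: exp_add)
     also have "... \<le> c\<^sup>2 * (A * B)" unfolding B_def using AB phi2 by (intro mult_left_mono) auto
     also have "A * B \<le> A\<^sup>2 + B\<^sup>2"
     proof -
      have "0 \<le> A * B" using AB by simp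
      thus ?thesis using sum_squares_bound[of A B] by linarith
     qed
     also have "A\<^sup>2 = exp (a * \<bar>u x\<bar> powr ?p)" by (simp add: A_def power2_eq_square flip: exp_add)
     also have "B\<^sup>2 = exp ((a + 4) * \<bar>\<phi> x\<bar> powr ?p)" by (simp add: B_def power2_eq_square algebra_simps flip: exp_add)
     finally have "(?D x)\<^sup>2 \<le> c\<^sup>2 * (exp (a * \<bar>u x\<bar> powr ?p) + exp ((a + 4) * \<bar>\<phi> x\<bar> powr ?p))"
      by (simp add: mult_left_mono)
     thus ?thesis using True by simp
    next
     case False
     thus ?thesis using R[of x] by (simp add: variation_dominator_def)
    qed
   qed
  qed measurable
 qed
qed

text \<open>With \<open>h\<^sub>t = F t - F 0\<close> the form expands into a linear term, a pairing of \<open>h\<^sub>t\<close> with the potential of \<open>F 0\<close>,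
 and a quadratic term of order \<open>t\<^sup>2\<close>.\<close>

lemma log_form_variation:
 fixes u \<phi> :: "'n::finite sfun" and G g :: "real => real"
 assumes N: "CARD('n) \<ge> 2" and u: "sobolev_fun u v" and \<phi>: "sobolev_fun \<phi> \<psi>"
  and R: "\<And>x. norm x > R ==> \<phi> x = 0" and c: "c > 0" "\<alpha> > 0"
  and G: "\<And>t. (G has_real_derivative g t) (at t)" and gc: "continuous_on UNIV g"
  and g: "\<And>t. \<bar>g t\<bar> \<le> c * exp (\<alpha> * \<bar>t\<bar> powr (real CARD('n) / (real CARD('n) - 1)))"
  and \<Omega> [measurable]: "\<Omega> \<in> sets borel" and f: "log_class (\<lambda>x. indicator \<Omega> x * G (u x))"
 defines "F \<equiv> \<lambda>t x. indicator \<Omega> x * G (u x + t * \<phi> x)"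
 shows "\<bar>t\<bar> \<le> 1 ==> log_class (F t)"
  "integrable lborel (\<lambda>x. log_potential (F 0) x * (indicator \<Omega> x * g (u x) * \<phi> x))"
  "(\<lambda>k. (log_form (F (inverse (real (Suc k)))) (F (inverse (real (Suc k)))) - log_form (F 0) (F 0)) / inverse (real (Suc k)))
   \<longlonglongrightarrow> 2 * (LBINT x. log_potential (F 0) x * (indicator \<Omega> x * g (u x) * \<phi> x))"
proof -
 let ?p = "real CARD('n) / (real CARD('n) - 1)"
 have p: "?p \<ge> 1" using N by (simp add: field_simps)
 have [measurable]: "u \<in> Borel" "\<phi> \<in> Borel"
  by (rule sobolev_funD[OF u], rule sobolev_funD[OF \<phi>])
 have [measurable]: "g \<in> Borel" using gc by (rule borel_measurable_continuous_onI)
 have [measurable]: "G \<in> Borel"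
  using G by (intro borel_measurable_continuous_onI) (auto intro: DERIV_isCont continuous_at_imp_continuous_on)
 define D where "D x = variation_dominator ?p \<alpha> c (u x) (\<phi> x)" for x
 have Dc: "log_class D" unfolding D_def by (rule variation_dominator_log_class[OF N u \<phi> R c])
 have Dm [measurable]: "D \<in> Borel" using log_classD(4)[OF Dc] .
 have D0: "D x \<ge> 0" for x using c by (simp add: D_def variation_dominator_def)
 have DR: "D x = 0" if "norm x > R" for x using R[OF that] by (simp add: D_def variation_dominator_def)
 define h where "h t x = indicator \<Omega> x * (G (u x + t * \<phi> x) - G (u x))" for t x
 have [measurable]: "h t \<in> Borel" for t unfolding h_def by measurable
 have hb: "\<bar>h t x\<bar> \<le> \<bar>t\<bar> * D x" if "\<bar>t\<bar> \<le> 1" for t x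
  using G_variation_bound[OF G c p g that, of "u x" "\<phi> x"] D0[of x] by (auto simp: h_def D_def indicator_def)
 have hb1: "\<bar>h t x\<bar> \<le> \<bar>D x\<bar>" if "\<bar>t\<bar> \<le> 1" for t x
  using hb[OF that, of x] mult_right_mono[OF that D0[of x]] D0[of x] by linarith
 have hc: "log_class (h t)" if "\<bar>t\<bar> \<le> 1" for t by (rule log_class_bound[OF Dc _ hb1[OF that]]) measurable
 have F0: "F 0 = (\<lambda>x. indicator \<Omega> x * G (u x))" by (simp add: F_def)
 have f0: "log_class (F 0)" unfolding F0 by (rule f)
 have Fh: "F t = (\<lambda>x. F 0 x + h t x)" for t by (auto simp: F_def h_def fun_eq_iff algebra_simps)
 show "log_class (F t)" if "\<bar>t\<bar> \<le> 1" for t unfolding Fh[of t] by (rule log_class_add[OF f0 hc[OF that]])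
 obtain P where P: "P \<ge> 0" "\<And>x. norm x \<le> R ==> \<bar>log_potential (F 0) x\<bar> \<le> P"
  using log_potential_locally_bounded[OF N f0, of R] by blast
 have [measurable]: "F 0 \<in> Borel" using log_classD(4)[OF f0] .
 have w: "integrable lborel (\<lambda>x. P * D x)" by (intro integrable_mult_right log_classD(1)[OF Dc])
 have gD: "\<bar>g (u x) * \<phi> x\<bar> \<le> D x" for x
 proof -
  have "\<alpha> * \<bar>u x\<bar> powr ?p \<le> \<alpha> * 2 powr ?p * (\<bar>u x\<bar> powr ?p + \<bar>\<phi> x\<bar> powr ?p)"
  proof -
   have "1 \<le> 2 powr ?p" using p by (intro ge_one_powr_ge_zero) auto
   hence "1 * \<bar>u x\<bar> powr ?p \<le> 2 powr ?p * (\<bar>u x\<bar> powr ?p + \<bar>\<phi> x\<bar> powr ?p)" by (intro mult_mono) auto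
   hence "\<alpha> * \<bar>u x\<bar> powr ?p \<le> \<alpha> * (2 powr ?p * (\<bar>u x\<bar> powr ?p + \<bar>\<phi> x\<bar> powr ?p))" using c by (intro mult_left_mono) auto
   thus ?thesis by (simp add: mult.assoc)
  qed
  hence "c * exp (\<alpha> * \<bar>u x\<bar> powr ?p) \<le> c * exp (\<alpha> * 2 powr ?p * (\<bar>u x\<bar> powr ?p + \<bar>\<phi> x\<bar> powr ?p))" using c by simp
  hence "\<bar>g (u x)\<bar> \<le> c * exp (\<alpha> * 2 powr ?p * (\<bar>u x\<bar> powr ?p + \<bar>\<phi> x\<bar> powr ?p))" using g[of "u x"] by linarith
  thus ?thesis unfolding D_def variation_dominator_def abs_mult by (intro mult_right_mono) auto
 qed
 have pot_b: "\<bar>log_potential (F 0) x * s\<bar> \<le> P * D x" if "\<bar>s\<bar> \<le> D x" for x s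
 proof (cases "norm x \<le> R")
  case True
  show ?thesis unfolding abs_mult using P True that by (intro mult_mono) auto
 next
  case False
  thus ?thesis using DR[of x] that by simp
 qed
 show "integrable lborel (\<lambda>x. log_potential (F 0) x * (indicator \<Omega> x * g (u x) * \<phi> x))"
 proof (rule integrable_dominated[OF w])
  show "AE x in lborel. norm (log_potential (F 0) x * (indicator \<Omega> x * g (u x) * \<phi> x)) \<le> norm (P * D x)"
  proof (rule AE_I2)
   fix x
   have "\<bar>indicator \<Omega> x * g (u x) * \<phi> x\<bar> \<le> D x" using gD[of x] D0[of x] by (auto simp: indicator_def)
   from pot_b[OF this] show "norm (log_potential (F 0) x * (indicator \<Omega> x * g (u x) * \<phi> x)) \<le> norm (P * D x)" by simp
  qed
 qed measurable
 define t where "t k = inverse (real (Suc k))" for k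
 have t: "0 < t k" "t k \<le> 1" "\<bar>t k\<bar> \<le> 1" for k by (auto simp: t_def field_simps)
 have t0: "t \<longlonglongrightarrow> 0" unfolding t_def by (rule LIMSEQ_inverse_real_of_nat)
 have A: "(\<lambda>k. LBINT x. log_potential (F 0) x * (h (t k) x / t k)) \<longlonglongrightarrow> (LBINT x. log_potential (F 0) x * (indicator \<Omega> x * g (u x) * \<phi> x))"
 proof (rule integral_dominated_convergence[OF _ _ w])
  show "AE x in lborel. norm (log_potential (F 0) x * (h (t k) x / t k)) \<le> P * D x" for k
  proof (rule AE_I2)
   fix x
   have "\<bar>h (t k) x / t k\<bar> \<le> D x" using hb[OF t(3), of k x] t(1)[of k] by (simp add: field_simps)
   from pot_b[OF this] show "norm (log_potential (F 0) x * (h (t k) x / t k)) \<le> P * D x" by simp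
  qed
  show "AE x in lborel. (\<lambda>k. log_potential (F 0) x * (h (t k) x / t k)) \<longlonglongrightarrow> log_potential (F 0) x * (indicator \<Omega> x * g (u x) * \<phi> x)"
  proof (intro AE_I2 tendsto_mult tendsto_const)
   fix x
   have "((\<lambda>s. u x + s * \<phi> x) has_real_derivative \<phi> x) (at 0)" by (auto intro!: derivative_eq_intros)
   from DERIV_chain2[where f = G, OF G this]
   have "((\<lambda>s. G (u x + s * \<phi> x)) has_real_derivative g (u x) * \<phi> x) (at 0)" by simp
   hence "((\<lambda>s. (G (u x + s * \<phi> x) - G (u x)) / s) \<longlongrightarrow> g (u x) * \<phi> x) (at 0)" by (simp add: DERIV_def)
   moreover have "filterlim t (at 0) sequentially"
    using t0 t(1) by (auto simp: filterlim_at intro!: always_eventually less_imp_neq[THEN not_sym])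
   ultimately have "(\<lambda>k. (G (u x + t k * \<phi> x) - G (u x)) / t k) \<longlonglongrightarrow> g (u x) * \<phi> x" by (rule filterlim_compose)
   from tendsto_mult[OF tendsto_const[of "indicator \<Omega> x"] this]
   show "(\<lambda>k. h (t k) x / t k) \<longlonglongrightarrow> indicator \<Omega> x * g (u x) * \<phi> x" by (simp add: h_def mult.assoc)
  qed
 qed measurable
 obtain K where K: "\<And>h' s. h' \<in> Borel ==> (\<And>x. \<bar>h' x\<bar> \<le> \<bar>s\<bar> * \<bar>D x\<bar>) ==> \<bar>log_form h' h'\<bar> \<le> s\<^sup>2 * K"
  using log_form_bound[OF N Dc] by blast
 have B: "(\<lambda>k. log_form (h (t k)) (h (t k)) / t k) \<longlonglongrightarrow> 0"
 proof (rule Lim_null_comparison)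
  show "eventually (\<lambda>k. norm (log_form (h (t k)) (h (t k)) / t k) \<le> t k * K) sequentially"
  proof (rule always_eventually, rule allI)
   fix k
   have "\<bar>log_form (h (t k)) (h (t k))\<bar> \<le> (t k)\<^sup>2 * K" by (rule K) (use hb[OF t(3)] D0 in auto)
   thus "norm (log_form (h (t k)) (h (t k)) / t k) \<le> t k * K" using t(1)[of k] by (simp add: field_simps power2_eq_square)
  qed
  show "(\<lambda>k. t k * K) \<longlonglongrightarrow> 0" using tendsto_mult[OF t0 tendsto_const[of K]] by simp
 qed
 have "(log_form (F (t k)) (F (t k)) - log_form (F 0) (F 0)) / t k
   = 2 * (LBINT x. log_potential (F 0) x * (h (t k) x / t k)) + log_form (h (t k)) (h (t k)) / t k" for k
 proof -
  have "log_form (F (t k)) (F (t k)) = log_form (F 0) (F 0) + 2 * (LBINT x. log_potential (F 0) x * h (t k) x) + log_form (h (t k)) (h (t k))"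
   unfolding Fh[of "t k"] by (rule log_form_add[OF N f0 hc[OF t(3)]])
  moreover have "(LBINT x. log_potential (F 0) x * (h (t k) x / t k)) = (LBINT x. log_potential (F 0) x * h (t k) x) / t k"
   by simp
  ultimately show ?thesis by (simp add: add_divide_distrib)
 qed
 moreover have "(\<lambda>k. 2 * (LBINT x. log_potential (F 0) x * (h (t k) x / t k)) + log_form (h (t k)) (h (t k)) / t k)
  \<longlonglongrightarrow> 2 * (LBINT x. log_potential (F 0) x * (indicator \<Omega> x * g (u x) * \<phi> x)) + 0"
  by (intro tendsto_add tendsto_mult tendsto_const A B)
 ultimately show "(\<lambda>k. (log_form (F (inverse (real (Suc k)))) (F (inverse (real (Suc k)))) - log_form (F 0) (F 0)) / inverse (real (Suc k)))
   \<longlonglongrightarrow> 2 * (LBINT x. log_potential (F 0) x * (indicator \<Omega> x * g (u x) * \<phi> x))"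
  by (simp add: t_def del: of_nat_Suc)
qed

section \<open>The Lagrange multiplier\<close>

text \<open>Take \<open>x\<^sub>0\<close> with \<open>A x\<^sub>0 > 0\<close>. If \<open>A y = 0\<close>, then \<open>A\<close> is positive on the whole line \<open>x\<^sub>0 + r y\<close>, so \<open>B\<close> is
 bounded below on it, and \<open>B y = 0\<close>. The operation \<open>comb x s y\<close> stands for \<open>x + s y\<close>.\<close>

lemma lagrange_multiplier:
 fixes A B :: "'a => real" and comb :: "'a => real => 'a => 'a"
 assumes comb: "\<And>x s y. x \<in> S ==> y \<in> S ==> comb x s y \<in> S"
  and A: "\<And>x s y. x \<in> S ==> y \<in> S ==> A (comb x s y) = A x + s * A y"
  and B: "\<And>x s y. x \<in> S ==> y \<in> S ==> B (comb x s y) = B x + s * B y"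
  and opp: "\<And>x. x \<in> S ==> A x > 0 ==> B x \<ge> 0"
  and deg: "(\<forall>x\<in>S. A x = 0) ==> (\<forall>x\<in>S. B x = 0)"
 shows "\<exists>\<theta>. \<forall>x\<in>S. B x = \<theta> * A x"
proof (cases "\<forall>x\<in>S. A x = 0")
 case True
 thus ?thesis using deg by auto
next
 case False
 then obtain x1 where x1: "x1 \<in> S" "A x1 \<noteq> 0" by blast
 have "\<exists>x0\<in>S. A x0 > 0"
 proof (cases "A x1 > 0")
  case True thus ?thesis using x1 by blast
 next
  case False
  hence "A (comb x1 (- 2) x1) > 0" using x1 by (simp add: A)
  thus ?thesis using comb[OF x1(1) x1(1)] by blast
 qed
 then obtain x0 where x0: "x0 \<in> S" "A x0 > 0" by blast
 show ?thesis
 proof (intro exI[of _ "B x0 / A x0"] ballI)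
  fix x assume x: "x \<in> S"
  define y where "y = comb x (- A x / A x0) x0"
  have y: "y \<in> S" "A y = 0" using x x0 comb by (auto simp: y_def A)
  have nn: "B x0 + r * B y \<ge> 0" for r
  proof -
   have "B (comb x0 r y) \<ge> 0" using x0 y comb by (intro opp) (auto simp: A)
   thus ?thesis using x0 y by (simp add: B)
  qed
  have "B y = 0"
  proof (rule ccontr)
   assume "B y \<noteq> 0"
   thus False using nn[of "(- B x0 - 1) / B y"] by simp
  qed
  thus "B x = B x0 / A x0 * A x" using x x0 by (simp add: y_def B field_simps)
 qed
qed

lemma wgrad_zero: "wgrad (\<lambda>x. 0) (\<lambda>x. 0)"
 by (simp add: wgrad_def locint_def)

lemma sobolev_fun_lincomb:
 fixes u \<phi> :: "'n::finite sfun"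
 assumes N: "CARD('n) \<ge> 2" and u: "sobolev_fun u v" and \<phi>: "sobolev_fun \<phi> \<psi>"
 shows "sobolev_fun (\<lambda>x. u x + t * \<phi> x) (\<lambda>x. v x + t *\<^sub>R \<psi> x)"
 unfolding sobolev_fun_def
proof (intro conjI)
 note U = sobolev_funD[OF u] and P = sobolev_funD[OF \<phi>]
 show "wgrad (\<lambda>x. u x + t * \<phi> x) (\<lambda>x. v x + t *\<^sub>R \<psi> x)" by (rule wgrad_lincomb[OF U(1) P(1)])
 show "integrable lborel (\<lambda>x. \<bar>u x + t * \<phi> x\<bar> ^ CARD('n))"
  using integral_norm_power_variation(1)[of "CARD('n)" u lborel \<phi> t] U P N by simp
 show "integrable lborel (\<lambda>x. norm (v x + t *\<^sub>R \<psi> x) ^ CARD('n))"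
  using integral_norm_power_variation(1)[of "CARD('n)" v lborel \<psi> t] U P N by simp
qed

section \<open>Sobolev spaces in terms of functions on the whole space\<close>

text \<open>Integrals for Lebesgue measure reduce to Borel representatives and Lebesgue-Borel measure.\<close>

lemma lebesgue_transfer:
 fixes h h' :: "real ^ 'n::finite => 'b::euclidean_space"
 assumes ae: "AE x in lborel. h x = h' x" and h': "h' \<in> Borel"
 shows "h \<in> borel_measurable lebesgue" "integrable lebesgue h \<longleftrightarrow> integrable lborel h'"
  "(LINT x|lebesgue. h x) = (LBINT x. h' x)"
proof -
 have m': "h' \<in> borel_measurable lebesgue" using h' by (intro measurable_completion) simp
 have ae': "AE x in lebesgue. h' x = h x" using ae by (intro AE_completion) (auto elim: eventually_mono)
 show m: "h \<in> borel_measurable lebesgue" by (rule borel_measurable_AE[OF m' ae'])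
 have "integrable lebesgue h \<longleftrightarrow> integrable lebesgue h'"
  by (rule integrable_cong_AE[OF m m']) (use ae' in \<open>auto elim: eventually_mono\<close>)
 thus "integrable lebesgue h \<longleftrightarrow> integrable lborel h'" using integrable_completion[of h' lborel] h' by simp
 have "(LINT x|lebesgue. h x) = (LINT x|lebesgue. h' x)"
  by (rule integral_cong_AE[OF m m']) (use ae' in \<open>auto elim: eventually_mono\<close>)
 thus "(LINT x|lebesgue. h x) = (LBINT x. h' x)" using integral_completion[of h' lborel] h' by simp
qed

lemma borel_representative:
 fixes h :: "'n::finite sfun"
 assumes "h \<in> borel_measurable lebesgue"
 shows "\<exists>h'\<in>borel_measurable borel. AE x in lborel. h x = h' x"
 using completion_ex_borel_measurable_real[OF assms] by simp

lemma borel_representative_vec: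
 fixes h :: "real ^ 'n::finite => real ^ 'n"
 assumes "h \<in> borel_measurable lebesgue"
 shows "\<exists>h'\<in>borel_measurable borel. AE x in lborel. h x = h' x"
proof -
 have "\<forall>i. \<exists>k. k \<in> Borel \<and> (AE x in lborel. h x $ i = k x)"
  using borel_representative[OF vec_nth_measurable[OF assms]] by blast
 then obtain k where k: "\<And>i. k i \<in> Borel" "\<And>i. AE x in lborel. h x $ i = k i x" by metis
 show ?thesis
 proof
  show "(\<lambda>x. \<chi> i. k i x) \<in> Borel"
   by (rule borel_measurable_vec_componentwise) (use k in simp)
  have "AE x in lborel. \<forall>i. h x $ i = k i x" using k(2) by (intro AE_finite_allI[of UNIV, simplified]) auto
  thus "AE x in lborel. h x = (\<chi> i. k i x)" by eventually_elim (simp add: vec_eq_iff)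
 qed
qed

lemma test_functions_mono: "\<Omega> \<subseteq> \<Omega>' ==> test_functions \<Omega> \<subseteq> test_functions \<Omega>'"
 by (auto simp: test_functions_def)

lemma test_functions_lincomb:
 assumes "\<phi> \<in> test_functions \<Omega>" "\<zeta> \<in> test_functions \<Omega>"
 shows "(\<lambda>x. \<phi> x + s * \<zeta> x) \<in> test_functions \<Omega>"
  "partial_deriv i (\<lambda>x. \<phi> x + s * \<zeta> x) x = partial_deriv i \<phi> x + s * partial_deriv i \<zeta> x"
proof -
 have pd: "partial_deriv i (\<lambda>x. f x + s * h x) = (\<lambda>x. partial_deriv i f x + s * partial_deriv i h x)"
  if "\<And>x. f differentiable (at x)" "\<And>x. h differentiable (at x)" for i and f h :: "'n::finite sfun"
 proof
  fix x
  have "(f has_derivative frechet_derivative f (at x)) (at x)" "(h has_derivative frechet_derivative h (at x)) (at x)"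
   using that frechet_derivative_works by blast+
  from frechet_derivative_at[OF has_derivative_add[OF this(1) has_derivative_mult_right[OF this(2), of s]]]
  show "partial_deriv i (\<lambda>x. f x + s * h x) x = partial_deriv i f x + s * partial_deriv i h x"
   unfolding partial_deriv_def by (auto dest: fun_cong[where x = "axis i 1"])
 qed
 have C: "C_times k f ==> C_times k h ==> C_times k (\<lambda>x. f x + s * h x)" for k and f h :: "'n::finite sfun"
 proof (induction k arbitrary: f h)
  case 0 thus ?case by (auto intro!: continuous_on_add continuous_on_mult_left)
 next
  case (Suc k)
  thus ?case using pd[of f h] by auto
 qed
 have d: "C_times (Suc 0) \<phi>" "C_times (Suc 0) \<zeta>" using assms unfolding test_functions_def by blast+
 thus "partial_deriv i (\<lambda>x. \<phi> x + s * \<zeta> x) x = partial_deriv i \<phi> x + s * partial_deriv i \<zeta> x"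
  using pd[of \<phi> \<zeta> i] by simp
 have "{x. \<phi> x + s * \<zeta> x \<noteq> 0} \<subseteq> {x. \<phi> x \<noteq> 0} \<union> {x. \<zeta> x \<noteq> 0}" by auto
 hence sub: "closure {x. \<phi> x + s * \<zeta> x \<noteq> 0} \<subseteq> closure {x. \<phi> x \<noteq> 0} \<union> closure {x. \<zeta> x \<noteq> 0}"
  unfolding closure_Un[symmetric] by (rule closure_mono)
 have "compact (closure {x. \<phi> x \<noteq> 0} \<union> closure {x. \<zeta> x \<noteq> 0})"
  using assms by (intro compact_Un) (auto simp: test_functions_def)
 from bounded_subset[OF compact_imp_bounded[OF this] order.trans[OF closure_subset sub]]
 have cc: "compact (closure {x. \<phi> x + s * \<zeta> x \<noteq> 0})" by (simp only: compact_closure)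
 have sO: "closure {x. \<phi> x + s * \<zeta> x \<noteq> 0} \<subseteq> \<Omega>"
  using assms by (intro order.trans[OF sub] Un_least) (auto simp: test_functions_def)
 have "\<forall>k. C_times k (\<lambda>x. \<phi> x + s * \<zeta> x)" using assms by (intro allI C) (auto simp: test_functions_def)
 with cc sO show "(\<lambda>x. \<phi> x + s * \<zeta> x) \<in> test_functions \<Omega>" by (simp add: test_functions_def)
qed

definition grad :: "(real ^ 'n::finite => real) => real ^ 'n => real ^ 'n" where
 "grad \<xi> x = (\<chi> i. partial_deriv i \<xi> x)"

lemma test_sobolev_fun:
 fixes \<xi> :: "'n::finite sfun"
 assumes \<xi>: "\<xi> \<in> test_functions \<Omega>"
 shows "sobolev_fun \<xi> (grad \<xi>)" "x \<notin> \<Omega> ==> grad \<xi> x = 0"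
proof -
 note T = test_functionD[OF \<xi>]
 have [measurable]: "\<xi> \<in> Borel" "\<And>i. partial_deriv i \<xi> \<in> Borel" by (rule T)+
 show "x \<notin> \<Omega> ==> grad \<xi> x = 0" using T(6) by (simp add: grad_def vec_eq_iff)
 have gm [measurable]: "grad \<xi> \<in> Borel"
  by (rule borel_measurable_vec_componentwise) (simp add: grad_def)
 have "\<forall>i. \<exists>RC. \<forall>x. \<bar>\<xi> x\<bar> \<le> snd RC \<and> \<bar>partial_deriv i \<xi> x\<bar> \<le> snd RC \<and> (norm x > fst RC --> \<xi> x = 0 \<and> partial_deriv i \<xi> x = 0)"
  using T(4) by (metis fst_conv snd_conv)
 then obtain RC where RC: "\<And>i x. \<bar>\<xi> x\<bar> \<le> snd (RC i) \<and> \<bar>partial_deriv i \<xi> x\<bar> \<le> snd (RC i) \<and> (norm x > fst (RC i) --> \<xi> x = 0 \<and> partial_deriv i \<xi> x = 0)"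
  by metis
 define R where "R = (\<Sum>i\<in>UNIV. \<bar>fst (RC i)\<bar>)"
 define C where "C = (\<Sum>i\<in>UNIV. \<bar>snd (RC i)\<bar>)"
 have le: "fst (RC i) \<le> R" "snd (RC i) \<le> C" for i
  unfolding R_def C_def
  by (rule order.trans[OF abs_ge_self member_le_sum[of i UNIV "\<lambda>i. \<bar>fst (RC i)\<bar>"]], auto)
    (rule order.trans[OF abs_ge_self member_le_sum[of i UNIV "\<lambda>i. \<bar>snd (RC i)\<bar>"]], auto)
 have b: "\<bar>\<xi> x\<bar> \<le> C" "\<bar>partial_deriv i \<xi> x\<bar> \<le> C" for i x
  using RC[of x i] le(2)[of i] by linarith+
 have z: "\<xi> x = 0" "partial_deriv i \<xi> x = 0" if "norm x > R" for i x
  using RC[of x i] le(1)[of i] that by linarith+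
 have gz: "grad \<xi> x = 0" if "norm x > R" for x using z(2)[OF that] by (simp add: grad_def vec_eq_iff)
 have gb: "norm (grad \<xi> x) \<le> real CARD('n) * C" for x
 proof -
  have "norm (grad \<xi> x) \<le> (\<Sum>i\<in>UNIV. \<bar>grad \<xi> x $ i\<bar>)" by (rule norm_le_l1_cart)
  also have "... \<le> (\<Sum>i\<in>(UNIV :: 'n set). C)" by (intro sum_mono) (simp add: grad_def b)
  finally show ?thesis by simp
 qed
 show "sobolev_fun \<xi> (grad \<xi>)"
  unfolding sobolev_fun_def wgrad_def
 proof (intro conjI ballI allI)
  show "locint \<xi>" by (rule integrable_locint, rule integrable_bounded_support[OF _ b(1) z(1)]) auto
  show "locint (\<lambda>x. grad \<xi> x $ i)" for i
   unfolding grad_def by (rule integrable_locint, rule integrable_bounded_support[where C = C and R = R]) (use b z in auto)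
  show "integrable lborel (\<lambda>x. \<bar>\<xi> x\<bar> ^ CARD('n))"
   by (rule integrable_bounded_support[where C = "C ^ CARD('n)" and R = R]) (use b z in \<open>auto simp: power_abs power_mono\<close>)
  show "integrable lborel (\<lambda>x. norm (grad \<xi> x) ^ CARD('n))"
   by (rule integrable_bounded_support[where C = "(real CARD('n) * C) ^ CARD('n)" and R = R]) (use gb gz in \<open>auto intro!: power_mono\<close>)
  fix \<phi> :: "'n sfun" and i assume p: "\<phi> \<in> test_functions UNIV"
  note P = test_functionD[OF p]
  obtain R' C' where RC': "\<And>x. \<bar>\<phi> x\<bar> \<le> C'" "\<And>x. \<bar>partial_deriv i \<phi> x\<bar> \<le> C'" using P(4)[of i] by blast
  have "(LBINT x. partial_deriv i \<xi> x * \<phi> x) = - (LBINT x. \<xi> x * partial_deriv i \<phi> x)"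
   by (rule integral_by_parts_ddiff[OF T(1) T(2) P(1) P(2) T(3) P(3), where C = "max C C'" and R = R])
     (use b z RC' in \<open>auto simp: le_max_iff_disj\<close>)
  thus "(LBINT x. \<xi> x * partial_deriv i \<phi> x) = - (LBINT x. grad \<xi> x $ i * \<phi> x)" by (simp add: grad_def)
 qed
qed

lemma Lp_imp_locint:
 fixes u :: "'n::finite sfun"
 assumes [measurable]: "u \<in> Borel" and i: "integrable lborel (\<lambda>x. \<bar>u x\<bar> ^ k)" and k: "k \<ge> 1"
 shows "locint u"
 unfolding locint_def
proof (intro conjI allI)
 fix R
 show "integrable lborel (\<lambda>x. indicator (cball 0 R) x * u x)"
 proof (rule integrable_dominated[OF integrable_plus[OF integrable_indicator_cball[of 0 R] i]])
  show "AE x in lborel. norm (indicator (cball 0 R) x * u x) \<le> norm (indicator (cball 0 R) x + \<bar>u x\<bar> ^ k)"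
   using le_one_plus_power[OF abs_ge_zero k, of "u _"] by (intro AE_I2) (auto simp: indicator_def)
 qed simp
qed simp

text \<open>Both domains of interest are exhausted by concentric closed balls.\<close>

lemma AE_on_domain:
 assumes \<Omega>: "\<Omega> = ball 0 1 \<or> \<Omega> = (UNIV :: (real ^ 'n::finite) set)"
  and P: "\<And>R R'. R < R' ==> cball 0 R' \<subseteq> \<Omega> ==> AE x in lborel. norm x \<le> R --> P x"
 shows "AE x in lborel. x \<in> \<Omega> --> P x"
proof -
 define \<rho> where "\<rho> k = (if \<Omega> = UNIV then real k else 1 - inverse (real (Suc k)))" for k
 have "AE x in lborel. norm x \<le> \<rho> k --> P x" for k
 proof (rule P[of _ "\<rho> k + inverse (real (Suc k)) / 2"])
  have i: "inverse (real (Suc k)) > 0" by (rule positive_imp_inverse_positive) simp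
  thus "\<rho> k < \<rho> k + inverse (real (Suc k)) / 2" by linarith
  show "cball 0 (\<rho> k + inverse (real (Suc k)) / 2) \<subseteq> \<Omega>"
  proof (cases "\<Omega> = UNIV")
   case False
   hence "\<rho> k + inverse (real (Suc k)) / 2 < 1" using i unfolding \<rho>_def by (simp only: if_False)
   thus ?thesis using \<Omega> False by auto
  qed simp
 qed
 hence "AE x in lborel. \<forall>k. norm x \<le> \<rho> k --> P x" by (subst AE_all_countable) auto
 thus ?thesis
 proof eventually_elim
  case (elim x)
  show ?case
  proof
   assume x: "x \<in> \<Omega>"
   show "P x"
   proof (cases "\<Omega> = UNIV")
    case True
    obtain k where "norm x \<le> real k" using real_arch_simple by blast
    thus ?thesis using elim[rule_format, of k] True by (simp add: \<rho>_def)
   next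
    case False
    hence "0 < 1 - norm x" using x \<Omega> by auto
    from eventually_happens[OF order_tendstoD(2)[OF LIMSEQ_inverse_real_of_nat this]]
    obtain k where "inverse (real (Suc k)) < 1 - norm x" by auto
    hence "norm x \<le> \<rho> k" using False by (simp add: \<rho>_def)
    thus ?thesis using elim by blast
   qed
  qed
 qed
qed

lemma locally_integrable_compact:
 assumes "locally_integrable_on \<Omega> w" "cball 0 R \<subseteq> \<Omega>"
 shows "integrable lebesgue (\<lambda>x. indicator (cball 0 R) x *\<^sub>R w x)"
 using assms unfolding locally_integrable_on_def set_integrable_def by auto

lemma locally_integrable_on_locint:
 fixes u :: "'n::finite sfun"
 assumes "locint u" shows "locally_integrable_on \<Omega> u"
 unfolding locally_integrable_on_def set_integrable_def
proof (intro allI impI)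
 fix K assume K: "compact K \<and> K \<subseteq> \<Omega>"
 have [measurable]: "u \<in> Borel" using assms by (rule locint_meas)
 have [measurable]: "K \<in> sets borel" using K by (auto intro: borel_compact)
 obtain R where R: "\<And>x. x \<in> K ==> norm x \<le> R" using compact_imp_bounded[of K] K unfolding bounded_iff by auto
 have "integrable lborel (\<lambda>x. indicator K x *\<^sub>R u x)"
  by (rule integrable_dominated[OF locint_integrable[OF assms, of R]]) (use R in \<open>auto simp: indicator_def\<close>)
 thus "integrable lebesgue (\<lambda>x. indicator K x *\<^sub>R u x)" by (subst integrable_completion) auto
qed

lemma locally_integrable_on_vec:
 fixes v :: "real ^ 'n::finite => real ^ 'n"
 assumes "\<And>i. locally_integrable_on \<Omega> (\<lambda>x. v x $ i)" shows "locally_integrable_on \<Omega> v"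
 unfolding locally_integrable_on_def set_integrable_def
proof (intro allI impI)
 fix K assume K: "compact K \<and> K \<subseteq> \<Omega>"
 have i: "integrable lebesgue (\<lambda>x. indicator K x * v x $ i)" for i
  using assms[of i] K unfolding locally_integrable_on_def set_integrable_def by simp
 show "integrable lebesgue (\<lambda>x. indicator K x *\<^sub>R v x)"
 proof (rule integrable_dominated)
  show "integrable lebesgue (\<lambda>x. \<Sum>i\<in>UNIV. \<bar>indicator K x * v x $ i\<bar>)"
   by (intro Bochner_Integration.integrable_sum integrable_abs i)
  show "(\<lambda>x. indicator K x *\<^sub>R v x) \<in> borel_measurable lebesgue"
   by (rule borel_measurable_vec_componentwise) (use i in auto)
  show "AE x in lebesgue. norm (indicator K x *\<^sub>R v x) \<le> norm (\<Sum>i\<in>UNIV. \<bar>indicator K x * v x $ i\<bar>)"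
   by (intro AE_I2 order.trans[OF norm_le_l1_cart]) (auto intro!: order.trans[OF _ abs_ge_self] sum_mono)
 qed
qed

lemma has_weak_gradient_of_wgrad:
 fixes u :: "'n::finite sfun"
 assumes u: "wgrad u v" and \<Omega> [measurable]: "\<Omega> \<in> sets borel"
 shows "has_weak_gradient \<Omega> u v"
 unfolding has_weak_gradient_def
proof (intro conjI ballI allI)
 show "locally_integrable_on \<Omega> u" by (rule locally_integrable_on_locint[OF wgradD(1)[OF u]])
 show "locally_integrable_on \<Omega> v"
  by (rule locally_integrable_on_vec, rule locally_integrable_on_locint[OF wgradD(2)[OF u]])
 fix \<phi> i assume p: "\<phi> \<in> test_functions \<Omega>"
 note T = test_functionD[OF p]
 have p': "\<phi> \<in> test_functions UNIV" using p test_functions_mono[of \<Omega> UNIV] by blast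
 have [measurable]: "u \<in> Borel" "(\<lambda>x. v x $ i) \<in> Borel"
  "\<phi> \<in> Borel" "partial_deriv i \<phi> \<in> Borel" using wgradD(3,4)[OF u] T by blast+
 have 1: "(\<lambda>x. indicator \<Omega> x *\<^sub>R (u x * partial_deriv i \<phi> x)) = (\<lambda>x. u x * partial_deriv i \<phi> x)"
  "(\<lambda>x. indicator \<Omega> x *\<^sub>R (v x $ i * \<phi> x)) = (\<lambda>x. v x $ i * \<phi> x)"
  using T(5,6) by (auto simp: fun_eq_iff indicator_def)
 show "(LINT x:\<Omega>|lebesgue. u x * partial_deriv i \<phi> x) = - (LINT x:\<Omega>|lebesgue. v x $ i * \<phi> x)"
  unfolding set_lebesgue_integral_def 1 using wgradD(5)[OF u p', of i] by (simp add: integral_completion)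
qed

text \<open>The difference, cut off to a ball inside the domain, is an integrable function to which
 \<open>fundamental_lemma\<close> applies on a smaller ball.\<close>

lemma has_weak_gradient_unique:
 fixes u :: "'n::finite sfun"
 assumes \<Omega>: "\<Omega> = ball 0 1 \<or> \<Omega> = UNIV" and w: "has_weak_gradient \<Omega> u w" and w': "has_weak_gradient \<Omega> u w'"
 shows "AE x in lborel. x \<in> \<Omega> --> w x = w' x"
proof -
 have "AE x in lborel. x \<in> \<Omega> --> w x $ i - w' x $ i = 0" for i
 proof (rule AE_on_domain[OF \<Omega>])
  fix R R' :: real assume R: "R < R'" "cball 0 R' \<subseteq> \<Omega>"
  have I: "integrable lebesgue (\<lambda>x. indicator (cball 0 R') x * w x $ i)" "integrable lebesgue (\<lambda>x. indicator (cball 0 R') x * w' x $ i)"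
   using integrable_vec_nth[OF locally_integrable_compact[of \<Omega> w R'], of i] integrable_vec_nth[OF locally_integrable_compact[of \<Omega> w' R'], of i]
    w w' R(2) by (auto simp: has_weak_gradient_def)
  let ?h = "\<lambda>x. indicator (cball 0 R') x * w x $ i - indicator (cball 0 R') x * w' x $ i"
  have ih: "integrable lebesgue ?h" using I by simp
  obtain h where h: "h \<in> Borel" "AE x in lborel. ?h x = h x"
   using borel_representative[OF borel_measurable_integrable[OF ih]] by blast
  have li: "locint h" by (rule integrable_locint) (use lebesgue_transfer(2)[OF h(2,1)] ih in simp)
  have "AE x in lborel. norm x \<le> R --> h x = 0"
  proof (rule fundamental_lemma[OF li, where \<Omega> = "ball 0 R'" and r = "(R' - R) / 2"])
   fix \<phi> assume p: "\<phi> \<in> test_functions (ball 0 R' :: (real ^ 'n) set)"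
   have "ball 0 R' \<subseteq> \<Omega>" using R(2) ball_subset_cball by blast
   hence p\<Omega>: "\<phi> \<in> test_functions \<Omega>" using p test_functions_mono by blast
   note T = test_functionD[OF p]
   have [measurable]: "\<phi> \<in> Borel" by (rule T)
   obtain C where C: "\<And>x. \<bar>\<phi> x\<bar> \<le> C" using T(4) by blast
   have m: "\<phi> \<in> borel_measurable lebesgue" by (intro measurable_completion) simp
   have i1: "integrable lebesgue (\<lambda>x. (indicator (cball 0 R') x * w x $ i) * \<phi> x)" "integrable lebesgue (\<lambda>x. (indicator (cball 0 R') x * w' x $ i) * \<phi> x)"
    by (rule integrable_bounded_mult[OF I(1) m C], rule integrable_bounded_mult[OF I(2) m C])
   have e: "indicator \<Omega> x *\<^sub>R (k x $ i * \<phi> x) = (indicator (cball 0 R') x * k x $ i) * \<phi> x" for k :: "real ^ 'n => real ^ 'n" and x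
   proof (cases "x \<in> ball 0 R'")
    case True
    hence "x \<in> \<Omega>" "x \<in> cball 0 R'" using R(2) by auto
    thus ?thesis by simp
   qed (simp add: T(5))
   have t: "(LINT x|lebesgue. (indicator (cball 0 R') x * k x $ i) * \<phi> x) = - (LINT x:\<Omega>|lebesgue. u x * partial_deriv i \<phi> x)"
    if k: "has_weak_gradient \<Omega> u k" for k
   proof -
    have "(LINT x:\<Omega>|lebesgue. k x $ i * \<phi> x) = (LINT x|lebesgue. (indicator (cball 0 R') x * k x $ i) * \<phi> x)"
     unfolding set_lebesgue_integral_def e ..
    thus ?thesis using k p\<Omega> by (auto simp: has_weak_gradient_def)
   qed
   note t = t[OF w] t[OF w']
   hence "(LINT x|lebesgue. ?h x * \<phi> x) = 0" using i1 t by (simp add: left_diff_distrib)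
   moreover have "(LINT x|lebesgue. ?h x * \<phi> x) = (LBINT x. h x * \<phi> x)"
    using h by (intro lebesgue_transfer(3)) (auto elim: eventually_mono)
   ultimately show "(LBINT x. h x * \<phi> x) = 0" by simp
  next
   fix x :: "real ^ 'n" assume "norm x \<le> R"
   thus "cball x ((R' - R) / 2) \<subseteq> ball 0 R'" using R(1) by (simp add: cball_subset_ball_iff field_simps)
  qed (use R in simp)
  thus "AE x in lborel. norm x \<le> R --> w x $ i - w' x $ i = 0"
   using h(2) by eventually_elim (use R(1) in \<open>auto simp: indicator_def split: if_splits\<close>)
 qed
 hence "AE x in lborel. \<forall>i. x \<in> \<Omega> --> w x $ i - w' x $ i = 0"
  by (intro AE_finite_allI[of UNIV, simplified]) auto
 thus ?thesis by eventually_elim (simp add: vec_eq_iff)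
qed

lemma weak_grad_AE:
 fixes u :: "'n::finite sfun"
 assumes \<Omega>: "\<Omega> = ball 0 1 \<or> \<Omega> = UNIV" and w: "has_weak_gradient \<Omega> u w"
 shows "AE x in lborel. x \<in> \<Omega> --> weak_grad \<Omega> u x = w x"
 by (rule has_weak_gradient_unique[OF \<Omega> _ w]) (auto simp: weak_grad_def intro: someI[of "has_weak_gradient \<Omega> u", OF w])

lemma Lp_norm_eq:
 fixes h h' :: "real ^ 'n::finite => 'b::euclidean_space"
 assumes "AE x in lborel. x \<in> \<Omega> --> h x = h' x" "\<And>x. x \<notin> \<Omega> ==> h' x = 0" "h' \<in> Borel" "p > 0"
 shows "Lp_norm \<Omega> p h ^ p = (LBINT x. norm (h' x) ^ p)"
  "Lp_norm \<Omega> p h = root p (LBINT x. norm (h' x) ^ p)"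
proof -
 have "(LINT x|lebesgue. indicator \<Omega> x *\<^sub>R norm (h x) ^ p) = (LBINT x. norm (h' x) ^ p)"
  by (rule lebesgue_transfer(3)) (use assms in \<open>auto elim!: eventually_mono simp: indicator_def\<close>)
 thus "Lp_norm \<Omega> p h = root p (LBINT x. norm (h' x) ^ p)" by (simp add: Lp_norm_def set_lebesgue_integral_def)
 thus "Lp_norm \<Omega> p h ^ p = (LBINT x. norm (h' x) ^ p)" using assms(4) by (simp add: real_root_pow_pos2)
qed

lemma Lp_spaceI:
 fixes h h' :: "real ^ 'n::finite => 'b::euclidean_space"
 assumes "AE x in lborel. x \<in> \<Omega> --> h x = h' x" "\<And>x. x \<notin> \<Omega> ==> h' x = 0" and [measurable]: "h' \<in> Borel"
  and "integrable lborel (\<lambda>x. norm (h' x) ^ p)" "p > 0"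
 shows "h \<in> Lp_space \<Omega> p"
proof -
 have "(\<lambda>x. indicator \<Omega> x *\<^sub>R h x) \<in> borel_measurable lebesgue"
  by (rule lebesgue_transfer(1)[of _ h']) (use assms in \<open>auto elim!: eventually_mono simp: indicator_def\<close>)
 moreover have "integrable lebesgue (\<lambda>x. indicator \<Omega> x *\<^sub>R norm (h x) ^ p)"
  by (subst lebesgue_transfer(2)[of _ "\<lambda>x. norm (h' x) ^ p"]) (use assms in \<open>auto elim!: eventually_mono simp: indicator_def\<close>)
 ultimately show ?thesis by (simp add: Lp_space_def set_borel_measurable_def set_integrable_def)
qed

lemma Lp_space_representative:
 fixes h :: "real ^ 'n::finite => 'b::euclidean_space"
 assumes h: "h \<in> Lp_space \<Omega> p" and [measurable]: "\<Omega> \<in> sets borel"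
  and rep: "\<And>k :: real ^ 'n => 'b. k \<in> borel_measurable lebesgue ==> \<exists>k'\<in>borel_measurable borel. AE x in lborel. k x = k' x"
  and p: "p > 0"
 shows "\<exists>h'. h' \<in> Borel \<and> (AE x in lborel. x \<in> \<Omega> --> h x = h' x) \<and> (\<forall>x. x \<notin> \<Omega> --> h' x = 0)
   \<and> integrable lborel (\<lambda>x. norm (h' x) ^ p)"
proof -
 have m: "(\<lambda>x. indicator \<Omega> x *\<^sub>R h x) \<in> borel_measurable lebesgue" and i: "integrable lebesgue (\<lambda>x. indicator \<Omega> x *\<^sub>R norm (h x) ^ p)"
  using h by (auto simp: Lp_space_def set_borel_measurable_def set_integrable_def)
 obtain k where k [measurable]: "k \<in> Borel" and kae: "AE x in lborel. indicator \<Omega> x *\<^sub>R h x = k x"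
  using rep[OF m] by blast
 define h' where "h' x = indicator \<Omega> x *\<^sub>R k x" for x
 have hm [measurable]: "h' \<in> Borel" unfolding h'_def by measurable
 have ae: "AE x in lborel. x \<in> \<Omega> --> h x = h' x" using kae by eventually_elim (auto simp: h'_def)
 have "integrable lborel (\<lambda>x. norm (h' x) ^ p)"
  using i by (subst lebesgue_transfer(2)[of "\<lambda>x. indicator \<Omega> x *\<^sub>R norm (h x) ^ p", symmetric])
   (use ae p in \<open>auto elim!: eventually_mono simp: indicator_def h'_def\<close>)
 thus ?thesis using hm ae by (intro exI[of _ h']) (auto simp: h'_def)
qed

lemma sobolev_of_sobolev_fun:
 fixes u :: "'n::finite sfun"
 assumes \<Omega>: "\<Omega> = ball 0 1 \<or> \<Omega> = UNIV" and u: "sobolev_fun u v" and z: "\<And>x. x \<notin> \<Omega> ==> u x = 0" "\<And>x. x \<notin> \<Omega> ==> v x = 0"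
 shows "u \<in> sobolev \<Omega> CARD('n)" "has_weak_gradient \<Omega> u v" "AE x in lborel. x \<in> \<Omega> --> weak_grad \<Omega> u x = v x"
  "Lp_norm \<Omega> CARD('n) (weak_grad \<Omega> u) = root CARD('n) (LBINT x. norm (v x) ^ CARD('n))"
  "sobolev_norm \<Omega> CARD('n) u = root CARD('n) ((LBINT x. norm (v x) ^ CARD('n)) + (LBINT x. norm (u x) ^ CARD('n)))"
proof -
 note U = sobolev_funD[OF u]
 have \<Omega>m: "\<Omega> \<in> sets borel" using \<Omega> by auto
 show w: "has_weak_gradient \<Omega> u v" by (rule has_weak_gradient_of_wgrad[OF U(1) \<Omega>m])
 show ae: "AE x in lborel. x \<in> \<Omega> --> weak_grad \<Omega> u x = v x" by (rule weak_grad_AE[OF \<Omega> w])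
 have "u \<in> Lp_space \<Omega> CARD('n)" "v \<in> Lp_space \<Omega> CARD('n)"
  by (rule Lp_spaceI[of \<Omega> _ u], use z U in auto) (rule Lp_spaceI[of \<Omega> _ v], use z U in auto)
 thus "u \<in> sobolev \<Omega> CARD('n)" using w by (auto simp: sobolev_def)
 note L = Lp_norm_eq[OF ae z(2) U(5), of "CARD('n)"] and L' = Lp_norm_eq(1)[of \<Omega> u u "CARD('n)", OF _ z(1) U(4)]
 show "Lp_norm \<Omega> CARD('n) (weak_grad \<Omega> u) = root CARD('n) (LBINT x. norm (v x) ^ CARD('n))" using L by simp
 show "sobolev_norm \<Omega> CARD('n) u = root CARD('n) ((LBINT x. norm (v x) ^ CARD('n)) + (LBINT x. norm (u x) ^ CARD('n)))"
  using L(1) L' by (simp add: sobolev_norm_def)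
qed

lemma sobolev_UNIV_representative:
 fixes u :: "'n::finite sfun"
 assumes "u \<in> sobolev UNIV CARD('n)" and [measurable]: "A \<in> sets borel" and A: "AE x in lborel. x \<notin> A --> u x = 0"
 shows "\<exists>u' v'. sobolev_fun u' v' \<and> (\<forall>x. x \<notin> A --> u' x = 0) \<and>
   (AE x in lborel. u x = u' x) \<and> (AE x in lborel. weak_grad UNIV u x = v' x)"
proof -
 obtain v where u: "u \<in> Lp_space UNIV CARD('n)" and v: "v \<in> Lp_space UNIV CARD('n)" and w: "has_weak_gradient UNIV u v"
  using assms by (auto simp: sobolev_def)
 obtain u0 where u0: "u0 \<in> Borel" "AE x in lborel. u x = u0 x" "integrable lborel (\<lambda>x. norm (u0 x) ^ CARD('n))"
  using Lp_space_representative[OF u _ borel_representative] by auto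
 have [measurable]: "u0 \<in> Borel" by fact
 define u' where "u' x = indicator A x * u0 x" for x
 have u': "u' \<in> Borel" "AE x in lborel. u x = u' x"
  unfolding u'_def[abs_def] using u0(2) A by (measurable, eventually_elim) (auto simp: indicator_def)
 have iu: "integrable lborel (\<lambda>x. norm (u' x) ^ CARD('n))"
  by (rule integrable_dominated[OF u0(3)]) (use u' in \<open>auto simp: u'_def indicator_def\<close>)
 obtain v' where v': "v' \<in> Borel" "AE x in lborel. v x = v' x" "integrable lborel (\<lambda>x. norm (v' x) ^ CARD('n))"
  using Lp_space_representative[OF v _ borel_representative_vec] by auto
 have [measurable]: "u' \<in> Borel" "v' \<in> Borel" by fact+
 have iv: "integrable lborel (\<lambda>x. \<bar>v' x $ i\<bar> ^ CARD('n))" for i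
  by (rule integrable_dominated[OF v'(3)]) (auto intro!: AE_I2 power_mono component_le_norm_cart simp: power_abs)
 have "wgrad u' v'" unfolding wgrad_def
 proof (intro conjI ballI allI)
  show "locint u'" by (rule Lp_imp_locint[of _ "CARD('n)"]) (use u' iu in auto)
  show "locint (\<lambda>x. v' x $ i)" for i by (rule Lp_imp_locint[of _ "CARD('n)"]) (use iv in auto)
  fix \<phi> :: "'n sfun" and i assume p: "\<phi> \<in> test_functions UNIV"
  have [measurable]: "\<phi> \<in> Borel" "partial_deriv i \<phi> \<in> Borel" by (rule test_functionD[OF p])+
  have "(LINT x|lebesgue. u x * partial_deriv i \<phi> x) = - (LINT x|lebesgue. v x $ i * \<phi> x)"
   using w p by (simp add: has_weak_gradient_def set_lebesgue_integral_def)
  moreover have "(LINT x|lebesgue. u x * partial_deriv i \<phi> x) = (LBINT x. u' x * partial_deriv i \<phi> x)"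
   by (rule lebesgue_transfer(3)) (use u' in \<open>auto elim!: eventually_mono\<close>)
  moreover have "(LINT x|lebesgue. v x $ i * \<phi> x) = (LBINT x. v' x $ i * \<phi> x)"
   by (rule lebesgue_transfer(3)) (use v' in \<open>auto elim!: eventually_mono\<close>)
  ultimately show "(LBINT x. u' x * partial_deriv i \<phi> x) = - (LBINT x. v' x $ i * \<phi> x)" by simp
 qed
 moreover have "AE x in lborel. weak_grad UNIV u x = v' x"
  using weak_grad_AE[OF disjI2[OF refl] w] v'(2) by eventually_elim simp
 ultimately show ?thesis using u' iu v' by (intro exI[of _ u'] exI[of _ v']) (auto simp: sobolev_fun_def u'_def)
qed

section \<open>Zero extension from the unit ball\<close>

text \<open>Extensions by zero of the members of \<open>W\<^sub>0\<close> on the ball together with the extended gradients; the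
 approximation by test functions is measured in the \<open>N\<close>-th powers of the norms.\<close>

definition zero_class :: "((real ^ 'n::finite => real) \<times> (real ^ 'n => real ^ 'n)) set" where
 "zero_class = {(\<phi>, \<psi>). sobolev_fun \<phi> \<psi> \<and> (\<forall>x. x \<notin> ball 0 1 --> \<phi> x = 0 \<and> \<psi> x = 0) \<and>
   (\<forall>\<epsilon>>0. \<exists>\<xi>\<in>test_functions (ball 0 1).
    (LBINT x. norm (\<psi> x - grad \<xi> x) ^ CARD('n)) + (LBINT x. norm (\<phi> x - \<xi> x) ^ CARD('n)) < \<epsilon>)}"

lemma integral_norm_lincomb_le:
 fixes a b :: "'a => 'b::euclidean_space"
 assumes N: "n \<ge> 2" and ab: "a \<in> borel_measurable M" "b \<in> borel_measurable M"
  "integrable M (\<lambda>x. norm (a x) ^ n)" "integrable M (\<lambda>x. norm (b x) ^ n)"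
 shows "(LINT x|M. norm (a x + t *\<^sub>R b x) ^ n) \<le> 2 ^ n * ((LINT x|M. norm (a x) ^ n) + \<bar>t\<bar> ^ n * (LINT x|M. norm (b x) ^ n))"
proof -
 have "(LINT x|M. norm (a x + t *\<^sub>R b x) ^ n) \<le> (LINT x|M. 2 ^ n * (norm (a x) ^ n + \<bar>t\<bar> ^ n * norm (b x) ^ n))"
 proof (rule integral_mono)
  show "integrable M (\<lambda>x. norm (a x + t *\<^sub>R b x) ^ n)" by (rule integral_norm_power_variation(1)[OF N ab])
  show "integrable M (\<lambda>x. 2 ^ n * (norm (a x) ^ n + \<bar>t\<bar> ^ n * norm (b x) ^ n))"
   by (intro integrable_mult_right integrable_plus ab)
  fix x
  have "norm (a x + t *\<^sub>R b x) ^ n \<le> (norm (a x) + \<bar>t\<bar> * norm (b x)) ^ n"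
   using norm_triangle_ineq[of "a x" "t *\<^sub>R b x"] by (intro power_mono) auto
  also have "... \<le> 2 ^ n * (norm (a x) ^ n + (\<bar>t\<bar> * norm (b x)) ^ n)" by (rule add_power_le) auto
  finally show "norm (a x + t *\<^sub>R b x) ^ n \<le> 2 ^ n * (norm (a x) ^ n + \<bar>t\<bar> ^ n * norm (b x) ^ n)" by (simp add: power_mult_distrib)
 qed
 also have "... = 2 ^ n * ((LINT x|M. norm (a x) ^ n) + \<bar>t\<bar> ^ n * (LINT x|M. norm (b x) ^ n))" using ab by simp
 finally show ?thesis .
qed

lemma grad_lincomb:
 "\<phi> \<in> test_functions \<Omega> ==> \<zeta> \<in> test_functions \<Omega> ==> grad (\<lambda>x. \<phi> x + s * \<zeta> x) x = grad \<phi> x + s *\<^sub>R grad \<zeta> x"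
 unfolding grad_def vec_eq_iff by (simp add: test_functions_lincomb(2)[of \<phi> \<Omega> \<zeta>])

lemma zero_class_lincomb:
 fixes \<phi> \<phi>' :: "'n::finite sfun"
 assumes N: "CARD('n) \<ge> 2" and p: "(\<phi>, \<psi>) \<in> zero_class" and p': "(\<phi>', \<psi>') \<in> zero_class"
 shows "((\<lambda>x. \<phi> x + s * \<phi>' x), (\<lambda>x. \<psi> x + s *\<^sub>R \<psi>' x)) \<in> zero_class"
proof -
 let ?n = "CARD('n)"
 have s: "sobolev_fun \<phi> \<psi>" "sobolev_fun \<phi>' \<psi>'" using p p' by (auto simp: zero_class_def)
 have "\<exists>\<xi>\<in>test_functions (ball 0 1). (LBINT x. norm (\<psi> x + s *\<^sub>R \<psi>' x - grad \<xi> x) ^ ?n) + (LBINT x. norm (\<phi> x + s * \<phi>' x - \<xi> x) ^ ?n) < \<epsilon>"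
  if e: "\<epsilon> > 0" for \<epsilon>
 proof -
  define \<delta> where "\<delta> = \<epsilon> / (2 ^ ?n * (1 + \<bar>s\<bar> ^ ?n))"
  have d: "\<delta> > 0" using e by (auto simp: \<delta>_def intro!: divide_pos_pos mult_pos_pos add_pos_nonneg)
  obtain \<xi> where x: "\<xi> \<in> test_functions (ball 0 1)"
   "(LBINT x. norm (\<psi> x - grad \<xi> x) ^ ?n) + (LBINT x. norm (\<phi> x - \<xi> x) ^ ?n) < \<delta>"
   using p d by (auto simp: zero_class_def)
  obtain \<xi>' where x': "\<xi>' \<in> test_functions (ball 0 1)"
   "(LBINT x. norm (\<psi>' x - grad \<xi>' x) ^ ?n) + (LBINT x. norm (\<phi>' x - \<xi>' x) ^ ?n) < \<delta>"
   using p' d by (auto simp: zero_class_def)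
  note D = sobolev_fun_lincomb[OF N s(1) test_sobolev_fun(1)[OF x(1)], of "- 1"]
   and D' = sobolev_fun_lincomb[OF N s(2) test_sobolev_fun(1)[OF x'(1)], of "- 1"]
  note E = sobolev_funD[OF D, simplified] and E' = sobolev_funD[OF D', simplified]
  let ?\<xi> = "\<lambda>x. \<xi> x + s * \<xi>' x"
  have 1: "(LBINT x. norm ((\<psi> x - grad \<xi> x) + s *\<^sub>R (\<psi>' x - grad \<xi>' x)) ^ ?n)
    \<le> 2 ^ ?n * ((LBINT x. norm (\<psi> x - grad \<xi> x) ^ ?n) + \<bar>s\<bar> ^ ?n * (LBINT x. norm (\<psi>' x - grad \<xi>' x) ^ ?n))"
   by (rule integral_norm_lincomb_le[OF N]) (use E E' in auto)
  have 2: "(LBINT x. norm ((\<phi> x - \<xi> x) + s *\<^sub>R (\<phi>' x - \<xi>' x)) ^ ?n)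
    \<le> 2 ^ ?n * ((LBINT x. norm (\<phi> x - \<xi> x) ^ ?n) + \<bar>s\<bar> ^ ?n * (LBINT x. norm (\<phi>' x - \<xi>' x) ^ ?n))"
   by (rule integral_norm_lincomb_le[OF N]) (use E E' in auto)
  have g: "grad ?\<xi> x = grad \<xi> x + s *\<^sub>R grad \<xi>' x" for x by (rule grad_lincomb[OF x(1) x'(1)])
  have eq: "\<psi> x + s *\<^sub>R \<psi>' x - grad ?\<xi> x = (\<psi> x - grad \<xi> x) + s *\<^sub>R (\<psi>' x - grad \<xi>' x)"
   "\<phi> x + s * \<phi>' x - ?\<xi> x = (\<phi> x - \<xi> x) + s *\<^sub>R (\<phi>' x - \<xi>' x)" for x
   by (simp_all add: g algebra_simps)
  have "(LBINT x. norm (\<psi> x + s *\<^sub>R \<psi>' x - grad ?\<xi> x) ^ ?n) + (LBINT x. norm (\<phi> x + s * \<phi>' x - ?\<xi> x) ^ ?n)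
    \<le> 2 ^ ?n * (((LBINT x. norm (\<psi> x - grad \<xi> x) ^ ?n) + (LBINT x. norm (\<phi> x - \<xi> x) ^ ?n))
     + \<bar>s\<bar> ^ ?n * ((LBINT x. norm (\<psi>' x - grad \<xi>' x) ^ ?n) + (LBINT x. norm (\<phi>' x - \<xi>' x) ^ ?n)))"
   unfolding eq using 1 2 by (simp add: algebra_simps)
  also have "... < 2 ^ ?n * (\<delta> + \<bar>s\<bar> ^ ?n * \<delta>)"
   using x(2) x'(2) by (intro mult_strict_left_mono add_less_le_mono mult_left_mono) auto
  also have "... = \<epsilon>"
  proof -
   have "1 + \<bar>s\<bar> ^ ?n > 0" by (intro add_pos_nonneg) auto
   hence "2 ^ ?n * (1 + \<bar>s\<bar> ^ ?n) * \<delta> = \<epsilon>" by (simp add: \<delta>_def)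
   thus ?thesis by (simp add: algebra_simps)
  qed
  finally show ?thesis using test_functions_lincomb(1)[OF x(1) x'(1), of s] by blast
 qed
 thus ?thesis using sobolev_fun_lincomb[OF N s, of s] p p' by (auto simp: zero_class_def)
qed

lemma test_in_zero_class:
 fixes \<xi> :: "'n::finite sfun"
 assumes "\<xi> \<in> test_functions (ball 0 1)" shows "(\<xi>, grad \<xi>) \<in> zero_class"
proof -
 have "\<exists>\<zeta>\<in>test_functions (ball 0 1). (LBINT x. norm (grad \<xi> x - grad \<zeta> x) ^ CARD('n)) + (LBINT x. norm (\<xi> x - \<zeta> x) ^ CARD('n)) < \<epsilon>"
  if "\<epsilon> > 0" for \<epsilon> using assms that by (intro bexI[of _ \<xi>]) (auto simp: power_0_left)
 thus ?thesis using test_sobolev_fun[OF assms] test_functionD(5)[OF assms] by (auto simp: zero_class_def)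
qed

lemma zero_class_sobolev0:
 fixes \<phi> :: "'n::finite sfun"
 assumes N: "CARD('n) \<ge> 2" and p: "(\<phi>, \<psi>) \<in> zero_class"
 shows "\<phi> \<in> sobolev0 (ball 0 1) CARD('n)"
proof -
 let ?B = "ball 0 1 :: (real ^ 'n) set"
 have s: "sobolev_fun \<phi> \<psi>" and z: "\<And>x. x \<notin> ?B ==> \<phi> x = 0" "\<And>x. x \<notin> ?B ==> \<psi> x = 0" using p by (auto simp: zero_class_def)
 have "\<exists>\<xi>\<in>test_functions ?B. sobolev_norm ?B CARD('n) (\<lambda>x. \<phi> x - \<xi> x) < \<epsilon>" if e: "\<epsilon> > 0" for \<epsilon>
 proof -
  have "\<epsilon> ^ CARD('n) > 0" using e by simp
  then obtain \<xi> where x: "\<xi> \<in> test_functions ?B" "(LBINT x. norm (\<psi> x - grad \<xi> x) ^ CARD('n)) + (LBINT x. norm (\<phi> x - \<xi> x) ^ CARD('n)) < \<epsilon> ^ CARD('n)"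
   using p unfolding zero_class_def by blast
  have D: "sobolev_fun (\<lambda>x. \<phi> x - \<xi> x) (\<lambda>x. \<psi> x - grad \<xi> x)"
   using sobolev_fun_lincomb[OF N s test_sobolev_fun(1)[OF x(1)], of "- 1"] by simp
  have "sobolev_norm ?B CARD('n) (\<lambda>x. \<phi> x - \<xi> x) = root CARD('n) ((LBINT x. norm (\<psi> x - grad \<xi> x) ^ CARD('n)) + (LBINT x. norm (\<phi> x - \<xi> x) ^ CARD('n)))"
   by (rule sobolev_of_sobolev_fun(5)[OF disjI1[OF refl] D]) (use z test_functionD(5)[OF x(1)] test_sobolev_fun(2)[OF x(1)] in auto)
  also have "... < root CARD('n) (\<epsilon> ^ CARD('n))" by (rule real_root_less_mono[OF _ x(2)]) simp
  also have "... = \<epsilon>" using e by (simp add: real_root_power_cancel)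
  finally show ?thesis using x(1) by blast
 qed
 thus ?thesis using sobolev_of_sobolev_fun(1)[OF disjI1[OF refl] s z] by (auto simp: sobolev0_def)
qed

text \<open>On the ball, \<open>|s| \<le> \<delta> + \<delta> (|s| / \<delta>) ^ n\<close>.\<close>

lemma integral_abs_small:
 fixes s :: "real ^ 'n::finite => 'b::euclidean_space"
 assumes [measurable]: "s \<in> Borel" and i: "integrable lborel (\<lambda>x. norm (s x) ^ n)" and n: "n \<ge> 1"
  and z: "\<And>x. x \<notin> ball 0 1 ==> s x = 0" and d: "\<delta> > 0" and le: "(LBINT x. norm (s x) ^ n) \<le> \<delta> ^ n"
 shows "integrable lborel (\<lambda>x. norm (s x))" "(LBINT x. norm (s x)) \<le> \<delta> * (measure lborel (cball (0 :: real ^ 'n) 1) + 1)"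
proof -
 let ?b = "\<lambda>x :: real ^ 'n. \<delta> * indicator (cball 0 1) x + \<delta> / \<delta> ^ n * norm (s x) ^ n"
 have b: "norm (s x) \<le> ?b x" for x
 proof (cases "x \<in> ball 0 1")
  case True
  have "norm (s x) / \<delta> \<le> 1 + (norm (s x) / \<delta>) ^ n" using d n by (intro le_one_plus_power) auto
  hence "\<delta> * (norm (s x) / \<delta>) \<le> \<delta> * (1 + (norm (s x) / \<delta>) ^ n)" using d by (intro mult_left_mono) auto
  thus ?thesis using d True by (simp add: power_divide algebra_simps)
 qed (use z d in simp)
 have ib: "integrable lborel ?b" by (intro integrable_plus integrable_mult_right integrable_indicator_cball i)
 show is1: "integrable lborel (\<lambda>x. norm (s x))"
  by (rule integrable_dominated[OF ib]) (use b in \<open>auto intro!: AE_I2 order.trans[OF _ abs_ge_self]\<close>)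
 have "(LBINT x. norm (s x)) \<le> (LBINT x. ?b x)" by (rule integral_mono[OF is1 ib b])
 also have "... = \<delta> * measure lborel (cball (0 :: real ^ 'n) 1) + \<delta> / \<delta> ^ n * (LBINT x. norm (s x) ^ n)"
  using i integrable_indicator_cball[of "0 :: real ^ 'n" 1] by simp
 also have "... \<le> \<delta> * measure lborel (cball (0 :: real ^ 'n) 1) + \<delta> / \<delta> ^ n * \<delta> ^ n"
  using le d by (intro add_left_mono mult_left_mono) auto
 also have "... = \<delta> * (measure lborel (cball (0 :: real ^ 'n) 1) + 1)" using d by (simp add: algebra_simps)
 finally show "(LBINT x. norm (s x)) \<le> \<delta> * (measure lborel (cball (0 :: real ^ 'n) 1) + 1)" .
qed

text \<open>Integration by parts over the whole space holds for test functions in the ball and passes to the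
 limit, since convergence in the \<open>N\<close>-th mean on the ball implies convergence in the mean.\<close>

lemma sobolev0_zero_class:
 fixes u :: "'n::finite sfun"
 assumes N: "CARD('n) \<ge> 2" and u: "u \<in> sobolev0 (ball 0 1) CARD('n)"
 shows "\<exists>u' v'. (u', v') \<in> zero_class \<and> (AE x in lborel. x \<in> ball 0 1 --> u x = u' x) \<and>
   (AE x in lborel. x \<in> ball 0 1 --> weak_grad (ball 0 1) u x = v' x)"
proof -
 let ?B = "ball 0 1 :: (real ^ 'n) set" let ?n = "CARD('n)"
 have dB: "?B = ball 0 1 \<or> ?B = UNIV" by simp
 obtain v where uL: "u \<in> Lp_space ?B ?n" and vL: "v \<in> Lp_space ?B ?n" and w: "has_weak_gradient ?B u v"
  using u by (auto simp: sobolev0_def sobolev_def)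
 obtain u' where u': "u' \<in> Borel" "AE x in lborel. x \<in> ?B --> u x = u' x" "\<And>x. x \<notin> ?B ==> u' x = 0" "integrable lborel (\<lambda>x. norm (u' x) ^ ?n)"
  using Lp_space_representative[OF uL _ borel_representative] by auto
 obtain v' where v': "v' \<in> Borel" "AE x in lborel. x \<in> ?B --> v x = v' x" "\<And>x. x \<notin> ?B ==> v' x = 0" "integrable lborel (\<lambda>x. norm (v' x) ^ ?n)"
  using Lp_space_representative[OF vL _ borel_representative_vec] by auto
 have [measurable]: "u' \<in> Borel" "v' \<in> Borel" by fact+
 have test: "(LINT x:?B|lebesgue. u x * partial_deriv i \<phi> x) = (LBINT x. u' x * partial_deriv i \<phi> x)"
   "(LINT x:?B|lebesgue. v x $ i * \<phi> x) = (LBINT x. v' x $ i * \<phi> x)" if p: "\<phi> \<in> test_functions UNIV" for \<phi> i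
 proof -
  have [measurable]: "\<phi> \<in> Borel" "partial_deriv i \<phi> \<in> Borel" by (rule test_functionD[OF p])+
  show "(LINT x:?B|lebesgue. u x * partial_deriv i \<phi> x) = (LBINT x. u' x * partial_deriv i \<phi> x)"
   unfolding set_lebesgue_integral_def
   by (rule lebesgue_transfer(3)) (use u' in \<open>auto elim!: eventually_mono simp: indicator_def\<close>)
  show "(LINT x:?B|lebesgue. v x $ i * \<phi> x) = (LBINT x. v' x $ i * \<phi> x)"
   unfolding set_lebesgue_integral_def
   by (rule lebesgue_transfer(3)) (use v' in \<open>auto elim!: eventually_mono simp: indicator_def\<close>)
 qed
 have iv: "integrable lborel (\<lambda>x. \<bar>v' x $ i\<bar> ^ ?n)" for i
  by (rule integrable_dominated[OF v'(4)]) (auto intro!: AE_I2 power_mono component_le_norm_cart simp: power_abs)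
 have lu: "locint u'" by (rule Lp_imp_locint[of _ ?n]) (use u' in auto)
 have lv: "locint (\<lambda>x. v' x $ i)" for i by (rule Lp_imp_locint[of _ ?n]) (use iv in auto)
 have hw: "has_weak_gradient ?B (\<lambda>x. u x - \<xi> x) (\<lambda>x. v x - grad \<xi> x)" if x: "\<xi> \<in> test_functions ?B" for \<xi>
 proof -
  have h: "has_weak_gradient ?B \<xi> (grad \<xi>)"
   by (rule has_weak_gradient_of_wgrad[OF sobolev_funD(1)[OF test_sobolev_fun(1)[OF x]]]) simp
  have I: "set_integrable lebesgue ?B (\<lambda>x. a x * b x)" if la: "locally_integrable_on ?B a" and p: "\<phi> \<in> test_functions ?B"
    and bp: "b = \<phi> \<or> b = partial_deriv i \<phi>" for a b \<phi> :: "'n sfun" and i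
  proof -
   note T = test_functionD[OF p]
   let ?K = "closure {x. \<phi> x \<noteq> 0}"
   have K: "compact ?K" "?K \<subseteq> ?B" using p by (auto simp: test_functions_def)
   obtain R C where C: "\<And>x. \<bar>b x\<bar> \<le> C" using T(4)[of i] bp by blast
   have bm: "b \<in> borel_measurable lebesgue" using T(1) T(2)[of i] bp by (auto intro!: measurable_completion)
   have bz: "b x = 0" if "x \<notin> ?K" for x
   proof -
    have "\<phi> \<in> test_functions ?K" using p by (auto simp: test_functions_def)
    from test_functionD(5,6)[OF this that] show ?thesis using bp by auto
   qed
   have "integrable lebesgue (\<lambda>x. (indicator ?K x * a x) * b x)"
    by (rule integrable_bounded_mult[OF _ bm C]) (use la K in \<open>auto simp: locally_integrable_on_def set_integrable_def\<close>)
   moreover have "(\<lambda>x. (indicator ?K x * a x) * b x) = (\<lambda>x. indicator ?B x *\<^sub>R (a x * b x))"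
    using bz K(2) by (auto simp: fun_eq_iff indicator_def)
   ultimately show ?thesis by (simp add: set_integrable_def)
  qed
  have li: "locally_integrable_on ?B u" "locally_integrable_on ?B \<xi>" "locally_integrable_on ?B v" "locally_integrable_on ?B (grad \<xi>)"
   using w h by (auto simp: has_weak_gradient_def)
  have lic: "locally_integrable_on ?B (\<lambda>x. k x $ i)" if "locally_integrable_on ?B k" for k :: "real ^ 'n => real ^ 'n" and i
   using that unfolding locally_integrable_on_def set_integrable_def
   using integrable_vec_nth[of lebesgue "\<lambda>x. indicator _ x *\<^sub>R k x" i] by simp
  show ?thesis unfolding has_weak_gradient_def
  proof (intro conjI ballI allI)
   show "locally_integrable_on ?B (\<lambda>x. u x - \<xi> x)" "locally_integrable_on ?B (\<lambda>x. v x - grad \<xi> x)"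
    using li by (auto simp: locally_integrable_on_def intro: set_integral_diff)
   fix \<phi> i assume p: "\<phi> \<in> test_functions ?B"
   have "(LINT x:?B|lebesgue. (u x - \<xi> x) * partial_deriv i \<phi> x) = (LINT x:?B|lebesgue. u x * partial_deriv i \<phi> x) - (LINT x:?B|lebesgue. \<xi> x * partial_deriv i \<phi> x)"
    unfolding left_diff_distrib by (intro set_integral_diff I[OF _ p]) (use li in auto)
   moreover have "(LINT x:?B|lebesgue. (v x - grad \<xi> x) $ i * \<phi> x) = (LINT x:?B|lebesgue. v x $ i * \<phi> x) - (LINT x:?B|lebesgue. grad \<xi> x $ i * \<phi> x)"
    unfolding vector_minus_component left_diff_distrib by (intro set_integral_diff I[OF _ p]) (use li lic in auto)
   ultimately show "(LINT x:?B|lebesgue. (u x - \<xi> x) * partial_deriv i \<phi> x) = - (LINT x:?B|lebesgue. (v x - grad \<xi> x) $ i * \<phi> x)"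
    using w h p by (simp add: has_weak_gradient_def)
  qed
 qed
 have approx: "\<exists>\<xi>\<in>test_functions ?B. (LBINT x. norm (v' x - grad \<xi> x) ^ ?n) + (LBINT x. norm (u' x - \<xi> x) ^ ?n) < \<epsilon>"
  if e: "\<epsilon> > 0" for \<epsilon>
 proof -
  have "root ?n \<epsilon> > 0" using e by simp
  then obtain \<xi> where x: "\<xi> \<in> test_functions ?B" "sobolev_norm ?B ?n (\<lambda>x. u x - \<xi> x) < root ?n \<epsilon>"
   using u unfolding sobolev0_def by blast
  note X = sobolev_funD[OF test_sobolev_fun(1)[OF x(1)]]
  have [measurable]: "\<xi> \<in> Borel" "grad \<xi> \<in> Borel" by (rule X)+
  have a1: "Lp_norm ?B ?n (weak_grad ?B (\<lambda>x. u x - \<xi> x)) ^ ?n = (LBINT x. norm (v' x - grad \<xi> x) ^ ?n)"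
  proof (rule Lp_norm_eq(1))
   show "AE xa in lborel. xa \<in> ?B --> weak_grad ?B (\<lambda>x. u x - \<xi> x) xa = v' xa - grad \<xi> xa"
    using weak_grad_AE[OF dB hw[OF x(1)]] v'(2) by eventually_elim auto
  qed (use v'(3) test_sobolev_fun(2)[OF x(1)] in auto)
  have a2: "Lp_norm ?B ?n (\<lambda>x. u x - \<xi> x) ^ ?n = (LBINT x. norm (u' x - \<xi> x) ^ ?n)"
   by (rule Lp_norm_eq(1)) (use u'(2,3) test_functionD(5)[OF x(1)] in \<open>auto elim!: eventually_mono\<close>)
  have "root ?n ((LBINT x. norm (v' x - grad \<xi> x) ^ ?n) + (LBINT x. norm (u' x - \<xi> x) ^ ?n)) < root ?n \<epsilon>"
   using x(2) unfolding sobolev_norm_def a1 a2 .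
  thus ?thesis using x(1) by (intro bexI[of _ \<xi>]) auto
 qed
 have "wgrad u' v'" unfolding wgrad_def
 proof (intro conjI ballI allI)
  show "locint u'" "locint (\<lambda>x. v' x $ i)" for i by (rule lu, rule lv)
  fix \<phi> :: "'n sfun" and i assume p: "\<phi> \<in> test_functions UNIV"
  note T = test_functionD[OF p]
  have [measurable]: "\<phi> \<in> Borel" "partial_deriv i \<phi> \<in> Borel" by (rule T)+
  obtain R C where C: "\<And>x. \<bar>\<phi> x\<bar> \<le> C" "\<And>x. \<bar>partial_deriv i \<phi> x\<bar> \<le> C" using T(4)[of i] by blast
  have C0: "C \<ge> 0" using C(1)[of 0] by linarith
  define I where "I = (LBINT x. u' x * partial_deriv i \<phi> x) + (LBINT x. v' x $ i * \<phi> x)"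
  define K where "K = measure lborel (cball (0 :: real ^ 'n) 1) + 1"
  have K: "K > 0" by (simp add: K_def add_nonneg_pos)
  have small: "\<bar>I\<bar> \<le> 2 * C * K * \<delta>" if d: "\<delta> > 0" for \<delta>
  proof -
   obtain \<xi> where x: "\<xi> \<in> test_functions ?B" "(LBINT x. norm (v' x - grad \<xi> x) ^ ?n) + (LBINT x. norm (u' x - \<xi> x) ^ ?n) < \<delta> ^ ?n"
    using approx[of "\<delta> ^ ?n"] d by auto
   note X = sobolev_funD[OF test_sobolev_fun(1)[OF x(1)]]
   have [measurable]: "\<xi> \<in> Borel" "grad \<xi> \<in> Borel" by (rule X)+
   have nn: "0 \<le> (LBINT x. norm (v' x - grad \<xi> x) ^ ?n)" "0 \<le> (LBINT x. norm (u' x - \<xi> x) ^ ?n)" by auto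
   have i1: "integrable lborel (\<lambda>x. norm (u' x - \<xi> x) ^ ?n)"
    using integral_norm_power_variation(1)[OF N, of u' lborel \<xi> "- 1"] u' X by simp
   have i2: "integrable lborel (\<lambda>x. norm (v' x - grad \<xi> x) ^ ?n)"
    using integral_norm_power_variation(1)[OF N, of v' lborel "grad \<xi>" "- 1"] v' X by simp
   have n1: "?n \<ge> 1" using N by simp
   have le: "(LBINT x. norm (u' x - \<xi> x) ^ ?n) \<le> \<delta> ^ ?n" "(LBINT x. norm (v' x - grad \<xi> x) ^ ?n) \<le> \<delta> ^ ?n"
    using x(2) nn by linarith+
   have z1: "u' x - \<xi> x = 0" "v' x - grad \<xi> x = 0" if "x \<notin> ?B" for x
    using that u'(3) v'(3) test_functionD(5)[OF x(1) that] test_sobolev_fun(2)[OF x(1) that] by auto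
   have m: "(\<lambda>x. u' x - \<xi> x) \<in> Borel" "(\<lambda>x. v' x - grad \<xi> x) \<in> Borel" by measurable
   note S1 = integral_abs_small[OF m(1) i1 n1 z1(1) d le(1), folded K_def]
    and S2 = integral_abs_small[OF m(2) i2 n1 z1(2) d le(2), folded K_def]
   have z: "(LBINT x. \<xi> x * partial_deriv i \<phi> x) + (LBINT x. grad \<xi> x $ i * \<phi> x) = 0"
    using wgradD(5)[OF X(1) p, of i] by simp
   note j = test_locint_integrable(2)[OF lu p, of i] test_locint_integrable(1)[OF lv[of i] p]
    test_locint_integrable(2)[OF wgradD(1)[OF X(1)] p, of i] test_locint_integrable(1)[OF wgradD(2)[OF X(1), of i] p]
   have "I = I - ((LBINT x. \<xi> x * partial_deriv i \<phi> x) + (LBINT x. grad \<xi> x $ i * \<phi> x))" using z by simp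
   also have "... = (LBINT x. (u' x - \<xi> x) * partial_deriv i \<phi> x) + (LBINT x. (v' x - grad \<xi> x) $ i * \<phi> x)"
    unfolding I_def vector_minus_component left_diff_distrib using j by simp
   finally have I: "I = (LBINT x. (u' x - \<xi> x) * partial_deriv i \<phi> x) + (LBINT x. (v' x - grad \<xi> x) $ i * \<phi> x)" .
   have "\<bar>LBINT x. (u' x - \<xi> x) * partial_deriv i \<phi> x\<bar> \<le> (LBINT x. C * norm (u' x - \<xi> x))"
   proof (rule integral_abs_bound[THEN order.trans], rule integral_mono')
    show "integrable lborel (\<lambda>x. C * norm (u' x - \<xi> x))" using S1 by (intro integrable_mult_right)
    show "\<bar>(u' x - \<xi> x) * partial_deriv i \<phi> x\<bar> \<le> C * norm (u' x - \<xi> x)" for x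
     using mult_left_mono[OF C(2)[of x], of "\<bar>u' x - \<xi> x\<bar>"] by (simp add: abs_mult mult.commute)
   qed (use C0 in auto)
   also have "... \<le> C * (\<delta> * K)" using S1 C0 by (simp add: mult_left_mono)
   finally have b1: "\<bar>LBINT x. (u' x - \<xi> x) * partial_deriv i \<phi> x\<bar> \<le> C * (\<delta> * K)" .
   have "\<bar>LBINT x. (v' x - grad \<xi> x) $ i * \<phi> x\<bar> \<le> (LBINT x. C * norm (v' x - grad \<xi> x))"
   proof (rule integral_abs_bound[THEN order.trans], rule integral_mono')
    show "integrable lborel (\<lambda>x. C * norm (v' x - grad \<xi> x))" using S2 by (intro integrable_mult_right)
    show "\<bar>(v' x - grad \<xi> x) $ i * \<phi> x\<bar> \<le> C * norm (v' x - grad \<xi> x)" for x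
    proof -
     have "\<bar>(v' x - grad \<xi> x) $ i\<bar> * \<bar>\<phi> x\<bar> \<le> norm (v' x - grad \<xi> x) * C" by (intro mult_mono component_le_norm_cart C) auto
     thus ?thesis by (simp add: abs_mult mult.commute)
    qed
   qed (use C0 in auto)
   also have "... \<le> C * (\<delta> * K)" using S2 C0 by (simp add: mult_left_mono)
   finally have b2: "\<bar>LBINT x. (v' x - grad \<xi> x) $ i * \<phi> x\<bar> \<le> C * (\<delta> * K)" .
   have "\<bar>I\<bar> \<le> C * (\<delta> * K) + C * (\<delta> * K)" unfolding I using b1 b2 by linarith
   thus ?thesis by (simp add: algebra_simps)
  qed
  have "I = 0"
  proof (rule ccontr)
   assume "I \<noteq> 0"
   define \<delta> where "\<delta> = \<bar>I\<bar> / (4 * (C + 1) * K)"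
   have "\<delta> > 0" using \<open>I \<noteq> 0\<close> C0 K by (simp add: \<delta>_def)
   have "\<bar>I\<bar> = 4 * (C + 1) * K * \<delta>" using C0 K by (simp add: \<delta>_def)
   moreover have "\<bar>I\<bar> \<le> 2 * C * K * \<delta>" using \<open>\<delta> > 0\<close> by (rule small)
   moreover have "0 < (2 * C + 4) * (K * \<delta>)" using \<open>\<delta> > 0\<close> K C0 by (intro mult_pos_pos) auto
   ultimately show False by (simp add: algebra_simps)
  qed
  thus "(LBINT x. u' x * partial_deriv i \<phi> x) = - (LBINT x. v' x $ i * \<phi> x)" by (simp add: I_def)
 qed
 hence "(u', v') \<in> zero_class" using u' v' approx by (auto simp: zero_class_def sobolev_fun_def)
 moreover have "AE x in lborel. x \<in> ?B --> weak_grad ?B u x = v' x"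
  using weak_grad_AE[OF dB w] v'(2) by eventually_elim auto
 ultimately show ?thesis using u'(2) by blast
qed

section \<open>The Euler-Lagrange equations\<close>

lemma convolution_eq_log_potential:
 fixes f F :: "'n::finite sfun"
 assumes N: "CARD('n) \<ge> 2" and F: "log_class F" and ae: "AE x in lborel. f x = F x"
 shows "convolution_exists log_kernel f x" "convolution log_kernel f x = log_potential F x"
proof -
 note i = log_potential_bound(1)[OF N F, of x]
 have m: "(\<lambda>y. log_kernel (x - y) * F y) \<in> Borel" using borel_measurable_integrable[OF i] by simp
 have ae': "AE y in lborel. log_kernel (x - y) * f y = log_kernel (x - y) * F y" using ae by eventually_elim simp
 show "convolution_exists log_kernel f x" "convolution log_kernel f x = log_potential F x"
  unfolding convolution_exists_def convolution_def log_potential_def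
  using lebesgue_transfer(2,3)[OF ae' m] i by simp_all
qed

text \<open>The derivative of an even function is odd, which turns the one-sided growth bound into a bound for
 the modulus.\<close>

lemma even_deriv_exp_growth:
 assumes G: "\<And>t. (G has_real_derivative g t) (at t)" and even: "\<And>t. G (- t) = G t" and growth: "exp_growth N g"
 shows "g 0 = 0" "\<exists>c>0. \<exists>\<alpha>>0. \<forall>t. \<bar>g t\<bar> \<le> c * exp (\<alpha> * \<bar>t\<bar> powr (real N / (real N - 1)))"
proof -
 have odd: "g (- t) = - g t" for t
 proof -
  have "((\<lambda>x. G (- x)) has_real_derivative g (- t) * (- 1)) (at t)"
   by (rule DERIV_chain2[OF G]) (auto intro!: derivative_eq_intros)
  hence "(G has_real_derivative - g (- t)) (at t)" by (simp add: even)
  from DERIV_unique[OF this G] show ?thesis by simp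
 qed
 show "g 0 = 0" using odd[of 0] by simp
 obtain \<alpha> c where b: "\<alpha> > 0" "c > 0" "\<And>t. g t \<le> c * exp (\<alpha> * \<bar>t\<bar> powr (real N / (real N - 1)))"
  using growth by (auto simp: exp_growth_def)
 have "\<bar>g t\<bar> \<le> c * exp (\<alpha> * \<bar>t\<bar> powr (real N / (real N - 1)))" for t
  using b(3)[of t] b(3)[of "- t"] odd[of t] by (simp add: abs_le_iff)
 thus "\<exists>c>0. \<exists>\<alpha>>0. \<forall>t. \<bar>g t\<bar> \<le> c * exp (\<alpha> * \<bar>t\<bar> powr (real N / (real N - 1)))" using b by blast
qed

lemma exp_growth_power:
 assumes "exp_growth N G" "\<And>t. 0 \<le> G t" "k > 0"
 shows "\<exists>c>0. \<exists>\<alpha>>0. \<forall>t. G t ^ k \<le> c * exp (\<alpha> * \<bar>t\<bar> powr (real N / (real N - 1)))"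
proof -
 obtain \<alpha> c where b: "\<alpha> > 0" "c > 0" "\<And>t. G t \<le> c * exp (\<alpha> * \<bar>t\<bar> powr (real N / (real N - 1)))"
  using assms by (auto simp: exp_growth_def)
 have "G t ^ k \<le> c ^ k * exp (real k * \<alpha> * \<bar>t\<bar> powr (real N / (real N - 1)))" for t
  using power_mono[OF b(3)[of t] assms(2), of k] by (simp add: power_mult_distrib exp_of_nat_mult[symmetric] mult.assoc)
 thus ?thesis using b assms(3) by (intro exI[of _ "c ^ k"] conjI exI[of _ "real k * \<alpha>"]) auto
qed

lemma exp_growth_power_locally_integrable:
 fixes u :: "'n::finite sfun"
 assumes N: "CARD('n) \<ge> 2" and u: "sobolev_fun u v" and G: "exp_growth CARD('n) G" "\<And>t. 0 \<le> G t"
  and [measurable]: "G \<in> Borel" and k: "k > 0"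
 shows "integrable lborel (\<lambda>x. indicator (cball 0 R) x * G (u x) ^ k)"
proof -
 note [measurable] = sobolev_funD(4,5)[OF u]
 obtain c \<alpha> where c: "c > 0" "\<alpha> > 0" "\<And>t. G t ^ k \<le> c * exp (\<alpha> * \<bar>t\<bar> powr (real CARD('n) / (real CARD('n) - 1)))"
  using exp_growth_power[OF G k] by blast
 show ?thesis
  by (rule integrable_dominated[OF integrable_mult_right[OF exp_locally_integrable[OF N u c(2)], of c R]])
    (use c G(2) in \<open>auto simp: indicator_def\<close>)
qed

text \<open>The values 0 and 1 of \<open>\<kappa>\<close> give the equations on the ball and on the whole space.\<close>

definition weak_equation ::
  "(real ^ 'n::finite) set => real => real => (real ^ 'n => real) => (real ^ 'n => real ^ 'n) => (real ^ 'n => real) =>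
   (real ^ 'n => real) => (real ^ 'n => real ^ 'n) => bool" where
 "weak_equation \<Omega> \<kappa> \<theta> u Du w \<phi> D\<phi> \<longleftrightarrow>
   set_integrable lebesgue \<Omega> (\<lambda>x. norm (Du x) ^ (CARD('n) - 2) * (Du x \<bullet> D\<phi> x)) \<and>
   set_integrable lebesgue \<Omega> (\<lambda>x. \<bar>u x\<bar> ^ (CARD('n) - 2) * u x * \<phi> x) \<and>
   set_integrable lebesgue \<Omega> (\<lambda>x. w x * \<phi> x) \<and>
   (LINT x:\<Omega>|lebesgue. norm (Du x) ^ (CARD('n) - 2) * (Du x \<bullet> D\<phi> x))
    + \<kappa> * (LINT x:\<Omega>|lebesgue. \<bar>u x\<bar> ^ (CARD('n) - 2) * u x * \<phi> x) = \<theta> * (LINT x:\<Omega>|lebesgue. w x * \<phi> x)"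

text \<open>The pair \<open>(u, v)\<close> consists of Borel representatives of a maximizer \<open>y\<close> and its gradient \<open>Dy\<close>, and \<open>S\<close> is the space
 of admissible directions. It has to contain the test functions, so that a vanishing derivative
 of the energy implies the pointwise identity to which \<open>potential_nondegenerate\<close> applies.\<close>

theorem euler_lagrange_multiplier:
 fixes u y :: "'n::finite sfun" and G g :: "real => real"
  and S :: "((real ^ 'n => real) \<times> (real ^ 'n => real ^ 'n)) set"
 assumes N: "CARD('n) \<ge> 2"
  and G: "\<And>t. (G has_real_derivative g t) (at t)" and gc: "continuous_on UNIV g" and growth: "exp_growth CARD('n) g"
  and even: "\<And>t. G (- t) = G t" and mono: "strict_mono_on {0..} G" and Gnn: "\<And>t. 0 \<le> G t"
  and \<Omega>: "\<Omega> = ball 0 1 \<or> \<Omega> = UNIV" and u: "sobolev_fun u v" and uz: "\<forall>x. x \<notin> \<Omega> --> u x = 0 \<and> v x = 0"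
  and ae: "AE x in lborel. x \<in> \<Omega> --> y x = u x" "AE x in lborel. x \<in> \<Omega> --> Dy x = v x"
  and Fc: "log_class (\<lambda>x. indicator \<Omega> x * G (u x))" and F3: "integrable lborel (\<lambda>x. \<bar>indicator \<Omega> x * G (u x)\<bar> ^ 3)"
  and S: "\<forall>\<phi> \<psi>. (\<phi>, \<psi>) \<in> S --> sobolev_fun \<phi> \<psi> \<and> (\<exists>R. \<forall>x. norm x > R --> \<phi> x = 0)"
  and Scomb: "\<forall>\<phi> \<psi> \<phi>' \<psi>' s. (\<phi>, \<psi>) \<in> S --> (\<phi>', \<psi>') \<in> S --> ((\<lambda>x. \<phi> x + s * \<phi>' x), (\<lambda>x. \<psi> x + s *\<^sub>R \<psi>' x)) \<in> S"
  and Stest: "\<forall>\<zeta>. \<zeta> \<in> test_functions \<Omega> --> (\<exists>\<psi>. (\<zeta>, \<psi>) \<in> S)"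
  and J: "(LBINT x. norm (v x) ^ CARD('n)) + \<kappa> * (LBINT x. norm (u x) ^ CARD('n)) \<le> 1"
  and max: "\<forall>\<phi> \<psi> t. (\<phi>, \<psi>) \<in> S -->
    (LBINT x. norm (v x + t *\<^sub>R \<psi> x) ^ CARD('n)) + \<kappa> * (LBINT x. norm (u x + t * \<phi> x) ^ CARD('n)) \<le> 1 -->
    log_energy \<Omega> G (\<lambda>x. u x + t * \<phi> x) \<le> log_energy \<Omega> G y"
 defines "f \<equiv> \<lambda>x. indicator \<Omega> x * G (y x)"
 shows "convolution_exists log_kernel f x"
  "\<exists>\<theta>. \<forall>\<phi> D\<phi> \<phi>0 \<psi>0. (\<phi>0, \<psi>0) \<in> S -->
    (AE x in lborel. x \<in> \<Omega> --> \<phi> x = \<phi>0 x) --> (AE x in lborel. x \<in> \<Omega> --> D\<phi> x = \<psi>0 x) -->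
    weak_equation \<Omega> \<kappa> \<theta> y Dy (\<lambda>x. convolution log_kernel f x * g (y x)) \<phi> D\<phi>"
proof -
 let ?n = "CARD('n)"
 note U = sobolev_funD[OF u]
 note [measurable] = U(4,5)
 have \<Omega>m [measurable]: "\<Omega> \<in> sets borel" using \<Omega> by auto
 have [measurable]: "g \<in> Borel" using gc by (rule borel_measurable_continuous_onI)
 define F where "F = (\<lambda>x. indicator \<Omega> x * G (u x))"
 note Fc = Fc[folded F_def]
 have [measurable]: "F \<in> Borel" by (rule log_classD(4)[OF Fc])
 obtain c \<alpha> where c: "c > 0" "\<alpha> > 0" and g: "\<And>t. \<bar>g t\<bar> \<le> c * exp (\<alpha> * \<bar>t\<bar> powr (real ?n / (real ?n - 1)))"
  using even_deriv_exp_growth(2)[OF G even growth] by blast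
 note g0 = even_deriv_exp_growth(1)[OF G even growth]
 have F0: "0 \<le> F x" for x using Gnn by (simp add: F_def)
 have aeF: "AE x in lborel. f x = F x" using ae(1) by eventually_elim (auto simp: f_def F_def indicator_def)
 note conv = convolution_eq_log_potential[OF N Fc aeF]
 show "convolution_exists log_kernel f x" by (rule conv)
 have energy: "log_energy \<Omega> G y = ereal (log_form F F)"
  by (rule log_energy_eq_form[OF N _ Gnn Fc F0]) (use aeF in \<open>simp add: f_def\<close>)
 define w where "w x = log_potential F x * (indicator \<Omega> x * g (u x))" for x
 define A where "A p = (LBINT x. log_potential F x * (indicator \<Omega> x * g (u x) * fst p x))" for p :: "(real ^ 'n => real) \<times> (real ^ 'n => real ^ 'n)"
 define B where "B p = (LBINT x. norm (v x) ^ (?n - 2) * (v x \<bullet> snd p x)) + \<kappa> * (LBINT x. norm (u x) ^ (?n - 2) * (u x * fst p x))" for p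
 define comb :: "(real ^ 'n => real) \<times> (real ^ 'n => real ^ 'n) => real => (real ^ 'n => real) \<times> (real ^ 'n => real ^ 'n) => (real ^ 'n => real) \<times> (real ^ 'n => real ^ 'n)"
  where "comb p s q = ((\<lambda>x. fst p x + s * fst q x), (\<lambda>x. snd p x + s *\<^sub>R snd q x))" for p s q
 have Sf: "sobolev_fun (fst p) (snd p)" "\<exists>R. \<forall>x. norm x > R --> fst p x = 0" if "p \<in> S" for p
  using S[rule_format, of "fst p" "snd p"] that by auto
 have iA: "integrable lborel (\<lambda>x. log_potential F x * (indicator \<Omega> x * g (u x) * fst p x))" if p: "p \<in> S" for p
 proof -
  obtain R where "\<And>x. norm x > R ==> fst p x = 0" using Sf(2)[OF p] by blast
  from log_form_variation(2)[OF N u Sf(1)[OF p] this c G gc g \<Omega>m Fc[unfolded F_def]] show ?thesis by (simp add: F_def)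
 qed
 have iv: "integrable lborel (\<lambda>x. norm (v x) ^ (?n - 2) * (v x \<bullet> snd p x))" if p: "p \<in> S" for p
  by (rule integral_norm_power_variation(2)[OF N]) (use U sobolev_funD[OF Sf(1)[OF p]] in auto)
 have iu: "integrable lborel (\<lambda>x. norm (u x) ^ (?n - 2) * (u x * fst p x))" if p: "p \<in> S" for p
  using integral_norm_power_variation(2)[OF N, of u lborel "fst p"] U sobolev_funD[OF Sf(1)[OF p]] by simp
 have "\<exists>\<theta>. \<forall>p\<in>S. B p = \<theta> * A p"
 proof (rule lagrange_multiplier[where comb = comb])
  fix p q and s :: real assume pq: "p \<in> S" "q \<in> S"
  show "comb p s q \<in> S" using Scomb[rule_format, of "fst p" "snd p" "fst q" "snd q" s] pq by (simp add: comb_def)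
  have "A (comb p s q) = (LBINT x. log_potential F x * (indicator \<Omega> x * g (u x) * fst p x) + s * (log_potential F x * (indicator \<Omega> x * g (u x) * fst q x)))"
   unfolding A_def by (intro integral_eqI refl) (simp add: comb_def algebra_simps)
  thus "A (comb p s q) = A p + s * A q" using iA[OF pq(1)] iA[OF pq(2)] by (simp add: A_def)
  have "B (comb p s q) = (LBINT x. norm (v x) ^ (?n - 2) * (v x \<bullet> snd p x) + s * (norm (v x) ^ (?n - 2) * (v x \<bullet> snd q x)))
   + \<kappa> * (LBINT x. norm (u x) ^ (?n - 2) * (u x * fst p x) + s * (norm (u x) ^ (?n - 2) * (u x * fst q x)))"
   unfolding B_def comb_def fst_conv snd_conv
   by (intro arg_cong2[where f = "(+)"] arg_cong2[where f = "(*)"] integral_eqI refl)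
     (simp_all add: inner_add_right algebra_simps)
  thus "B (comb p s q) = B p + s * B q"
   using iv[OF pq(1)] iv[OF pq(2)] iu[OF pq(1)] iu[OF pq(2)] by (simp add: B_def algebra_simps)
 next
  fix p assume p: "p \<in> S" and Ap: "A p > 0"
  show "B p \<ge> 0"
  proof (rule ccontr)
   \<comment> \<open>Otherwise a small step along \<open>p\<close> raises the energy and keeps the constraint.\<close>
   assume "\<not> B p \<ge> 0"
   hence Bp: "B p < 0" by simp
   note P = sobolev_funD[OF Sf(1)[OF p]]
   obtain R where R: "\<And>x. norm x > R ==> fst p x = 0" using Sf(2)[OF p] by blast
   define t where "t k = inverse (real (Suc k))" for k
   have t: "0 < t k" "\<bar>t k\<bar> \<le> 1" for k by (auto simp: t_def field_simps)
   note V = log_form_variation[OF N u Sf(1)[OF p] R c G gc g \<Omega>m Fc[unfolded F_def]]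
   let ?Q = "\<lambda>t. log_form (\<lambda>x. indicator \<Omega> x * G (u x + t * fst p x)) (\<lambda>x. indicator \<Omega> x * G (u x + t * fst p x))"
   have "(\<lambda>k. (?Q (t k) - ?Q 0) / t k) \<longlonglongrightarrow> 2 * A p"
    using V(3) by (simp add: A_def F_def t_def del: of_nat_Suc)
   hence e1: "eventually (\<lambda>k. (?Q (t k) - ?Q 0) / t k > 0) sequentially"
    by (rule order_tendstoD(1)) (use Ap in simp)
   let ?Jv = "\<lambda>t. LBINT x. norm (v x + t *\<^sub>R snd p x) ^ ?n" and ?Ju = "\<lambda>t. LBINT x. norm (u x + t * fst p x) ^ ?n"
   have j1: "(\<lambda>k. (?Jv (t k) - ?Jv 0) / t k) \<longlonglongrightarrow> real ?n * (LBINT x. norm (v x) ^ (?n - 2) * (v x \<bullet> snd p x))"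
    using integral_norm_power_variation(3)[OF N, of v lborel "snd p"] U P by (simp add: t_def del: of_nat_Suc)
   have j2: "(\<lambda>k. (?Ju (t k) - ?Ju 0) / t k) \<longlonglongrightarrow> real ?n * (LBINT x. norm (u x) ^ (?n - 2) * (u x * fst p x))"
    using integral_norm_power_variation(3)[OF N, of u lborel "fst p"] U P by (simp add: t_def del: of_nat_Suc)
   have "(\<lambda>k. (?Jv (t k) - ?Jv 0) / t k + \<kappa> * ((?Ju (t k) - ?Ju 0) / t k)) \<longlonglongrightarrow> real ?n * B p"
    using tendsto_add[OF j1 tendsto_mult[OF tendsto_const[of \<kappa>] j2]] by (simp add: B_def algebra_simps)
   moreover have "real ?n * B p < 0" using Bp N by (simp add: mult_pos_neg)
   ultimately have e2: "eventually (\<lambda>k. (?Jv (t k) - ?Jv 0) / t k + \<kappa> * ((?Ju (t k) - ?Ju 0) / t k) < 0) sequentially"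
    by (rule order_tendstoD)
   from eventually_happens[OF eventually_conj[OF e1 e2]]
   obtain k where k: "(?Q (t k) - ?Q 0) / t k > 0" "(?Jv (t k) - ?Jv 0) / t k + \<kappa> * ((?Ju (t k) - ?Ju 0) / t k) < 0" by auto
   have "?Q (t k) > ?Q 0" using k(1) t(1)[of k] by (simp add: zero_less_divide_iff)
   moreover have "?Jv (t k) + \<kappa> * ?Ju (t k) \<le> 1"
   proof -
    have "((?Jv (t k) - ?Jv 0) + \<kappa> * (?Ju (t k) - ?Ju 0)) / t k < 0" using k(2) by (simp add: add_divide_distrib)
    hence "(?Jv (t k) - ?Jv 0) + \<kappa> * (?Ju (t k) - ?Ju 0) < 0" using t(1)[of k] by (simp add: divide_less_0_iff)
    moreover have "?Jv 0 + \<kappa> * ?Ju 0 \<le> 1" using J by simp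
    ultimately show ?thesis by (simp add: algebra_simps)
   qed
   moreover have "log_energy \<Omega> G (\<lambda>x. u x + t k * fst p x) = ereal (?Q (t k))"
    by (rule log_energy_eq_form[OF N _ Gnn V(1)[OF _ t(2)]]) (use Gnn in auto)
   ultimately show False using max[rule_format, of "fst p" "snd p" "t k"] p energy by (simp add: F_def)
  qed
 next
  \<comment> \<open>The degenerate case: the energy is stationary in every admissible direction.\<close>
  assume z: "\<forall>p\<in>S. A p = 0"
  have [measurable]: "w \<in> Borel" unfolding w_def by measurable
  have lw: "locint w" unfolding locint_def
  proof (intro conjI allI)
   show "w \<in> Borel" by simp
   fix R
   obtain P where P: "P \<ge> 0" "\<And>x. norm x \<le> R ==> \<bar>log_potential F x\<bar> \<le> P"
    using log_potential_locally_bounded[OF N Fc, of R] by blast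
   show "integrable lborel (\<lambda>x. indicator (cball 0 R) x * w x)"
   proof (rule integrable_dominated[OF integrable_mult_right[OF exp_locally_integrable[OF N u c(2), of R], of "P * c"]])
    show "AE x in lborel. norm (indicator (cball 0 R) x * w x) \<le> norm (P * c * (indicator (cball 0 R) x * exp (\<alpha> * \<bar>u x\<bar> powr (real ?n / (real ?n - 1)))))"
    proof (rule AE_I2)
     fix x
     show "norm (indicator (cball 0 R) x * w x) \<le> norm (P * c * (indicator (cball 0 R) x * exp (\<alpha> * \<bar>u x\<bar> powr (real ?n / (real ?n - 1)))))"
     proof (cases "norm x \<le> R")
      case True
      have i: "\<bar>indicator \<Omega> x * g (u x)\<bar> \<le> c * exp (\<alpha> * \<bar>u x\<bar> powr (real ?n / (real ?n - 1)))"
       using g[of "u x"] c by (auto simp: indicator_def)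
      have "\<bar>w x\<bar> \<le> P * (c * exp (\<alpha> * \<bar>u x\<bar> powr (real ?n / (real ?n - 1))))"
       unfolding w_def abs_mult[of "log_potential F x"] by (intro mult_mono P True i) auto
      thus ?thesis using True P c by (simp add: abs_mult)
     qed simp
    qed
   qed measurable
  qed
  have wz: "(LBINT x. w x * \<zeta> x) = 0" if \<zeta>: "\<zeta> \<in> test_functions \<Omega>" for \<zeta>
  proof -
   obtain \<psi> where "(\<zeta>, \<psi>) \<in> S" using Stest \<zeta> by blast
   hence "A (\<zeta>, \<psi>) = 0" using z by blast
   thus ?thesis by (simp add: A_def w_def mult.assoc)
  qed
  have "AE x in lborel. x \<in> \<Omega> --> w x = 0"
  proof (rule AE_on_domain[OF \<Omega>], rule fundamental_lemma[OF lw wz])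
   fix R R' :: real and x :: "real ^ 'n" assume R: "R < R'" "cball 0 R' \<subseteq> \<Omega>" "norm x \<le> R"
   have "cball x (R' - R) \<subseteq> cball 0 R'" using R by (simp add: cball_subset_cball_iff)
   thus "cball x (R' - R) \<subseteq> \<Omega>" using R(2) by blast
  qed auto
  hence crit: "AE x in lborel. log_potential F x * g (u x) = 0"
  proof eventually_elim
   case (elim x)
   thus ?case using uz[rule_format, of x] g0 by (cases "x \<in> \<Omega>") (auto simp: w_def)
  qed
  have Gpos: "G t > 0" if "t \<noteq> 0" for t
  proof -
   have "G \<bar>t\<bar> = G t" using even[of t] by (cases "t \<ge> 0") auto
   moreover have "G 0 < G \<bar>t\<bar>" using strict_mono_onD[OF mono, of 0 "\<bar>t\<bar>"] that by simp
   ultimately show ?thesis using Gnn[of 0] by linarith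
  qed
  have sup: "AE x in lborel. u x \<noteq> 0 --> F x > 0"
  proof (rule AE_I2, rule impI)
   fix x assume ux: "u x \<noteq> 0"
   hence "x \<in> \<Omega>" using uz by blast
   thus "F x > 0" using Gpos[OF ux] by (simp add: F_def)
  qed
  have u0: "AE x in lborel. u x = 0"
   by (rule potential_nondegenerate[OF N u Fc _ F0 sup G gc g0 even mono crit]) (use F3 in \<open>simp add: F_def\<close>)
  have v0: "AE x in lborel. v x = 0" by (rule wgrad_unique[OF U(1) wgrad_zero u0])
  show "\<forall>p\<in>S. B p = 0"
  proof
   fix p assume "p \<in> S"
   have "(LBINT x. norm (v x) ^ (?n - 2) * (v x \<bullet> snd p x)) = 0"
    by (rule integral_eq_zero_AE) (use v0 in \<open>auto elim!: eventually_mono\<close>)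
   moreover have "(LBINT x. norm (u x) ^ (?n - 2) * (u x * fst p x)) = 0"
    by (rule integral_eq_zero_AE) (use u0 in \<open>auto elim!: eventually_mono\<close>)
   ultimately show "B p = 0" by (simp add: B_def)
  qed
 qed
 then obtain \<theta> where \<theta>: "\<forall>p\<in>S. B p = \<theta> * A p" by blast
 show "\<exists>\<theta>. \<forall>\<phi> D\<phi> \<phi>0 \<psi>0. (\<phi>0, \<psi>0) \<in> S -->
    (AE x in lborel. x \<in> \<Omega> --> \<phi> x = \<phi>0 x) --> (AE x in lborel. x \<in> \<Omega> --> D\<phi> x = \<psi>0 x) -->
    weak_equation \<Omega> \<kappa> \<theta> y Dy (\<lambda>x. convolution log_kernel f x * g (y x)) \<phi> D\<phi>"
 proof (intro exI[of _ \<theta>] allI impI)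
  fix \<phi> D\<phi> \<phi>0 \<psi>0
  assume s: "(\<phi>0, \<psi>0) \<in> S" and ap: "AE x in lborel. x \<in> \<Omega> --> \<phi> x = \<phi>0 x" "AE x in lborel. x \<in> \<Omega> --> D\<phi> x = \<psi>0 x"
  have a1: "AE x in lborel. indicator \<Omega> x *\<^sub>R (norm (Dy x) ^ (?n - 2) * (Dy x \<bullet> D\<phi> x)) = norm (v x) ^ (?n - 2) * (v x \<bullet> snd (\<phi>0, \<psi>0) x)"
   using ae(2) ap(2) by eventually_elim (use uz in \<open>auto simp: indicator_def\<close>)
  have a2: "AE x in lborel. indicator \<Omega> x *\<^sub>R (\<bar>y x\<bar> ^ (?n - 2) * y x * \<phi> x) = norm (u x) ^ (?n - 2) * (u x * fst (\<phi>0, \<psi>0) x)"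
   using ae(1) ap(1) by eventually_elim (use uz in \<open>auto simp: indicator_def\<close>)
  have a3: "AE x in lborel. indicator \<Omega> x *\<^sub>R (convolution log_kernel f x * g (y x) * \<phi> x) = log_potential F x * (indicator \<Omega> x * g (u x) * fst (\<phi>0, \<psi>0) x)"
   using ae(1) ap(1) by eventually_elim (auto simp: indicator_def conv(2))
  have m: "h \<in> Borel" if "integrable lborel h" for h :: "'n sfun"
   using borel_measurable_integrable[OF that] by simp
  note l = lebesgue_transfer(2,3)[OF a1 m[OF iv[OF s]]] lebesgue_transfer(2,3)[OF a2 m[OF iu[OF s]]] lebesgue_transfer(2,3)[OF a3 m[OF iA[OF s]]]
  show "weak_equation \<Omega> \<kappa> \<theta> y Dy (\<lambda>x. convolution log_kernel f x * g (y x)) \<phi> D\<phi>"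
   unfolding weak_equation_def set_integrable_def set_lebesgue_integral_def l
   using iv[OF s] iu[OF s] iA[OF s] \<theta>[rule_format, OF s] by (simp add: A_def B_def)
 qed
qed

lemma euler_lagrange_ball:
 fixes u :: "'n::finite sfun" and G g :: "real => real"
 assumes N: "CARD('n) \<ge> 2" and G: "\<And>t. (G has_real_derivative g t) (at t)" and gc: "continuous_on UNIV g"
  and growth: "exp_growth CARD('n) g" and G0: "cond_G0 CARD('n) G" and u: "is_arg_max (Phi G) (\<lambda>v. v \<in> ball_B1) u"
 defines "f \<equiv> \<lambda>x. indicator (ball 0 1) x * G (u x)" and "Du \<equiv> weak_grad (ball 0 1) u"
 shows "convolution_exists log_kernel f x"
  "\<exists>\<theta>. \<forall>\<phi>\<in>sobolev0 (ball 0 1) CARD('n).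
    weak_equation (ball 0 1) 0 \<theta> u Du (\<lambda>x. convolution log_kernel f x * g (u x)) \<phi> (weak_grad (ball 0 1) \<phi>)"
proof -
 let ?B = "ball 0 1 :: (real ^ 'n) set" let ?n = "CARD('n)"
 have dB: "?B = ball 0 1 \<or> ?B = UNIV" by simp
 have Gnn: "\<And>t. 0 \<le> G t" and even: "\<And>t. G (- t) = G t" and mono: "strict_mono_on {0..} G" and Ge: "exp_growth ?n G"
  and Gc: "continuous_on UNIV G" using G0 by (auto simp: cond_G0_def)
 have [measurable]: "G \<in> Borel" using Gc by (rule borel_measurable_continuous_onI)
 have uB: "u \<in> sobolev0 ?B ?n" "Lp_norm ?B ?n (weak_grad ?B u) \<le> 1"
  and umax: "\<And>y. y \<in> ball_B1 ==> log_energy ?B G y \<le> log_energy ?B G u"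
  using u by (auto simp: is_arg_max_def ball_B1_def Phi_def not_less)
 obtain u0 v0 where z: "(u0, v0) \<in> zero_class" and ae: "AE x in lborel. x \<in> ?B --> u x = u0 x"
  "AE x in lborel. x \<in> ?B --> Du x = v0 x" using sobolev0_zero_class[OF N uB(1)] unfolding Du_def by blast
 have s: "sobolev_fun u0 v0" and uz: "\<forall>x. x \<notin> ?B --> u0 x = 0 \<and> v0 x = 0" using z by (auto simp: zero_class_def)
 note [measurable] = sobolev_funD(4,5)[OF s]
 have Fk: "integrable lborel (\<lambda>x. (indicator ?B x * G (u0 x)) ^ k)" if "k > 0" for k
  by (rule integrable_dominated[OF exp_growth_power_locally_integrable[OF N s Ge Gnn _ that, of 1]])
    (use that Gnn in \<open>auto simp: indicator_def power_0_left\<close>)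
 have Fc: "log_class (\<lambda>x. indicator ?B x * G (u0 x))"
  by (rule bounded_support_log_class[OF Fk, of 1]) auto
 have F3: "integrable lborel (\<lambda>x. \<bar>indicator ?B x * G (u0 x)\<bar> ^ 3)" using Fk[of 3] Gnn by simp
 have J: "(LBINT x. norm (v0 x) ^ ?n) + 0 * (LBINT x. norm (u0 x) ^ ?n) \<le> 1"
  using uB(2) Lp_norm_eq(2)[of ?B Du v0 ?n] ae(2) uz by (simp add: Du_def)
 have S: "\<forall>(\<phi> :: real ^ 'n => real) \<psi>. (\<phi>, \<psi>) \<in> zero_class --> sobolev_fun \<phi> \<psi> \<and> (\<exists>R. \<forall>x. norm x > R --> \<phi> x = 0)"
  by (auto simp: zero_class_def intro!: exI[of _ 1])
 have max: "\<forall>\<phi> \<psi> t. (\<phi>, \<psi>) \<in> zero_class -->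
   (LBINT x. norm (v0 x + t *\<^sub>R \<psi> x) ^ ?n) + 0 * (LBINT x. norm (u0 x + t * \<phi> x) ^ ?n) \<le> 1 -->
   log_energy ?B G (\<lambda>x. u0 x + t * \<phi> x) \<le> log_energy ?B G u"
 proof (intro allI impI umax)
  fix \<phi> \<psi> t
  assume p: "(\<phi>, \<psi>) \<in> zero_class" and le: "(LBINT x. norm (v0 x + t *\<^sub>R \<psi> x) ^ ?n) + 0 * (LBINT x. norm (u0 x + t * \<phi> x) ^ ?n) \<le> 1"
  note c = zero_class_lincomb[OF N z p, of t]
  have "Lp_norm ?B ?n (weak_grad ?B (\<lambda>x. u0 x + t * \<phi> x)) = root ?n (LBINT x. norm (v0 x + t *\<^sub>R \<psi> x) ^ ?n)"
   by (rule sobolev_of_sobolev_fun(4)[OF dB]) (use c in \<open>auto simp: zero_class_def\<close>)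
  thus "(\<lambda>x. u0 x + t * \<phi> x) \<in> ball_B1" using zero_class_sobolev0[OF N c] le by (simp add: ball_B1_def)
 qed
 have Stest: "\<forall>\<zeta>. \<zeta> \<in> test_functions ?B --> (\<exists>\<psi>. (\<zeta>, \<psi>) \<in> zero_class)" using test_in_zero_class by blast
 have Scomb: "\<forall>(\<phi> :: real ^ 'n => real) \<psi> \<phi>' \<psi>' s. (\<phi>, \<psi>) \<in> zero_class --> (\<phi>', \<psi>') \<in> zero_class -->
   ((\<lambda>x. \<phi> x + s * \<phi>' x), (\<lambda>x. \<psi> x + s *\<^sub>R \<psi>' x)) \<in> zero_class" using zero_class_lincomb[OF N] by blast
 note E = euler_lagrange_multiplier[OF N G gc growth even mono Gnn dB s uz ae Fc F3 S Scomb Stest J max, folded f_def]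
 show "convolution_exists log_kernel f x" by (rule E(1))
 from E(2) obtain \<theta> where th: "\<forall>\<phi> D\<phi> \<phi>0 \<psi>0. (\<phi>0, \<psi>0) \<in> zero_class -->
    (AE x in lborel. x \<in> ?B --> \<phi> x = \<phi>0 x) --> (AE x in lborel. x \<in> ?B --> D\<phi> x = \<psi>0 x) -->
    weak_equation ?B 0 \<theta> u Du (\<lambda>x. convolution log_kernel f x * g (u x)) \<phi> D\<phi>" by blast
 show "\<exists>\<theta>. \<forall>\<phi>\<in>sobolev0 ?B ?n. weak_equation ?B 0 \<theta> u Du (\<lambda>x. convolution log_kernel f x * g (u x)) \<phi> (weak_grad ?B \<phi>)"
  using th sobolev0_zero_class[OF N] by blast
qed

text \<open>Finiteness of the negative part of the energy gives integrability and decay of \<open>F\<close>. Powers of \<open>F\<close> are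
 bounded by a multiple of \<open>F\<close> where \<open>|u| \<le> 1\<close> and by \<open>trudinger\<close> elsewhere.\<close>

lemma euler_lagrange_space:
 fixes u :: "'n::finite sfun" and G g :: "real => real"
 assumes N: "CARD('n) \<ge> 2" and G: "\<And>t. (G has_real_derivative g t) (at t)" and gc: "continuous_on UNIV g"
  and growth: "exp_growth CARD('n) g" and G1: "cond_G1 CARD('n) G" and u: "is_arg_max (Psi G) (\<lambda>v. v \<in> ball_Binf) u"
 defines "f \<equiv> \<lambda>x. G (u x)" and "Du \<equiv> weak_grad UNIV u"
 shows "convolution_exists log_kernel f x"
  "\<exists>\<theta>. \<forall>\<phi>\<in>sobolev0 UNIV CARD('n). bounded_support \<phi> -->
    weak_equation UNIV 1 \<theta> u Du (\<lambda>x. convolution log_kernel f x * g (u x)) \<phi> (weak_grad UNIV \<phi>)"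
proof -
 let ?U = "UNIV :: (real ^ 'n) set" let ?n = "CARD('n)"
 have dU: "?U = ball 0 1 \<or> ?U = UNIV" by simp
 have Gnn: "\<And>t. 0 \<le> G t" and even: "\<And>t. G (- t) = G t" and mono: "strict_mono_on {0..} G" and Ge: "exp_growth ?n G"
  and Gc: "continuous_on UNIV G" and GO: "G \<in> O[at 0](\<lambda>t. \<bar>t\<bar>)" using G1 by (auto simp: cond_G0_def cond_G1_def)
 have [measurable]: "G \<in> Borel" using Gc by (rule borel_measurable_continuous_onI)
 \<comment> \<open>This is where the growth condition at zero enters.\<close>
 have G00: "G 0 = 0"
 proof -
  obtain C where C: "\<forall>\<^sub>F t in at 0. norm (G t) \<le> C * norm \<bar>t\<bar>" using GO by (elim landau_o.bigE)
  have "((\<lambda>t :: real. C * norm \<bar>t\<bar>) \<longlongrightarrow> C * norm \<bar>0 :: real\<bar>) (at 0)" by (intro tendsto_mult tendsto_norm tendsto_rabs tendsto_ident_at tendsto_const)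
  hence "(G \<longlongrightarrow> 0) (at 0)" by (intro Lim_null_comparison[OF C]) simp
  moreover have "(G \<longlongrightarrow> G 0) (at 0)" using Gc by (simp add: continuous_on_eq_continuous_at isCont_def)
  ultimately show ?thesis using LIM_unique by blast
 qed
 have uB: "u \<in> sobolev ?U ?n" "sobolev_norm ?U ?n u \<le> 1"
  and umax: "\<And>y. y \<in> ball_Binf ==> log_energy ?U G y \<le> log_energy ?U G u"
  using u by (auto simp: is_arg_max_def ball_Binf_def Psi_def not_less)
 obtain u0 v0 where s: "sobolev_fun u0 v0" and ae: "AE x in lborel. u x = u0 x" "AE x in lborel. Du x = v0 x"
  using sobolev_UNIV_representative[OF uB(1), of UNIV] unfolding Du_def by auto
 note [measurable] = sobolev_funD(4,5)[OF s]
 define F where "F x = G (u0 x)" for x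
 have [measurable]: "F \<in> Borel" unfolding F_def[abs_def] by measurable
 have aeF: "AE x in lborel. indicator ?U x * G (u x) = F x" using ae(1) by eventually_elim (simp add: F_def)
 have lF: "locint F" unfolding locint_def
  using exp_growth_power_locally_integrable[OF N s Ge Gnn, of 1] by (simp add: F_def)
 \<comment> \<open>The zero function competes with energy zero, so the maximizer has energy above \<open>-\<infinity>\<close>.\<close>
 have zero: "log_energy ?U G (\<lambda>x. 0) = 0"
 proof -
  have "log_energy ?U G (\<lambda>x. 0) = ereal (log_form (\<lambda>x :: real ^ 'n. 0) (\<lambda>x. 0))"
   by (rule log_energy_eq_form[OF N _ Gnn]) (auto simp: G00 log_class_def)
  thus ?thesis by (simp add: log_form_def case_prod_unfold)
 qed
 have s0: "sobolev_fun (\<lambda>x :: real ^ 'n. 0) (\<lambda>x. 0)" using wgrad_zero by (simp add: sobolev_fun_def power_0_left)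
 have "(\<lambda>x :: real ^ 'n. 0) \<in> ball_Binf"
  using sobolev_of_sobolev_fun(1,5)[OF dU s0] by (simp add: ball_Binf_def power_0_left)
 from umax[OF this] have fin: "energy_neg ?U G u \<noteq> \<infinity>" unfolding zero by (auto simp: log_energy_def)
 have F0: "0 \<le> F x" for x using Gnn by (simp add: F_def)
 note Fi = energy_neg_finite_imp[OF aeF Gnn F0 lF fin]
 have Fk: "integrable lborel (\<lambda>x. F x ^ k)" if k: "k > 0" for k
 proof -
  obtain c \<alpha> where c: "c > 0" "\<alpha> > 0" and Gk: "\<And>t. G t ^ k \<le> c * exp (\<alpha> * \<bar>t\<bar> powr (real ?n / (real ?n - 1)))"
   using exp_growth_power[OF Ge Gnn k] by blast
  let ?E = "\<lambda>x. indicator {x. 1 < \<bar>u0 x\<bar>} x * exp (\<alpha> * \<bar>u0 x\<bar> powr (real ?n / (real ?n - 1)))"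
  have "integrable lborel (\<lambda>x. G 1 ^ (k - 1) * F x + c * ?E x)"
   by (intro integrable_plus integrable_mult_right Fi trudinger[OF N s c(2)]) simp
  thus ?thesis
  proof (rule integrable_dominated)
   have "F x ^ k \<le> G 1 ^ (k - 1) * F x + c * ?E x" for x
   proof (cases "1 < \<bar>u0 x\<bar>")
    case True
    thus ?thesis using Gk[of "u0 x"] Gnn F0 by (simp add: F_def add_increasing)
   next
    case False
    have "G (u0 x) = G \<bar>u0 x\<bar>" using even[of "u0 x"] by (simp add: abs_if)
    also have "... \<le> G 1" using False strict_mono_on_leD[OF mono, of "\<bar>u0 x\<bar>" 1] by simp
    finally have "F x ^ (k - 1) * F x \<le> G 1 ^ (k - 1) * F x"
     using F0 by (intro mult_right_mono power_mono) (auto simp: F_def)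
    moreover have "F x ^ (k - 1) * F x = F x ^ k" by (rule power_minus_mult[OF k])
    ultimately show ?thesis using False by simp
   qed
   thus "AE x in lborel. norm (F x ^ k) \<le> norm (G 1 ^ (k - 1) * F x + c * ?E x)"
    using F0 by (intro AE_I2) (auto intro: order.trans[OF _ abs_ge_self])
  qed simp
 qed
 have Fc: "log_class (\<lambda>x. indicator ?U x * G (u0 x))" using Fi Fk[of 2] by (simp add: log_class_def F_def[abs_def])
 have F3: "integrable lborel (\<lambda>x. \<bar>indicator ?U x * G (u0 x)\<bar> ^ 3)" using Fk[of 3] Gnn by (simp add: F_def)
 have J: "(LBINT x. norm (v0 x) ^ ?n) + 1 * (LBINT x. norm (u0 x) ^ ?n) \<le> 1"
  using uB(2) Lp_norm_eq(1)[of ?U Du v0 ?n] Lp_norm_eq(1)[of ?U u u0 ?n] ae unfolding sobolev_norm_def by (simp add: Du_def)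
 define S where "S = {(\<phi> :: real ^ 'n => real, \<psi>). sobolev_fun \<phi> \<psi> \<and> (\<exists>R. \<forall>x. norm x > R --> \<phi> x = 0)}"
 have Scomb: "\<forall>\<phi> \<psi> \<phi>' \<psi>' s. (\<phi>, \<psi>) \<in> S --> (\<phi>', \<psi>') \<in> S --> ((\<lambda>x. \<phi> x + s * \<phi>' x), (\<lambda>x. \<psi> x + s *\<^sub>R \<psi>' x)) \<in> S"
 proof (intro allI impI)
  fix \<phi> \<psi> \<phi>' \<psi>' s assume p: "(\<phi>, \<psi>) \<in> S" "(\<phi>', \<psi>') \<in> S"
  obtain R R' where R: "\<And>x. norm x > R ==> \<phi> x = 0" "\<And>x. norm x > R' ==> \<phi>' x = 0" using p by (auto simp: S_def)
  have "\<forall>x. norm x > max R R' --> \<phi> x + s * \<phi>' x = 0" using R by auto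
  thus "((\<lambda>x. \<phi> x + s * \<phi>' x), (\<lambda>x. \<psi> x + s *\<^sub>R \<psi>' x)) \<in> S"
   using p sobolev_fun_lincomb[OF N, of \<phi> \<psi> \<phi>' \<psi>' s] unfolding S_def by blast
 qed
 have Stest: "\<forall>\<zeta>. \<zeta> \<in> test_functions ?U --> (\<exists>\<psi>. (\<zeta>, \<psi>) \<in> S)"
  using test_sobolev_fun(1) test_functionD(4) unfolding S_def by blast
 have max: "\<forall>\<phi> \<psi> t. (\<phi>, \<psi>) \<in> S -->
   (LBINT x. norm (v0 x + t *\<^sub>R \<psi> x) ^ ?n) + 1 * (LBINT x. norm (u0 x + t * \<phi> x) ^ ?n) \<le> 1 -->
   log_energy ?U G (\<lambda>x. u0 x + t * \<phi> x) \<le> log_energy ?U G u"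
 proof (intro allI impI umax)
  fix \<phi> \<psi> t
  assume p: "(\<phi>, \<psi>) \<in> S" and le: "(LBINT x. norm (v0 x + t *\<^sub>R \<psi> x) ^ ?n) + 1 * (LBINT x. norm (u0 x + t * \<phi> x) ^ ?n) \<le> 1"
  have "sobolev_fun (\<lambda>x. u0 x + t * \<phi> x) (\<lambda>x. v0 x + t *\<^sub>R \<psi> x)" using p by (intro sobolev_fun_lincomb[OF N s]) (auto simp: S_def)
  from sobolev_of_sobolev_fun(1,5)[OF dU this]
  show "(\<lambda>x. u0 x + t * \<phi> x) \<in> ball_Binf" using le by (simp add: ball_Binf_def)
 qed
 have SS: "\<forall>\<phi> \<psi>. (\<phi>, \<psi>) \<in> S --> sobolev_fun \<phi> \<psi> \<and> (\<exists>R. \<forall>x. norm x > R --> \<phi> x = 0)" by (auto simp: S_def)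
 have fU: "(\<lambda>x. indicator ?U x * G (u x)) = f" by (simp add: f_def)
 have ae': "AE x in lborel. x \<in> ?U --> u x = u0 x" "AE x in lborel. x \<in> ?U --> Du x = v0 x" using ae by simp_all
 have uz: "\<forall>x. x \<notin> ?U --> u0 x = 0 \<and> v0 x = 0" by simp
 note E = euler_lagrange_multiplier[OF N G gc growth even mono Gnn dU s uz ae' Fc F3 SS Scomb Stest J max, unfolded fU]
 show "convolution_exists log_kernel f x" by (rule E(1))
 from E(2) obtain \<theta> where th: "\<forall>\<phi> D\<phi> \<phi>0 \<psi>0. (\<phi>0, \<psi>0) \<in> S -->
    (AE x in lborel. x \<in> ?U --> \<phi> x = \<phi>0 x) --> (AE x in lborel. x \<in> ?U --> D\<phi> x = \<psi>0 x) -->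
    weak_equation ?U 1 \<theta> u Du (\<lambda>x. convolution log_kernel f x * g (u x)) \<phi> D\<phi>" by blast
 show "\<exists>\<theta>. \<forall>\<phi>\<in>sobolev0 ?U ?n. bounded_support \<phi> --> weak_equation ?U 1 \<theta> u Du (\<lambda>x. convolution log_kernel f x * g (u x)) \<phi> (weak_grad ?U \<phi>)"
 proof (intro exI[of _ \<theta>] ballI impI)
  fix \<phi> assume "\<phi> \<in> sobolev0 ?U ?n" and b: "bounded_support \<phi>"
  hence s: "\<phi> \<in> sobolev ?U ?n" by (simp add: sobolev0_def)
  obtain R where "AE x in lborel. norm x > R --> \<phi> x = 0" using b unfolding bounded_support_def AE_completion_iff by blast
  hence "AE x in lborel. x \<notin> cball 0 R --> \<phi> x = 0" by (simp add: not_le)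
  from sobolev_UNIV_representative[OF s _ this] obtain \<phi>0 \<psi>0 where p: "(\<phi>0, \<psi>0) \<in> S"
   "AE x in lborel. x \<in> ?U --> \<phi> x = \<phi>0 x" "AE x in lborel. x \<in> ?U --> weak_grad ?U \<phi> x = \<psi>0 x" by (auto simp: S_def not_le)
  show "weak_equation ?U 1 \<theta> u Du (\<lambda>x. convolution log_kernel f x * g (u x)) \<phi> (weak_grad ?U \<phi>)"
   using th p by blast
 qed
qed

theorem theorem1p4:
  fixes G g :: "real \<Rightarrow> real"
  assumes dim: "CARD('n::finite) \<ge> 2"
    and C1: "\<forall>t. (G has_real_derivative g t) (at t)" "continuous_on UNIV g"
    and growth: "exp_growth CARD('n) g"
  shows
   "(cond_G0 CARD('n) G \<longrightarrow>
      (\<forall>u :: real ^ 'n \<Rightarrow> real. is_arg_max (Phi G) (\<lambda>v. v \<in> ball_B1) u \<longrightarrow>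
        (let f = (\<lambda>x. indicator (ball 0 1) x * G (u x));
             Du = weak_grad (ball 0 1) u in
         (AE x in lebesgue. convolution_exists log_kernel f x) \<and>
         (\<exists>\<theta>::real. \<forall>\<phi>\<in>sobolev0 (ball 0 1) CARD('n).
            set_integrable lebesgue (ball 0 1)
              (\<lambda>x. norm (Du x) ^ (CARD('n) - 2) * (Du x \<bullet> weak_grad (ball 0 1) \<phi> x)) \<and>
            set_integrable lebesgue (ball 0 1)
              (\<lambda>x. convolution log_kernel f x * g (u x) * \<phi> x) \<and>
            (LINT x:ball 0 1|lebesgue.
               norm (Du x) ^ (CARD('n) - 2) * (Du x \<bullet> weak_grad (ball 0 1) \<phi> x))
            = \<theta> * (LINT x:ball 0 1|lebesgue. convolution log_kernel f x * g (u x) * \<phi> x))))) \<and>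
    (cond_G1 CARD('n) G \<longrightarrow>
      (\<forall>u :: real ^ 'n \<Rightarrow> real. is_arg_max (Psi G) (\<lambda>v. v \<in> ball_Binf) u \<longrightarrow>
        (let f = (\<lambda>x. G (u x));
             Du = weak_grad UNIV u in
         (AE x in lebesgue. convolution_exists log_kernel f x) \<and>
         (\<exists>\<theta>::real. \<forall>\<phi>\<in>sobolev0 UNIV CARD('n). bounded_support \<phi> \<longrightarrow>
            integrable lebesgue
              (\<lambda>x. norm (Du x) ^ (CARD('n) - 2) * (Du x \<bullet> weak_grad UNIV \<phi> x)
                 + \<bar>u x\<bar> ^ (CARD('n) - 2) * u x * \<phi> x) \<and>
            integrable lebesgue
              (\<lambda>x. convolution log_kernel f x * g (u x) * \<phi> x) \<and>
            (LINT x|lebesgue.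
               norm (Du x) ^ (CARD('n) - 2) * (Du x \<bullet> weak_grad UNIV \<phi> x)
                 + \<bar>u x\<bar> ^ (CARD('n) - 2) * u x * \<phi> x)
            = \<theta> * (LINT x|lebesgue. convolution log_kernel f x * g (u x) * \<phi> x)))))"
  unfolding Let_def
  apply (intro conjI impI allI)
  subgoal premises p for u
    by (rule AE_I2, rule euler_lagrange_ball(1)[OF dim spec[OF C1(1)] C1(2) growth p])
  subgoal premises p for u
    using euler_lagrange_ball(2)[OF dim spec[OF C1(1)] C1(2) growth p] unfolding weak_equation_def
    by (elim ex_forward) auto
  subgoal premises p for u
    by (rule AE_I2, rule euler_lagrange_space(1)[OF dim spec[OF C1(1)] C1(2) growth p])
  subgoal premises p for u
    using euler_lagrange_space(2)[OF dim spec[OF C1(1)] C1(2) growth p] unfolding weak_equation_def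
    by (elim ex_forward) (auto simp: set_integrable_def set_lebesgue_integral_def)
  done

end
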